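(* Let $(X,\|\cdot\|,\tau)$ be a sequentially complete C-sequential Saks space. Let $(A,D(A))$ be a linear operator on $X$, $\omega\ge0$ and $M\ge1$. Then the following assertions are equivalent. (a) $A$ is the bi-generator of a locally $\tau$-bi-continuous and exponentially bounded cosine family $(S(t))_{t\ge0}$ on $X$ such that $\|S(t)\|_{\mathcal L(X)}\le Me^{\omega t}$ for all $t\ge0$. (b) $A$ is bi-densely defined, bi-closed, $(\omega^2,\infty)\subseteq\rho_{\|\cdot\|}(A)$, $$\sup_{\lambda>\omega,\,m\in\mathbb N_0}\Bigl\|\frac{(\lambda-\omega)^{m+1}}{m!}\frac{d^m}{d\lambda^m}\,\lambda R(\lambda^2,A)\Bigr\|_{\mathcal L(X)}\le M,$$ and the family $\Bigl(\frac{(\lambda-\alpha)^{m+1}}{m!}\frac{d^m}{d\lambda^m}\,\lambda R(\lambda^2,A)\Bigr)_{\lambda>\alpha,\,m\in\mathbb N_0}$ is bi-equicontinuous for all $\alpha>\omega$.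
   Context: Linear spaces are over $\mathbb R$ or $\mathbb C$; $\mathbb N_0=\{0,1,2,\dots\}$. For a normed space $(X,\|\cdot\|)$, $\tau_{\|\cdot\|}$ is the norm topology and $\mathcal L(X)$ the bounded linear operators with the operator norm. $\frac{d^m}{d\lambda^m}\lambda R(\lambda^2,A)$ denotes the $m$-th derivative of the map $\lambda\mapsto\lambda R(\lambda^2,A)$. Saks space: a triple $(X,\|\cdot\|,\tau)$ where $(X,\|\cdot\|)$ is a normed space and $\tau\subseteq\tau_{\|\cdot\|}$ is a Hausdorff locally convex topology on $X$ such that some directed system of seminorms $\mathcal P_\tau$ generating $\tau$ satisfies $\|x\|=\sup_{p\in\mathcal P_\tau}p(x)$ for all $x\in X$. Its mixed topology $\gamma$ is the finest linear topology on $X$ that coincides with $\tau$ on $\|\cdot\|$-bounded sets and satisfies $\tau\subseteq\gamma\subseteq\tau_{\|\cdot\|}$; it is Hausdorff locally convex. The Saks space is sequentially complete if $(X,\gamma)$ is sequentially complete, and C-sequential if $(X,\gamma)$ is C-sequential, i.e. every convex sequentially open subset of $(X,\gamma)$ is open ($U$ is sequentially open if every sequence converging to a point of $U$ is eventually in $U$). A family $(T_j)_{j\in J}$ of linear maps $X\to X$ is bi-equicontinuous if for every $\|\cdot\|$-bounded sequence $(x_n)$ in $X$ and $x\in X$ with $x_n\to x$ w.r.t. $\tau$ one has $\tau$-$\lim_{n\to\infty}T_j(x_n-x)=0$ uniformly for $j\in J$. A cosine family $(S(t))_{t\ge0}$ on $X$ consists of linear maps with $S(0)=\mathrm{id}$,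 $2S(t)S(s)=S(t+s)+S(t-s)$ for $t\ge s\ge0$. It is locally $\tau$-bi-continuous if all $S(t)\in\mathcal L(X)$, $t\mapsto S(t)x$ is $\tau$-continuous for every $x\in X$, and for every compact $N\subseteq[0,\infty)$ one has $\sup_{t\in N}\|S(t)\|_{\mathcal L(X)}<\infty$ and $(S(t))_{t\in N}$ is bi-equicontinuous. It is exponentially bounded if $\sup_{t\ge0}\|e^{\alpha t}S(t)\|_{\mathcal L(X)}<\infty$ for some $\alpha\in\mathbb R$. Its bi-generator is the operator $Ax:=\tau\text{-}\lim_{t\to0+}\frac2{t^2}(S(t)x-x)$ with domain $D(A)$ the set of all $x\in X$ such that this limit exists and $\sup_{t\in(0,1]}\frac2{t^2}\|S(t)x-x\|<\infty$. A linear operator $(A,D(A))$ on $X$ is bi-closed if for each sequence $(x_i)$ in $D(A)$ with $(x_i)$, $(Ax_i)$ $\|\cdot\|$-bounded and $x_i\to x$, $Ax_i\to y$ w.r.t. $\tau$ for some $x,y\in X$ one has $x\in D(A)$ and $Ax=y$. It is bi-densely defined if for every $x\in X$ there is a $\|\cdot\|$-bounded sequence $(x_i)$ in $D(A)$ with $x_i\to x$ w.r.t. $\tau$. $\rho_{\|\cdot\|}(A)$ is the set of scalars $\lambda$ such that $\lambda-A\colon D(A)\to X$ is bijective with $R(\lambda,A):=(\lambda-A)^{-1}\in\mathcal L(X)$. *)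

theory Defs
  imports "HOL-Analysis.Analysis"
begin

section \<open>Normed spaces over the real or complex numbers\<close>

text \<open>
  The real structure and the norm are those of the type class; \<open>scl\<close> is the multiplication
  by scalars of the ground field. The sort \<open>{real_normed_field, euclidean_space}\<close>, used for
  \<^typ>\<open>'k\<close> throughout, has the instances \<^typ>\<open>real\<close> and \<^typ>\<open>complex\<close>, and by Frobenius' theorem
  every type of this sort is one of the two up to isometric isomorphism.
\<close>

locale normed_space_over = vector_space scl
  for scl :: "'k::{real_normed_field,euclidean_space} \<Rightarrow> 'a::real_normed_vector \<Rightarrow> 'a" +
  assumes scl_of_real: "scl (of_real r) x = r *\<^sub>R x"
    and norm_scl: "norm (scl c x) = norm c * norm x"

lemma normed_space_over_real:
  "normed_space_over (scaleR :: real \<Rightarrow> 'a::real_normed_vector \<Rightarrow> 'a)"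
  by unfold_locales (auto simp: algebra_simps)

lemma normed_space_over_complex:
  "normed_space_over ((*) :: complex \<Rightarrow> complex \<Rightarrow> complex)"
  by unfold_locales (auto simp: algebra_simps scaleR_conv_of_real norm_mult)

text \<open>The operator norm on \<open>bounded_operators\<close> is \<^const>\<open>onorm\<close>.\<close>

definition bounded_operators ::
  "('k::{real_normed_field,euclidean_space} \<Rightarrow> 'a::real_normed_vector \<Rightarrow> 'a) \<Rightarrow> ('a \<Rightarrow> 'a) set"
  where "bounded_operators scl =
    {T. Vector_Spaces.linear scl scl T \<and> bounded_linear T}"


section \<open>Saks spaces\<close>

definition seminorm ::
  "('k::{real_normed_field,euclidean_space} \<Rightarrow> 'a::real_normed_vector \<Rightarrow> 'a) \<Rightarrow> ('a \<Rightarrow> real) \<Rightarrow> bool"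
  where "seminorm scl p \<longleftrightarrow>
    (\<forall>x. 0 \<le> p x) \<and> (\<forall>c x. p (scl c x) = norm c * p x) \<and> (\<forall>x y. p (x + y) \<le> p x + p y)"

definition directed_seminorms ::
  "('k::{real_normed_field,euclidean_space} \<Rightarrow> 'a::real_normed_vector \<Rightarrow> 'a) \<Rightarrow> ('a \<Rightarrow> real) set \<Rightarrow> bool"
  where "directed_seminorms scl P \<longleftrightarrow>
    P \<noteq> {} \<and> (\<forall>p\<in>P. seminorm scl p) \<and>
    (\<forall>p\<in>P. \<forall>q\<in>P. \<exists>r\<in>P. \<forall>x. p x \<le> r x \<and> q x \<le> r x)"

text \<open>For a directed system the open balls of single seminorms form a neighbourhood base.\<close>

definition generates_topology :: "('a::real_normed_vector \<Rightarrow> real) set \<Rightarrow> 'a topology \<Rightarrow> bool"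
  where "generates_topology P \<tau> \<longleftrightarrow>
    (\<forall>U. openin \<tau> U \<longleftrightarrow> (\<forall>x\<in>U. \<exists>p\<in>P. \<exists>e>0. {y. p (y - x) < e} \<subseteq> U))"

text \<open>
  A topology with carrier \<^term>\<open>UNIV\<close> generated by seminorms is locally convex; the norm topology
  is the type class topology, whose open sets are given by \<^const>\<open>open\<close>.
\<close>

locale saks_space = normed_space_over scl
  for scl :: "'k::{real_normed_field,euclidean_space} \<Rightarrow> 'a::real_normed_vector \<Rightarrow> 'a"
    and \<tau> :: "'a topology" +
  assumes Hausdorff_\<tau>: "Hausdorff_space \<tau>"
    and coarser_than_norm: "openin \<tau> U \<Longrightarrow> open U"
    and norming_seminorms:
      "\<exists>P. directed_seminorms scl P \<and> generates_topology P \<tau> \<and>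
         (\<forall>x. bdd_above ((\<lambda>p. p x) ` P) \<and> norm x = (SUP p\<in>P. p x))"

definition linear_topology ::
  "('k::{real_normed_field,euclidean_space} \<Rightarrow> 'a::real_normed_vector \<Rightarrow> 'a) \<Rightarrow> 'a topology \<Rightarrow> bool"
  where "linear_topology scl T \<longleftrightarrow>
    topspace T = UNIV \<and>
    continuous_map (prod_topology T T) T (\<lambda>(x, y). x + y) \<and>
    continuous_map (prod_topology euclidean T) T (\<lambda>(c, x). scl c x)"

definition mixed_candidate ::
  "('k::{real_normed_field,euclidean_space} \<Rightarrow> 'a::real_normed_vector \<Rightarrow> 'a) \<Rightarrow>
     'a topology \<Rightarrow> 'a topology \<Rightarrow> bool"
  where "mixed_candidate scl \<tau> T \<longleftrightarrow>
    linear_topology scl T \<and>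
    (\<forall>B. bounded B \<longrightarrow> subtopology T B = subtopology \<tau> B) \<and>
    (\<forall>U. openin \<tau> U \<longrightarrow> openin T U) \<and>
    (\<forall>U. openin T U \<longrightarrow> open U)"

definition mixed_topology ::
  "('k::{real_normed_field,euclidean_space} \<Rightarrow> 'a::real_normed_vector \<Rightarrow> 'a) \<Rightarrow>
     'a topology \<Rightarrow> 'a topology"
  where "mixed_topology scl \<tau> =
    (THE \<gamma>. mixed_candidate scl \<tau> \<gamma> \<and>
      (\<forall>T. mixed_candidate scl \<tau> T \<longrightarrow> (\<forall>U. openin T U \<longrightarrow> openin \<gamma> U)))"

definition tvs_Cauchy :: "'a::real_normed_vector topology \<Rightarrow> (nat \<Rightarrow> 'a) \<Rightarrow> bool"
  where "tvs_Cauchy T x \<longleftrightarrow>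
    (\<forall>U. openin T U \<and> 0 \<in> U \<longrightarrow> (\<exists>N. \<forall>m\<ge>N. \<forall>n\<ge>N. x m - x n \<in> U))"

definition sequentially_complete_topology :: "'a::real_normed_vector topology \<Rightarrow> bool"
  where "sequentially_complete_topology T \<longleftrightarrow>
    (\<forall>x. tvs_Cauchy T x \<longrightarrow> (\<exists>l. limitin T x l sequentially))"

definition sequentially_open :: "'a topology \<Rightarrow> 'a set \<Rightarrow> bool"
  where "sequentially_open T U \<longleftrightarrow>
    (\<forall>x. \<forall>l\<in>U. limitin T x l sequentially \<longrightarrow> (\<forall>\<^sub>F n in sequentially. x n \<in> U))"

definition C_sequential_topology :: "'a::real_normed_vector topology \<Rightarrow> bool"
  where "C_sequential_topology T \<longleftrightarrow>
    (\<forall>U. convex U \<and> sequentially_open T U \<longrightarrow> openin T U)"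

definition sequentially_complete_saks ::
  "('k::{real_normed_field,euclidean_space} \<Rightarrow> 'a::real_normed_vector \<Rightarrow> 'a) \<Rightarrow> 'a topology \<Rightarrow> bool"
  where "sequentially_complete_saks scl \<tau> \<longleftrightarrow>
    sequentially_complete_topology (mixed_topology scl \<tau>)"

definition C_sequential_saks ::
  "('k::{real_normed_field,euclidean_space} \<Rightarrow> 'a::real_normed_vector \<Rightarrow> 'a) \<Rightarrow> 'a topology \<Rightarrow> bool"
  where "C_sequential_saks scl \<tau> \<longleftrightarrow> C_sequential_topology (mixed_topology scl \<tau>)"

text \<open>
  The definite description above denotes: \<open>\<tau>\<close> itself is a candidate in every Saks space, and
  the supremum of all candidates is again one.
\<close>

lemma (in saks_space) mixed_candidate_self: "mixed_candidate scl \<tau> \<tau>"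
proof -
  obtain P where dir: "directed_seminorms scl P" and gen: "generates_topology P \<tau>"
    using norming_seminorms by blast
  have op: "openin \<tau> U \<longleftrightarrow> (\<forall>x\<in>U. \<exists>p\<in>P. \<exists>e>0. {y. p (y - x) < e} \<subseteq> U)" for U
    using gen by (simp add: generates_topology_def)
  have nonempty: "P \<noteq> {}" and semi: "seminorm scl p" if "p \<in> P" for p
    using dir that by (auto simp: directed_seminorms_def)
  have homog: "p (scl c x) = norm c * p x" and tri: "p (x + y) \<le> p x + p y" and nn: "0 \<le> p x"
    if "p \<in> P" for p c x y
    using semi[OF that] by (auto simp: seminorm_def)
  have ball: "openin \<tau> {y. p (y - x) < e}" if p: "p \<in> P" for p x e
    unfolding op
  proof
    fix z assume z: "z \<in> {y. p (y - x) < e}"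
    have "{y. p (y - z) < e - p (z - x)} \<subseteq> {y. p (y - x) < e}"
    proof clarify
      fix y assume "p (y - z) < e - p (z - x)"
      then show "p (y - x) < e" using tri[OF p, of "y - z" "z - x"] by simp
    qed
    then show "\<exists>q\<in>P. \<exists>d>0. {y. q (y - z) < d} \<subseteq> {y. p (y - x) < e}"
      using z p by (intro bexI[of _ p] exI[of _ "e - p (z - x)"]) auto
  qed
  have centre: "x \<in> {y. p (y - x) < e}" if "p \<in> P" "e > 0" for p x e
    using homog[OF that(1), of 0 "x - x"] that(2) by simp
  have top: "topspace \<tau> = UNIV"
  proof -
    have "openin \<tau> UNIV"
      unfolding op using dir by (auto simp: directed_seminorms_def intro: zero_less_one)
    then show ?thesis using openin_subset by blast
  qed
  have add: "continuous_map (prod_topology \<tau> \<tau>) \<tau> (\<lambda>(x, y). x + y)"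
    unfolding continuous_map
  proof (intro conjI allI impI)
    fix U assume U: "openin \<tau> U"
    show "openin (prod_topology \<tau> \<tau>) {z \<in> topspace (prod_topology \<tau> \<tau>). (case z of (x, y) \<Rightarrow> x + y) \<in> U}"
      unfolding openin_prod_topology_alt
    proof (intro allI impI)
      fix x y assume "(x, y) \<in> {z \<in> topspace (prod_topology \<tau> \<tau>). (case z of (x, y) \<Rightarrow> x + y) \<in> U}"
      then have "x + y \<in> U" by simp
      then obtain p e where p: "p \<in> P" "e > 0" and sub: "{z. p (z - (x + y)) < e} \<subseteq> U"
        using U unfolding op by blast
      have "u + v \<in> U" if "p (u - x) < e/2" "p (v - y) < e/2" for u v
      proof -
        have "p (u + v - (x + y)) < e"
          using that tri[OF p(1), of "u - x" "v - y"] by (simp add: algebra_simps)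
        then show ?thesis using sub by blast
      qed
      then have "{u. p (u - x) < e/2} \<times> {v. p (v - y) < e/2} \<subseteq>
          {z \<in> topspace (prod_topology \<tau> \<tau>). (case z of (x, y) \<Rightarrow> x + y) \<in> U}"
        by (auto simp: top)
      from ball[OF p(1)] ball[OF p(1)] centre[OF p(1) half_gt_zero[OF p(2)]]
        centre[OF p(1) half_gt_zero[OF p(2)]] this
      show "\<exists>V W. openin \<tau> V \<and> openin \<tau> W \<and> x \<in> V \<and> y \<in> W \<and> V \<times> W \<subseteq>
          {z \<in> topspace (prod_topology \<tau> \<tau>). (case z of (x, y) \<Rightarrow> x + y) \<in> U}"
        by (intro exI conjI)
    qed
  qed (simp add: top)
  have mult: "continuous_map (prod_topology euclidean \<tau>) \<tau> (\<lambda>(c, x). scl c x)"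
    unfolding continuous_map
  proof (intro conjI allI impI)
    fix U assume U: "openin \<tau> U"
    show "openin (prod_topology euclidean \<tau>)
        {z \<in> topspace (prod_topology euclidean \<tau>). (case z of (c, x) \<Rightarrow> scl c x) \<in> U}"
      unfolding openin_prod_topology_alt
    proof (intro allI impI)
      fix c x assume "(c, x) \<in>
        {z \<in> topspace (prod_topology euclidean \<tau>). (case z of (c, x) \<Rightarrow> scl c x) \<in> U}"
      then have "scl c x \<in> U" by simp
      then obtain p e where p: "p \<in> P" "e > 0" and sub: "{z. p (z - scl c x) < e} \<subseteq> U"
        using U unfolding op by blast
      define r where "r = e / (2 * (p x + 1))"
      define s where "s = e / (2 * (norm c + r))"
      have px: "p x \<ge> 0" using nn[OF p(1)] .
      have r: "r > 0" using px p(2) by (simp add: r_def)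
      have cr: "norm c + r > 0" using r by (simp add: add_nonneg_pos)
      have s: "s > 0" using cr p(2) by (simp add: s_def)
      have "scl b u \<in> U" if b: "dist b c < r" and u: "p (u - x) < s" for b u
      proof -
        have nb: "norm b \<le> norm c + r"
          using b norm_triangle_sub[of b c] by (simp add: dist_norm)
        have "p (scl b u - scl c x) = p (scl b (u - x) + scl (b - c) x)"
          by (simp add: scale_right_diff_distrib scale_left_diff_distrib)
        also have "\<dots> \<le> norm b * p (u - x) + norm (b - c) * p x"
          using tri[OF p(1)] homog[OF p(1)] by metis
        also have "norm b * p (u - x) \<le> (norm c + r) * p (u - x)"
          using nb nn[OF p(1)] by (rule mult_right_mono)
        also have "(norm c + r) * p (u - x) < (norm c + r) * s"
          using u cr by (rule mult_strict_left_mono)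
        also have "(norm c + r) * s = e / 2"
          using cr by (simp add: s_def field_simps)
        also have "norm (b - c) * p x \<le> r * (p x + 1)"
          using b px r by (intro mult_mono) (auto simp: dist_norm)
        also have "r * (p x + 1) = e / 2"
          using px by (simp add: r_def field_simps)
        finally have "p (scl b u - scl c x) < e" by simp
        then show ?thesis using sub by blast
      qed
      then have "ball c r \<times> {u. p (u - x) < s} \<subseteq>
          {z \<in> topspace (prod_topology euclidean \<tau>). (case z of (c, x) \<Rightarrow> scl c x) \<in> U}"
        by (auto simp: top dist_commute)
      then show "\<exists>V W. openin euclidean V \<and> openin \<tau> W \<and> c \<in> V \<and> x \<in> W \<and> V \<times> W \<subseteq>
          {z \<in> topspace (prod_topology euclidean \<tau>). (case z of (c, x) \<Rightarrow> scl c x) \<in> U}"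
        using ball[OF p(1)] centre[OF p(1) s] r
        by (intro exI[of _ "ball c r"] exI[of _ "{u. p (u - x) < s}"] conjI; assumption?) simp_all
    qed
  qed (simp add: top)
  show ?thesis
    using top add mult coarser_than_norm by (simp add: mixed_candidate_def linear_topology_def)
qed

lemma mixed_topology_finest:
  fixes scl :: "'k::{real_normed_field,euclidean_space} \<Rightarrow> 'a::real_normed_vector \<Rightarrow> 'a"
  assumes "mixed_candidate scl \<tau> T0"
  shows "mixed_candidate scl \<tau> (mixed_topology scl \<tau>)"
    and "mixed_candidate scl \<tau> T \<Longrightarrow> openin T U \<Longrightarrow> openin (mixed_topology scl \<tau>) U"
proof -
  define C where "C = {T. mixed_candidate scl \<tau> T}"
  define SB where "SB = {U. \<exists>T\<in>C. openin T U}"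
  define G where "G = topology_generated_by SB"
  have T0: "T0 \<in> C" using assms by (simp add: C_def)
  have finer: "openin G U" if "T \<in> C" "openin T U" for T U
    using that unfolding G_def SB_def by (auto intro: topology_generated_by_Basis)
  have C_top: "topspace T = UNIV" if "T \<in> C" for T
    using that by (simp add: C_def mixed_candidate_def linear_topology_def)
  have topG: "topspace G = UNIV"
    using finer[OF T0 openin_topspace] C_top[OF T0] openin_subset by fastforce
  have topSB: "\<Union>SB = UNIV"
    using topG unfolding G_def by simp
  have into_G: "continuous_map Y G f"
    if top: "topspace Y = UNIV"
      and step: "\<And>T. T \<in> C \<Longrightarrow> \<exists>Z. continuous_map Z T f \<and> topspace Z = UNIV \<and>
                   (\<forall>V. openin Z V \<longrightarrow> openin Y V)"
    for Y :: "'c topology" and f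
  proof -
    have "openin Y (f -` U \<inter> topspace Y)" if U: "U \<in> SB" for U
    proof -
      obtain T where T: "T \<in> C" "openin T U" using U by (auto simp: SB_def)
      obtain Z where Z: "continuous_map Z T f" "topspace Z = UNIV"
          "\<forall>V. openin Z V \<longrightarrow> openin Y V"
        using step[OF T(1)] by blast
      have "openin Z {x \<in> topspace Z. f x \<in> U}"
        using openin_continuous_map_preimage[OF Z(1) T(2)] .
      then have "openin Y {x. f x \<in> U}" using Z by simp
      then show ?thesis using top by (simp add: vimage_def)
    qed
    then show ?thesis
      unfolding G_def using topSB by (intro continuous_on_generated_topo) auto
  qed
  have prod_mono: "openin (prod_topology Y G) V"
    if T: "T \<in> C" and V: "openin (prod_topology X T) V"
      and XY: "\<And>W. openin X W \<Longrightarrow> openin Y W"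
    for T V and X Y :: "'c topology"
    unfolding openin_prod_topology_alt
  proof (intro allI impI)
    fix x y assume "(x, y) \<in> V"
    then obtain W1 W2 where "openin X W1" "openin T W2" "x \<in> W1" "y \<in> W2" "W1 \<times> W2 \<subseteq> V"
      using V unfolding openin_prod_topology_alt by meson
    then show "\<exists>W1 W2. openin Y W1 \<and> openin G W2 \<and> x \<in> W1 \<and> y \<in> W2 \<and> W1 \<times> W2 \<subseteq> V"
      using finer[OF T] XY by meson
  qed
  have add: "continuous_map (prod_topology G G) G (\<lambda>(x, y). x + y)"
  proof (rule into_G)
    fix T assume T: "T \<in> C"
    then have "continuous_map (prod_topology T T) T (\<lambda>(x, y). x + y)"
      by (simp add: C_def mixed_candidate_def linear_topology_def)
    then show "\<exists>Z. continuous_map Z T (\<lambda>(x, y). x + y) \<and> topspace Z = UNIV \<and>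
        (\<forall>V. openin Z V \<longrightarrow> openin (prod_topology G G) V)"
      using C_top[OF T] prod_mono[OF T _ finer[OF T]]
      by (intro exI[of _ "prod_topology T T"]) (simp add: topspace_prod_topology)
  qed (simp add: topspace_prod_topology topG)
  have mult: "continuous_map (prod_topology euclidean G) G (\<lambda>(c, x). scl c x)"
  proof (rule into_G)
    fix T assume T: "T \<in> C"
    then have "continuous_map (prod_topology euclidean T) T (\<lambda>(c, x). scl c x)"
      by (simp add: C_def mixed_candidate_def linear_topology_def)
    moreover have "topspace (prod_topology euclidean T) = UNIV"
      using C_top[OF T] by simp
    moreover have "\<forall>V. openin (prod_topology euclidean T) V \<longrightarrow> openin (prod_topology euclidean G) V"
      by (intro allI impI) (rule prod_mono[OF T])
    ultimately show "\<exists>Z. continuous_map Z T (\<lambda>(c, x). scl c x) \<and> topspace Z = UNIV \<and>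
        (\<forall>V. openin Z V \<longrightarrow> openin (prod_topology euclidean G) V)"
      by blast
  qed (simp add: topspace_prod_topology topG)
  have sub_norm: "open U" if "openin G U" for U
  proof -
    have "generate_topology_on SB U"
      using that by (simp add: G_def openin_topology_generated_by_iff)
    then show ?thesis
    proof induction
      case (Basis s)
      then obtain T where "T \<in> C" "openin T s" unfolding SB_def by blast
      then show ?case unfolding C_def mixed_candidate_def by blast
    qed (auto intro: open_Union)
  qed
  have tau_G: "openin G U" if "openin \<tau> U" for U
    using finer[OF T0] that assms by (simp add: mixed_candidate_def)
  have agree: "subtopology G B = subtopology \<tau> B" if B: "bounded B" for B
  proof -
    have "openin (subtopology \<tau> B) (U \<inter> B)" if "openin G U" for U
    proof -
      have "generate_topology_on SB U"
        using that by (simp add: G_def openin_topology_generated_by_iff)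
      then show ?thesis
      proof induction
        case (Int a b)
        from openin_Int[OF Int.IH] show ?case
          by (rule back_subst[where P = "openin _"]) blast
      next
        case (UN K)
        have "openin (subtopology \<tau> B) (\<Union>k\<in>K. k \<inter> B)"
          by (rule openin_Union) (use UN.IH in blast)
        then show ?case by (rule back_subst[where P = "openin _"]) blast
      next
        case (Basis s)
        then obtain T where "T \<in> C" "openin T s" by (auto simp: SB_def)
        then have "openin (subtopology T B) (s \<inter> B)"
          unfolding openin_subtopology by blast
        moreover have "subtopology T B = subtopology \<tau> B"
          using \<open>T \<in> C\<close> B by (simp add: C_def mixed_candidate_def)
        ultimately show ?case by simp
      qed simp
    qed
    moreover have "openin (subtopology G B) (U \<inter> B)" if "openin \<tau> U" for U
      using tau_G[OF that] by (auto simp: openin_subtopology)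
    ultimately have "openin (subtopology G B) V \<longleftrightarrow> openin (subtopology \<tau> B) V" for V
      unfolding openin_subtopology[of G] openin_subtopology[of \<tau>]
      by (metis openin_subtopology)
    then show ?thesis unfolding topology_eq by simp
  qed
  have G: "mixed_candidate scl \<tau> G"
    unfolding mixed_candidate_def linear_topology_def
    using topG add mult agree tau_G sub_norm by simp
  have "mixed_topology scl \<tau> = G"
    unfolding mixed_topology_def
  proof (rule the_equality)
    show "mixed_candidate scl \<tau> G \<and>
      (\<forall>T. mixed_candidate scl \<tau> T \<longrightarrow> (\<forall>U. openin T U \<longrightarrow> openin G U))"
      using G finer by (auto simp: C_def)
  next
    fix H assume "mixed_candidate scl \<tau> H \<and>
      (\<forall>T. mixed_candidate scl \<tau> T \<longrightarrow> (\<forall>U. openin T U \<longrightarrow> openin H U))"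
    then show "H = G"
      using G finer by (auto simp: C_def topology_eq)
  qed
  then show "mixed_candidate scl \<tau> (mixed_topology scl \<tau>)"
    and "mixed_candidate scl \<tau> T \<Longrightarrow> openin T U \<Longrightarrow> openin (mixed_topology scl \<tau>) U"
    using G finer by (auto simp: C_def)
qed


section \<open>Cosine families and bi-generators\<close>

definition bi_equicontinuous ::
  "'a::real_normed_vector topology \<Rightarrow> 'j set \<Rightarrow> ('j \<Rightarrow> 'a \<Rightarrow> 'a) \<Rightarrow> bool"
  where "bi_equicontinuous \<tau> J T \<longleftrightarrow>
    (\<forall>x l. bounded (range x) \<and> limitin \<tau> x l sequentially \<longrightarrow>
      (\<forall>U. openin \<tau> U \<and> 0 \<in> U \<longrightarrow>
        (\<forall>\<^sub>F n in sequentially. \<forall>j\<in>J. T j (x n - l) \<in> U)))"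

text \<open>A family indexed by \<open>t \<ge> 0\<close> is a function on \<^typ>\<open>real\<close> whose values at \<open>t < 0\<close> are irrelevant.\<close>

definition cosine_family ::
  "('k::{real_normed_field,euclidean_space} \<Rightarrow> 'a::real_normed_vector \<Rightarrow> 'a) \<Rightarrow>
     (real \<Rightarrow> 'a \<Rightarrow> 'a) \<Rightarrow> bool"
  where "cosine_family scl S \<longleftrightarrow>
    (\<forall>t\<ge>0. Vector_Spaces.linear scl scl (S t)) \<and>
    S 0 = id \<and>
    (\<forall>t s x. 0 \<le> s \<and> s \<le> t \<longrightarrow> 2 *\<^sub>R S t (S s x) = S (t + s) x + S (t - s) x)"

definition locally_bi_continuous ::
  "('k::{real_normed_field,euclidean_space} \<Rightarrow> 'a::real_normed_vector \<Rightarrow> 'a) \<Rightarrow> 'a topology \<Rightarrow>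
     (real \<Rightarrow> 'a \<Rightarrow> 'a) \<Rightarrow> bool"
  where "locally_bi_continuous scl \<tau> S \<longleftrightarrow>
    (\<forall>t\<ge>0. S t \<in> bounded_operators scl) \<and>
    (\<forall>x. continuous_map (top_of_set {0..}) \<tau> (\<lambda>t. S t x)) \<and>
    (\<forall>N. compact N \<and> N \<subseteq> {0..} \<longrightarrow>
      bdd_above ((\<lambda>t. onorm (S t)) ` N) \<and> bi_equicontinuous \<tau> N S)"

definition exponentially_bounded :: "(real \<Rightarrow> 'a::real_normed_vector \<Rightarrow> 'a) \<Rightarrow> bool"
  where "exponentially_bounded S \<longleftrightarrow>
    (\<exists>\<alpha>. bdd_above ((\<lambda>t. onorm (\<lambda>x. exp (\<alpha> * t) *\<^sub>R S t x)) ` {0..}))"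

definition bi_generator_domain ::
  "'a::real_normed_vector topology \<Rightarrow> (real \<Rightarrow> 'a \<Rightarrow> 'a) \<Rightarrow> 'a set"
  where "bi_generator_domain \<tau> S =
    {x. (\<exists>y. limitin \<tau> (\<lambda>t. (2 / t\<^sup>2) *\<^sub>R (S t x - x)) y (at_right 0)) \<and>
        bdd_above ((\<lambda>t. 2 / t\<^sup>2 * norm (S t x - x)) ` {0<..1})}"

text \<open>
  An operator \<open>(A, D(A))\<close> is a pair of a function \<open>A\<close> and a set \<open>D\<close>; the values of \<open>A\<close>
  outside of \<open>D\<close> are irrelevant.
\<close>

definition is_bi_generator ::
  "'a::real_normed_vector topology \<Rightarrow> (real \<Rightarrow> 'a \<Rightarrow> 'a) \<Rightarrow> 'a set \<Rightarrow> ('a \<Rightarrow> 'a) \<Rightarrow> bool"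
  where "is_bi_generator \<tau> S D A \<longleftrightarrow>
    D = bi_generator_domain \<tau> S \<and>
    (\<forall>x\<in>D. limitin \<tau> (\<lambda>t. (2 / t\<^sup>2) *\<^sub>R (S t x - x)) (A x) (at_right 0))"


section \<open>Linear operators and their resolvents\<close>

definition linear_operator ::
  "('k::{real_normed_field,euclidean_space} \<Rightarrow> 'a::real_normed_vector \<Rightarrow> 'a) \<Rightarrow>
     'a set \<Rightarrow> ('a \<Rightarrow> 'a) \<Rightarrow> bool"
  where "linear_operator scl D A \<longleftrightarrow>
    module.subspace scl D \<and>
    (\<forall>x\<in>D. \<forall>y\<in>D. A (x + y) = A x + A y) \<and>
    (\<forall>c. \<forall>x\<in>D. A (scl c x) = scl c (A x))"

definition bi_closed :: "'a::real_normed_vector topology \<Rightarrow> 'a set \<Rightarrow> ('a \<Rightarrow> 'a) \<Rightarrow> bool"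
  where "bi_closed \<tau> D A \<longleftrightarrow>
    (\<forall>u x y. (\<forall>i::nat. u i \<in> D) \<and> bounded (range u) \<and> bounded (range (\<lambda>i. A (u i))) \<and>
        limitin \<tau> u x sequentially \<and> limitin \<tau> (\<lambda>i. A (u i)) y sequentially
      \<longrightarrow> x \<in> D \<and> A x = y)"

definition bi_densely_defined :: "'a::real_normed_vector topology \<Rightarrow> 'a set \<Rightarrow> bool"
  where "bi_densely_defined \<tau> D \<longleftrightarrow>
    (\<forall>x. \<exists>u. (\<forall>i::nat. u i \<in> D) \<and> bounded (range u) \<and> limitin \<tau> u x sequentially)"

definition resolvent ::
  "('k::{real_normed_field,euclidean_space} \<Rightarrow> 'a::real_normed_vector \<Rightarrow> 'a) \<Rightarrow>
     'a set \<Rightarrow> ('a \<Rightarrow> 'a) \<Rightarrow> 'k \<Rightarrow> 'a \<Rightarrow> 'a"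
  where "resolvent scl D A \<mu> = inv_into D (\<lambda>x. scl \<mu> x - A x)"

definition resolvent_set ::
  "('k::{real_normed_field,euclidean_space} \<Rightarrow> 'a::real_normed_vector \<Rightarrow> 'a) \<Rightarrow>
     'a set \<Rightarrow> ('a \<Rightarrow> 'a) \<Rightarrow> 'k set"
  where "resolvent_set scl D A =
    {\<mu>. bij_betw (\<lambda>x. scl \<mu> x - A x) D UNIV \<and> resolvent scl D A \<mu> \<in> bounded_operators scl}"

text \<open>
  Derivatives are taken in the operator norm. The space \<^typ>\<open>'a \<Rightarrow>\<^sub>L 'a\<close> consists of the bounded
  real-linear operators; \<^const>\<open>bounded_operators\<close> is a closed real subspace of it with the same norm,
  so derivatives with respect to a real variable are the same in both spaces.
\<close>

definition higher_vector_derivative :: "nat \<Rightarrow> (real \<Rightarrow> 'b::real_normed_vector) \<Rightarrow> real \<Rightarrow> 'b"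
  where "higher_vector_derivative m f = ((\<lambda>g t. vector_derivative g (at t)) ^^ m) f"

definition lambda_resolvent ::
  "('k::{real_normed_field,euclidean_space} \<Rightarrow> 'a::real_normed_vector \<Rightarrow> 'a) \<Rightarrow>
     'a set \<Rightarrow> ('a \<Rightarrow> 'a) \<Rightarrow> real \<Rightarrow> 'a \<Rightarrow>\<^sub>L 'a"
  where "lambda_resolvent scl D A \<mu> = \<mu> *\<^sub>R Blinfun (resolvent scl D A (of_real (\<mu>\<^sup>2)))"

definition hille_yosida_term ::
  "('k::{real_normed_field,euclidean_space} \<Rightarrow> 'a::real_normed_vector \<Rightarrow> 'a) \<Rightarrow>
     'a set \<Rightarrow> ('a \<Rightarrow> 'a) \<Rightarrow> real \<Rightarrow> real \<Rightarrow> nat \<Rightarrow> 'a \<Rightarrow>\<^sub>L 'a"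
  where "hille_yosida_term scl D A \<alpha> \<mu> m =
    ((\<mu> - \<alpha>) ^ (m + 1) / fact m) *\<^sub>R higher_vector_derivative m (lambda_resolvent scl D A) \<mu>"

end

theory Submission
  imports Defs "HOL-Real_Asymp.Real_Asymp"
begin

text \<open>
  A vector is determined by its values under the real functionals that are bounded and sequentially
  \<open>\<tau>\<close>-continuous on bounded sets, since by Hahn--Banach these contain the functionals dominated by a
  single seminorm of the norming system. This reduces identities for the cosine family and for the
  resolvent to real Laplace transforms, and only sequential \<open>\<tau>\<close>-limits of bounded sequences occur.

  Let \<open>V m l\<close> be \<open>(- 1) ^ m * l ^ (m + 1) / m!\<close> times the \<open>m\<close>-th derivative of \<open>l * R (l\<^sup>2)\<close>. The resolvent
  equation gives \<open>V (m + 2) l - 2 * V (m + 1) l + V m l = A V (m + 2) l / l\<^sup>2\<close>, that is, \<open>m \<mapsto> V m l\<close> is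
  the implicit difference scheme with step \<open>1 / l\<close> for \<open>u'' = A u\<close>. The bounds in (b) are its stability,
  so \<open>V n (n / t)\<close> converges to an operator \<open>S t\<close>, whose weak Laplace transform is \<open>l * R (l\<^sup>2)\<close>. The
  cosine law follows from the uniqueness of Laplace transforms.

  Conversely, the weak integral of \<open>exp (- l * t) * S t\<close> exists by sequential completeness, equals
  \<open>l * R (l\<^sup>2)\<close>, and the bounds in (b) are obtained by differentiating it.
\<close>

section \<open>The Hahn--Banach theorem for seminorms\<close>

text \<open>The scheme is started from two fictitious values \<open>x\<close> before
  \<open>V 0 l x\<close>, which encodes \<open>u 0 = x\<close> and \<open>u' 0 = 0\<close>. For
  \<open>l = n / t\<close> its stability bound is \<open>M * (l / (l - \<omega>)) ^ (n + 1)\<close>,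
  and this tends to \<open>M * exp (\<omega> * t)\<close>: hence the same constants in (a) and (b).
  Conversely, \<open>V m l\<close> is the average of \<open>S\<close> against the gamma density with
  mean \<open>(m + 1) / l\<close>, so \<open>V n (n / t)\<close> is the Post-Widder inversion of the
  transform.

  The limit must be found without knowing it. On the domain the approximants for \<open>n\<close>
  and \<open>n + 1\<close> differ by \<open>O(1 / n ^ 2)\<close> in norm, because the first-order
  effects of raising the index and of shortening the step cancel. This norm estimate cannot be
  carried over by norm density: a vector is only the \<tau>-limit of a bounded sequence from
  \<open>D\<close>. The passage to all vectors therefore uses the equicontinuity in (b), one
  seminorm at a time, and yields no rate. In the same way operators are only known to respect
  \<tau>-limits of bounded sequences, which is why bounded ranges are tracked everywhere and why
  vector-valued integrals are built as limits of Riemann sums.\<close>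

definition sublinear :: "('a::real_vector \<Rightarrow> real) \<Rightarrow> bool"
  where "sublinear q \<longleftrightarrow>
    (\<forall>x y. q (x + y) \<le> q x + q y) \<and> (\<forall>c\<ge>0. \<forall>x. q (c *\<^sub>R x) = c * q x)"

text \<open>The largest sublinear functional below \<open>q\<close> whose value at \<open>- y\<close> is at most \<open>- q y\<close>.\<close>

definition tilt :: "('a::real_vector \<Rightarrow> real) \<Rightarrow> 'a \<Rightarrow> 'a \<Rightarrow> real"
  where "tilt q y x = (INF t\<in>{0..}. q (x + t *\<^sub>R y) - t * q y)"

lemma sublinear_add: "sublinear q \<Longrightarrow> q (x + y) \<le> q x + q y"
  and sublinear_scale: "sublinear q \<Longrightarrow> c \<ge> 0 \<Longrightarrow> q (c *\<^sub>R x) = c * q x"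
  by (auto simp: sublinear_def)

lemma sublinear_zero: "sublinear q \<Longrightarrow> q 0 = 0"
  using sublinear_scale[of q 0 0] by simp

lemma tilt_bdd_below:
  assumes q: "sublinear q"
  shows "bdd_below ((\<lambda>t. q (x + t *\<^sub>R y) - t * q y) ` {0..})"
proof (rule bdd_belowI2)
  fix t :: real assume "t \<in> {0..}"
  then show "- q (- x) \<le> q (x + t *\<^sub>R y) - t * q y"
    using sublinear_add[OF q, of "x + t *\<^sub>R y" "- x"] sublinear_scale[OF q, of t y] by simp
qed

lemma tilt_le: "sublinear q \<Longrightarrow> t \<ge> 0 \<Longrightarrow> tilt q y x \<le> q (x + t *\<^sub>R y) - t * q y"
  unfolding tilt_def by (rule cINF_lower[OF tilt_bdd_below]) auto

lemma tilt_greatest: "(\<And>t. t \<ge> 0 \<Longrightarrow> c \<le> q (x + t *\<^sub>R y) - t * q y) \<Longrightarrow> c \<le> tilt q y x"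
  unfolding tilt_def by (rule cINF_greatest) auto

lemma sublinear_tilt:
  assumes q: "sublinear q"
  shows "sublinear (tilt q y)"
  unfolding sublinear_def
proof (intro conjI allI impI)
  fix x x'
  \<comment> \<open>A parameter \<open>t\<close> for \<open>x\<close> and a parameter
    \<open>s\<close> for \<open>x'\<close> are answered by \<open>t + s\<close> for the sum.\<close>
  have "tilt q y (x + x') - (q (x' + s *\<^sub>R y) - s * q y) \<le> tilt q y x" if s: "s \<ge> 0" for s
  proof (rule tilt_greatest)
    fix t :: real assume t: "t \<ge> 0"
    have "tilt q y (x + x') \<le> q ((x + x') + (t + s) *\<^sub>R y) - (t + s) * q y"
      using s t by (intro tilt_le[OF q]) auto
    also have "(x + x') + (t + s) *\<^sub>R y = (x + t *\<^sub>R y) + (x' + s *\<^sub>R y)"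
      by (simp add: algebra_simps)
    also have "q \<dots> - (t + s) * q y \<le> (q (x + t *\<^sub>R y) + q (x' + s *\<^sub>R y)) - (t + s) * q y"
      using sublinear_add[OF q] by (intro diff_right_mono)
    finally show "tilt q y (x + x') - (q (x' + s *\<^sub>R y) - s * q y) \<le> q (x + t *\<^sub>R y) - t * q y"
      by (simp add: algebra_simps)
  qed
  then have "tilt q y (x + x') - tilt q y x \<le> tilt q y x'"
    by (intro tilt_greatest) (simp add: algebra_simps)
  then show "tilt q y (x + x') \<le> tilt q y x + tilt q y x'" by simp
next
  have *: "tilt q y (c *\<^sub>R x) \<le> c * tilt q y x" if c: "c > 0" for c x
  proof -
    have "tilt q y (c *\<^sub>R x) / c \<le> tilt q y x"
    proof (rule tilt_greatest)
      fix t :: real assume t: "t \<ge> 0"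
      have "tilt q y (c *\<^sub>R x) \<le> q (c *\<^sub>R x + (c * t) *\<^sub>R y) - (c * t) * q y"
        using c t by (intro tilt_le[OF q]) auto
      also have "c *\<^sub>R x + (c * t) *\<^sub>R y = c *\<^sub>R (x + t *\<^sub>R y)"
        by (simp add: algebra_simps)
      also have "q \<dots> = c * q (x + t *\<^sub>R y)"
        using c by (simp add: sublinear_scale[OF q])
      finally show "tilt q y (c *\<^sub>R x) / c \<le> q (x + t *\<^sub>R y) - t * q y"
        using c by (simp add: field_simps)
    qed
    then show ?thesis using c by (simp add: field_simps)
  qed
  fix c :: real and x assume "c \<ge> 0"
  then consider "c = 0" | "c > 0" by linarith
  then show "tilt q y (c *\<^sub>R x) = c * tilt q y x"
  proof cases
    case 1
    have "tilt q y 0 \<le> 0"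
      using tilt_le[OF q, of 0 y 0] sublinear_zero[OF q] by simp
    moreover have "0 \<le> tilt q y 0"
      by (rule tilt_greatest) (simp add: sublinear_scale[OF q])
    ultimately show ?thesis using 1 by simp
  next
    case 2
    have "tilt q y x \<le> (1 / c) * tilt q y (c *\<^sub>R x)"
      using *[of "1 / c" "c *\<^sub>R x"] 2 by simp
    then show ?thesis using *[OF 2, of x] 2 by (simp add: field_simps)
  qed
qed

text \<open>Zorn's lemma for the reversed pointwise order. The lower bound of a chain is its
  pointwise infimum, finite because \<open>0 \<le> q x + q (- x)\<close> keeps every
  \<open>q\<close> below \<open>p\<close> above \<open>- p (- x)\<close>.\<close>

lemma minimal_sublinear_below:
  assumes p: "sublinear (p :: 'a::real_vector \<Rightarrow> real)"
  obtains q where "sublinear q" "q \<le> p" "\<And>r. sublinear r \<Longrightarrow> r \<le> q \<Longrightarrow> r = q"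
proof -
  define Q where "Q = {q. sublinear q \<and> q \<le> p}"
  have low: "- p (- x) \<le> q x" if "q \<in> Q" for q x
  proof -
    have "0 \<le> q x + q (- x)" using sublinear_add[of q x "- x"] sublinear_zero[of q] that
      by (simp add: Q_def)
    moreover have "q (- x) \<le> p (- x)" using that by (simp add: Q_def le_fun_def)
    ultimately show ?thesis by linarith
  qed
  have "\<exists>m\<in>Q. \<forall>a\<in>Q. m \<ge> a \<longrightarrow> a = m"
  proof (rule predicate_Zorn[where A = Q and P = "\<lambda>a b. a \<ge> b"])
    show "partial_order_on Q (relation_of (\<lambda>a b. a \<ge> b) Q)"
      by (rule partial_order_on_relation_ofI) auto
  next
    fix C assume C: "C \<in> Chains (relation_of (\<lambda>a b. a \<ge> b) Q)"
    then have CQ: "C \<subseteq> Q" and tot: "\<And>a b. a \<in> C \<Longrightarrow> b \<in> C \<Longrightarrow> a \<le> b \<or> b \<le> a"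
      by (auto simp: Chains_def relation_of_def)
    show "\<exists>u\<in>Q. \<forall>a\<in>C. a \<ge> u"
    proof (cases "C = {}")
      case True
      then show ?thesis using p by (auto simp: Q_def)
    next
      case False
      define u where "u x = (INF q\<in>C. q x)" for x
      have bdd: "bdd_below ((\<lambda>q. q x) ` C)" for x
        using low CQ by (intro bdd_belowI2[where m = "- p (- x)"]) auto
      have le: "u x \<le> q x" if "q \<in> C" for q x
        unfolding u_def by (rule cINF_lower[OF bdd that])
      have gr: "c \<le> u x" if "\<And>q. q \<in> C \<Longrightarrow> c \<le> q x" for c x
        unfolding u_def using False that by (intro cINF_greatest) auto
      have "sublinear u"
        unfolding sublinear_def
      proof (intro conjI allI impI)
        fix x y
        have "u (x + y) - q' y \<le> u x" if q': "q' \<in> C" for q'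
        proof (rule gr)
          fix q assume q: "q \<in> C"
          \<comment> \<open>Subadditivity of the infimum involves two members of the chain; the
            smaller one serves for both arguments.\<close>
          obtain r where r: "r \<in> C" "r \<le> q" "r \<le> q'" using tot[OF q q'] q q' by auto
          have "u (x + y) \<le> r x + r y"
            using le[OF r(1), of "x + y"] sublinear_add[of r x y] r(1) CQ by (force simp: Q_def)
          also have "\<dots> \<le> q x + q' y" using r by (intro add_mono) (auto simp: le_fun_def)
          finally show "u (x + y) - q' y \<le> q x" by simp
        qed
        then have "u (x + y) - u x \<le> u y" by (intro gr) (simp add: algebra_simps)
        then show "u (x + y) \<le> u x + u y" by simp
      next
        have *: "u (c *\<^sub>R x) \<le> c * u x" if c: "c > 0" for c x
        proof -
          have "u (c *\<^sub>R x) / c \<le> u x"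
          proof (rule gr)
            fix q assume q: "q \<in> C"
            then have "q (c *\<^sub>R x) = c * q x" using CQ c by (auto simp: Q_def sublinear_scale)
            then show "u (c *\<^sub>R x) / c \<le> q x" using le[OF q, of "c *\<^sub>R x"] c by (simp add: field_simps)
          qed
          then show ?thesis using c by (simp add: field_simps)
        qed
        fix c :: real and x assume "c \<ge> 0"
        then consider "c = 0" | "c > 0" by linarith
        then show "u (c *\<^sub>R x) = c * u x"
        proof cases
          case 1
          have q0: "q 0 = 0" if "q \<in> C" for q using that CQ by (auto simp: Q_def sublinear_zero)
          obtain q where q: "q \<in> C" using False by auto
          have "0 \<le> u 0" by (rule gr) (simp add: q0)
          then have "u 0 = 0" using q0[OF q] le[OF q, of 0] by simp
          then show ?thesis using 1 by simp
        next
          case 2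
          have "u x \<le> (1 / c) * u (c *\<^sub>R x)"
            using *[of "1 / c" "c *\<^sub>R x"] 2 by simp
          then show ?thesis using *[OF 2, of x] 2 by (simp add: field_simps)
        qed
      qed
      moreover obtain q where "q \<in> C" using False by auto
      then have "q \<le> p" "u \<le> q" using le CQ by (auto simp: Q_def le_fun_def)
      then have "u \<le> p" by (rule order_trans[rotated])
      ultimately show ?thesis using le by (intro bexI[of _ u]) (auto simp: Q_def le_fun_def)
    qed
  qed
  then obtain m where m: "m \<in> Q" "\<And>a. a \<in> Q \<Longrightarrow> a \<le> m \<Longrightarrow> a = m" by blast
  show ?thesis
  proof (rule that[of m])
    fix r assume "sublinear r" "r \<le> m"
    then show "r = m" using m by (auto simp: Q_def)
  qed (use m in \<open>auto simp: Q_def\<close>)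
qed

text \<open>Tilting in a direction \<open>y\<close> never increases a sublinear functional, so a
  minimal one is fixed by it. The parameter \<open>1\<close> in the infimum then gives
  \<open>q x + q y \<le> q (x + y)\<close>, the missing half of additivity.\<close>

lemma minimal_sublinear_linear:
  assumes q: "sublinear q" and min: "\<And>r. sublinear r \<Longrightarrow> r \<le> q \<Longrightarrow> r = q"
  shows "linear q"
proof -
  have add: "q (x + y) = q x + q y" for x y
  proof -
    have "tilt q y \<le> q"
      using tilt_le[OF q, of 0 y] by (simp add: le_fun_def)
    then have "tilt q y = q" by (rule min[OF sublinear_tilt[OF q]])
    then have "q x \<le> q (x + y) - q y" using tilt_le[OF q, of 1 y x] by simp
    then show ?thesis using sublinear_add[OF q, of x y] by simp
  qed
  have neg: "q (- x) = - q x" for x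
    using add[of x "- x"] sublinear_zero[OF q] by simp
  have "q (c *\<^sub>R x) = c * q x" for c x
  proof (cases "c \<ge> 0")
    case True then show ?thesis by (rule sublinear_scale[OF q])
  next
    case False
    then show ?thesis using sublinear_scale[OF q, of "- c" x] neg[of "c *\<^sub>R x"] by simp
  qed
  then show ?thesis using add by (intro linearI) auto
qed

text \<open>The minimal functional is sought below \<open>tilt p x0\<close> instead of
  \<open>p\<close>. This forces \<open>\<phi> (- x0) \<le> - p x0\<close>, so the prescribed value
  at \<open>x0\<close> is built in and no extension from a subspace is carried out.\<close>

lemma Hahn_Banach_seminorm:
  fixes p :: "'a::real_vector \<Rightarrow> real"
  assumes add: "\<And>x y. p (x + y) \<le> p x + p y" and scale: "\<And>c x. p (c *\<^sub>R x) = \<bar>c\<bar> * p x"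
  obtains \<phi> where "linear \<phi>" "\<phi> x0 = p x0" "\<And>y. \<bar>\<phi> y\<bar> \<le> p y"
proof -
  have p: "sublinear p" using assms by (simp add: sublinear_def)
  obtain \<phi> where \<phi>: "sublinear \<phi>" "\<phi> \<le> tilt p x0" "\<And>r. sublinear r \<Longrightarrow> r \<le> \<phi> \<Longrightarrow> r = \<phi>"
    using minimal_sublinear_below[OF sublinear_tilt[OF p]] by blast
  have lin: "linear \<phi>" using \<phi>(1,3) by (rule minimal_sublinear_linear)
  have le: "\<phi> y \<le> p y" for y
    using le_funD[OF \<phi>(2), of y] tilt_le[OF p, of 0 x0 y] by simp
  have pm: "p (- y) = p y" for y using scale[of "-1" y] by simp
  have "\<phi> (- x0) \<le> - p x0"
    using le_funD[OF \<phi>(2), of "- x0"] tilt_le[OF p, of 1 x0 "- x0"] sublinear_zero[OF p] by simp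
  then have "p x0 \<le> \<phi> x0" using linear_neg[OF lin, of x0] by simp
  then have "\<phi> x0 = p x0" using le[of x0] by simp
  moreover have "\<bar>\<phi> y\<bar> \<le> p y" for y
    using le[of y] le[of "- y"] pm[of y] linear_neg[OF lin, of y] by simp
  ultimately show ?thesis using lin that by blast
qed

section \<open>Saks spaces through a norming system of seminorms\<close>

text \<open>The mixed topology survives only in \<open>complete\<close>: it agrees with \<tau> on
  bounded sets, so its sequential completeness becomes convergence of bounded sequences that are
  Cauchy for every seminorm of \<open>P\<close>.\<close>

locale saks_seminorms = normed_space_over scl
  for scl :: "'k::{real_normed_field,euclidean_space} \<Rightarrow> 'a::real_normed_vector \<Rightarrow> 'a" +
  fixes \<tau> :: "'a topology" and P :: "('a \<Rightarrow> real) set"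
  assumes directed: "directed_seminorms scl P"
    and generates: "generates_topology P \<tau>"
    and bdd: "bdd_above ((\<lambda>p. p x) ` P)"
    and norm_SUP: "norm x = (SUP p\<in>P. p x)"
    and complete: "bounded (range u) \<Longrightarrow>
      (\<And>p e. p \<in> P \<Longrightarrow> e > 0 \<Longrightarrow> \<exists>N. \<forall>m\<ge>N. \<forall>n\<ge>N. p (u m - u n) < e) \<Longrightarrow>
      \<exists>l. limitin \<tau> u l sequentially"
begin

lemma P_nonempty: "P \<noteq> {}"
  using directed by (simp add: directed_seminorms_def)

context
  fixes p assumes p: "p \<in> P"
begin

lemma P_nonneg: "0 \<le> p x"
  and P_scl: "p (scl c x) = norm c * p x"
  and P_triangle: "p (x + y) \<le> p x + p y"
  using directed p by (auto simp: directed_seminorms_def seminorm_def)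

lemma P_scaleR: "p (c *\<^sub>R x) = \<bar>c\<bar> * p x"
  using P_scl[of "of_real c" x] by (simp add: scl_of_real)

lemma P_zero: "p 0 = 0"
  using P_scaleR[of 0 0] by simp

lemma P_minus: "p (- x) = p x"
  using P_scaleR[of "-1" x] by simp

lemma P_minus_commute: "p (x - y) = p (y - x)"
  using P_minus[of "x - y"] by simp

lemma P_triangle_diff: "p (x - z) \<le> p (x - y) + p (y - z)"
  using P_triangle[of "x - y" "y - z"] by simp

lemma P_abs_diff: "\<bar>p x - p y\<bar> \<le> p (x - y)"
  using P_triangle[of "x - y" y] P_triangle[of "y - x" x] P_minus_commute[of x y] by simp

lemma P_le_norm: "p x \<le> norm x"
  unfolding norm_SUP[of x] by (rule cSUP_upper[OF p bdd])

end

lemma norm_le_P: "(\<And>p. p \<in> P \<Longrightarrow> p x \<le> c) \<Longrightarrow> norm x \<le> c"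
  unfolding norm_SUP[of x] by (rule cSUP_least[OF P_nonempty])

lemma openin_\<tau>: "openin \<tau> U \<longleftrightarrow> (\<forall>x\<in>U. \<exists>p\<in>P. \<exists>e>0. {y. p (y - x) < e} \<subseteq> U)"
  using generates by (simp add: generates_topology_def)

lemma openin_P_ball: "p \<in> P \<Longrightarrow> openin \<tau> {y. p (y - x) < e}"
  unfolding openin_\<tau>
proof
  fix z assume p: "p \<in> P" and z: "z \<in> {y. p (y - x) < e}"
  have "{y. p (y - z) < e - p (z - x)} \<subseteq> {y. p (y - x) < e}"
  proof clarify
    fix y assume "p (y - z) < e - p (z - x)"
    then show "p (y - x) < e" using P_triangle_diff[OF p, of y x z] by simp
  qed
  then show "\<exists>q\<in>P. \<exists>d>0. {y. q (y - z) < d} \<subseteq> {y. p (y - x) < e}"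
    using p z by (intro bexI[of _ p] exI[of _ "e - p (z - x)"]) auto
qed

lemma topspace_\<tau> [simp]: "topspace \<tau> = UNIV"
proof -
  have "openin \<tau> UNIV" unfolding openin_\<tau> using P_nonempty by (auto intro: zero_less_one)
  then show ?thesis using openin_subset by blast
qed

lemma limitin_iff: "limitin \<tau> f l F \<longleftrightarrow> (\<forall>p\<in>P. ((\<lambda>i. p (f i - l)) \<longlongrightarrow> 0) F)"
proof
  assume lim: "limitin \<tau> f l F"
  show "\<forall>p\<in>P. ((\<lambda>i. p (f i - l)) \<longlongrightarrow> 0) F"
  proof (intro ballI tendstoI)
    fix p and e :: real assume p: "p \<in> P" and e: "e > 0"
    have "\<forall>\<^sub>F i in F. f i \<in> {y. p (y - l) < e}"
      using lim openin_P_ball[OF p, of l e] P_zero[OF p] e by (auto simp: limitin_def)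
    then show "\<forall>\<^sub>F i in F. dist (p (f i - l)) 0 < e"
      by (rule eventually_mono) (use P_nonneg[OF p] in auto)
  qed
next
  assume lim: "\<forall>p\<in>P. ((\<lambda>i. p (f i - l)) \<longlongrightarrow> 0) F"
  show "limitin \<tau> f l F"
    unfolding limitin_def
  proof (intro conjI allI impI)
    fix U assume "openin \<tau> U \<and> l \<in> U"
    then obtain p e where p: "p \<in> P" "e > 0" "{y. p (y - l) < e} \<subseteq> U"
      unfolding openin_\<tau> by blast
    have "\<forall>\<^sub>F i in F. p (f i - l) < e"
      using order_tendstoD(2)[of _ 0 F e] lim p by blast
    then show "\<forall>\<^sub>F i in F. f i \<in> U" by (rule eventually_mono) (use p in auto)
  qed simp
qed

lemma limitinD: "limitin \<tau> f l F \<Longrightarrow> p \<in> P \<Longrightarrow> ((\<lambda>i. p (f i - l)) \<longlongrightarrow> 0) F"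
  by (simp add: limitin_iff)

lemma limitin_norm: "((\<lambda>i. f i) \<longlongrightarrow> l) F \<Longrightarrow> limitin \<tau> f l F"
  unfolding limitin_iff
  by (intro ballI tendsto_sandwich[OF _ _ tendsto_const tendsto_norm_zero[OF LIM_zero]])
     (auto simp: P_nonneg P_le_norm)

lemma limitin_unique:
  assumes "limitin \<tau> f l F" "limitin \<tau> f l' F" "F \<noteq> bot"
  shows "l = l'"
proof -
  have "p (l - l') \<le> 0" if p: "p \<in> P" for p
  proof (rule tendsto_lowerbound[OF _ _ assms(3)])
    show "((\<lambda>i. p (f i - l) + p (f i - l')) \<longlongrightarrow> 0) F"
      using tendsto_add[OF limitinD[OF assms(1) p] limitinD[OF assms(2) p]] by simp
    show "\<forall>\<^sub>F i in F. p (l - l') \<le> p (f i - l) + p (f i - l')"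
    proof (intro always_eventually allI)
      fix i show "p (l - l') \<le> p (f i - l) + p (f i - l')"
        using P_triangle_diff[OF p, of l l' "f i"] P_minus_commute[OF p, of l "f i"] by simp
    qed
  qed
  then have "norm (l - l') \<le> 0" by (rule norm_le_P)
  then show ?thesis by simp
qed

lemma limitin_add:
  assumes "limitin \<tau> f l F" "limitin \<tau> g m F"
  shows "limitin \<tau> (\<lambda>i. f i + g i) (l + m) F"
  unfolding limitin_iff
proof
  fix p assume p: "p \<in> P"
  show "((\<lambda>i. p (f i + g i - (l + m))) \<longlongrightarrow> 0) F"
  proof (rule tendsto_sandwich[OF _ _ tendsto_const])
    show "((\<lambda>i. p (f i - l) + p (g i - m)) \<longlongrightarrow> 0) F"
      using tendsto_add[OF limitinD[OF assms(1) p] limitinD[OF assms(2) p]] by simp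
    show "\<forall>\<^sub>F i in F. p (f i + g i - (l + m)) \<le> p (f i - l) + p (g i - m)"
      unfolding add_diff_add by (intro always_eventually allI P_triangle[OF p])
  qed (simp add: P_nonneg[OF p])
qed

lemma limitin_scl: "limitin \<tau> f l F \<Longrightarrow> limitin \<tau> (\<lambda>i. scl c (f i)) (scl c l) F"
  unfolding limitin_iff scale_right_diff_distrib[symmetric]
proof
  fix p assume *: "\<forall>p\<in>P. ((\<lambda>i. p (f i - l)) \<longlongrightarrow> 0) F" and p: "p \<in> P"
  then have "((\<lambda>i. p (f i - l)) \<longlongrightarrow> 0) F" by blast
  then show "((\<lambda>i. p (scl c (f i - l))) \<longlongrightarrow> 0) F"
    unfolding P_scl[OF p] by (rule tendsto_mult_right_zero)
qed

lemma limitin_scaleR: "limitin \<tau> f l F \<Longrightarrow> limitin \<tau> (\<lambda>i. c *\<^sub>R f i) (c *\<^sub>R l) F"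
  using limitin_scl[of f l F "of_real c"] by (simp add: scl_of_real)

lemma limitin_diff:
  "limitin \<tau> f l F \<Longrightarrow> limitin \<tau> g m F \<Longrightarrow> limitin \<tau> (\<lambda>i. f i - g i) (l - m) F"
  using limitin_add[OF _ limitin_scaleR[of g m F "-1"]] by simp

lemma limitin_const: "limitin \<tau> (\<lambda>i. l) l F"
  by (simp add: limitin_iff P_zero)

text \<open>The norm is a supremum of \<tau>-continuous seminorms, hence lower semicontinuous for
  \<tau>. The bound may vary with the index so that the sharp constant
  \<open>M * exp (\<omega> * t)\<close> can be reached as a limit of bounds.\<close>

lemma norm_limitin_le:
  assumes lim: "limitin \<tau> f l F" and F: "F \<noteq> bot"
    and le: "\<forall>\<^sub>F i in F. norm (f i) \<le> c i" and c: "(c \<longlongrightarrow> b) F"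
  shows "norm l \<le> b"
proof (rule norm_le_P)
  fix p assume p: "p \<in> P"
  show "p l \<le> b"
  proof (rule tendsto_lowerbound[OF _ _ F])
    show "((\<lambda>i. p (f i - l) + c i) \<longlongrightarrow> b) F"
      using tendsto_add[OF limitinD[OF lim p] c] by simp
    show "\<forall>\<^sub>F i in F. p l \<le> p (f i - l) + c i"
      using le
    proof eventually_elim
      case (elim i)
      then show ?case
        using P_triangle[OF p, of "l - f i" "f i"] P_minus_commute[OF p, of l "f i"] P_le_norm[OF p, of "f i"]
        by simp
    qed
  qed
qed

lemma P_limitin_le:
  assumes lim: "limitin \<tau> f l F" and F: "F \<noteq> bot" and p: "p \<in> P"
    and le: "\<forall>\<^sub>F i in F. p (f i) \<le> c"
  shows "p l \<le> c"
proof (rule tendsto_lowerbound[OF _ _ F])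
  show "((\<lambda>i. p (f i - l) + c) \<longlongrightarrow> c) F"
    using tendsto_add[OF limitinD[OF lim p] tendsto_const[of c]] by simp
  show "\<forall>\<^sub>F i in F. p l \<le> p (f i - l) + c"
    using le
  proof eventually_elim
    case (elim i)
    then show ?case
      using P_triangle[OF p, of "l - f i" "f i"] P_minus_commute[OF p, of l "f i"] by simp
  qed
qed

lemma Cauchy_convergent:
  assumes b: "\<forall>\<^sub>F n in sequentially. norm (u n) \<le> C"
    and c: "\<And>p e. p \<in> P \<Longrightarrow> e > 0 \<Longrightarrow> \<exists>N. \<forall>m\<ge>N. \<forall>n\<ge>N. p (u m - u n) < e"
  obtains l where "limitin \<tau> u l sequentially"
proof -
  obtain N where N: "\<And>n. n \<ge> N \<Longrightarrow> norm (u n) \<le> C" using b by (auto simp: eventually_sequentially)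
  have "\<exists>l. limitin \<tau> (\<lambda>n. u (n + N)) l sequentially"
  proof (rule complete)
    show "bounded (range (\<lambda>n. u (n + N)))" using N by (intro boundedI[of _ C]) auto
    fix p and e :: real assume "p \<in> P" "e > 0"
    from c[OF this] show "\<exists>K. \<forall>m\<ge>K. \<forall>n\<ge>K. p (u (m + N) - u (n + N)) < e"
      by (meson trans_le_add1)
  qed
  then obtain l where l: "limitin \<tau> (\<lambda>n. u (n + N)) l sequentially" ..
  have "limitin \<tau> u l sequentially"
    unfolding limitin_iff by (intro ballI LIMSEQ_offset[OF limitinD[OF l]])
  then show ?thesis by (rule that)
qed

text \<open>Real-linear functionals are used over the complex numbers as well: they separate points
  and lead to integrals of real functions only.\<close>

definition bi_functional :: "('a \<Rightarrow> real) \<Rightarrow> bool"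
  where "bi_functional \<phi> \<longleftrightarrow> bounded_linear \<phi> \<and>
    (\<forall>u x. bounded (range u) \<and> limitin \<tau> u x sequentially \<longrightarrow> (\<lambda>n. \<phi> (u n)) \<longlonglongrightarrow> \<phi> x)"

definition bi_operator :: "('a \<Rightarrow> 'a) \<Rightarrow> bool"
  where "bi_operator T \<longleftrightarrow> bounded_linear T \<and>
    (\<forall>u x. bounded (range u) \<and> limitin \<tau> u x sequentially \<longrightarrow>
      limitin \<tau> (\<lambda>n. T (u n)) (T x) sequentially)"

lemma bi_functional_linear: "bi_functional \<phi> \<Longrightarrow> bounded_linear \<phi>"
  by (simp add: bi_functional_def)

lemma bi_functional_tendsto:
  "bi_functional \<phi> \<Longrightarrow> bounded (range u) \<Longrightarrow> limitin \<tau> u x sequentially \<Longrightarrow>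
    (\<lambda>n. \<phi> (u n)) \<longlonglongrightarrow> \<phi> x"
  by (simp add: bi_functional_def)

lemma bi_operator_linear: "bi_operator T \<Longrightarrow> bounded_linear T"
  by (simp add: bi_operator_def)

lemma bi_operator_limitin:
  "bi_operator T \<Longrightarrow> bounded (range u) \<Longrightarrow> limitin \<tau> u x sequentially \<Longrightarrow>
    limitin \<tau> (\<lambda>n. T (u n)) (T x) sequentially"
  by (simp add: bi_operator_def)

lemma bounded_range_linear_image:
  assumes "bounded_linear T" "bounded (range u)"
  shows "bounded (range (\<lambda>n. T (u n)))"
  using bounded_linear_image[OF assms(2,1)] by (simp add: image_image)

text \<open>This closure property is the reason for demanding sequential continuity on bounded sets
  only. The operators of a bi-continuous family need not be \<tau>-continuous, so a class of
  \<tau>-continuous functionals would not be preserved by them.\<close>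

lemma bi_functional_compose:
  assumes "bi_functional \<phi>" "bi_operator T"
  shows "bi_functional (\<lambda>x. \<phi> (T x))"
  unfolding bi_functional_def
proof (intro conjI allI impI)
  show "bounded_linear (\<lambda>x. \<phi> (T x))"
    by (intro bounded_linear_compose[OF bi_functional_linear bi_operator_linear] assms)
  fix u x assume "bounded (range u) \<and> limitin \<tau> u x sequentially"
  then show "(\<lambda>n. \<phi> (T (u n))) \<longlonglongrightarrow> \<phi> (T x)"
    by (intro bi_functional_tendsto[OF assms(1)] bi_operator_limitin[OF assms(2)]
        bounded_range_linear_image[OF bi_operator_linear[OF assms(2)]]) auto
qed

lemma bi_functional_exists:
  assumes p: "p \<in> P"
  obtains \<phi> where "bi_functional \<phi>" "\<And>y. \<bar>\<phi> y\<bar> \<le> p y" "\<phi> x = p x"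
proof -
  obtain \<phi> where \<phi>: "linear \<phi>" "\<phi> x = p x" "\<And>y. \<bar>\<phi> y\<bar> \<le> p y"
    using Hahn_Banach_seminorm[of p x] P_triangle[OF p] P_scaleR[OF p] by metis
  have "bounded_linear \<phi>"
    using \<phi>(1) order_trans[OF \<phi>(3) P_le_norm[OF p]]
    by (intro bounded_linear_intro[of _ 1]) (auto simp: linear_add linear_scale)
  moreover have "(\<lambda>n. \<phi> (u n)) \<longlonglongrightarrow> \<phi> y" if "limitin \<tau> u y sequentially" for u y
  proof (rule LIM_zero_cancel, rule Lim_null_comparison[OF _ limitinD[OF that p]])
    show "\<forall>\<^sub>F n in sequentially. norm (\<phi> (u n) - \<phi> y) \<le> p (u n - y)"
      using \<phi>(3) by (simp add: linear_diff[OF \<phi>(1), symmetric])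
  qed
  ultimately have "bi_functional \<phi>" by (simp add: bi_functional_def)
  then show ?thesis using \<phi> that by blast
qed

text \<open>Scalar estimates return to the space through this rule: a bound that is uniform over all
  functionals below \<open>p\<close> bounds the seminorm itself, because one of them attains
  \<open>p x\<close>.\<close>

lemma P_le_functional:
  assumes p: "p \<in> P"
    and le: "\<And>\<phi>. bi_functional \<phi> \<Longrightarrow> (\<And>y. \<bar>\<phi> y\<bar> \<le> p y) \<Longrightarrow> \<bar>\<phi> x\<bar> \<le> c"
  shows "p x \<le> c"
proof -
  obtain \<phi> where "bi_functional \<phi>" "\<And>y. \<bar>\<phi> y\<bar> \<le> p y" "\<phi> x = p x"
    using bi_functional_exists[OF p, of x] by blast
  then show ?thesis using le[of \<phi>] by simp
qed

lemma norm_le_functional: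
  assumes "\<And>\<phi>. bi_functional \<phi> \<Longrightarrow> (\<And>y. \<bar>\<phi> y\<bar> \<le> norm y) \<Longrightarrow> \<bar>\<phi> x\<bar> \<le> c"
  shows "norm x \<le> c"
proof (rule norm_le_P, rule P_le_functional)
  fix p \<phi> assume p: "p \<in> P" and \<phi>: "bi_functional \<phi>" "\<And>y. \<bar>\<phi> y\<bar> \<le> p y"
  show "\<bar>\<phi> x\<bar> \<le> c" by (rule assms[OF \<phi>(1)]) (use \<phi>(2) P_le_norm[OF p] order_trans in blast)
qed

lemma bi_functional_eqI:
  assumes "\<And>\<phi>. bi_functional \<phi> \<Longrightarrow> \<phi> x = \<phi> y"
  shows "x = y"
proof -
  have "norm (x - y) \<le> 0"
    by (rule norm_le_functional)
       (simp add: assms linear_diff[OF bounded_linear.linear[OF bi_functional_linear]])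
  then show ?thesis by simp
qed

end

text \<open>A bounded sequence that is Cauchy for all seminorms is Cauchy for the mixed topology,
  since its differences stay in one ball, where both topologies agree. Its limit in the mixed
  topology is also a limit for the coarser \<tau>.\<close>

lemma saks_seminorms_exist:
  assumes saks: "saks_space scl \<tau>" and sc: "sequentially_complete_saks scl \<tau>"
  obtains P where "saks_seminorms scl \<tau> P"
proof -
  interpret saks_space scl \<tau> by fact
  obtain P where P0: "directed_seminorms scl P \<and> generates_topology P \<tau> \<and>
         (\<forall>x. bdd_above ((\<lambda>p. p x) ` P) \<and> norm x = (SUP p\<in>P. p x))"
    using norming_seminorms by (elim exE)
  note P = conjunct1[OF P0] conjunct1[OF conjunct2[OF P0]]
  note Pn = conjunct2[OF conjunct2[OF P0], rule_format]
  let ?g = "mixed_topology scl \<tau>"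
  have mix: "mixed_candidate scl \<tau> ?g"
    by (rule mixed_topology_finest(1)[OF mixed_candidate_self])
  have compl: "\<exists>l. limitin \<tau> u l sequentially" if b: "bounded (range u)"
    and c: "\<And>p e. p \<in> P \<Longrightarrow> e > 0 \<Longrightarrow> \<exists>N. \<forall>m\<ge>N. \<forall>n\<ge>N. p (u m - u n) < e" for u :: "nat \<Rightarrow> 'b"
  proof -
    obtain C where C: "\<And>n. norm (u n) \<le> C" using b by (auto simp: bounded_iff)
    have "tvs_Cauchy ?g u"
      unfolding tvs_Cauchy_def
    proof (intro allI impI)
      fix U assume U: "openin ?g U \<and> 0 \<in> U"
      \<comment> \<open>The radius is doubled because the ball has to contain the differences of the
        sequence.\<close>
      let ?B = "cball (0::'b) (2 * C)"
      have "openin (subtopology ?g ?B) (U \<inter> ?B)" using U by (auto simp: openin_subtopology)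
      moreover have "subtopology ?g ?B = subtopology \<tau> ?B"
        using mix by (simp add: mixed_candidate_def)
      ultimately obtain V where V: "openin \<tau> V" "U \<inter> ?B = V \<inter> ?B"
        by (metis openin_subtopology)
      have "0 \<le> C" using C[of 0] norm_ge_zero[of "u 0"] by linarith
      then have "0 \<in> U \<inter> ?B" using U by simp
      then have "0 \<in> V" using V(2) by blast
      then obtain p e where p: "p \<in> P" "e > 0" "{y. p (y - 0) < e} \<subseteq> V"
        using V(1) P(2) unfolding generates_topology_def by blast
      obtain N where N: "\<forall>m\<ge>N. \<forall>n\<ge>N. p (u m - u n) < e" using c[OF p(1,2)] by blast
      have nd: "norm (u m - u n) \<le> 2 * C" for m n
        using norm_triangle_ineq4[of "u m" "u n"] C[of m] C[of n] by simp
      have "u m - u n \<in> U" if "m \<ge> N" "n \<ge> N" for m n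
      proof -
        have "u m - u n \<in> V" using N p(3) that by auto
        then have "u m - u n \<in> V \<inter> ?B" using nd[of m n] by simp
        then show ?thesis using V(2) by blast
      qed
      then show "\<exists>N. \<forall>m\<ge>N. \<forall>n\<ge>N. u m - u n \<in> U" by blast
    qed
    then obtain l where "limitin ?g u l sequentially"
      using sc unfolding sequentially_complete_saks_def sequentially_complete_topology_def by blast
    moreover have "topspace \<tau> = UNIV"
      using mixed_candidate_self by (simp add: mixed_candidate_def linear_topology_def)
    ultimately have "limitin \<tau> u l sequentially"
      using mix unfolding limitin_def mixed_candidate_def by auto
    then show ?thesis ..
  qed
  have "saks_seminorms scl \<tau> P"
  proof (intro saks_seminorms.intro saks_seminorms_axioms.intro normed_space_over_axioms P
      conjunct1[OF Pn] conjunct2[OF Pn])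
    fix u :: "nat \<Rightarrow> 'b"
    assume "bounded (range u)" "\<And>p e. p \<in> P \<Longrightarrow> e > 0 \<Longrightarrow> \<exists>N. \<forall>m\<ge>N. \<forall>n\<ge>N. p (u m - u n) < e"
    then show "\<exists>l. limitin \<tau> u l sequentially" by (rule compl)
  qed
  then show ?thesis by (rule that)
qed

section \<open>The Laplace transform of real functions\<close>

definition laplace :: "(real \<Rightarrow> real) \<Rightarrow> real \<Rightarrow> real"
  where "laplace f s = (LINT t:{0..}|lborel. exp (- s * t) * f t)"

text \<open>Growth is controlled at every rate above \<open>b\<close>, not at \<open>b\<close>
  itself. In this form the class with a fixed \<open>b\<close> is stable under multiplication by
  powers of \<open>t\<close> and, for \<open>b \<ge> 0\<close>, under antiderivatives vanishing at
  \<open>0\<close>.\<close>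

definition exp_growth :: "real \<Rightarrow> (real \<Rightarrow> real) \<Rightarrow> bool"
  where "exp_growth b f \<longleftrightarrow> continuous_on {0..} f \<and> (\<forall>c>b. \<exists>C. \<forall>t\<ge>0. \<bar>f t\<bar> \<le> C * exp (c * t))"

lemma exp_growthI:
  assumes "continuous_on {0..} f" "\<And>t. t \<ge> 0 \<Longrightarrow> \<bar>f t\<bar> \<le> C * exp (b * t)"
  shows "exp_growth b f"
  unfolding exp_growth_def
proof (intro conjI allI impI)
  fix c assume "c > b"
  have "0 \<le> C" using assms(2)[of 0] by simp
  have "\<bar>f t\<bar> \<le> C * exp (c * t)" if "t \<ge> 0" for t
    using assms(2)[OF that] \<open>c > b\<close> that \<open>0 \<le> C\<close>
    by (elim order_trans) (auto intro!: mult_left_mono mult_right_mono)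
  then show "\<exists>C. \<forall>t\<ge>0. \<bar>f t\<bar> \<le> C * exp (c * t)" by blast
qed (fact assms(1))

lemma exp_growthE:
  assumes "exp_growth b f" "c > b"
  obtains C where "C \<ge> 0" "\<And>t. t \<ge> 0 \<Longrightarrow> \<bar>f t\<bar> \<le> C * exp (c * t)"
proof -
  obtain C where C: "\<forall>t\<ge>0. \<bar>f t\<bar> \<le> C * exp (c * t)" using assms by (auto simp: exp_growth_def)
  have "0 \<le> C" using C[rule_format, of 0] by simp
  then show ?thesis using C that by blast
qed

lemma exp_growth_continuous: "exp_growth b f \<Longrightarrow> continuous_on {0..} f"
  by (simp add: exp_growth_def)

lemma exp_growth_add:
  assumes "exp_growth b f" "exp_growth b g"
  shows "exp_growth b (\<lambda>t. f t + g t)"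
  unfolding exp_growth_def
proof (intro conjI allI impI)
  show "continuous_on {0..} (\<lambda>t. f t + g t)"
    by (intro continuous_on_add exp_growth_continuous[OF assms(1)] exp_growth_continuous[OF assms(2)])
  fix c assume c: "c > b"
  obtain C D where "\<And>t. t \<ge> 0 \<Longrightarrow> \<bar>f t\<bar> \<le> C * exp (c * t)" "\<And>t. t \<ge> 0 \<Longrightarrow> \<bar>g t\<bar> \<le> D * exp (c * t)"
    using assms c by (meson exp_growthE)
  then have "\<bar>f t + g t\<bar> \<le> (C + D) * exp (c * t)" if "t \<ge> 0" for t
    using that by (smt (verit) distrib_right)
  then show "\<exists>C. \<forall>t\<ge>0. \<bar>f t + g t\<bar> \<le> C * exp (c * t)" by blast
qed

lemma exp_growth_cmult:
  assumes "exp_growth b f"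
  shows "exp_growth b (\<lambda>t. a * f t)"
  unfolding exp_growth_def
proof (intro conjI allI impI)
  show "continuous_on {0..} (\<lambda>t. a * f t)"
    by (intro continuous_intros exp_growth_continuous[OF assms])
  fix c assume "c > b"
  then obtain C where "\<And>t. t \<ge> 0 \<Longrightarrow> \<bar>f t\<bar> \<le> C * exp (c * t)" using assms by (meson exp_growthE)
  then have "\<bar>a * f t\<bar> \<le> (\<bar>a\<bar> * C) * exp (c * t)" if "t \<ge> 0" for t
    using that by (simp add: abs_mult mult.assoc mult_left_mono)
  then show "\<exists>C. \<forall>t\<ge>0. \<bar>a * f t\<bar> \<le> C * exp (c * t)" by blast
qed

lemma exp_growth_diff: "exp_growth b f \<Longrightarrow> exp_growth b g \<Longrightarrow> exp_growth b (\<lambda>t. f t - g t)"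
  using exp_growth_add[OF _ exp_growth_cmult[of b g "-1"]] by simp

lemma exp_growth_exp: "c \<le> b \<Longrightarrow> exp_growth b (\<lambda>t. exp (c * t))"
  by (rule exp_growthI[where C = 1]) (auto intro!: continuous_intros mult_right_mono)

lemma exp_growth_const: "b \<ge> 0 \<Longrightarrow> exp_growth b (\<lambda>t. c)"
  using exp_growth_cmult[OF exp_growth_exp[of 0 b], of c] by simp

lemma exp_growth_times:
  assumes "exp_growth b f"
  shows "exp_growth b (\<lambda>t. t * f t)"
  unfolding exp_growth_def
proof (intro conjI allI impI)
  show "continuous_on {0..} (\<lambda>t. t * f t)"
    by (intro continuous_intros exp_growth_continuous[OF assms])
  fix c assume c: "c > b"
  \<comment> \<open>One half of the gap between \<open>b\<close> and \<open>c\<close> pays for the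
    factor \<open>t\<close>, through \<open>d * t \<le> exp (d * t)\<close>.\<close>
  define d where "d = (c - b) / 2"
  have d: "d > 0" "c = (c - d) + d" "c - d > b" using c by (auto simp: d_def field_simps)
  obtain C where C: "C \<ge> 0" "\<And>t. t \<ge> 0 \<Longrightarrow> \<bar>f t\<bar> \<le> C * exp ((c - d) * t)"
    using exp_growthE[OF assms d(3)] by blast
  have "\<bar>t * f t\<bar> \<le> (C / d) * exp (c * t)" if t: "t \<ge> 0" for t
  proof -
    have "d * t \<le> exp (d * t)" using exp_ge_add_one_self[of "d * t"] by linarith
    then have "t \<le> exp (d * t) / d" using d by (simp add: field_simps)
    then have "t * \<bar>f t\<bar> \<le> (exp (d * t) / d) * (C * exp ((c - d) * t))"
      using C(2)[OF t] t by (intro mult_mono) auto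
    also have "\<dots> = (C / d) * exp (c * t)"
      by (simp add: exp_add[symmetric] algebra_simps)
    finally show ?thesis using t by (simp add: abs_mult)
  qed
  then show "\<exists>C. \<forall>t\<ge>0. \<bar>t * f t\<bar> \<le> C * exp (c * t)" by blast
qed

lemma exp_growth_power: "exp_growth b f \<Longrightarrow> exp_growth b (\<lambda>t. t ^ m * f t)"
  by (induction m) (auto simp: mult.assoc dest: exp_growth_times)

lemma set_integrable_exp_minus:
  assumes "a > 0"
  shows "set_integrable lborel {0..} (\<lambda>t. exp (- a * t) :: real)"
proof -
  have "(\<lambda>t. exp (- a * t)) absolutely_integrable_on {0..}"
    using has_integral_exp_minus_to_infinity[OF assms, of 0]
    by (intro nonnegative_absolutely_integrable_1) (auto simp: integrable_on_def)
  then show ?thesis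
    unfolding set_integrable_def by (subst (asm) integrable_completion) auto
qed

lemma set_borel_measurable_continuous:
  assumes "continuous_on {0..} (f :: real \<Rightarrow> real)"
  shows "set_borel_measurable lborel {0..} f"
  using borel_measurable_continuous_on_indicator[OF _ assms]
  by (simp add: set_borel_measurable_def)

lemma laplace_integrable:
  assumes "exp_growth b f" "s > b"
  shows "set_integrable lborel {0..} (\<lambda>t. exp (- s * t) * f t)"
proof -
  define c where "c = (b + s) / 2"
  have c: "c > b" "s > c" using assms(2) by (auto simp: c_def)
  obtain C where C: "C \<ge> 0" "\<And>t. t \<ge> 0 \<Longrightarrow> \<bar>f t\<bar> \<le> C * exp (c * t)"
    using exp_growthE[OF assms(1) c(1)] by blast
  have "set_integrable lborel {0..} (\<lambda>t. C * exp (- (s - c) * t))"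
    using set_integrable_exp_minus[of "s - c"] c by simp
  then show ?thesis
  proof (rule set_integrable_bound)
    show "set_borel_measurable lborel {0..} (\<lambda>t. exp (- s * t) * f t)"
      by (rule set_borel_measurable_continuous)
         (intro continuous_intros exp_growth_continuous[OF assms(1)])
    show "AE t in lborel. t \<in> {0..} \<longrightarrow> norm (exp (- s * t) * f t) \<le> norm (C * exp (- (s - c) * t))"
    proof (intro AE_I2 impI)
      fix t :: real assume "t \<in> {0..}"
      then have "exp (- s * t) * \<bar>f t\<bar> \<le> exp (- s * t) * (C * exp (c * t))"
        by (intro mult_left_mono C) auto
      also have "\<dots> = C * exp (- (s - c) * t)"
        by (simp add: exp_add[symmetric] algebra_simps)
      finally show "norm (exp (- s * t) * f t) \<le> norm (C * exp (- (s - c) * t))"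
        using C(1) by (simp add: abs_mult)
    qed
  qed
qed

lemma laplace_cong: "(\<And>t. t \<ge> 0 \<Longrightarrow> f t = g t) \<Longrightarrow> laplace f s = laplace g s"
  unfolding laplace_def by (intro set_lebesgue_integral_cong) auto

lemma laplace_add:
  "exp_growth b f \<Longrightarrow> exp_growth b g \<Longrightarrow> s > b \<Longrightarrow> laplace (\<lambda>t. f t + g t) s = laplace f s + laplace g s"
  unfolding laplace_def distrib_left by (rule set_integral_add) (rule laplace_integrable; assumption)+

lemma laplace_diff:
  "exp_growth b f \<Longrightarrow> exp_growth b g \<Longrightarrow> s > b \<Longrightarrow> laplace (\<lambda>t. f t - g t) s = laplace f s - laplace g s"
  unfolding laplace_def right_diff_distrib by (rule set_integral_diff) (rule laplace_integrable; assumption)+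

lemma laplace_cmult: "laplace (\<lambda>t. a * f t) s = a * laplace f s"
  unfolding laplace_def by (subst mult.left_commute) simp

lemma laplace_mono:
  assumes "exp_growth b f" "exp_growth b g" "s > b" "\<And>t. t \<ge> 0 \<Longrightarrow> f t \<le> g t"
  shows "laplace f s \<le> laplace g s"
  unfolding laplace_def
  by (intro set_integral_mono laplace_integrable[OF _ assms(3)] assms) (auto intro!: assms mult_left_mono)

lemma laplace_abs_le:
  assumes "exp_growth b f" "exp_growth b g" "s > b" "\<And>t. t \<ge> 0 \<Longrightarrow> \<bar>f t\<bar> \<le> g t"
  shows "\<bar>laplace f s\<bar> \<le> laplace g s"
proof -
  have "f t \<le> g t" "- 1 * f t \<le> g t" if "t \<ge> 0" for t using assms(4)[OF that] by auto
  then show ?thesis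
    using laplace_mono[OF assms(1-3)] laplace_mono[OF exp_growth_cmult[OF assms(1), of "-1"] assms(2,3)]
      laplace_cmult[of "-1" f s] by fastforce
qed

lemma laplace_exp: "s > c \<Longrightarrow> laplace (\<lambda>t. exp (c * t)) s = 1 / (s - c)"
proof -
  assume s: "s > c"
  have "laplace (\<lambda>t. exp (c * t)) s = (LINT t:{0..}|lborel. exp (- (s - c) * t))"
    unfolding laplace_def by (intro set_lebesgue_integral_cong) (auto simp: exp_add[symmetric] algebra_simps)
  also have "\<dots> = integral {0..} (\<lambda>t. exp (- (s - c) * t))"
    by (rule set_borel_integral_eq_integral(2)[OF set_integrable_exp_minus]) (use s in simp)
  also have "\<dots> = 1 / (s - c)"
    using has_integral_exp_minus_to_infinity[of "s - c" 0] s by (simp add: integral_unique)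
  finally show ?thesis .
qed

lemma exp_minus_diff_le:
  fixes a b m :: real
  assumes "m \<le> a" "m \<le> b"
  shows "\<bar>exp (- a) - exp (- b)\<bar> \<le> \<bar>a - b\<bar> * exp (- m)"
proof -
  have *: "\<bar>exp (- a) - exp (- b)\<bar> \<le> \<bar>a - b\<bar> * exp (- m)" if "m \<le> a" "a \<le> b" for a b
  proof -
    have "exp (- a) - exp (- b) = exp (- a) * (1 - exp (- (b - a)))"
      by (simp add: right_diff_distrib exp_add[symmetric])
    also have "\<dots> \<le> exp (- m) * (b - a)"
    proof (intro mult_mono)
      show "1 - exp (- (b - a)) \<le> b - a" using exp_ge_add_one_self[of "- (b - a)"] by linarith
    qed (use that in auto)
    finally show ?thesis using that by (simp add: mult.commute abs_if)
  qed
  show ?thesis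
    using *[of a b] *[of b a] assms by (cases a b rule: le_cases) (auto simp: abs_minus_commute)
qed

text \<open>Differentiation under the integral by dominated convergence. The auxiliary
  \<open>r\<close> lies strictly between \<open>b\<close> and \<open>s\<close>; for parameters above
  \<open>r\<close> the difference quotients of the kernel are bounded by
  \<open>t * exp (- r * t)\<close>, by \<open>exp_minus_diff_le\<close>, and this is still
  integrable against \<open>f\<close>.\<close>

lemma laplace_DERIV:
  assumes f: "exp_growth b f" and s: "s > b"
  shows "(laplace f has_real_derivative - laplace (\<lambda>t. t * f t) s) (at s)"
proof -
  define r where "r = (b + s) / 2"
  have r: "r > b" "s > r" using s by (auto simp: r_def)
  let ?T = "{r<..}"
  have "((\<lambda>y. (laplace f y - laplace f s) / (y - s)) \<longlongrightarrow> - laplace (\<lambda>t. t * f t) s) (at s within ?T)"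
    unfolding tendsto_at_iff_sequentially comp_def
  proof (intro allI impI)
    fix X :: "nat \<Rightarrow> real" assume X: "\<forall>i. X i \<in> ?T - {s}" and lim: "X \<longlonglongrightarrow> s"
    let ?q = "\<lambda>i t. ((exp (- X i * t) - exp (- s * t)) / (X i - s)) * f t"
    have eq: "(laplace f (X i) - laplace f s) / (X i - s) = (LINT t:{0..}|lborel. ?q i t)" for i
    proof -
      have "laplace f (X i) - laplace f s = (LINT t:{0..}|lborel. exp (- X i * t) * f t - exp (- s * t) * f t)"
        unfolding laplace_def
      proof (rule set_integral_diff(2)[symmetric])
        have "b < X i" using X[rule_format, of i] r(1) by simp
        then show "set_integrable lborel {0..} (\<lambda>t. exp (- X i * t) * f t)" by (rule laplace_integrable[OF f])
      qed (rule laplace_integrable[OF f s])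
      then have "(laplace f (X i) - laplace f s) / (X i - s) =
          (LINT t:{0..}|lborel. (exp (- X i * t) * f t - exp (- s * t) * f t) / (X i - s))"
        by simp
      then show ?thesis by (simp add: left_diff_distrib[symmetric] field_simps)
    qed
    have cont: "continuous_on {0..} (\<lambda>t. ?q i t)" for i
      by (intro continuous_intros exp_growth_continuous[OF f]) (use X in auto)
    have lim0: "(\<lambda>i. (exp (- X i * t) - exp (- s * t)) / (X i - s)) \<longlonglongrightarrow> - t * exp (- s * t)" for t
    proof -
      have "((\<lambda>y. exp (- y * t)) has_real_derivative - t * exp (- s * t)) (at s)"
        by (auto intro!: derivative_eq_intros)
      then have "((\<lambda>y. (exp (- y * t) - exp (- s * t)) / (y - s)) \<longlongrightarrow> - t * exp (- s * t)) (at s)"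
        by (simp add: has_field_derivative_iff)
      then show ?thesis
        unfolding tendsto_at_iff_sequentially comp_def using X lim by auto
    qed
    have "(\<lambda>i. LINT t:{0..}|lborel. ?q i t) \<longlonglongrightarrow> (LINT t:{0..}|lborel. (- t * exp (- s * t)) * f t)"
      unfolding set_lebesgue_integral_def
    proof (rule integral_dominated_convergence)
      show "integrable lborel (\<lambda>t. indicator {0..} t *\<^sub>R \<bar>exp (- r * t) * (t * f t)\<bar>)"
        using set_integrable_abs[OF laplace_integrable[OF exp_growth_times[OF f] r(1)]]
        by (simp add: set_integrable_def)
      show "(\<lambda>t. indicator {0..} t *\<^sub>R ?q i t) \<in> borel_measurable lborel" for i
        using set_borel_measurable_continuous[OF cont[of i]] by (simp add: set_borel_measurable_def)
      show "(\<lambda>t. indicator {0..} t *\<^sub>R (- t * exp (- s * t) * f t)) \<in> borel_measurable lborel"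
      proof -
        have "continuous_on {0..} (\<lambda>t. - t * exp (- s * t) * f t)"
          by (intro continuous_intros exp_growth_continuous[OF f])
        from set_borel_measurable_continuous[OF this] show ?thesis
          by (simp add: set_borel_measurable_def)
      qed
      show "AE t in lborel. (\<lambda>i. indicator {0..} t *\<^sub>R ?q i t) \<longlonglongrightarrow>
          indicator {0..} t *\<^sub>R (- t * exp (- s * t) * f t)"
        by (intro AE_I2 tendsto_intros lim0)
      show "AE t in lborel. norm (indicator {0..} t *\<^sub>R ?q i t) \<le>
          indicator {0..} t *\<^sub>R \<bar>exp (- r * t) * (t * f t)\<bar>" for i
      proof (intro AE_I2)
        fix t :: real
        have "norm (?q i t) \<le> \<bar>exp (- r * t) * (t * f t)\<bar>" if t: "t \<ge> 0"
        proof -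
          have "\<bar>exp (- (X i * t)) - exp (- (s * t))\<bar> \<le> \<bar>X i * t - s * t\<bar> * exp (- (r * t))"
            using X r t by (intro exp_minus_diff_le mult_right_mono) (auto simp: less_imp_le)
          also have "\<dots> = \<bar>X i - s\<bar> * (t * exp (- (r * t)))"
            using t by (simp add: left_diff_distrib[symmetric] abs_mult)
          finally have "\<bar>(exp (- X i * t) - exp (- s * t)) / (X i - s)\<bar> \<le> t * exp (- (r * t))"
            using X by (simp add: abs_divide divide_le_eq mult.commute)
          then have "\<bar>(exp (- X i * t) - exp (- s * t)) / (X i - s)\<bar> * \<bar>f t\<bar> \<le> t * exp (- (r * t)) * \<bar>f t\<bar>"
            by (rule mult_right_mono) simp
          then show ?thesis using t by (simp add: abs_mult mult_ac)
        qed
        then show "norm (indicator {0..} t *\<^sub>R ?q i t) \<le> indicator {0..} t *\<^sub>R \<bar>exp (- r * t) * (t * f t)\<bar>"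
          by (auto simp: indicator_def)
      qed
    qed
    also have "(LINT t:{0..}|lborel. (- t * exp (- s * t)) * f t) = - laplace (\<lambda>t. t * f t) s"
      using laplace_cmult[of "-1" "\<lambda>t. t * f t" s]
      by (simp add: laplace_def mult_ac)
    finally show "(\<lambda>i. (laplace f (X i) - laplace f s) / (X i - s)) \<longlonglongrightarrow> - laplace (\<lambda>t. t * f t) s"
      unfolding eq .
  qed
  then have "(laplace f has_real_derivative - laplace (\<lambda>t. t * f t) s) (at s within ?T)"
    by (simp add: has_field_derivative_iff)
  moreover have "at s within ?T = at s" using r by (intro at_within_open) auto
  ultimately show ?thesis by simp
qed

text \<open>Induction by differentiation in the transform variable: one more factor
  \<open>- t\<close> on the left, the derivative of a power on the right.\<close>

lemma laplace_power_exp: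
  "s > c \<Longrightarrow> laplace (\<lambda>t. t ^ m * exp (c * t)) s = fact m / (s - c) ^ Suc m"
proof (induction m arbitrary: s)
  case 0
  then show ?case by (simp add: laplace_exp)
next
  case (Suc m)
  have "((\<lambda>s. fact m * inverse ((s - c) ^ Suc m)) has_real_derivative
      - laplace (\<lambda>t. t * (t ^ m * exp (c * t))) s) (at s)"
  proof (rule has_field_derivative_transform_within_open)
    show "(laplace (\<lambda>t. t ^ m * exp (c * t)) has_real_derivative
        - laplace (\<lambda>t. t * (t ^ m * exp (c * t))) s) (at s)"
      by (intro laplace_DERIV[OF exp_growth_power[OF exp_growth_exp[OF order_refl]]] Suc.prems)
    show "open {c<..}" "s \<in> {c<..}" using Suc.prems by auto
    fix s assume "s \<in> {c<..}"
    then show "laplace (\<lambda>t. t ^ m * exp (c * t)) s = fact m * inverse ((s - c) ^ Suc m)"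
      using Suc.IH[of s] by (simp add: divide_inverse)
  qed
  moreover have "((\<lambda>s. fact m * inverse ((s - c) ^ Suc m)) has_real_derivative
      - (fact (Suc m) / (s - c) ^ Suc (Suc m))) (at s)"
    using Suc.prems
    by (auto intro!: derivative_eq_intros simp: field_simps simp del: power_Suc)
       (simp add: field_simps)
  ultimately have "laplace (\<lambda>t. t * (t ^ m * exp (c * t))) s = fact (Suc m) / (s - c) ^ Suc (Suc m)"
    using DERIV_unique neg_equal_iff_equal by blast
  then show ?case by (simp add: mult.assoc)
qed

lemma exp_growth_bounded_mult:
  assumes f: "exp_growth b f" and g: "continuous_on {0..} g" "\<And>t. t \<ge> 0 \<Longrightarrow> \<bar>g t\<bar> \<le> K"
  shows "exp_growth b (\<lambda>t. g t * f t)"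
  unfolding exp_growth_def
proof (intro conjI allI impI)
  show "continuous_on {0..} (\<lambda>t. g t * f t)"
    by (intro continuous_intros exp_growth_continuous[OF f] g)
  fix c assume "c > b"
  then obtain C where C: "\<And>t. t \<ge> 0 \<Longrightarrow> \<bar>f t\<bar> \<le> C * exp (c * t)" using f by (meson exp_growthE)
  have "\<bar>g t * f t\<bar> \<le> (K * C) * exp (c * t)" if "t \<ge> 0" for t
    using mult_mono[OF g(2)[OF that] C[OF that]] g(2)[OF that] by (simp add: abs_mult mult.assoc)
  then show "\<exists>C. \<forall>t\<ge>0. \<bar>g t * f t\<bar> \<le> C * exp (c * t)" by blast
qed

lemma exp_growth_weaken: "exp_growth b f \<Longrightarrow> b \<le> c \<Longrightarrow> exp_growth c f"
  unfolding exp_growth_def by auto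

lemma exp_growth_sum:
  assumes "\<And>i. i \<in> I \<Longrightarrow> exp_growth b (f i)"
  shows "exp_growth b (\<lambda>t. \<Sum>i\<in>I. f i t)"
  using assms
proof (induction I rule: infinite_finite_induct)
  case (insert x F)
  then show ?case by (simp add: exp_growth_add)
qed (auto simp: exp_growth_def intro!: exI[of _ 0])

lemma laplace_zero: "laplace (\<lambda>t. 0) s = 0"
  by (simp add: laplace_def)

lemma laplace_sum:
  assumes "finite I" "\<And>i. i \<in> I \<Longrightarrow> exp_growth b (f i)" "s > b"
  shows "laplace (\<lambda>t. \<Sum>i\<in>I. f i t) s = (\<Sum>i\<in>I. laplace (f i) s)"
  using assms(1,2)
proof (induction I)
  case (insert x F)
  then show ?case
    using laplace_add[of b "f x" "\<lambda>t. \<Sum>i\<in>F. f i t" s] assms(3) by (simp add: exp_growth_sum)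
qed (simp add: laplace_zero)

lemma laplace_shift: "laplace (\<lambda>t. exp (- c * t) * f t) s = laplace f (s + c)"
  unfolding laplace_def
  by (intro set_lebesgue_integral_cong) (auto simp: exp_add[symmetric] algebra_simps mult.assoc[symmetric])

lemma laplace_nonneg_eq_0:
  assumes f: "exp_growth b f" and s: "s > b" and nonneg: "\<And>t. t \<ge> 0 \<Longrightarrow> f t \<ge> 0"
    and le: "laplace f s \<le> 0" and t: "t \<ge> 0"
  shows "f t = 0"
proof -
  let ?g = "\<lambda>t. exp (- s * t) * f t"
  have int: "set_integrable lborel {0..} ?g" by (rule laplace_integrable[OF f s])
  \<comment> \<open>The right end \<open>t + 1\<close> keeps the interval nondegenerate for
    \<open>t = 0\<close>, as required for concluding that a continuous nonnegative function with
    zero integral vanishes.\<close>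
  have cont: "continuous_on {0..t + 1} ?g"
    by (rule continuous_on_subset[of "{0..}"]) (auto intro!: continuous_intros exp_growth_continuous[OF f])
  have "integral {0..t + 1} ?g \<le> integral {0..} ?g"
  proof (rule integral_subset_le)
    show "?g integrable_on {0..t + 1}"
      using cont by (rule integrable_continuous_interval)
    show "?g integrable_on {0..}"
      using set_borel_integral_eq_integral(1)[OF int] .
  qed (use nonneg in auto)
  also have "\<dots> \<le> 0"
    using le set_borel_integral_eq_integral(2)[OF int] by (simp add: laplace_def)
  finally have "integral {0..t + 1} ?g \<le> 0" .
  moreover have "0 \<le> integral {0..t + 1} ?g"
    by (rule integral_nonneg) (use nonneg cont in \<open>auto intro: integrable_continuous_interval\<close>)
  ultimately have "integral {0..t + 1} ?g = 0" by simp
  then have "?g t = 0"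
    using integral_eq_0_iff[OF cont] nonneg t by fastforce
  then show ?thesis by simp
qed

text \<open>
  Substituting \<open>y = exp (- t)\<close> turns the values of the transform at \<open>b + 2, b + 3, \<dots>\<close> into the moments
  of a function on \<open>[0, 1]\<close>, so that Weierstrass approximation applies.
\<close>

theorem laplace_unique_zero:
  assumes f: "exp_growth b f" and zero: "\<And>s. s > b \<Longrightarrow> laplace f s = 0" and t: "t \<ge> 0"
  shows "f t = 0"
proof -
  \<comment> \<open>Since \<open>f\<close> is \<open>O(exp ((b + 1) * t))\<close>, the weight leaves
    \<open>h = O(exp (- t))\<close>, that is, \<open>O(y)\<close> in the variable
    \<open>y = exp (- t)\<close>. This is what makes \<psi> below continuous at \<open>0\<close>,
    and it brings the transform point \<open>0\<close> into the admissible range.\<close>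
  define h where "h t = exp (- (b + 2) * t) * f t" for t
  have cont_h: "continuous_on {0..} h"
    unfolding h_def by (intro continuous_intros exp_growth_continuous[OF f])
  obtain C where C: "C \<ge> 0" "\<And>t. t \<ge> 0 \<Longrightarrow> \<bar>f t\<bar> \<le> C * exp ((b + 1) * t)"
    using exp_growthE[OF f, of "b + 1"] by auto
  have h_le: "\<bar>h t\<bar> \<le> C * exp (- t)" if "t \<ge> 0" for t
  proof -
    have "\<bar>h t\<bar> \<le> exp (- (b + 2) * t) * (C * exp ((b + 1) * t))"
      unfolding h_def abs_mult abs_exp_cancel by (intro mult_left_mono C that) simp
    also have "\<dots> = C * exp (- t)" by (simp add: exp_add[symmetric] algebra_simps)
    finally show ?thesis .
  qed
  have gh: "exp_growth (- 1) h"
    by (rule exp_growthI[OF cont_h, of C]) (use h_le in simp)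
  have gexp: "exp_growth (- 1) (\<lambda>t. exp (- t) ^ i * h t)" for i
    by (rule exp_growth_bounded_mult[OF gh, where K = 1]) (auto intro!: continuous_intros power_le_one)
  have moments: "laplace (\<lambda>t. exp (- t) ^ i * h t) 0 = 0" for i
  proof -
    have "laplace (\<lambda>t. exp (- t) ^ i * h t) 0 = laplace (\<lambda>t. exp (- (real i) * t) * (exp (- (b + 2) * t) * f t)) 0"
      by (rule laplace_cong) (simp add: h_def exp_of_nat_mult[symmetric])
    also have "\<dots> = laplace f (b + 2 + real i)"
      unfolding laplace_shift by (simp add: add.commute)
    finally show ?thesis using zero by simp
  qed
  \<comment> \<open>Only the approximation is done in the variable \<open>y\<close>; the integrals
    stay in \<open>t\<close>, where \<open>g (exp (- t))\<close> is a linear combination of the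
    functions with vanishing moments.\<close>
  define \<psi> where "\<psi> y = (if y \<le> 0 then 0 else h (- ln y))" for y :: real
  have "continuous_on {0..1} \<psi>"
    unfolding continuous_on_eq_continuous_within
  proof
    fix y :: real assume y: "y \<in> {0..1}"
    show "continuous (at y within {0..1}) \<psi>"
    proof (cases "y = 0")
      case True
      have "(\<psi> \<longlongrightarrow> 0) (at 0 within {0..1})"
      proof (rule Lim_null_comparison)
        show "\<forall>\<^sub>F y in at 0 within {0..1}. norm (\<psi> y) \<le> C * y"
          unfolding eventually_at_filter
        proof (rule always_eventually, intro allI impI)
          fix y :: real assume "y \<noteq> 0" "y \<in> {0..1}"
          then show "norm (\<psi> y) \<le> C * y" using h_le[of "- ln y"] by (auto simp: \<psi>_def)
        qed
        show "((\<lambda>y. C * y) \<longlongrightarrow> 0) (at 0 within {0..1})"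
          by (rule tendsto_eq_intros refl tendsto_ident_at)+ simp
      qed
      then show ?thesis using True by (simp add: continuous_within \<psi>_def)
    next
      case False
      have "continuous_on {0<..1} (\<lambda>y. h (- ln y))"
        by (rule continuous_on_compose2[OF cont_h]) (auto intro!: continuous_intros)
      then have "continuous_on {0<..1} \<psi>"
        by (rule continuous_on_eq) (auto simp: \<psi>_def)
      then have "continuous (at y within {0<..1}) \<psi>"
        using False y by (auto simp: continuous_on_eq_continuous_within)
      moreover have "at y within {0<..1} = at y within {0..1}"
        using False y by (intro at_within_nhd[of _ "{0<..}"]) auto
      ultimately show ?thesis by simp
    qed
  qed
  then have approx: "\<exists>g. real_polynomial_function g \<and> (\<forall>y\<in>{0..1}. \<bar>\<psi> y - g y\<bar> < e)" if "e > 0" for e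
    using Stone_Weierstrass_real_polynomial_function[of "{0..1}" \<psi> e] that by (metis compact_Icc)
  have ghh: "exp_growth (- 1) (\<lambda>t. h t * h t)"
    by (rule exp_growth_bounded_mult[OF gh cont_h, where K = C])
       (meson C(1) exp_le_one_iff h_le mult_left_le neg_le_0_iff_le order_trans)
  have gabs: "exp_growth (- 1) (\<lambda>t. \<bar>h t\<bar>)"
    using h_le by (intro exp_growthI[where C = C] continuous_intros cont_h) auto
  \<comment> \<open>The moments annihilate the polynomial, so the integral of \<open>h * h\<close>
    equals that of \<open>(h - g) * h\<close>, which is small; letting \<open>e\<close> tend to
    \<open>0\<close> shows that the square has integral \<open>0\<close>.\<close>
  have le_e: "laplace (\<lambda>t. h t * h t) 0 \<le> e * laplace (\<lambda>t. \<bar>h t\<bar>) 0" if e: "e > 0" for e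
  proof -
    obtain g where g: "real_polynomial_function g" "\<And>y. y \<in> {0..1} \<Longrightarrow> \<bar>\<psi> y - g y\<bar> < e"
      using approx[OF e] by blast
    obtain a n where gs: "g = (\<lambda>x. \<Sum>i\<le>n. a i * x ^ i)"
      using g(1) by (auto simp: real_polynomial_function_iff_sum)
    have gg: "exp_growth (- 1) (\<lambda>t. g (exp (- t)) * h t)"
      unfolding gs sum_distrib_right mult.assoc by (intro exp_growth_sum exp_growth_cmult gexp)
    have "laplace (\<lambda>t. g (exp (- t)) * h t) 0 = (\<Sum>i\<le>n. laplace (\<lambda>t. a i * (exp (- t) ^ i * h t)) 0)"
      unfolding gs sum_distrib_right mult.assoc
      by (rule laplace_sum[of _ "-1"]) (auto intro: exp_growth_cmult gexp)
    also have "\<dots> = 0" by (simp add: laplace_cmult moments)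
    finally have "laplace (\<lambda>t. h t * h t) 0 = laplace (\<lambda>t. h t * h t - g (exp (- t)) * h t) 0"
      using laplace_diff[OF ghh gg, of 0] by simp
    also have "\<dots> \<le> laplace (\<lambda>t. e * \<bar>h t\<bar>) 0"
    proof (rule laplace_mono[of "-1"])
      fix t :: real assume "t \<ge> 0"
      then have "\<bar>h t - g (exp (- t))\<bar> \<le> e"
        using g(2)[of "exp (- t)"] by (simp add: \<psi>_def)
      then have "\<bar>h t - g (exp (- t))\<bar> * \<bar>h t\<bar> \<le> e * \<bar>h t\<bar>" by (rule mult_right_mono) simp
      then show "h t * h t - g (exp (- t)) * h t \<le> e * \<bar>h t\<bar>"
        unfolding abs_mult[symmetric] by (simp add: left_diff_distrib)
    qed (auto intro: exp_growth_diff exp_growth_cmult ghh gg gabs)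
    finally show ?thesis by (simp add: laplace_cmult)
  qed
  have "laplace (\<lambda>t. h t * h t) 0 \<le> 0"
  proof (rule tendsto_lowerbound)
    show "((\<lambda>e. e * laplace (\<lambda>t. \<bar>h t\<bar>) 0) \<longlongrightarrow> 0) (at_right 0)"
      by (rule tendsto_eq_intros refl tendsto_ident_at)+ simp
    show "\<forall>\<^sub>F e in at_right 0. laplace (\<lambda>t. h t * h t) 0 \<le> e * laplace (\<lambda>t. \<bar>h t\<bar>) 0"
      using eventually_at_right_less by (rule eventually_mono) (rule le_e)
  qed simp
  then have "h t * h t = 0"
    by (intro laplace_nonneg_eq_0[OF ghh _ _ _ t]) auto
  then show ?thesis by (simp add: h_def)
qed

lemma laplace_unique:
  assumes f: "exp_growth b f" and g: "exp_growth b g"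
    and eq: "\<And>s. s > b \<Longrightarrow> laplace f s = laplace g s" and t: "t \<ge> 0"
  shows "f t = g t"
  using laplace_unique_zero[OF exp_growth_diff[OF f g] _ t] laplace_diff[OF f g] eq by simp

section \<open>Transforms of second derivatives and of shifted functions\<close>

lemma exp_growth_tendsto_0:
  assumes f: "exp_growth b f" and s: "s > b"
  shows "((\<lambda>t. exp (- s * t) * f t) \<longlongrightarrow> 0) at_top"
proof -
  define c where "c = (b + s) / 2"
  have c: "c > b" "s > c" using s by (auto simp: c_def)
  obtain C where C: "\<And>t. t \<ge> 0 \<Longrightarrow> \<bar>f t\<bar> \<le> C * exp (c * t)" using f c by (meson exp_growthE)
  show ?thesis
  proof (rule Lim_null_comparison)
    show "\<forall>\<^sub>F t in at_top. norm (exp (- s * t) * f t) \<le> C * exp (- ((s - c) * t))"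
      using eventually_ge_at_top[of 0]
    proof eventually_elim
      case (elim t)
      then have "exp (- s * t) * \<bar>f t\<bar> \<le> exp (- s * t) * (C * exp (c * t))"
        by (intro mult_left_mono C) auto
      then show ?case by (simp add: abs_mult exp_add[symmetric] algebra_simps)
    qed
    have "((\<lambda>t. exp (- ((s - c) * t))) \<longlongrightarrow> 0) at_top"
      using c by (intro filterlim_compose[OF exp_at_bot] filterlim_uminus_at_top[THEN iffD1]
          filterlim_tendsto_pos_mult_at_top[OF tendsto_const]) (auto simp: filterlim_ident)
    then show "((\<lambda>t. C * exp (- ((s - c) * t))) \<longlongrightarrow> 0) at_top"
      by (rule tendsto_mult_right_zero)
  qed
qed

lemma exp_growth_antiderivative:
  assumes F: "\<And>t. t \<ge> 0 \<Longrightarrow> (F has_real_derivative f t) (at t within {0..})"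
    and f: "exp_growth b f" and b: "b \<ge> 0" and F0: "F 0 = 0"
  shows "exp_growth b F"
  unfolding exp_growth_def
proof (intro conjI allI impI)
  show "continuous_on {0..} F"
    using F by (intro DERIV_continuous_on) auto
  fix c assume c: "c > b"
  define d where "d = (c - b) / 2"
  have d: "d > 0" "c - d > b" using c by (auto simp: d_def field_simps)
  obtain C where C: "C \<ge> 0" "\<And>t. t \<ge> 0 \<Longrightarrow> \<bar>f t\<bar> \<le> C * exp ((c - d) * t)"
    using exp_growthE[OF f d(2)] by blast
  have "\<bar>F t\<bar> \<le> (C / d) * exp (c * t)" if t: "t \<ge> 0" for t
  proof -
    have "norm (F t - F 0) \<le> (C * exp ((c - d) * t)) * norm (t - 0)"
    proof (rule field_differentiable_bound[where S = "{0..t}"])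
      fix r assume r: "r \<in> {0..t}"
      then show "(F has_real_derivative f r) (at r within {0..t})"
        using DERIV_subset[OF F, of r "{0..t}"] by auto
      have "\<bar>f r\<bar> \<le> C * exp ((c - d) * r)" using C r by auto
      also have "\<dots> \<le> C * exp ((c - d) * t)"
        using C(1) d b r by (intro mult_left_mono) (auto intro!: mult_left_mono)
      finally show "norm (f r) \<le> C * exp ((c - d) * t)" by simp
    qed (use t in auto)
    also have "t \<le> exp (d * t) / d"
    proof -
      have "d * t \<le> exp (d * t)" using exp_ge_add_one_self[of "d * t"] by linarith
      then show ?thesis using d by (simp add: field_simps)
    qed
    then have "(C * exp ((c - d) * t)) * norm (t - 0) \<le> (C * exp ((c - d) * t)) * (exp (d * t) / d)"
      using t C(1) by (intro mult_left_mono) auto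
    also have "\<dots> = (C / d) * exp (c * t)"
      by (simp add: exp_add[symmetric] algebra_simps)
    finally show ?thesis using F0 by simp
  qed
  then show "\<exists>C. \<forall>t\<ge>0. \<bar>F t\<bar> \<le> C * exp (c * t)" by blast
qed

text \<open>Two integrations by parts in one: \<open>exp (- s * t) * (U1 t + s * U t)\<close> is an
  antiderivative of \<open>exp (- s * t) * (K t - s\<^sup>2 * U t)\<close>. It vanishes at infinity,
  and at \<open>0\<close> its value is \<open>s * U 0\<close> because the initial slope is
  zero.\<close>

lemma laplace_second_derivative:
  assumes U: "\<And>t. t \<ge> 0 \<Longrightarrow> (U has_real_derivative U1 t) (at t within {0..})"
    and U1: "\<And>t. t \<ge> 0 \<Longrightarrow> (U1 has_real_derivative K t) (at t within {0..})"
    and U10: "U1 0 = 0" and gU: "exp_growth b U" and gK: "exp_growth b K" and b: "b \<ge> 0" and s: "s > b"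
  shows "s\<^sup>2 * laplace U s - laplace K s = s * U 0"
proof -
  define G where "G t = exp (- s * t) * (U1 t + s * U t)" for t
  define k where "k t = K t - s\<^sup>2 * U t" for t
  have gU1: "exp_growth b U1" by (rule exp_growth_antiderivative[OF U1 gK b U10])
  have gk: "exp_growth b k" unfolding k_def by (intro exp_growth_diff gK exp_growth_cmult gU)
  have G': "(G has_real_derivative exp (- s * t) * k t) (at t within {0..})" if "t \<ge> 0" for t
    unfolding G_def k_def
    by (rule derivative_eq_intros U[OF that] U1[OF that] refl)+
       (simp add: algebra_simps power2_eq_square)
  have "((\<lambda>T. LINT t:{0..T}|lborel. exp (- s * t) * k t) \<longlongrightarrow> laplace k s) at_top"
    unfolding laplace_def by (rule tendsto_set_lebesgue_integral_at_top[OF _ laplace_integrable[OF gk s]]) simp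
  moreover have "(LINT t:{0..T}|lborel. exp (- s * t) * k t) = G T - G 0" if T: "T \<ge> 0" for T
  proof -
    have "set_integrable lborel {0..T} (\<lambda>t. exp (- s * t) * k t)"
      by (rule set_integrable_subset[OF laplace_integrable[OF gk s]]) auto
    then have "(LINT t:{0..T}|lborel. exp (- s * t) * k t) = integral {0..T} (\<lambda>t. exp (- s * t) * k t)"
      by (rule set_borel_integral_eq_integral)
    also have "\<dots> = G T - G 0"
    proof (rule integral_unique, rule fundamental_theorem_of_calculus[OF T])
      fix t assume "t \<in> {0..T}"
      then show "(G has_vector_derivative exp (- s * t) * k t) (at t within {0..T})"
        unfolding has_real_derivative_iff_has_vector_derivative[symmetric]
        by (intro DERIV_subset[OF G']) auto
    qed
    finally show ?thesis .
  qed
  then have "\<forall>\<^sub>F T in at_top. (LINT t:{0..T}|lborel. exp (- s * t) * k t) = G T - G 0"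
    by (intro eventually_mono[OF eventually_ge_at_top[of 0]]) auto
  ultimately have "((\<lambda>T. G T - G 0) \<longlongrightarrow> laplace k s) at_top"
    by (rule Lim_transform_eventually)
  moreover have "((\<lambda>T. G T - G 0) \<longlongrightarrow> 0 - G 0) at_top"
    unfolding G_def by (intro tendsto_diff tendsto_const exp_growth_tendsto_0[OF _ s] exp_growth_add exp_growth_cmult gU gU1)
  ultimately have "laplace k s = - G 0"
    using tendsto_unique[OF trivial_limit_at_top_linorder] by fastforce
  moreover have "laplace k s = laplace K s - s\<^sup>2 * laplace U s"
    unfolding k_def using laplace_diff[OF gK exp_growth_cmult[OF gU] s] by (simp add: laplace_cmult)
  ultimately show ?thesis using U10 by (simp add: G_def)
qed

lemma continuous_antiderivative_UNIV:
  fixes f :: "real \<Rightarrow> real"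
  assumes f: "continuous_on UNIV f"
  obtains F where "\<And>x. (F has_real_derivative f x) (at x)" "F 0 = 0"
proof
  define F where "F u = (LBINT y=ereal 0..ereal u. f y)" for u :: real
  show "(F has_real_derivative f x) (at x)" for x
  proof -
    define N where "N = \<bar>x\<bar> + 1"
    have "(F has_vector_derivative f x) (at x within {- N..N})"
      unfolding F_def
      by (rule interval_integral_FTC2) (auto simp: N_def intro: continuous_on_subset[OF f])
    moreover have "at x within {- N..N} = at x"
      by (rule at_within_interior) (auto simp: N_def abs_if)
    ultimately show ?thesis by (simp add: has_real_derivative_iff_has_vector_derivative)
  qed
  show "F 0 = 0" by (simp add: F_def)
qed

text \<open>The hypothesis says that \<open>g - g 0\<close> is the double antiderivative of
  \<open>k\<close> with slope zero at \<open>0\<close>, so its even extension is twice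
  differentiable on the whole line. Functions of \<open>\<bar>t + r\<bar>\<close> can then be
  differentiated without distinguishing the sign of \<open>t + r\<close>, and the oddness of the
  derivative yields a zero initial slope for sums of opposite shifts.\<close>

lemma even_extension_derivatives:
  fixes g k :: "real \<Rightarrow> real"
  assumes k: "continuous_on {0..} k"
    and int: "\<And>t. t \<ge> 0 \<Longrightarrow> ((\<lambda>s. (t - s) * k s) has_integral g t - g 0) {0..t}"
  obtains g1 where "\<And>t. ((\<lambda>t. g \<bar>t\<bar>) has_real_derivative g1 t) (at t)"
    "\<And>t. (g1 has_real_derivative k \<bar>t\<bar>) (at t)" "\<And>t. g1 (- t) = - g1 t"
proof -
  have "continuous_on UNIV (\<lambda>t. k \<bar>t\<bar>)"
    by (rule continuous_on_compose2[OF k]) (auto intro!: continuous_intros)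
  then obtain G1 where G1: "\<And>x. (G1 has_real_derivative k \<bar>x\<bar>) (at x)" "G1 0 = 0"
    by (rule continuous_antiderivative_UNIV) blast
  have "continuous_on UNIV G1"
    using G1(1) by (intro DERIV_continuous_on) (auto intro: DERIV_subset)
  then obtain G where G: "\<And>x. (G has_real_derivative G1 x) (at x)" "G 0 = 0"
    by (rule continuous_antiderivative_UNIV) blast
  have odd: "G1 (- t) = - G1 t" for t
  proof -
    have "((\<lambda>t. G1 (- t) + G1 t) has_real_derivative 0) (at t)" for t
      by (rule derivative_eq_intros G1 DERIV_chain2[OF G1(1)] refl)+ simp
    then have "G1 (- t) + G1 t = G1 (- 0) + G1 0"
      by (intro DERIV_isconst_all) blast
    then show ?thesis using G1(2) by simp
  qed
  have even: "G (- t) = G t" for t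
  proof -
    have "((\<lambda>t. G (- t) - G t) has_real_derivative 0) (at t)" for t
      by (rule derivative_eq_intros G DERIV_chain2[OF G(1)] refl)+ (simp add: odd)
    then have "G (- t) - G t = G (- 0) - G 0"
      by (intro DERIV_isconst_all) blast
    then show ?thesis by simp
  qed
  have pos: "g t - g 0 = G t" if t: "t \<ge> 0" for t
  proof -
    have "((\<lambda>s. (t - s) * k \<bar>s\<bar>) has_integral ((t - t) * G1 t + G t) - ((t - 0) * G1 0 + G 0)) {0..t}"
    proof (rule fundamental_theorem_of_calculus[OF t])
      fix s assume "s \<in> {0..t}"
      have "((\<lambda>s. (t - s) * G1 s + G s) has_real_derivative (t - s) * k \<bar>s\<bar>) (at s)"
        by (rule derivative_eq_intros G G1 refl)+ (simp add: algebra_simps)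
      then show "((\<lambda>s. (t - s) * G1 s + G s) has_vector_derivative (t - s) * k \<bar>s\<bar>) (at s within {0..t})"
        by (auto simp: has_real_derivative_iff_has_vector_derivative intro: has_vector_derivative_at_within)
    qed
    then have "((\<lambda>s. (t - s) * k s) has_integral G t) {0..t}"
      using G1(2) G(2) by (subst has_integral_cong[where g = "\<lambda>s. (t - s) * k \<bar>s\<bar>"]) auto
    then show ?thesis using int[OF t] has_integral_unique by blast
  qed
  have "g \<bar>t\<bar> = G t + g 0" for t
    using pos[of "\<bar>t\<bar>"] even[of t] by (cases "t \<ge> 0") auto
  then have "((\<lambda>t. g \<bar>t\<bar>) has_real_derivative G1 t) (at t)" for t
    using DERIV_add[OF G(1) DERIV_const] by simp
  then show ?thesis using G1 odd that by blast
qed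

lemma exp_growth_shift:
  assumes g: "exp_growth b g" and b: "b \<ge> 0"
  shows "exp_growth b (\<lambda>t. g \<bar>t + r\<bar>)"
  unfolding exp_growth_def
proof (intro conjI allI impI)
  show "continuous_on {0..} (\<lambda>t. g \<bar>t + r\<bar>)"
    by (rule continuous_on_compose2[OF exp_growth_continuous[OF g]]) (auto intro!: continuous_intros)
  fix c assume c: "c > b"
  obtain C where C: "C \<ge> 0" "\<And>t. t \<ge> 0 \<Longrightarrow> \<bar>g t\<bar> \<le> C * exp (c * t)"
    using exp_growthE[OF g c] by blast
  have "\<bar>g \<bar>t + r\<bar>\<bar> \<le> (C * exp (c * \<bar>r\<bar>)) * exp (c * t)" if "t \<ge> 0" for t
  proof -
    have "\<bar>g \<bar>t + r\<bar>\<bar> \<le> C * exp (c * \<bar>t + r\<bar>)" by (intro C) simp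
    also have "\<dots> \<le> C * exp (c * (\<bar>r\<bar> + t))"
      using C(1) b c that by (intro mult_left_mono) auto
    finally show ?thesis by (simp add: distrib_left exp_add mult.assoc)
  qed
  then show "\<exists>C. \<forall>t\<ge>0. \<bar>g \<bar>t + r\<bar>\<bar> \<le> C * exp (c * t)" by blast
qed

lemma set_integral_remove_point:
  fixes f :: "real \<Rightarrow> real"
  assumes [measurable]: "f \<in> borel_measurable lborel" "A \<in> sets lborel" "B \<in> sets lborel"
    and AB: "A - {c} = B - {c}"
  shows "set_lebesgue_integral lborel A f = set_lebesgue_integral lborel B f"
  unfolding set_lebesgue_integral_def
proof (rule integral_cong_AE)
  show "AE x in lborel. indicator A x *\<^sub>R f x = indicator B x *\<^sub>R f x"
    using AE_lborel_singleton[of c]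
  proof eventually_elim
    case (elim x)
    then have "x \<in> A \<longleftrightarrow> x \<in> B" using AB by blast
    then show ?case by (simp add: indicator_def)
  qed
qed measurable

text \<open>Translating the variable multiplies the transform by \<open>exp (s * h)\<close> or
  \<open>exp (- s * h)\<close>. The integration domains then fail to match on an interval of length
  \<open>h\<close> each; after reflection at \<open>0\<close> both defects live on
  \<open>[0, h]\<close> and combine to the \<open>sinh\<close> kernel. With the cosine law this
  evaluates \<open>S h\<close> on a transform of the family, which is how the generator is computed
  there.\<close>

lemma laplace_cosine_shift:
  assumes g: "exp_growth b g" and b: "b \<ge> 0" and s: "s > b" and h: "h \<ge> 0"
  shows "laplace (\<lambda>t. g (t + h) + g \<bar>t - h\<bar>) s =
    2 * cosh (s * h) * laplace g s - 2 * (LINT t:{0..h}|lborel. sinh (s * (h - t)) * g t)"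
proof -
  define G where "G u = g \<bar>u\<bar>" for u
  have contG: "continuous_on UNIV G"
    unfolding G_def
    by (rule continuous_on_compose2[OF exp_growth_continuous[OF g]]) (auto intro!: continuous_intros)
  have meas: "(\<lambda>u. exp (p * u) * G u) \<in> borel_measurable lborel" for p
    using contG by (auto intro!: borel_measurable_continuous_onI continuous_intros)
  have int: "set_integrable lborel {0..} (\<lambda>u. exp (- s * u) * G u)"
    by (rule set_integrable_cong[THEN iffD1, OF refl refl _ laplace_integrable[OF g s]]) (simp add: G_def)
  have int': "set_integrable lborel {0..h} (\<lambda>u. exp (p * u) * G u)" for p
    by (rule borel_integrable_atLeastAtMost') (auto intro!: continuous_intros continuous_on_subset[OF contG])
  let ?L = "laplace g s" and ?I = "\<lambda>p. LINT u:{0..h}|lborel. exp (p * u) * G u"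
  have L: "?L = (LINT u:{0..}|lborel. exp (- s * u) * G u)"
    unfolding laplace_def by (intro set_lebesgue_integral_cong) (auto simp: G_def)
  have 1: "laplace (\<lambda>t. g (t + h)) s = exp (s * h) * (?L - ?I (- s))"
  proof -
    have "laplace (\<lambda>t. g (t + h)) s =
        (LBINT x. indicator {0..} (- h + 1 * x) *\<^sub>R (exp (- s * (- h + 1 * x)) * g ((- h + 1 * x) + h)))"
      unfolding laplace_def set_lebesgue_integral_def
      by (subst lborel_integral_real_affine[where c = 1 and t = "- h"]) simp_all
    also have "\<dots> = (LINT u:{h..}|lborel. exp (s * h) * (exp (- s * u) * G u))"
      unfolding set_lebesgue_integral_def using h
    proof (intro Bochner_Integration.integral_cong refl)
      fix u :: real
      have "exp (- s * (- h + 1 * u)) = exp (s * h) * exp (- s * u)"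
        by (simp add: exp_add[symmetric] algebra_simps)
      then show "indicator {0..} (- h + 1 * u) *\<^sub>R (exp (- s * (- h + 1 * u)) * g ((- h + 1 * u) + h)) =
          indicator {h..} u *\<^sub>R (exp (s * h) * (exp (- s * u) * G u))"
        using h by (cases "h \<le> u") (auto simp: indicator_def G_def)
    qed
    also have "\<dots> = exp (s * h) * (LINT u:{h..}|lborel. exp (- s * u) * G u)"
      by simp
    finally have L1: "laplace (\<lambda>t. g (t + h)) s = exp (s * h) * (LINT u:{h..}|lborel. exp (- s * u) * G u)" .
    have L2: "?L = (LINT u:{0..<h} \<union> {h..}|lborel. exp (- s * u) * G u)"
      unfolding L using h by (intro arg_cong[where f = "\<lambda>A. set_lebesgue_integral lborel A _"]) auto
    have "(LINT u:{h..}|lborel. exp (- s * u) * G u) = ?L - (LINT u:{0..<h}|lborel. exp (- s * u) * G u)"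
    proof -
      have "set_integrable lborel {0..<h} (\<lambda>u. exp (- s * u) * G u)"
        by (rule set_integrable_subset[OF int]) auto
      moreover have "set_integrable lborel {h..} (\<lambda>u. exp (- s * u) * G u)"
        by (rule set_integrable_subset[OF int]) (use h in auto)
      moreover have "{0..<h} \<inter> {h..} = {}" by auto
      ultimately show ?thesis
        using set_integral_Un[of "{0..<h}" "{h..}" lborel "\<lambda>u. exp (- s * u) * G u"] L2 by simp
    qed
    also have "(LINT u:{0..<h}|lborel. exp (- s * u) * G u) = ?I (- s)"
      by (rule set_integral_remove_point[OF meas, where c = h]) auto
    finally show ?thesis unfolding L1 by simp
  qed
  have 2: "laplace (\<lambda>t. g \<bar>t - h\<bar>) s = exp (- s * h) * (?L + ?I s)"
  proof -
    have "laplace (\<lambda>t. g \<bar>t - h\<bar>) s =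
        (LBINT x. indicator {0..} (h + 1 * x) *\<^sub>R (exp (- s * (h + 1 * x)) * g \<bar>h + 1 * x - h\<bar>))"
      unfolding laplace_def set_lebesgue_integral_def
      by (subst lborel_integral_real_affine[where c = 1 and t = h]) simp_all
    also have "\<dots> = (LINT u:{- h..}|lborel. exp (- s * h) * (exp (- s * u) * G u))"
      unfolding set_lebesgue_integral_def using h
    proof (intro Bochner_Integration.integral_cong refl)
      fix u :: real
      have "exp (- s * (h + 1 * u)) = exp (- s * h) * exp (- s * u)"
        by (simp add: exp_add[symmetric] algebra_simps)
      then show "indicator {0..} (h + 1 * u) *\<^sub>R (exp (- s * (h + 1 * u)) * g \<bar>h + 1 * u - h\<bar>) =
          indicator {- h..} u *\<^sub>R (exp (- s * h) * (exp (- s * u) * G u))"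
        by (cases "- h \<le> u") (auto simp: indicator_def G_def)
    qed
    also have "\<dots> = exp (- s * h) * (LINT u:{- h..}|lborel. exp (- s * u) * G u)"
      by simp
    also have "(LINT u:{- h..}|lborel. exp (- s * u) * G u) = (LINT u:{- h..<0} \<union> {0..}|lborel. exp (- s * u) * G u)"
      using h by (intro arg_cong[where f = "\<lambda>A. set_lebesgue_integral lborel A _"]) auto
    also have "\<dots> = (LINT u:{- h..<0}|lborel. exp (- s * u) * G u) + ?L"
      unfolding L
    proof (rule set_integral_Un[OF _ _ int])
      have "set_integrable lborel {- h..0} (\<lambda>u. exp (- s * u) * G u)"
        by (rule borel_integrable_atLeastAtMost') (auto intro!: continuous_intros continuous_on_subset[OF contG])
      then show "set_integrable lborel {- h..<0} (\<lambda>u. exp (- s * u) * G u)"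
        by (rule set_integrable_subset) auto
    qed auto
    \<comment> \<open>Reflection \<open>u \<mapsto> - u\<close> turns the part on the negative axis
      into an integral over \<open>(0, h]\<close>; the exponent changes sign and the even extension
      does not.\<close>
    also have "(LINT u:{- h..<0}|lborel. exp (- s * u) * G u) =
        (LBINT x. indicator {- h..<0} (0 + (- 1) * x) *\<^sub>R (exp (- s * (0 + (- 1) * x)) * G (0 + (- 1) * x)))"
      unfolding set_lebesgue_integral_def
      by (subst lborel_integral_real_affine[where c = "- 1" and t = 0]) simp_all
    also have "\<dots> = (LINT u:{0<..h}|lborel. exp (s * u) * G u)"
      unfolding set_lebesgue_integral_def
      by (intro Bochner_Integration.integral_cong) (auto simp: indicator_def G_def)
    also have "\<dots> = ?I s"
      by (rule set_integral_remove_point[OF meas, where c = 0]) auto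
    finally show ?thesis by (simp add: add.commute)
  qed
  have "laplace (\<lambda>t. g (t + h) + g \<bar>t - h\<bar>) s = laplace (\<lambda>t. g \<bar>t + h\<bar> + g \<bar>t + (- h)\<bar>) s"
    using h by (intro laplace_cong) auto
  also have "\<dots> = laplace (\<lambda>t. g \<bar>t + h\<bar>) s + laplace (\<lambda>t. g \<bar>t + (- h)\<bar>) s"
    by (rule laplace_add[OF exp_growth_shift[OF g b] exp_growth_shift[OF g b] s])
  also have "laplace (\<lambda>t. g \<bar>t + h\<bar>) s = laplace (\<lambda>t. g (t + h)) s"
    using h by (intro laplace_cong) auto
  also have "laplace (\<lambda>t. g \<bar>t + (- h)\<bar>) s = laplace (\<lambda>t. g \<bar>t - h\<bar>) s" by simp
  finally have "laplace (\<lambda>t. g (t + h) + g \<bar>t - h\<bar>) s =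
      2 * cosh (s * h) * ?L - (exp (s * h) * ?I (- s) - exp (- s * h) * ?I s)"
    unfolding 1 2 by (simp add: cosh_field_def algebra_simps)
  also have "exp (s * h) * ?I (- s) - exp (- s * h) * ?I s =
      (LINT t:{0..h}|lborel. exp (s * h) * (exp (- s * t) * G t)) -
      (LINT t:{0..h}|lborel. exp (- s * h) * (exp (s * t) * G t))"
    by (simp only: set_integral_mult_right)
  also have "\<dots> =
      (LINT t:{0..h}|lborel. exp (s * h) * (exp (- s * t) * G t) - exp (- s * h) * (exp (s * t) * G t))"
    by (rule set_integral_diff(2)[symmetric]; intro set_integrable_mult_right int')
  also have "\<dots> = (LINT t:{0..h}|lborel. 2 * (sinh (s * (h - t)) * g t))"
    by (intro set_lebesgue_integral_cong)
       (auto simp: G_def sinh_field_def right_diff_distrib exp_diff exp_minus field_simps)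
  also have "\<dots> = 2 * (LINT t:{0..h}|lborel. sinh (s * (h - t)) * g t)" by simp
  finally show ?thesis .
qed

section \<open>The implicit difference scheme of the wave equation\<close>

lemma has_vector_derivative_iff_tendsto:
  fixes f :: "real \<Rightarrow> 'a::real_normed_vector"
  shows "(f has_vector_derivative D) (at x) \<longleftrightarrow> ((\<lambda>y. (1 / (y - x)) *\<^sub>R (f y - f x)) \<longlongrightarrow> D) (at x)"
proof -
  have "\<forall>\<^sub>F y in at x. norm (f y - f x - (y - x) *\<^sub>R D) / norm (y - x) =
      norm ((1 / (y - x)) *\<^sub>R (f y - f x) - D)"
    unfolding eventually_at_filter
  proof (intro always_eventually allI impI)
    fix y assume "y \<noteq> x"
    then have "(1 / (y - x)) *\<^sub>R (f y - f x) - D = (1 / (y - x)) *\<^sub>R (f y - f x - (y - x) *\<^sub>R D)"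
      by (simp add: scaleR_diff_right)
    then show "norm (f y - f x - (y - x) *\<^sub>R D) / norm (y - x) = norm ((1 / (y - x)) *\<^sub>R (f y - f x) - D)"
      by simp
  qed
  then have "((\<lambda>y. norm (f y - f x - (y - x) *\<^sub>R D) / norm (y - x)) \<longlongrightarrow> 0) (at x) \<longleftrightarrow>
      ((\<lambda>y. norm ((1 / (y - x)) *\<^sub>R (f y - f x) - D)) \<longlongrightarrow> 0) (at x)"
    by (rule filterlim_cong[OF refl refl])
  then show ?thesis
    by (simp add: has_vector_derivative_def has_derivative_iff_norm bounded_linear_scaleR_left
        tendsto_norm_zero_iff LIM_zero_iff)
qed

text \<open>For \<open>B = l\<^sup>2 *\<^sub>R Res l\<close>, the inverse of
  \<open>1 - A / l\<^sup>2\<close>, this is the implicit scheme solved for its newest value. The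
  first two clauses are the same recursion with the fictitious values \<open>id_blinfun\<close> at
  the indices \<open>- 1\<close> and \<open>- 2\<close>, that is, with zero initial
  velocity.\<close>

fun wave :: "('a::real_normed_vector \<Rightarrow>\<^sub>L 'a) \<Rightarrow> nat \<Rightarrow> 'a \<Rightarrow>\<^sub>L 'a" where
  "wave B 0 = B"
| "wave B (Suc 0) = B o\<^sub>L (2 *\<^sub>R B - id_blinfun)"
| "wave B (Suc (Suc m)) = B o\<^sub>L (2 *\<^sub>R wave B (Suc m) - wave B m)"

text \<open>Common ground of both directions, which use it with \<open>C = M\<close>. The bound on
  the resolvent is the case \<open>m = 0\<close> of the estimates in (b). It is assumed in this form
  because it involves no derivative, and the norm continuity of the resolvent, hence the existence
  of all derivatives, rests on it.\<close>

locale cosine_resolvent = saks_seminorms scl \<tau> P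
  for scl :: "'k::{real_normed_field,euclidean_space} \<Rightarrow> 'a::real_normed_vector \<Rightarrow> 'a"
    and \<tau> :: "'a topology" and P :: "('a \<Rightarrow> real) set" +
  fixes D :: "'a set" and A :: "'a \<Rightarrow> 'a" and \<omega> C :: real
  assumes linop: "linear_operator scl D A"
    and \<omega>_nonneg: "\<omega> \<ge> 0"
    and resolvent_set: "of_real ` {\<omega>\<^sup>2<..} \<subseteq> resolvent_set scl D A"
    and resolvent_bound:
      "l > \<omega> \<Longrightarrow> norm (Blinfun (resolvent scl D A (of_real (l\<^sup>2)))) \<le> C / (l * (l - \<omega>))"
begin

section \<open>The resolvent and the difference scheme on the domain\<close>

lemma D_subspace: "module.subspace scl D"
  and A_add: "x \<in> D \<Longrightarrow> y \<in> D \<Longrightarrow> A (x + y) = A x + A y"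
  and A_scl: "x \<in> D \<Longrightarrow> A (scl c x) = scl c (A x)"
  using linop by (auto simp: linear_operator_def)

lemma D_add: "x \<in> D \<Longrightarrow> y \<in> D \<Longrightarrow> x + y \<in> D"
  and D_scl: "x \<in> D \<Longrightarrow> scl c x \<in> D"
  and D_0: "0 \<in> D"
  using D_subspace by (auto simp: subspace_def)

lemma D_scaleR: "x \<in> D \<Longrightarrow> r *\<^sub>R x \<in> D"
  and A_scaleR: "x \<in> D \<Longrightarrow> A (r *\<^sub>R x) = r *\<^sub>R A x"
  using D_scl[of x "of_real r"] A_scl[of x "of_real r"] by (simp_all add: scl_of_real)

lemma D_diff: "x \<in> D \<Longrightarrow> y \<in> D \<Longrightarrow> x - y \<in> D"
  and A_diff: "x \<in> D \<Longrightarrow> y \<in> D \<Longrightarrow> A (x - y) = A x - A y"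
  using D_add[OF _ D_scaleR[of y "-1"]] A_add[OF _ D_scaleR[of y "-1"]] A_scaleR[of y "-1"] by simp_all

definition Res :: "real \<Rightarrow> 'a \<Rightarrow>\<^sub>L 'a"
  where "Res l = Blinfun (resolvent scl D A (of_real (l\<^sup>2)))"

definition V :: "nat \<Rightarrow> real \<Rightarrow> 'a \<Rightarrow>\<^sub>L 'a"
  where "V m l = wave (l\<^sup>2 *\<^sub>R Res l) m"

lemma V_0: "V 0 l x = l\<^sup>2 *\<^sub>R Res l x"
  and V_1: "V (Suc 0) l x = l\<^sup>2 *\<^sub>R Res l (2 *\<^sub>R V 0 l x - x)"
  and V_Suc_Suc: "V (Suc (Suc m)) l x = l\<^sup>2 *\<^sub>R Res l (2 *\<^sub>R V (Suc m) l x - V m l x)"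
  by (simp_all add: V_def blinfun.bilinear_simps scaleR_diff_right mult.commute)

context
  fixes l assumes l: "l > \<omega>"
begin

lemma square_in_resolvent_set: "of_real (l\<^sup>2) \<in> resolvent_set scl D A"
proof -
  have "\<omega>\<^sup>2 < l\<^sup>2" using l \<omega>_nonneg by (intro power_strict_mono) auto
  then show ?thesis using resolvent_set by auto
qed

lemma Res_bij: "bij_betw (\<lambda>x. l\<^sup>2 *\<^sub>R x - A x) D UNIV"
  and Res_apply: "blinfun_apply (Res l) = inv_into D (\<lambda>x. l\<^sup>2 *\<^sub>R x - A x)"
  and Res_scl: "Res l (scl c x) = scl c (Res l x)"
proof -
  have bij: "bij_betw (\<lambda>x. scl (of_real (l\<^sup>2)) x - A x) D UNIV"
    and b: "resolvent scl D A (of_real (l\<^sup>2)) \<in> bounded_operators scl"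
    using square_in_resolvent_set by (auto simp: resolvent_set_def)
  show "bij_betw (\<lambda>x. l\<^sup>2 *\<^sub>R x - A x) D UNIV" using bij unfolding scl_of_real .
  have eq: "blinfun_apply (Res l) = resolvent scl D A (of_real (l\<^sup>2))"
    using b unfolding Res_def bounded_operators_def by (auto simp: bounded_linear_Blinfun_apply)
  then show "blinfun_apply (Res l) = inv_into D (\<lambda>x. l\<^sup>2 *\<^sub>R x - A x)"
    unfolding resolvent_def scl_of_real .
  interpret lin: Vector_Spaces.linear scl scl "resolvent scl D A (of_real (l\<^sup>2))"
    using b by (simp add: bounded_operators_def)
  show "Res l (scl c x) = scl c (Res l x)" unfolding eq by (rule lin.scale)
qed

lemma l_pos: "l > 0" using l \<omega>_nonneg by simp

lemma Res_in_D: "Res l y \<in> D"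
  unfolding Res_apply using Res_bij by (intro inv_into_into) (auto simp: bij_betw_def)

lemma Res_right: "l\<^sup>2 *\<^sub>R Res l y - A (Res l y) = y"
  unfolding Res_apply using f_inv_into_f[of y "\<lambda>x. l\<^sup>2 *\<^sub>R x - A x" D] Res_bij
  by (auto simp: bij_betw_def)

lemma Res_left: "x \<in> D \<Longrightarrow> Res l (l\<^sup>2 *\<^sub>R x - A x) = x"
  unfolding Res_apply using Res_bij
  by (intro inv_into_f_f[of "\<lambda>x. l\<^sup>2 *\<^sub>R x - A x"]) (auto simp: bij_betw_def)

lemma A_Res: "A (Res l y) = l\<^sup>2 *\<^sub>R Res l y - y"
  using Res_right[of y] by (simp add: algebra_simps)

lemma A_Res_commute: "x \<in> D \<Longrightarrow> A (Res l x) = Res l (A x)"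
  using Res_left[of x] by (simp add: A_Res blinfun.bilinear_simps algebra_simps)

lemma V_commute:
  assumes "x \<in> D"
  shows "V m l x \<in> D" "A (V m l x) = V m l (A x)"
proof -
  have "V m l x \<in> D \<and> A (V m l x) = V m l (A x)"
  proof (induction m rule: induct_nat_012)
    case 0
    show ?case using assms by (simp add: V_0 D_scaleR Res_in_D A_scaleR A_Res_commute)
  next
    case 1
    have "V 0 l x \<in> D" "A (V 0 l x) = V 0 l (A x)"
      using assms by (simp_all add: V_0 D_scaleR Res_in_D A_scaleR A_Res_commute)
    then show ?case using assms
      by (simp add: V_1 D_scaleR Res_in_D A_scaleR A_Res_commute D_diff A_diff)
  next
    case (ge2 m)
    then show ?case
      by (simp add: V_Suc_Suc D_scaleR Res_in_D A_scaleR A_Res_commute D_diff A_diff)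
  qed
  then show "V m l x \<in> D" "A (V m l x) = V m l (A x)" by auto
qed

lemma V_scl: "V m l (scl c x) = scl c (V m l x)"
proof (induction m rule: induct_nat_012)
  have sR: "r *\<^sub>R scl c y = scl c (r *\<^sub>R y)" for r y
    by (simp add: scl_of_real[symmetric] mult.commute)
  case 0
  show ?case by (simp add: V_0 Res_scl sR)
next
  have sR: "r *\<^sub>R scl c y = scl c (r *\<^sub>R y)" for r y
    by (simp add: scl_of_real[symmetric] mult.commute)
  case 1
  show ?case by (simp add: V_1 V_0 Res_scl sR scale_right_diff_distrib[symmetric])
next
  have sR: "r *\<^sub>R scl c y = scl c (r *\<^sub>R y)" for r y
    by (simp add: scl_of_real[symmetric] mult.commute)
  case (ge2 m)
  then show ?case by (simp add: V_Suc_Suc Res_scl sR scale_right_diff_distrib[symmetric])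
qed

lemma resolvent_scheme:
  assumes "x \<in> D"
  shows "l\<^sup>2 *\<^sub>R Res l x = x + Res l (A x)"
  using Res_left[OF assms] by (simp add: blinfun.bilinear_simps algebra_simps)

lemma V_difference_0: "x \<in> D \<Longrightarrow> V 0 l x - x = (1 / l\<^sup>2) *\<^sub>R V 0 l (A x)"
  using l_pos by (simp add: V_0 resolvent_scheme)

lemma V_difference_1: "x \<in> D \<Longrightarrow> V (Suc 0) l x - 2 *\<^sub>R V 0 l x + x = (1 / l\<^sup>2) *\<^sub>R V (Suc 0) l (A x)"
proof -
  assume x: "x \<in> D"
  let ?y = "2 *\<^sub>R V 0 l x - x"
  have y: "?y \<in> D" using x by (intro D_diff D_scaleR V_commute)
  have "V (Suc 0) l x = ?y + Res l (A ?y)"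
    unfolding V_1 by (rule resolvent_scheme[OF y])
  moreover have "A ?y = 2 *\<^sub>R V 0 l (A x) - A x"
    using x by (simp add: A_diff A_scaleR V_commute D_scaleR)
  moreover have "(1 / l\<^sup>2) *\<^sub>R V (Suc 0) l (A x) = Res l (2 *\<^sub>R V 0 l (A x) - A x)"
    using l_pos by (simp add: V_1)
  ultimately show ?thesis by simp
qed

lemma V_difference_Suc_Suc:
  "x \<in> D \<Longrightarrow> V (Suc (Suc m)) l x - 2 *\<^sub>R V (Suc m) l x + V m l x = (1 / l\<^sup>2) *\<^sub>R V (Suc (Suc m)) l (A x)"
proof -
  assume x: "x \<in> D"
  let ?y = "2 *\<^sub>R V (Suc m) l x - V m l x"
  have y: "?y \<in> D" using x by (intro D_diff D_scaleR V_commute)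
  have "V (Suc (Suc m)) l x = ?y + Res l (A ?y)"
    unfolding V_Suc_Suc by (rule resolvent_scheme[OF y])
  moreover have "A ?y = 2 *\<^sub>R V (Suc m) l (A x) - V m l (A x)"
    using x by (simp add: A_diff A_scaleR V_commute D_scaleR)
  moreover have "(1 / l\<^sup>2) *\<^sub>R V (Suc (Suc m)) l (A x) = Res l (2 *\<^sub>R V (Suc m) l (A x) - V m l (A x))"
    using l_pos by (simp add: V_Suc_Suc)
  ultimately show ?thesis by simp
qed

end

text \<open>\<open>V m l\<close> commutes with \<open>A\<close> on the domain, hence with
  \<open>k\<^sup>2 - A\<close> and with its inverse. Commutation with the limit family is later
  inherited from here.\<close>

lemma V_Res_commute:
  assumes l: "l > \<omega>" and k: "k > \<omega>"
  shows "V m l (Res k y) = Res k (V m l y)"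
proof -
  have "Res k (V m l y) = Res k (V m l (k\<^sup>2 *\<^sub>R Res k y - A (Res k y)))"
    by (simp only: Res_right[OF k])
  also have "V m l (k\<^sup>2 *\<^sub>R Res k y - A (Res k y)) = k\<^sup>2 *\<^sub>R V m l (Res k y) - A (V m l (Res k y))"
    by (simp add: blinfun.bilinear_simps V_commute[OF l Res_in_D[OF k]])
  also have "Res k \<dots> = V m l (Res k y)"
    by (rule Res_left[OF k V_commute(1)[OF l Res_in_D[OF k]]])
  finally show ?thesis ..
qed

text \<open>Second differences are at most \<open>a / l\<^sup>2\<close>, by the scheme. Summing once
  from the fictitious values gives the first estimate, summing again the second;
  \<open>(m + 1)\<^sup>2\<close> is a convenient majorant of
  \<open>1 + 2 + ... + (m + 1)\<close>.\<close>

lemma V_estimates: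
  assumes l: "l > \<omega>" and x: "x \<in> D" and a: "\<And>j. j \<le> m + 1 \<Longrightarrow> norm (V j l (A x)) \<le> a"
  shows "norm (V (m + 1) l x - V m l x) \<le> (real m + 2) * a / l\<^sup>2"
    and "norm (V m l x - x) \<le> (real m + 1)\<^sup>2 * a / l\<^sup>2"
proof -
  have lp: "l > 0" using l \<omega>_nonneg by simp
  have a0: "a \<ge> 0" using a[of 0] norm_ge_zero[of "V 0 l (A x)"] by linarith
  have sc: "norm ((1 / l\<^sup>2) *\<^sub>R V j l (A x)) \<le> a / l\<^sup>2" if "j \<le> m + 1" for j
    using a[OF that] lp by (simp add: divide_right_mono)
  have 0: "norm (V 0 l x - x) \<le> a / l\<^sup>2"
    unfolding V_difference_0[OF l x] by (rule sc) simp
  have 1: "norm (V (j + 1) l x - V j l x) \<le> (real j + 2) * a / l\<^sup>2" if "j \<le> m" for j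
    using that
  proof (induction j)
    case 0
    have "V 1 l x - V 0 l x = (V 1 l x - 2 *\<^sub>R V 0 l x + x) + (V 0 l x - x)"
      by (simp add: scaleR_2)
    also have "norm \<dots> \<le> a / l\<^sup>2 + a / l\<^sup>2"
      using sc[of 1] \<open>norm (V 0 l x - x) \<le> a / l\<^sup>2\<close> V_difference_1[OF l x]
      by (intro norm_triangle_mono) auto
    finally show ?case by (simp add: field_simps)
  next
    case (Suc j)
    have "V (Suc j + 1) l x - V (Suc j) l x =
        (V (Suc (Suc j)) l x - 2 *\<^sub>R V (Suc j) l x + V j l x) + (V (j + 1) l x - V j l x)"
      by (simp add: scaleR_2)
    also have "norm \<dots> \<le> a / l\<^sup>2 + (real j + 2) * a / l\<^sup>2"
      using sc[of "Suc (Suc j)"] V_difference_Suc_Suc[OF l x, of j] Suc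
      by (intro norm_triangle_mono) auto
    also have "\<dots> = (real (Suc j) + 2) * a / l\<^sup>2" by (simp add: add_divide_distrib[symmetric] algebra_simps)
    finally show ?case .
  qed
  show "norm (V (m + 1) l x - V m l x) \<le> (real m + 2) * a / l\<^sup>2" by (rule 1) simp
  have "norm (V j l x - x) \<le> (real j + 1)\<^sup>2 * a / l\<^sup>2" if "j \<le> m" for j
    using that
  proof (induction j)
    case 0
    then show ?case using \<open>norm (V 0 l x - x) \<le> a / l\<^sup>2\<close> by simp
  next
    case (Suc j)
    have "V (Suc j) l x - x = (V (j + 1) l x - V j l x) + (V j l x - x)" by simp
    also have "norm \<dots> \<le> (real j + 2) * a / l\<^sup>2 + (real j + 1)\<^sup>2 * a / l\<^sup>2"
      using Suc by (intro norm_triangle_mono 1) auto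
    also have "\<dots> = (real j + 2 + (real j + 1)\<^sup>2) * (a / l\<^sup>2)"
      by (simp add: distrib_right add_divide_distrib)
    also have "\<dots> \<le> (real (Suc j) + 1)\<^sup>2 * (a / l\<^sup>2)"
      using a0 lp by (intro mult_right_mono) (auto simp: power2_eq_square algebra_simps)
    finally show ?case by simp
  qed
  then show "norm (V m l x - x) \<le> (real m + 1)\<^sup>2 * a / l\<^sup>2" by simp
qed

lemma V_second_difference:
  assumes l: "l > \<omega>" and x: "x \<in> D"
  shows "(V (m + 2) l x - V (m + 1) l x) - (V (m + 1) l x - V m l x) = (1 / l\<^sup>2) *\<^sub>R V (m + 2) l (A x)"
  using V_difference_Suc_Suc[OF l x, of m] by (simp add: scaleR_2 algebra_simps)

section \<open>Derivatives with respect to the spectral parameter\<close>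

lemma resolvent_identity:
  assumes l: "l > \<omega>" and k: "k > \<omega>"
  shows "Res l - Res k = (k\<^sup>2 - l\<^sup>2) *\<^sub>R (Res l o\<^sub>L Res k)"
proof (rule blinfun_eqI)
  fix y
  have "Res l y - Res k y = Res l y - Res l (l\<^sup>2 *\<^sub>R Res k y - A (Res k y))"
    by (simp add: Res_left[OF l Res_in_D[OF k]])
  also have "\<dots> = Res l (y - (l\<^sup>2 *\<^sub>R Res k y - A (Res k y)))"
    by (simp add: blinfun.diff_right)
  also have "y - (l\<^sup>2 *\<^sub>R Res k y - A (Res k y)) = (k\<^sup>2 - l\<^sup>2) *\<^sub>R Res k y"
    using Res_right[OF k, of y] by (simp add: algebra_simps)
  finally show "(Res l - Res k) y = ((k\<^sup>2 - l\<^sup>2) *\<^sub>R (Res l o\<^sub>L Res k)) y"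
    by (simp add: blinfun.bilinear_simps)
qed

text \<open>The assumed bound keeps the resolvent bounded near \<open>l\<close>, so the resolvent
  identity makes the difference small in operator norm. The same identity then gives the
  derivative.\<close>

lemma Res_continuous:
  assumes l: "l > \<omega>"
  shows "Res \<midarrow>l\<rightarrow> Res l"
proof -
  define b where "b k = \<bar>l\<^sup>2 - k\<^sup>2\<bar> * (C / (k * (k - \<omega>)) * norm (Res l))" for k
  have ev: "\<forall>\<^sub>F k in at l. k > \<omega>"
    using l by (intro eventually_at_in_open'[of "{\<omega><..}", simplified]) auto
  have "(b \<longlongrightarrow> \<bar>l\<^sup>2 - l\<^sup>2\<bar> * (C / (l * (l - \<omega>)) * norm (Res l))) (at l)"
    unfolding b_def using l \<omega>_nonneg by (intro tendsto_intros) auto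
  then have b0: "(b \<longlongrightarrow> 0) (at l)" by simp
  have "((\<lambda>k. Res k - Res l) \<longlongrightarrow> 0) (at l)"
  proof (rule Lim_null_comparison[OF _ b0])
    show "\<forall>\<^sub>F k in at l. norm (Res k - Res l) \<le> b k"
      using ev
    proof eventually_elim
      case (elim k)
      have "norm (Res k - Res l) = \<bar>l\<^sup>2 - k\<^sup>2\<bar> * norm (Res k o\<^sub>L Res l)"
        by (simp add: resolvent_identity[OF elim l])
      also have "\<dots> \<le> \<bar>l\<^sup>2 - k\<^sup>2\<bar> * (norm (Res k) * norm (Res l))"
        by (intro mult_left_mono norm_blinfun_compose) auto
      also have "\<dots> \<le> b k"
        unfolding b_def using resolvent_bound[OF elim]
        by (intro mult_left_mono mult_right_mono) (auto simp: Res_def)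
      finally show ?case .
    qed
  qed
  then show ?thesis by (rule LIM_zero_cancel)
qed

lemma Res_has_derivative:
  assumes l: "l > \<omega>"
  shows "(Res has_vector_derivative - (2 * l) *\<^sub>R (Res l o\<^sub>L Res l)) (at l)"
  unfolding has_vector_derivative_iff_tendsto
proof (rule Lim_transform_eventually)
  show "((\<lambda>k. - (l + k) *\<^sub>R (Res k o\<^sub>L Res l)) \<longlongrightarrow> - (2 * l) *\<^sub>R (Res l o\<^sub>L Res l)) (at l)"
  proof -
    have "((\<lambda>k. - (l + k) *\<^sub>R (Res k o\<^sub>L Res l)) \<longlongrightarrow> - (l + l) *\<^sub>R (Res l o\<^sub>L Res l)) (at l)"
      by (intro tendsto_intros bounded_bilinear.tendsto[OF bounded_bilinear_blinfun_compose]
          Res_continuous[OF l])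
    then show ?thesis by (simp only: mult_2)
  qed
  have "\<forall>\<^sub>F k in at l. k > \<omega>"
    using l by (intro eventually_at_in_open'[of "{\<omega><..}", simplified]) auto
  then show "\<forall>\<^sub>F k in at l. - (l + k) *\<^sub>R (Res k o\<^sub>L Res l) = (1 / (k - l)) *\<^sub>R (Res k - Res l)"
    using eventually_neq_at_within[of l l UNIV]
  proof eventually_elim
    case (elim k)
    have "(1 / (k - l)) * (l\<^sup>2 - k\<^sup>2) = - (l + k)"
      using elim(2) by (simp add: field_simps power2_eq_square)
    then show ?case by (simp add: resolvent_identity[OF elim(1) l])
  qed
qed

text \<open>Induction along the recursion, starting from \<open>B' = (2 / l) (B - B B)\<close> for
  \<open>B = l\<^sup>2 *\<^sub>R Res l\<close>. The derivative in the continuous parameter is a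
  difference in the discrete index; this turns all differentiations into statements about the
  scheme.\<close>

lemma V_has_derivative:
  assumes l: "l > \<omega>"
  shows "(V m has_vector_derivative ((real m + 1) / l) *\<^sub>R (V m l - V (m + 1) l)) (at l)"
proof -
  have lp: "l > 0" using l \<omega>_nonneg by simp
  define B where "B l = l\<^sup>2 *\<^sub>R Res l" for l
  have B': "(B has_vector_derivative (2 / l) *\<^sub>R (B l - (B l o\<^sub>L B l))) (at l)"
  proof -
    have "(B has_vector_derivative l\<^sup>2 *\<^sub>R (- (2 * l) *\<^sub>R (Res l o\<^sub>L Res l)) + (2 * l) *\<^sub>R Res l) (at l)"
      unfolding B_def
      by (rule has_vector_derivative_eq_rhs[OF has_vector_derivative_scaleR[OF _ Res_has_derivative[OF l]]])
         (auto intro!: derivative_eq_intros)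
    moreover have "l\<^sup>2 *\<^sub>R (- (2 * l) *\<^sub>R (Res l o\<^sub>L Res l)) + (2 * l) *\<^sub>R Res l =
        (2 / l) *\<^sub>R (B l - (B l o\<^sub>L B l))"
      using lp
      by (intro blinfun_eqI) (simp add: B_def blinfun.bilinear_simps scaleR_diff_right power2_eq_square)
    ultimately show ?thesis by simp
  qed
  have Bc: "((\<lambda>l. B l o\<^sub>L f l) has_vector_derivative (B l o\<^sub>L f') + ((2 / l) *\<^sub>R (B l - (B l o\<^sub>L B l)) o\<^sub>L f l)) (at l)"
    if "(f has_vector_derivative f') (at l)" for f f'
    by (rule bounded_bilinear.has_vector_derivative[OF bounded_bilinear_blinfun_compose B' that])
  have V0: "V 0 = B" and V1: "V (Suc 0) = (\<lambda>l. B l o\<^sub>L (2 *\<^sub>R B l - id_blinfun))"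
    and VSS: "\<And>m. V (Suc (Suc m)) = (\<lambda>l. B l o\<^sub>L (2 *\<^sub>R V (Suc m) l - V m l))"
    by (simp_all add: V_def B_def fun_eq_iff)
  show ?thesis
  proof (induction m rule: induct_nat_012)
    case 0
    have "(2 / l) *\<^sub>R (B l - (B l o\<^sub>L B l)) = ((real 0 + 1) / l) *\<^sub>R (V 0 l - V (0 + 1) l)"
      by (rule blinfun_eqI) (simp add: V0 V1 blinfun.bilinear_simps scaleR_diff_right scaleR_2 algebra_simps flip: scaleR_add_left)
    then show ?case using B' by (simp only: V0)
  next
    case 1
    have "((\<lambda>l. 2 *\<^sub>R B l - id_blinfun) has_vector_derivative 2 *\<^sub>R ((2 / l) *\<^sub>R (B l - (B l o\<^sub>L B l)))) (at l)"
      by (rule has_vector_derivative_eq_rhs, rule has_vector_derivative_diff,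
          rule bounded_linear.has_vector_derivative[OF bounded_linear_scaleR_right B'],
          rule has_vector_derivative_const) simp
    note Bc[OF this]
    moreover have "(B l o\<^sub>L (2 *\<^sub>R ((2 / l) *\<^sub>R (B l - (B l o\<^sub>L B l))))) +
        ((2 / l) *\<^sub>R (B l - (B l o\<^sub>L B l)) o\<^sub>L (2 *\<^sub>R B l - id_blinfun)) =
        ((real (Suc 0) + 1) / l) *\<^sub>R (V (Suc 0) l - V (Suc 0 + 1) l)"
    \<comment> \<open>Applying a functional reduces the operator identity to an identity of real
      numbers, where division by \<open>l\<close> can be cleared.\<close>
    proof (intro blinfun_eqI bi_functional_eqI)
      fix x \<phi> assume "bi_functional \<phi>"
      then interpret bounded_linear \<phi> by (rule bi_functional_linear)
      show "\<phi> (((B l o\<^sub>L (2 *\<^sub>R ((2 / l) *\<^sub>R (B l - (B l o\<^sub>L B l))))) +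
          ((2 / l) *\<^sub>R (B l - (B l o\<^sub>L B l)) o\<^sub>L (2 *\<^sub>R B l - id_blinfun))) x) =
          \<phi> ((((real (Suc 0) + 1) / l) *\<^sub>R (V (Suc 0) l - V (Suc 0 + 1) l)) x)"
        using lp by (simp add: V0 V1 VSS blinfun.bilinear_simps add diff scale field_simps)
    qed
    ultimately show ?case by (simp only: V1)
  next
    case (ge2 m)
    have "((\<lambda>l. 2 *\<^sub>R V (Suc m) l - V m l) has_vector_derivative
        2 *\<^sub>R (((real (Suc m) + 1) / l) *\<^sub>R (V (Suc m) l - V (Suc m + 1) l)) -
        ((real m + 1) / l) *\<^sub>R (V m l - V (m + 1) l)) (at l)"
      by (intro has_vector_derivative_diff bounded_linear.has_vector_derivative[OF bounded_linear_scaleR_right] ge2)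
    note Bc[OF this]
    moreover have "(B l o\<^sub>L (2 *\<^sub>R (((real (Suc m) + 1) / l) *\<^sub>R (V (Suc m) l - V (Suc m + 1) l)) -
        ((real m + 1) / l) *\<^sub>R (V m l - V (m + 1) l))) +
        ((2 / l) *\<^sub>R (B l - (B l o\<^sub>L B l)) o\<^sub>L (2 *\<^sub>R V (Suc m) l - V m l)) =
        ((real (Suc (Suc m)) + 1) / l) *\<^sub>R (V (Suc (Suc m)) l - V (Suc (Suc m) + 1) l)" (is "?L = ?R")
    proof (intro blinfun_eqI bi_functional_eqI)
      fix x \<phi> assume "bi_functional \<phi>"
      then interpret bounded_linear \<phi> by (rule bi_functional_linear)
      \<comment> \<open>All terms of the identity are linear combinations of \<open>a\<close>,
        \<open>b\<close> and \<open>e\<close>, which turns it into a comparison of three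
        coefficients.\<close>
      define a b where "a = B l (V m l x)" and "b = B l (V (Suc m) l x)"
      have c: "V (Suc (Suc m)) l x = 2 *\<^sub>R b - a"
        by (simp add: VSS a_def b_def blinfun.bilinear_simps)
      define e where "e = B l (2 *\<^sub>R b - a)"
      have "?L x = B l (2 *\<^sub>R (((real (Suc m) + 1) / l) *\<^sub>R (V (Suc m) l x - V (Suc (Suc m)) l x)) -
          ((real m + 1) / l) *\<^sub>R (V m l x - V (Suc m) l x)) +
          (2 / l) *\<^sub>R (V (Suc (Suc m)) l x - B l (V (Suc (Suc m)) l x))"
        by (simp add: VSS blinfun.add_left blinfun.diff_left blinfun.scaleR_left)
      also have "\<dots> = (2 * (real m + 2) / l) *\<^sub>R (b - e) - ((real m + 1) / l) *\<^sub>R (a - b) +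
          (2 / l) *\<^sub>R ((2 *\<^sub>R b - a) - e)"
        unfolding c e_def[symmetric]
        by (simp add: blinfun.diff_right blinfun.scaleR_right e_def a_def b_def scaleR_diff_right
            add.commute)
      finally have L: "?L x = \<dots>" .
      have "V (Suc (Suc (Suc m))) l x = B l (2 *\<^sub>R V (Suc (Suc m)) l x - V (Suc m) l x)"
        by (simp only: VSS[of "Suc m"] blinfun_apply_blinfun_compose blinfun.diff_left blinfun.scaleR_left)
      also have "\<dots> = 2 *\<^sub>R e - b"
        by (simp only: c e_def b_def blinfun.diff_right[of "B l"] blinfun.scaleR_right[of "B l"])
      finally have R: "?R x = ((real m + 3) / l) *\<^sub>R ((2 *\<^sub>R b - a) - (2 *\<^sub>R e - b))"
        by (simp add: blinfun.diff_left blinfun.scaleR_left c)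
      show "\<phi> (?L x) = \<phi> (?R x)"
        unfolding L R using lp by (simp add: add diff scale field_simps)
    qed
    ultimately show ?case by (simp only: VSS)
  qed
qed

text \<open>The function itself is \<open>V 0 l / l\<close>. At each further differentiation the
  derivative of the power of \<open>l\<close> cancels the \<open>V m l\<close> part of
  \<open>V_has_derivative\<close>, so that only \<open>V (m + 1) l\<close> remains.\<close>

lemma higher_derivative_lambda_resolvent:
  "l > \<omega> \<Longrightarrow> higher_vector_derivative m (lambda_resolvent scl D A) l =
    ((- 1) ^ m * fact m / l ^ Suc m) *\<^sub>R V m l"
proof (induction m arbitrary: l)
  case 0
  then have "l > 0" using \<omega>_nonneg by simp
  then show ?case
    by (simp add: higher_vector_derivative_def lambda_resolvent_def V_def Res_def power2_eq_square)
next
  case (Suc m)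
  then have lp: "l > 0" using \<omega>_nonneg by simp
  let ?g = "\<lambda>l. ((- 1) ^ m * fact m * inverse (l ^ Suc m)) *\<^sub>R V m l"
  have "(?g has_vector_derivative ((- 1) ^ m * fact m * inverse (l ^ Suc m)) *\<^sub>R
          (((real m + 1) / l) *\<^sub>R (V m l - V (m + 1) l)) +
        (- ((- 1) ^ m * fact m * (real m + 1) / l ^ Suc (Suc m))) *\<^sub>R V m l) (at l)"
  proof (rule has_vector_derivative_scaleR[OF _ V_has_derivative[OF Suc.prems]])
    show "((\<lambda>l. (- 1) ^ m * fact m * inverse (l ^ Suc m)) has_real_derivative
        - ((- 1) ^ m * fact m * (real m + 1) / l ^ Suc (Suc m))) (at l)"
      using lp by (auto intro!: derivative_eq_intros simp: field_simps simp del: power_Suc)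
        (simp add: field_simps)
  qed
  moreover have "((- 1) ^ m * fact m * inverse (l ^ Suc m)) *\<^sub>R
          (((real m + 1) / l) *\<^sub>R (V m l - V (m + 1) l)) +
        (- ((- 1) ^ m * fact m * (real m + 1) / l ^ Suc (Suc m))) *\<^sub>R V m l =
      ((- 1) ^ Suc m * fact (Suc m) / l ^ Suc (Suc m)) *\<^sub>R V (Suc m) l"
  proof -
    define c where "c = (- 1) ^ m * fact m * (real m + 1) / l ^ Suc (Suc m)"
    have c1: "((- 1) ^ m * fact m * inverse (l ^ Suc m)) * ((real m + 1) / l) = c"
      and c2: "(- 1) ^ Suc m * fact (Suc m) / l ^ Suc (Suc m) = - c"
      using lp by (simp_all add: c_def field_simps)
    show ?thesis
      unfolding c2 c_def[symmetric] scaleR_scaleR c1 by (simp add: scaleR_diff_right)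
  qed
  ultimately have "(?g has_vector_derivative
      ((- 1) ^ Suc m * fact (Suc m) / l ^ Suc (Suc m)) *\<^sub>R V (Suc m) l) (at l)"
    by simp
  then have "(higher_vector_derivative m (lambda_resolvent scl D A) has_vector_derivative
      ((- 1) ^ Suc m * fact (Suc m) / l ^ Suc (Suc m)) *\<^sub>R V (Suc m) l) (at l)"
    by (rule has_vector_derivative_transform_within_open[where S = "{\<omega><..}"])
       (use Suc in \<open>auto simp: divide_inverse\<close>)
  then show ?case
    by (simp add: higher_vector_derivative_def vector_derivative_at)
qed

lemma hille_yosida_term_eq:
  assumes l: "l > \<omega>"
  shows "hille_yosida_term scl D A \<alpha> l m = ((- 1) ^ m * ((l - \<alpha>) / l) ^ Suc m) *\<^sub>R V m l"
proof -
  have "l > 0" using l \<omega>_nonneg by simp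
  then show ?thesis
    by (simp add: hille_yosida_term_def higher_derivative_lambda_resolvent[OF l] field_simps)
qed

end

section \<open>Generation of the cosine family\<close>

context saks_seminorms
begin

lemma exp_growth_functional:
  assumes \<phi>: "bi_functional \<phi>" and b: "b \<ge> 0"
    and cont: "\<And>t p. t \<ge> 0 \<Longrightarrow> p \<in> P \<Longrightarrow> ((\<lambda>s. p (f s - f t)) \<longlongrightarrow> 0) (at t within {0..})"
    and bound: "\<And>t. t \<ge> 0 \<Longrightarrow> norm (f t) \<le> c * exp (b * t)"
  shows "exp_growth b (\<lambda>t. \<phi> (f t))"
proof -
  obtain B where B: "B \<ge> 0" "\<And>y. \<bar>\<phi> y\<bar> \<le> norm y * B"
    using bounded_linear.nonneg_bounded[OF bi_functional_linear[OF \<phi>]] by auto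
  have c: "c \<ge> 0" using bound[of 0] norm_ge_zero[of "f 0"] by (simp del: norm_ge_zero)
  show ?thesis
  proof (rule exp_growthI)
    show "continuous_on {0..} (\<lambda>t. \<phi> (f t))"
      unfolding continuous_on_def
    proof
      fix t :: real assume t: "t \<in> {0..}"
      show "((\<lambda>s. \<phi> (f s)) \<longlongrightarrow> \<phi> (f t)) (at t within {0..})"
        \<comment> \<open>Continuity is tested along sequences because \<phi> only respects limits
          of bounded sequences; a convergent sequence of times is bounded, and the exponential bound
          then bounds the trajectory along it.\<close>
        unfolding tendsto_at_iff_sequentially comp_def
      proof (intro allI impI)
        fix X :: "nat \<Rightarrow> real" assume X: "\<forall>i. X i \<in> {0..} - {t}" and lim: "X \<longlonglongrightarrow> t"
        have "bounded (range X)" using lim by (rule convergent_imp_bounded)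
        then obtain N where N: "\<And>i. X i \<le> N" by (auto simp: bounded_iff abs_le_iff)
        have "norm (f (X i)) \<le> c * exp (b * N)" for i
        proof -
          have "norm (f (X i)) \<le> c * exp (b * X i)" using X by (intro bound) auto
          also have "\<dots> \<le> c * exp (b * N)"
            using c b N by (intro mult_left_mono) (auto intro: mult_left_mono)
          finally show ?thesis .
        qed
        then have "bounded (range (\<lambda>i. f (X i)))" by (intro boundedI[where B = "c * exp (b * N)"]) auto
        moreover have "limitin \<tau> (\<lambda>i. f (X i)) (f t) sequentially"
          unfolding limitin_iff
        proof
          fix p assume "p \<in> P"
          from cont[OF _ this, of t] t X lim show "(\<lambda>i. p (f (X i) - f t)) \<longlonglongrightarrow> 0"
            unfolding tendsto_at_iff_sequentially comp_def by auto
        qed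
        ultimately show "(\<lambda>i. \<phi> (f (X i))) \<longlonglongrightarrow> \<phi> (f t)" by (rule bi_functional_tendsto[OF \<phi>])
      qed
    qed
    fix t :: real assume t: "t \<ge> 0"
    have "\<bar>\<phi> (f t)\<bar> \<le> norm (f t) * B" by (rule B)
    also have "\<dots> \<le> c * exp (b * t) * B" by (intro mult_right_mono bound t B)
    finally show "\<bar>\<phi> (f t)\<bar> \<le> (c * B) * exp (b * t)" by (simp add: mult_ac)
  qed
qed

lemma bi_equicontinuous_iff:
  "bi_equicontinuous \<tau> J T \<longleftrightarrow>
    (\<forall>u x. bounded (range u) \<longrightarrow> limitin \<tau> u x sequentially \<longrightarrow>
      (\<forall>p\<in>P. \<forall>e>0. \<exists>N. \<forall>n\<ge>N. \<forall>j\<in>J. p (T j (u n - x)) < e))"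
proof
  assume bi: "bi_equicontinuous \<tau> J T"
  show "\<forall>u x. bounded (range u) \<longrightarrow> limitin \<tau> u x sequentially \<longrightarrow>
      (\<forall>p\<in>P. \<forall>e>0. \<exists>N. \<forall>n\<ge>N. \<forall>j\<in>J. p (T j (u n - x)) < e)"
  proof (intro allI impI ballI)
    fix u x p and e :: real
    assume u: "bounded (range u)" "limitin \<tau> u x sequentially" and p: "p \<in> P" "e > 0"
    have "openin \<tau> {y. p (y - 0) < e} \<and> 0 \<in> {y. p (y - 0) < e}"
      using openin_P_ball[OF p(1), of 0 e] P_zero[OF p(1)] p(2) by simp
    then have "\<forall>\<^sub>F n in sequentially. \<forall>j\<in>J. T j (u n - x) \<in> {y. p (y - 0) < e}"
      using bi u unfolding bi_equicontinuous_def by blast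
    then show "\<exists>N. \<forall>n\<ge>N. \<forall>j\<in>J. p (T j (u n - x)) < e"
      by (simp add: eventually_sequentially)
  qed
next
  assume rhs: "\<forall>u x. bounded (range u) \<longrightarrow> limitin \<tau> u x sequentially \<longrightarrow>
      (\<forall>p\<in>P. \<forall>e>0. \<exists>N. \<forall>n\<ge>N. \<forall>j\<in>J. p (T j (u n - x)) < e)"
  show "bi_equicontinuous \<tau> J T"
    unfolding bi_equicontinuous_def
  proof (intro allI impI)
    fix u x U
    assume u: "bounded (range u) \<and> limitin \<tau> u x sequentially" and U: "openin \<tau> U \<and> 0 \<in> U"
    then obtain p e where p: "p \<in> P" "e > 0" "{y. p (y - 0) < e} \<subseteq> U"
      unfolding openin_\<tau> by blast
    then obtain N where "\<forall>n\<ge>N. \<forall>j\<in>J. p (T j (u n - x)) < e"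
      using rhs u by blast
    then show "\<forall>\<^sub>F n in sequentially. \<forall>j\<in>J. T j (u n - x) \<in> U"
      unfolding eventually_sequentially using p(3) by auto
  qed
qed

lemma bi_equicontinuousD:
  assumes "bi_equicontinuous \<tau> J T" "bounded (range u)" "limitin \<tau> u x sequentially" "p \<in> P" "e > 0"
  obtains N where "\<And>n j. n \<ge> N \<Longrightarrow> j \<in> J \<Longrightarrow> p (T j (u n - x)) < e"
  using assms unfolding bi_equicontinuous_iff by meson

text \<open>The density argument behind every passage from \<open>D\<close> to the whole space.
  First one member \<open>u i\<close> of the approximating sequence is fixed by equicontinuity,
  uniformly along the filter; then convergence at this single vector of \<open>D\<close> is used.
  The filter is arbitrary, so the rule serves Cauchy properties, limits and continuity
  alike.\<close>

lemma equicontinuous_extension: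
  assumes dense: "bi_densely_defined \<tau> D"
    and add: "\<And>j x y. T j (x + y) = T j x + T j y"
    and equi: "\<And>u x e. bounded (range u) \<Longrightarrow> limitin \<tau> u x sequentially \<Longrightarrow> e > 0 \<Longrightarrow>
      \<exists>i. \<forall>\<^sub>F j in F. p (T j (u i - x)) < e"
    and D: "\<And>x. x \<in> D \<Longrightarrow> ((\<lambda>j. p (T j x)) \<longlongrightarrow> 0) F"
    and p: "p \<in> P"
  shows "((\<lambda>j. p (T j x)) \<longlongrightarrow> 0) F"
proof (rule tendstoI)
  fix e :: real assume e: "e > 0"
  obtain u where u: "\<And>i::nat. u i \<in> D" "bounded (range u)" "limitin \<tau> u x sequentially"
    using dense unfolding bi_densely_defined_def by blast
  obtain i where i: "\<forall>\<^sub>F j in F. p (T j (u i - x)) < e / 2"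
    using equi[OF u(2,3) half_gt_zero[OF e]] by blast
  have "\<forall>\<^sub>F j in F. p (T j (u i)) < e / 2"
    using order_tendstoD(2)[OF D[OF u(1)] half_gt_zero[OF e]] .
  with i show "\<forall>\<^sub>F j in F. dist (p (T j x)) 0 < e"
  proof eventually_elim
    case (elim j)
    have "T j (u i - x) = T j (u i) - T j x"
      using add[of j "u i - x" x] by simp
    then have "T j x = T j (u i) + - T j (u i - x)" by simp
    then have "p (T j x) \<le> p (T j (u i)) + p (T j (u i - x))"
      using P_triangle[OF p, of "T j (u i)" "- T j (u i - x)"] P_minus[OF p] by simp
    then show ?case using elim P_nonneg[OF p] by simp
  qed
qed

end

lemma onorm_scaleR_left_le:
  assumes "norm v \<le> c"
  shows "onorm (\<lambda>h::real. h *\<^sub>R v) \<le> c"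
proof (rule onorm_bound)
  show "0 \<le> c" using assms norm_ge_zero[of v] by linarith
  fix h :: real
  show "norm (h *\<^sub>R v) \<le> c * norm h"
    using mult_left_mono[OF assms, of "\<bar>h\<bar>"] by (simp add: mult.commute)
qed

text \<open>With \<open>v = \<alpha> / l \<le> 1 / 2\<close> the ratio is
  \<open>1 / (1 - v)\<close>, at most \<open>exp (2 * v)\<close>. Since
  \<open>v \<le> \<alpha> * t / n\<close> and \<open>k + 1 \<le> n + 4 \<le> 5 * n\<close>, the
  power is at most the exponential of \<open>5 * 2 * \<alpha> * t\<close>, whence the constant
  10.\<close>

lemma resolvent_ratio_le:
  fixes \<alpha> t l :: real
  assumes \<alpha>: "\<alpha> \<ge> 0" and t: "t > 0" and n: "n \<ge> 1" "2 * \<alpha> * t \<le> real n" and l: "l \<ge> real n / t" and k: "k \<le> n + 3"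
  shows "(l / (l - \<alpha>)) ^ Suc k \<le> exp (10 * \<alpha> * t)" and "l \<ge> 2 * \<alpha>" "l > 0"
proof -
  have nt: "real n / t > 0" using n t by simp
  then show l0: "l > 0" using l by linarith
  have "2 * \<alpha> \<le> real n / t" using n(2) t by (simp add: field_simps)
  then show l2: "l \<ge> 2 * \<alpha>" using l by linarith
  define v where "v = \<alpha> / l"
  have v: "0 \<le> v" "v \<le> 1/2" using \<alpha> l0 l2 by (auto simp: v_def field_simps)
  have "v \<le> \<alpha> / (real n / t)" unfolding v_def using \<alpha> l nt l0 by (intro divide_left_mono mult_pos_pos)
  then have vn: "v \<le> \<alpha> * t / real n" by simp
  have "1 \<le> exp (2 * v) * (1 - v)"
  proof -
    have "(1 + 2 * v) * (1 - v) \<le> exp (2 * v) * (1 - v)"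
      using exp_ge_add_one_self[of "2 * v"] v by (intro mult_right_mono) auto
    moreover have "1 \<le> (1 + 2 * v) * (1 - v)" using v mult_left_mono[OF v(2) v(1)] by (simp add: algebra_simps)
    ultimately show ?thesis by linarith
  qed
  moreover have "l / (l - \<alpha>) = 1 / (1 - v)"
    using l0 l2 \<alpha> v by (simp add: v_def field_simps)
  moreover from calculation(1) have "1 / (1 - v) \<le> exp (2 * v)" using v by (simp add: pos_divide_le_eq)
  ultimately have "l / (l - \<alpha>) \<le> exp (2 * v)" by simp
  moreover have "0 \<le> l / (l - \<alpha>)" using l0 l2 \<alpha> by auto
  ultimately have "(l / (l - \<alpha>)) ^ Suc k \<le> exp (2 * v) ^ Suc k" by (rule power_mono)
  also have "\<dots> = exp (real (Suc k) * (2 * v))" by (simp only: exp_of_nat_mult)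
  also have "\<dots> \<le> exp (10 * \<alpha> * t)"
  proof -
    have "real (Suc k) \<le> 5 * real n" using n(1) k by linarith
    then have "real (Suc k) * (2 * v) \<le> (5 * real n) * (2 * (\<alpha> * t / real n))"
      using v vn by (intro mult_mono) auto
    also have "\<dots> = 10 * \<alpha> * t" using n(1) by simp
    finally show ?thesis by simp
  qed
  finally show "(l / (l - \<alpha>)) ^ Suc k \<le> exp (10 * \<alpha> * t)" .
qed

locale hille_yosida = cosine_resolvent scl \<tau> P D A \<omega> C
  for scl :: "'k::{real_normed_field,euclidean_space} \<Rightarrow> 'a::real_normed_vector \<Rightarrow> 'a"
    and \<tau> P D A \<omega> C +
  fixes M :: real
  assumes M: "M \<ge> 1"
    and dense: "bi_densely_defined \<tau> D"
    and closed: "bi_closed \<tau> D A"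
    and hy_bound: "\<And>l m. l > \<omega> \<Longrightarrow> norm (hille_yosida_term scl D A \<omega> l m) \<le> M"
    and hy_equicontinuous: "\<And>\<alpha>. \<alpha> > \<omega> \<Longrightarrow> bi_equicontinuous \<tau> ({\<alpha><..} \<times> UNIV)
         (\<lambda>(l, m). blinfun_apply (hille_yosida_term scl D A \<alpha> l m))"
begin

lemma norm_V_le:
  assumes l: "l > \<omega>"
  shows "norm (V m l) \<le> M * (l / (l - \<omega>)) ^ Suc m"
proof -
  have l0: "l > 0" "l - \<omega> > 0" using l \<omega>_nonneg by auto
  have "((l - \<omega>) / l) ^ Suc m * norm (V m l) \<le> M"
    using hy_bound[OF l, of m] l0 by (simp add: hille_yosida_term_eq[OF l] abs_mult power_abs)
  then have "(l / (l - \<omega>)) ^ Suc m * (((l - \<omega>) / l) ^ Suc m * norm (V m l)) \<le> (l / (l - \<omega>)) ^ Suc m * M"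
    using l0 by (intro mult_left_mono) auto
  moreover have "(l / (l - \<omega>)) ^ Suc m * ((l - \<omega>) / l) ^ Suc m = 1"
    unfolding power_mult_distrib[symmetric] using l0 by simp
  ultimately show ?thesis by (simp only: mult.assoc[symmetric] mult_1 mult.commute[of M])
qed

lemma V_equicontinuous:
  assumes u: "bounded (range u)" "limitin \<tau> u x sequentially" and p: "p \<in> P" and e: "e > 0" and \<alpha>: "\<alpha> > \<omega>"
  obtains N where "\<And>i l m. i \<ge> N \<Longrightarrow> l > \<alpha> \<Longrightarrow> p (V m l (u i - x)) < e * (l / (l - \<alpha>)) ^ Suc m"
proof -
  obtain N where N: "\<And>n j. n \<ge> N \<Longrightarrow> j \<in> {\<alpha><..} \<times> UNIV \<Longrightarrow>
      p ((case j of (l, m) \<Rightarrow> blinfun_apply (hille_yosida_term scl D A \<alpha> l m)) (u n - x)) < e"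
    using bi_equicontinuousD[OF hy_equicontinuous[OF \<alpha>] u p e] by blast
  have "p (V m l (u i - x)) < e * (l / (l - \<alpha>)) ^ Suc m" if i: "i \<ge> N" and l: "l > \<alpha>" for i l m
  proof -
    have l0: "l > 0" "l - \<alpha> > 0" "l > \<omega>" using l \<alpha> \<omega>_nonneg by auto
    have "p (hille_yosida_term scl D A \<alpha> l m (u i - x)) < e"
      using N[OF i, of "(l, m)"] l by simp
    then have "((l - \<alpha>) / l) ^ Suc m * p (V m l (u i - x)) < e"
      using l0 by (simp add: hille_yosida_term_eq blinfun.scaleR_left P_scaleR[OF p] abs_mult power_abs)
    then have "(l / (l - \<alpha>)) ^ Suc m * (((l - \<alpha>) / l) ^ Suc m * p (V m l (u i - x))) < (l / (l - \<alpha>)) ^ Suc m * e"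
      using l0 by (intro mult_strict_left_mono) auto
    moreover have "(l / (l - \<alpha>)) ^ Suc m * ((l - \<alpha>) / l) ^ Suc m = 1"
      unfolding power_mult_distrib[symmetric] using l0 by simp
    ultimately show ?thesis by (simp only: mult.assoc[symmetric] mult_1 mult.commute[of e])
  qed
  then show ?thesis by (rule that)
qed

text \<open>The range of parameters on which \<open>V k l\<close> is bounded and equicontinuous
  uniformly for times up to \<open>T\<close>. Index \<open>n + 3\<close> occurs in the second time
  derivative of \<open>V (n + 1)\<close>, and \<open>l \<ge> n / t\<close> covers the intermediate
  parameters between consecutive approximants. The number \<open>\<omega> + 1\<close> stands for
  some exponent above \<omega>, as the equicontinuity in (b) requires.\<close>

definition admissible :: "real \<Rightarrow> real \<Rightarrow> nat \<Rightarrow> real \<Rightarrow> nat \<Rightarrow> bool"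
  where "admissible T t n l k \<longleftrightarrow>
    0 < t \<and> t \<le> T \<and> n \<ge> 1 \<and> 2 * (\<omega> + 1) * T \<le> real n \<and> l \<ge> real n / t \<and> k \<le> n + 3"

definition K :: "real \<Rightarrow> real"
  where "K T = M * exp (10 * (\<omega> + 1) * T)"

lemma K_pos: "K T > 0"
  using M by (simp add: K_def)

lemma admissibleD:
  assumes "admissible T t n l k"
  shows "l > \<omega> + 1" "(l / (l - (\<omega> + 1))) ^ Suc k \<le> exp (10 * (\<omega> + 1) * T)"
    "norm (V k l) \<le> K T"
proof -
  have *: "0 < t" "t \<le> T" "n \<ge> 1" "2 * (\<omega> + 1) * T \<le> real n" "l \<ge> real n / t" "k \<le> n + 3"
    using assms by (auto simp: admissible_def)
  have "2 * (\<omega> + 1) * t \<le> 2 * (\<omega> + 1) * T"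
    using * \<omega>_nonneg by (intro mult_left_mono) auto
  then have n: "2 * (\<omega> + 1) * t \<le> real n" using * by linarith
  note r = resolvent_ratio_le[OF _ *(1) *(3) n *(5,6)]
  show l: "l > \<omega> + 1" using r(2) \<omega>_nonneg by simp
  from \<omega>_nonneg * have "exp (10 * (\<omega> + 1) * t) \<le> exp (10 * (\<omega> + 1) * T)"
    by simp
  then show b: "(l / (l - (\<omega> + 1))) ^ Suc k \<le> exp (10 * (\<omega> + 1) * T)"
    by (rule order_trans[rotated]) (rule r(1), use \<omega>_nonneg in simp)
  have "norm (V k l) \<le> M * (l / (l - \<omega>)) ^ Suc k" using l by (intro norm_V_le) simp
  also have "\<dots> \<le> M * (l / (l - (\<omega> + 1))) ^ Suc k"
    using M l \<omega>_nonneg by (intro mult_left_mono power_mono divide_left_mono) auto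
  also have "\<dots> \<le> K T" unfolding K_def using M b by (intro mult_left_mono) auto
  finally show "norm (V k l) \<le> K T" .
qed

lemma admissible_equicontinuous:
  assumes u: "bounded (range u)" "limitin \<tau> u x sequentially" and p: "p \<in> P" and e: "e > 0"
  obtains N where "\<And>i t n l k. i \<ge> N \<Longrightarrow> admissible T t n l k \<Longrightarrow> p (V k l (u i - x)) < e"
proof -
  define e' where "e' = e / exp (10 * (\<omega> + 1) * T)"
  have e': "e' > 0" using e by (simp add: e'_def)
  obtain N where N: "\<And>i l m. i \<ge> N \<Longrightarrow> l > \<omega> + 1 \<Longrightarrow>
      p (V m l (u i - x)) < e' * (l / (l - (\<omega> + 1))) ^ Suc m"
    using V_equicontinuous[OF u p e', of "\<omega> + 1"] by auto
  have "p (V k l (u i - x)) < e" if i: "i \<ge> N" and a: "admissible T t n l k" for i t n l k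
  proof -
    have "p (V k l (u i - x)) < e' * (l / (l - (\<omega> + 1))) ^ Suc k"
      by (rule N[OF i admissibleD(1)[OF a]])
    also have "\<dots> \<le> e' * exp (10 * (\<omega> + 1) * T)"
      using e' admissibleD(2)[OF a] by (intro mult_left_mono) auto
    also have "\<dots> = e" by (simp add: e'_def)
    finally show ?thesis .
  qed
  then show ?thesis by (rule that)
qed

text \<open>For \<open>c = m\<close> the factor is close to the inverse of the step
  \<open>t / m\<close>: the time derivative of the approximant is almost its own difference quotient
  in the index.\<close>

lemma V_time_derivative:
  assumes t: "t > 0" and c: "c / t > \<omega>"
  shows "((\<lambda>t. V m (c / t) x) has_vector_derivative
    ((real m + 1) / t) *\<^sub>R (V (m + 1) (c / t) x - V m (c / t) x)) (at t)"
proof -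
  have "c / t > 0" using c \<omega>_nonneg by simp
  then have c0: "c > 0" using t by (simp add: zero_less_divide_iff)
  have "((\<lambda>l. V m l x) has_vector_derivative ((real m + 1) / (c / t)) *\<^sub>R (V m (c / t) x - V (m + 1) (c / t) x)) (at (c / t))"
    using bounded_linear.has_vector_derivative[OF blinfun.bounded_linear_left[of x] V_has_derivative[OF c, of m]]
    by (simp add: blinfun.bilinear_simps)
  moreover have "((\<lambda>t. c / t) has_vector_derivative - (c / t\<^sup>2)) (at t)"
    unfolding has_real_derivative_iff_has_vector_derivative[symmetric]
    using t by (auto intro!: derivative_eq_intros simp: power2_eq_square)
  ultimately have "(((\<lambda>l. V m l x) \<circ> (\<lambda>t. c / t)) has_vector_derivative
      - (c / t\<^sup>2) *\<^sub>R ((real m + 1) / (c / t)) *\<^sub>R (V m (c / t) x - V (m + 1) (c / t) x)) (at t)"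
    by (intro vector_diff_chain_at) auto
  moreover have "- (c / t\<^sup>2) * ((real m + 1) / (c / t)) = - ((real m + 1) / t)"
    using t c0 by (simp add: field_simps power2_eq_square)
  ultimately show ?thesis
    by (simp add: o_def scaleR_diff_right)
qed

text \<open>Differentiating twice produces a second difference, which the scheme replaces by
  \<open>A\<close>. Thus \<open>V m (c / t) x\<close> satisfies \<open>u'' = A u\<close> up to an
  index shift by two and a factor that tends to 1 when \<open>c = m\<close> grows.\<close>

lemma V_time_second_derivative:
  assumes t: "t > 0" and c: "c / t > \<omega>" and x: "x \<in> D"
  shows "((\<lambda>t. ((real m + 1) / t) *\<^sub>R (V (m + 1) (c / t) x - V m (c / t) x)) has_vector_derivative
    ((real m + 1) * (real m + 2) / c\<^sup>2) *\<^sub>R V (m + 2) (c / t) (A x)) (at t)"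
proof -
  define d where "d m = V (m + 1) (c / t) x - V m (c / t) x" for m
  have c0: "c \<noteq> 0" using c t \<omega>_nonneg by auto
  have "((\<lambda>t. V (m + 1) (c / t) x - V m (c / t) x) has_vector_derivative
      ((real (m + 1) + 1) / t) *\<^sub>R d (m + 1) - ((real m + 1) / t) *\<^sub>R d m) (at t)"
    unfolding d_def by (intro has_vector_derivative_diff V_time_derivative t c)
  moreover have "((\<lambda>t. (real m + 1) / t) has_real_derivative - ((real m + 1) / t\<^sup>2)) (at t)"
    using t by (auto intro!: derivative_eq_intros simp: power2_eq_square field_simps)
  ultimately have "((\<lambda>t. ((real m + 1) / t) *\<^sub>R (V (m + 1) (c / t) x - V m (c / t) x)) has_vector_derivative
      ((real m + 1) / t) *\<^sub>R (((real (m + 1) + 1) / t) *\<^sub>R d (m + 1) - ((real m + 1) / t) *\<^sub>R d m) +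
      (- ((real m + 1) / t\<^sup>2)) *\<^sub>R d m) (at t)"
    unfolding d_def by (rule has_vector_derivative_scaleR[rotated])
  also have "((real m + 1) / t) *\<^sub>R (((real (m + 1) + 1) / t) *\<^sub>R d (m + 1) - ((real m + 1) / t) *\<^sub>R d m) +
      (- ((real m + 1) / t\<^sup>2)) *\<^sub>R d m = ((real m + 1) * (real m + 2) / t\<^sup>2) *\<^sub>R (d (m + 1) - d m)"
  proof -
    have "((real m + 1) / t) *\<^sub>R (((real (m + 1) + 1) / t) *\<^sub>R d (m + 1) - ((real m + 1) / t) *\<^sub>R d m) +
      (- ((real m + 1) / t\<^sup>2)) *\<^sub>R d m =
      ((real m + 1) * (real m + 2) / t\<^sup>2) *\<^sub>R d (m + 1) -
      (((real m + 1) * (real m + 1) / t\<^sup>2) + (real m + 1) / t\<^sup>2) *\<^sub>R d m"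
      by (simp add: scaleR_diff_right scaleR_left_distrib power2_eq_square add.commute)
    also have "((real m + 1) * (real m + 1) / t\<^sup>2) + (real m + 1) / t\<^sup>2 = (real m + 1) * (real m + 2) / t\<^sup>2"
      by (simp add: add_divide_distrib[symmetric] algebra_simps)
    finally show ?thesis by (simp add: scaleR_diff_right)
  qed
  also have "d (m + 1) - d m = (1 / (c / t)\<^sup>2) *\<^sub>R V (m + 2) (c / t) (A x)"
    using V_second_difference[OF c x, of m] by (simp add: d_def)
  finally show ?thesis
    using t c0 by (simp add: power_divide)
qed

text \<open>Going from \<open>n\<close> to \<open>n + 1\<close> raises the index and, at fixed
  \<open>t\<close>, also raises the parameter from \<open>n / t\<close> to
  \<open>(n + 1) / t\<close>. Each change alone is of order \<open>1 / n\<close>; they cancel to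
  first order, and the remainder \<open>O(1 / n ^ 2)\<close> is summable. This is the consistency
  estimate on which convergence rests.\<close>

lemma approximant_step:
  assumes x: "x \<in> D" and t: "0 < t" "t \<le> T" and n: "n \<ge> 1" "2 * (\<omega> + 1) * T \<le> real n"
  shows "norm (V (n + 1) (real (n + 1) / t) x - V n (real n / t) x) \<le>
    6 * (K T * norm (A x)) * t\<^sup>2 / (real n)\<^sup>2"
proof -
  define a where "a = K T * norm (A x)"
  \<comment> \<open>At time \<open>r0\<close> the parameter \<open>(n + 1) / r0\<close> equals
    \<open>n / t\<close>, so \<open>w r0\<close> differs from \<open>V n (n / t) x\<close> in the
    index only, and moving from \<open>r0\<close> back to \<open>t\<close> changes the parameter
    only.\<close>
  define r0 where "r0 = t * (real n + 1) / real n"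
  define w where "w r = V (n + 1) (real (n + 1) / r) x" for r
  define w1 where "w1 r = ((real (n + 1) + 1) / r) *\<^sub>R (V (n + 1 + 1) (real (n + 1) / r) x - V (n + 1) (real (n + 1) / r) x)" for r
  have n0: "real n > 0" using n by simp
  have a0: "a \<ge> 0" using K_pos[of T] by (simp add: a_def)
  have r0: "t \<le> r0" "r0 - t = t / real n" "real (n + 1) / r0 = real n / t" "r0 > 0"
  proof -
    have n1: "real n + 1 > 0" by simp
    show "r0 > 0" unfolding r0_def using t n0 n1 by (intro divide_pos_pos mult_pos_pos)
    show "t \<le> r0" "r0 - t = t / real n"
      using t n0 n1 by (auto simp: r0_def field_simps)
    have "real n / t * r0 = real (n + 1)"
      using t n0 by (simp add: r0_def)
    then show "real (n + 1) / r0 = real n / t"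
      using \<open>r0 > 0\<close> by (intro sym[OF eq_divide_imp]) auto
  qed
  have adm: "admissible T t n (real (n + 1) / r) k" if "r \<in> {t..r0}" "k \<le> n + 3" for r k
  proof -
    have "real n / t \<le> real (n + 1) / r"
      unfolding r0(3)[symmetric] using that t by (intro divide_left_mono) auto
    then show ?thesis using t n that by (simp add: admissible_def)
  qed
  have l: "real (n + 1) / r > \<omega>" if "r \<in> {t..r0}" for r
    using admissibleD(1)[OF adm[OF that, of 0]] by simp
  have Va: "norm (V k (real (n + 1) / r) (A x)) \<le> a" if "r \<in> {t..r0}" "k \<le> n + 3" for k r
    unfolding a_def
    by (rule order_trans[OF norm_blinfun]) (intro mult_right_mono admissibleD(3)[OF adm[OF that]] norm_ge_zero)
  have w': "(w has_vector_derivative w1 r) (at r within {t..r0})" if "r \<in> {t..r0}" for r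
    unfolding w_def w1_def
    by (rule has_vector_derivative_at_within, rule V_time_derivative) (use that t l in auto)
  have w1': "(w1 has_vector_derivative ((real (n + 1) + 1) * (real (n + 1) + 2) / (real (n + 1))\<^sup>2) *\<^sub>R
      V (n + 1 + 2) (real (n + 1) / r) (A x)) (at r within {t..r0})" if "r \<in> {t..r0}" for r
    unfolding w1_def
    by (rule has_vector_derivative_at_within, rule V_time_second_derivative[OF _ _ x]) (use that t l in auto)
  have coeff: "(real (n + 1) + 1) * (real (n + 1) + 2) / (real (n + 1))\<^sup>2 \<le> 3"
  proof -
    have "1 \<le> (real n)\<^sup>2" using n by simp
    then have "(real (n + 1) + 1) * (real (n + 1) + 2) \<le> 3 * (real (n + 1))\<^sup>2"
      using n by (simp add: power2_eq_square algebra_simps)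
    then show ?thesis by (simp add: divide_le_eq)
  qed
  have lip: "norm (w1 r - w1 r0) \<le> (3 * a) * (t / real n)" if r: "r \<in> {t..r0}" for r
  proof -
    have "norm (w1 r - w1 r0) \<le> (3 * a) * norm (r - r0)"
    proof (rule differentiable_bound[of "{t..r0}"])
      fix r assume r: "r \<in> {t..r0}"
      show "(w1 has_derivative (\<lambda>h. h *\<^sub>R (((real (n + 1) + 1) * (real (n + 1) + 2) / (real (n + 1))\<^sup>2) *\<^sub>R
          V (n + 1 + 2) (real (n + 1) / r) (A x)))) (at r within {t..r0})"
        using w1'[OF r] by (simp add: has_vector_derivative_def)
      have "norm (((real (n + 1) + 1) * (real (n + 1) + 2) / (real (n + 1))\<^sup>2) *\<^sub>R
          V (n + 1 + 2) (real (n + 1) / r) (A x)) \<le> 3 * a"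
        unfolding norm_scaleR using Va[OF r, of "n + 1 + 2"] coeff a0
        by (intro mult_mono) auto
      then show "onorm (\<lambda>h. h *\<^sub>R (((real (n + 1) + 1) * (real (n + 1) + 2) / (real (n + 1))\<^sup>2) *\<^sub>R
          V (n + 1 + 2) (real (n + 1) / r) (A x))) \<le> 3 * a"
        by (rule onorm_scaleR_left_le)
    qed (use r r0 in auto)
    also have "norm (r - r0) \<le> t / real n" using r r0(2) by auto
    finally show ?thesis using a0 by (simp add: mult_left_mono)
  qed
  \<comment> \<open>First-order Taylor expansion of \<open>w\<close> at \<open>r0\<close> over the
    distance \<open>t / n\<close>, with \<open>3 * a\<close> bounding the second derivative.\<close>
  have "norm (w t - w r0 - (t - r0) *\<^sub>R w1 r0) \<le> norm (t - r0) * ((3 * a) * (t / real n))"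
    by (rule vector_differentiable_bound_linearization[of "{t..r0}"])
       (use w' lip r0(1) in \<open>auto simp: closed_segment_eq_real_ivl\<close>)
  also have "norm (t - r0) = t / real n" using r0 by simp
  finally have 1: "norm (w t - w r0 - (t - r0) *\<^sub>R w1 r0) \<le> 3 * (a * t\<^sup>2 / (real n)\<^sup>2)"
    by (simp add: power2_eq_square mult_ac)
  let ?l = "real n / t"
  have r0in: "r0 \<in> {t..r0}" using r0 by simp
  define d where "d k = V (k + 1) ?l x - V k ?l x" for k
  have l0: "?l > \<omega>" using l[OF r0in] r0(3) by simp
  have Va0: "norm (V k ?l (A x)) \<le> a" if "k \<le> n + 3" for k
    using Va[OF r0in that] r0(3) by simp
  have a2: "a / ?l\<^sup>2 = a * t\<^sup>2 / (real n)\<^sup>2" by (simp add: power_divide)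
  have "d (n + 1) - d n = (1 / ?l\<^sup>2) *\<^sub>R V (n + 2) ?l (A x)"
    using V_second_difference[OF l0 x, of n] by (simp add: d_def)
  then have 2: "norm (d (n + 1) - d n) \<le> a * t\<^sup>2 / (real n)\<^sup>2"
    unfolding a2[symmetric] using Va0[of "n + 2"] by (simp add: divide_right_mono)
  have "norm (d (n + 1)) \<le> (real (n + 1) + 2) * a / ?l\<^sup>2"
    unfolding d_def by (rule V_estimates(1)[OF l0 x]) (use Va0 in auto)
  then have "norm ((1 / real (n + 1)) *\<^sub>R d (n + 1)) \<le> (1 / real (n + 1)) * ((real (n + 1) + 2) * a / ?l\<^sup>2)"
    unfolding norm_scaleR by (intro mult_mono) auto
  also have "\<dots> = ((real (n + 1) + 2) / real (n + 1)) * (a * t\<^sup>2 / (real n)\<^sup>2)"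
    unfolding a2[symmetric] by simp
  also have "\<dots> \<le> 2 * (a * t\<^sup>2 / (real n)\<^sup>2)"
    using n a0 by (intro mult_right_mono) (auto simp: field_simps)
  finally have 3: "norm ((1 / real (n + 1)) *\<^sub>R d (n + 1)) \<le> 2 * (a * t\<^sup>2 / (real n)\<^sup>2)" .
  \<comment> \<open>The linear term equals \<open>- (1 + 1 / (n + 1))\<close> times
    \<open>d (n + 1)\<close>. Its main part meets \<open>d n\<close> and leaves a second difference;
    the rest is \<open>d (n + 1) / (n + 1)\<close>. Together with the Taylor remainder the bounds
    are 3, 1 and 2, whose sum is the constant 6.\<close>
  have jump: "w r0 + (t - r0) *\<^sub>R w1 r0 = V n ?l x - (d (n + 1) - d n) - (1 / real (n + 1)) *\<^sub>R d (n + 1)"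
  proof -
    define y where "y = t / real n"
    have y: "y \<noteq> 0" "r0 = real (n + 1) * y" "t - r0 = - y"
      using r0(2) t n0 by (simp_all add: y_def r0_def add.commute mult.commute)
    have "(t - r0) / r0 = - (1 / real (n + 1))"
      unfolding y(3) using y(1) by (simp add: y(2))
    moreover have "(t - r0) * ((real (n + 1) + 1) / r0) = (t - r0) / r0 * (real (n + 1) + 1)"
      by simp
    ultimately have "(t - r0) * ((real (n + 1) + 1) / r0) = - (1 / real (n + 1)) * (real (n + 1) + 1)"
      by (simp only:)
    also have "\<dots> = - (1 + 1 / real (n + 1))"
      by (simp add: field_simps)
    finally have "(t - r0) * ((real (n + 1) + 1) / r0) = - (1 + 1 / real (n + 1))" .
    then have "(t - r0) *\<^sub>R w1 r0 = - (1 + 1 / real (n + 1)) *\<^sub>R d (n + 1)"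
      unfolding w1_def scaleR_scaleR r0(3) d_def by (simp only:)
    also have "\<dots> = - d (n + 1) - (1 / real (n + 1)) *\<^sub>R d (n + 1)"
      by (simp only: scaleR_minus_left scaleR_left_distrib scaleR_one) simp
    finally have "(t - r0) *\<^sub>R w1 r0 = - d (n + 1) - (1 / real (n + 1)) *\<^sub>R d (n + 1)" .
    moreover have "w r0 = V n ?l x + d n"
      unfolding w_def r0(3) d_def by simp
    ultimately show ?thesis by simp
  qed
  have "V (n + 1) (real (n + 1) / t) x - V n ?l x =
      (w t - w r0 - (t - r0) *\<^sub>R w1 r0) - (d (n + 1) - d n) - (1 / real (n + 1)) *\<^sub>R d (n + 1)"
    using jump by (simp add: w_def algebra_simps)
  also have "norm \<dots> \<le> 3 * (a * t\<^sup>2 / (real n)\<^sup>2) + a * t\<^sup>2 / (real n)\<^sup>2 + 2 * (a * t\<^sup>2 / (real n)\<^sup>2)"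
    by (intro norm_triangle_le_diff add_mono 1 2 3)
  finally show ?thesis by (simp add: a_def mult_ac)
qed

end

section \<open>Convergence of the approximants and regularity of the limit family\<close>

context hille_yosida
begin

definition n0 :: "real \<Rightarrow> nat"
  where "n0 T = nat \<lceil>2 * (\<omega> + 1) * T\<rceil> + 1"

lemma admissible_approximant:
  assumes "0 < t" "t \<le> T" "n \<ge> n0 T" "k \<le> n + 3"
  shows "admissible T t n (real n / t) k"
proof -
  have "2 * (\<omega> + 1) * T \<le> real (nat \<lceil>2 * (\<omega> + 1) * T\<rceil>)" by (rule real_nat_ceiling_ge)
  then show ?thesis using assms by (simp add: admissible_def n0_def)
qed

lemma n0_pos: "n \<ge> n0 T \<Longrightarrow> n \<ge> 1"
  and n0_ge: "n \<ge> n0 T \<Longrightarrow> 2 * (\<omega> + 1) * T \<le> real n"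
proof -
  assume n: "n \<ge> n0 T"
  then show "n \<ge> 1" by (simp add: n0_def)
  have "2 * (\<omega> + 1) * T \<le> real (nat \<lceil>2 * (\<omega> + 1) * T\<rceil>)" by (rule real_nat_ceiling_ge)
  then show "2 * (\<omega> + 1) * T \<le> real n" using n by (simp add: n0_def)
qed

lemma approximant_bounds:
  assumes "0 < t" "t \<le> T" "n \<ge> n0 T" "k \<le> n + 3"
  shows "real n / t > \<omega>" "norm (V k (real n / t)) \<le> K T" "norm (V k (real n / t) y) \<le> K T * norm y"
proof -
  note adm = admissible_approximant[OF assms]
  show "real n / t > \<omega>" using admissibleD(1)[OF adm] by simp
  show le: "norm (V k (real n / t)) \<le> K T" by (rule admissibleD(3)[OF adm])
  show "norm (V k (real n / t) y) \<le> K T * norm y"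
    by (rule order_trans[OF norm_blinfun mult_right_mono[OF le]]) simp
qed

lemma approximant_estimates:
  assumes t: "0 < t" "t \<le> T" "n \<ge> n0 T" and m: "m \<le> n + 2" and x: "x \<in> D"
  shows "norm (V (m + 1) (real n / t) x - V m (real n / t) x) \<le> (real m + 2) * (K T * norm (A x)) * t\<^sup>2 / (real n)\<^sup>2"
    and "norm (V m (real n / t) x - x) \<le> (real m + 1)\<^sup>2 * (K T * norm (A x)) * t\<^sup>2 / (real n)\<^sup>2"
  using V_estimates[OF approximant_bounds(1)[OF t, of 0] x, of m "K T * norm (A x)"]
    approximant_bounds(3)[OF t, of _ "A x"] m
  by (auto simp: power_divide)

text \<open>The steps telescope by \<open>1 / k\<^sup>2 \<le> 2 * (1 / k - 1 / (k + 1))\<close>,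
  which doubles the constant 6 of a single step.\<close>

lemma approximant_Cauchy:
  assumes x: "x \<in> D" and t: "0 < t" and m: "m \<ge> n0 t" and n: "n \<ge> m"
  shows "norm (V n (real n / t) x - V m (real m / t) x) \<le>
    12 * (K t * norm (A x)) * t\<^sup>2 * (1 / real m - 1 / real n)"
  using n
proof (induction n rule: dec_induct)
  case base
  show ?case by simp
next
  case (step k)
  define c where "c = 6 * (K t * norm (A x)) * t\<^sup>2"
  have c: "c \<ge> 0" using K_pos[of t] by (simp add: c_def)
  have k: "k \<ge> n0 t" "k \<ge> 1" using m step n0_pos[of t k] by auto
  have "V (Suc k) (real (Suc k) / t) x - V m (real m / t) x =
      (V (k + 1) (real (k + 1) / t) x - V k (real k / t) x) + (V k (real k / t) x - V m (real m / t) x)"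
    by simp
  also have "norm \<dots> \<le> c / (real k)\<^sup>2 + 2 * c * (1 / real m - 1 / real k)"
    using approximant_step[OF x t order_refl k(2) n0_ge[OF k(1)]] step.IH
    by (intro norm_triangle_mono) (simp_all add: c_def)
  also have "c / (real k)\<^sup>2 \<le> c * (2 * (1 / real k - 1 / real (Suc k)))"
  proof -
    have "1 / (real k)\<^sup>2 \<le> 2 * (1 / real k - 1 / real (Suc k))"
    proof -
      have k1: "real k \<ge> 1" using k by simp
      have "1 / (real k)\<^sup>2 = 2 / (2 * (real k)\<^sup>2)" by simp
      also have "\<dots> \<le> 2 / (real k * (real k + 1))"
      proof (rule divide_left_mono)
        have "1 * real k \<le> real k * real k" using k1 by (intro mult_right_mono) auto
        then show "real k * (real k + 1) \<le> 2 * (real k)\<^sup>2"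
          by (simp add: power2_eq_square algebra_simps)
      qed (use k1 in auto)
      also have "\<dots> = 2 * (1 / real k - 1 / real (Suc k))"
        using k1 by (simp add: field_simps)
      finally show ?thesis .
    qed
    then have "c * (1 / (real k)\<^sup>2) \<le> c * (2 * (1 / real k - 1 / real (Suc k)))"
      by (rule mult_left_mono[OF _ c])
    then show ?thesis by simp
  qed
  also have "c * (2 * (1 / real k - 1 / real (Suc k))) + 2 * c * (1 / real m - 1 / real k) =
      2 * c * (1 / real m - 1 / real (Suc k))"
    by (simp add: algebra_simps)
  finally show ?case by (simp add: c_def)
qed

text \<open>Written as a limit along pairs of indices, the Cauchy property is an instance of
  \<open>equicontinuous_extension\<close>: the rate on the domain is lost, the convergence
  remains.\<close>

lemma approximant_difference_tendsto:
  assumes t: "t > 0" and p: "p \<in> P"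
  shows "((\<lambda>(m, n). p (V m (real m / t) x - V n (real n / t) x)) \<longlongrightarrow> 0) (sequentially \<times>\<^sub>F sequentially)"
proof -
  define T where "T = (\<lambda>(m, n) x. V m (real m / t) x - V n (real n / t) x)"
  have "((\<lambda>j. p (T j x)) \<longlongrightarrow> 0) (sequentially \<times>\<^sub>F sequentially)"
  proof (rule equicontinuous_extension[where T = T, OF dense _ _ _ p])
    show "T j (x + y) = T j x + T j y" for j x y
      by (cases j) (simp add: T_def blinfun.add_right)
    fix u x and e :: real assume u: "bounded (range u)" "limitin \<tau> u x sequentially" and e: "e > 0"
    obtain i where "\<And>j t' n l k. j \<ge> i \<Longrightarrow> admissible t t' n l k \<Longrightarrow> p (V k l (u j - x)) < e / 2"
      using admissible_equicontinuous[OF u p half_gt_zero[OF e], of t] by metis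
    then have i: "\<And>n l k. admissible t t n l k \<Longrightarrow> p (V k l (u i - x)) < e / 2" by blast
    have "p (T (m, n) (u i - x)) < e" if "m \<ge> n0 t" "n \<ge> n0 t" for m n
    proof -
      have "p (T (m, n) (u i - x)) \<le> p (V m (real m / t) (u i - x)) + p (V n (real n / t) (u i - x))"
        using P_triangle_diff[OF p, of "V m (real m / t) (u i - x)" "V n (real n / t) (u i - x)" 0] P_minus[OF p]
        by (simp add: T_def)
      also have "\<dots> < e / 2 + e / 2"
        using i[OF admissible_approximant[OF t order_refl that(1), of m]]
            i[OF admissible_approximant[OF t order_refl that(2), of n]] by (intro add_strict_mono) auto
      finally show ?thesis by simp
    qed
    then show "\<exists>i. \<forall>\<^sub>F j in sequentially \<times>\<^sub>F sequentially. p (T j (u i - x)) < e"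
      unfolding eventually_prod_sequentially by (intro exI[of _ i] exI[of _ "n0 t"]) simp
  next
    fix x assume x: "x \<in> D"
    define c where "c = 12 * (K t * norm (A x)) * t\<^sup>2"
    have c: "c \<ge> 0" using K_pos[of t] by (simp add: c_def)
    have le: "norm (V n (real n / t) x - V m (real m / t) x) \<le> c / real N"
      if "m \<ge> N" "n \<ge> m" "N \<ge> n0 t" for m n N
    proof -
      have N: "N \<ge> 1" by (rule n0_pos[OF that(3)])
      have "norm (V n (real n / t) x - V m (real m / t) x) \<le> c * (1 / real m - 1 / real n)"
        unfolding c_def using that by (intro approximant_Cauchy[OF x t]) auto
      also have "\<dots> \<le> c * (1 / real N)"
      proof (rule mult_left_mono[OF _ c])
        have "1 / real m \<le> 1 / real N" using that N by (intro divide_left_mono) auto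
        moreover have "1 / real n \<ge> 0" by simp
        ultimately show "1 / real m - 1 / real n \<le> 1 / real N" by linarith
      qed
      finally show ?thesis by simp
    qed
    show "((\<lambda>j. p (T j x)) \<longlongrightarrow> 0) (sequentially \<times>\<^sub>F sequentially)"
    proof (rule tendstoI)
      fix e :: real assume e: "e > 0"
      obtain N1 where N1: "c / e < real N1" using reals_Archimedean2 by blast
      define N where "N = max N1 (n0 t)"
      have N: "N \<ge> n0 t" "N \<ge> 1" using n0_pos[of t N] by (auto simp: N_def)
      have "c / e < real N" using N1 by (simp add: N_def)
      then have cN: "c / real N < e" using e N by (simp add: field_simps)
      have "dist (p (T (m, n) x)) 0 < e" if "m \<ge> N" "n \<ge> N" for m n
      proof -
        have "p (T (m, n) x) \<le> norm (T (m, n) x)" by (rule P_le_norm[OF p])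
        also have "\<dots> \<le> c / real N"
        proof (cases "m \<le> n")
          case True
          then show ?thesis
            unfolding T_def prod.case by (subst norm_minus_commute) (rule le[OF that(1) True N(1)])
        next
          case False
          then show ?thesis using le[OF that(2) _ N(1), of m] by (simp add: T_def)
        qed
        finally show ?thesis using cN P_nonneg[OF p] by simp
      qed
      then show "\<forall>\<^sub>F j in sequentially \<times>\<^sub>F sequentially. dist (p (T j x)) 0 < e"
        unfolding eventually_prod_sequentially by (intro exI[of _ N]) simp
    qed
  qed
  then show ?thesis by (simp add: T_def case_prod_unfold)
qed

text \<open>The parameter \<open>n / t\<close> degenerates at \<open>t = 0\<close>, so the identity
  is prescribed there. For \<open>t > 0\<close> the description denotes by
  \<open>approximant_limit\<close>.\<close>

definition S :: "real \<Rightarrow> 'a \<Rightarrow> 'a"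
  where "S t x = (if t \<le> 0 then x else (THE l. limitin \<tau> (\<lambda>n. V n (real n / t) x) l sequentially))"

lemma S_0 [simp]: "S 0 x = x"
  by (simp add: S_def)

lemma approximant_limit:
  assumes t: "t > 0"
  shows "limitin \<tau> (\<lambda>n. V n (real n / t) x) (S t x) sequentially"
proof -
  obtain l where l: "limitin \<tau> (\<lambda>n. V n (real n / t) x) l sequentially"
  proof (rule Cauchy_convergent[where C = "K t * norm x"])
    show "\<forall>\<^sub>F n in sequentially. norm (V n (real n / t) x) \<le> K t * norm x"
      using eventually_ge_at_top[of "n0 t"]
      by (rule eventually_mono) (use t in \<open>auto intro!: approximant_bounds(3)\<close>)
    fix p and e :: real assume p: "p \<in> P" and e: "e > 0"
    have "\<forall>\<^sub>F (m, n) in sequentially \<times>\<^sub>F sequentially. p (V m (real m / t) x - V n (real n / t) x) < e"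
      using order_tendstoD(2)[OF approximant_difference_tendsto[OF t p, of x] e] by (simp add: case_prod_unfold)
    then show "\<exists>N. \<forall>m\<ge>N. \<forall>n\<ge>N. p (V m (real m / t) x - V n (real n / t) x) < e"
      unfolding eventually_prod_sequentially by fast
  qed
  have "(THE l. limitin \<tau> (\<lambda>n. V n (real n / t) x) l sequentially) = l"
    by (rule the_equality, rule l, rule limitin_unique[OF _ l sequentially_bot])
  then show ?thesis using l t by (simp add: S_def)
qed

text \<open>The second time derivative of the approximants carries the index \<open>n + 2\<close>,
  so the integral equation for the limit needs this shifted version. On the domain the shift costs
  two first differences, each of order \<open>1 / n\<close>.\<close>

lemma approximant_limit_2:
  assumes t: "t > 0"
  shows "limitin \<tau> (\<lambda>n. V (n + 2) (real n / t) x) (S t x) sequentially"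
proof -
  define T where "T n x = V (n + 2) (real n / t) x - V n (real n / t) x" for n x
  have "limitin \<tau> (\<lambda>n. T n x) 0 sequentially"
    unfolding limitin_iff diff_zero
  proof
    fix p assume p: "p \<in> P"
    show "(\<lambda>n. p (T n x)) \<longlonglongrightarrow> 0"
    proof (rule equicontinuous_extension[where T = T, OF dense _ _ _ p])
      show "T j (x + y) = T j x + T j y" for j x y
        by (simp add: T_def blinfun.add_right)
      fix u x and e :: real assume u: "bounded (range u)" "limitin \<tau> u x sequentially" and e: "e > 0"
      obtain i where "\<And>j t' n l k. j \<ge> i \<Longrightarrow> admissible t t' n l k \<Longrightarrow> p (V k l (u j - x)) < e / 2"
        using admissible_equicontinuous[OF u p half_gt_zero[OF e], of t] by metis
      then have i: "\<And>n l k. admissible t t n l k \<Longrightarrow> p (V k l (u i - x)) < e / 2" by blast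
      have "p (T n (u i - x)) < e" if "n \<ge> n0 t" for n
      proof -
        have "p (T n (u i - x)) \<le> p (V (n + 2) (real n / t) (u i - x)) + p (V n (real n / t) (u i - x))"
          using P_triangle_diff[OF p, of "V (n + 2) (real n / t) (u i - x)" "V n (real n / t) (u i - x)" 0] P_minus[OF p]
          by (simp add: T_def)
        also have "\<dots> < e / 2 + e / 2"
          using i[OF admissible_approximant[OF t order_refl that, of "n + 2"]]
            i[OF admissible_approximant[OF t order_refl that, of n]] by (intro add_strict_mono) auto
        finally show ?thesis by simp
      qed
      then show "\<exists>i. \<forall>\<^sub>F n in sequentially. p (T n (u i - x)) < e"
        unfolding eventually_sequentially by blast
    next
      fix x assume x: "x \<in> D"
      define c where "c = (K t * norm (A x)) * t\<^sup>2"
      show "(\<lambda>n. p (T n x)) \<longlonglongrightarrow> 0"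
      proof (rule Lim_null_comparison)
        show "\<forall>\<^sub>F n in sequentially. norm (p (T n x)) \<le> (2 * real n + 5) / (real n)\<^sup>2 * c"
          using eventually_ge_at_top[of "n0 t"]
        proof eventually_elim
          case (elim n)
          have "T n x = (V (n + 1 + 1) (real n / t) x - V (n + 1) (real n / t) x) +
              (V (n + 1) (real n / t) x - V n (real n / t) x)"
            by (simp add: T_def)
          also have "norm \<dots> \<le> (real (n + 1) + 2) * (K t * norm (A x)) * t\<^sup>2 / (real n)\<^sup>2 +
              (real n + 2) * (K t * norm (A x)) * t\<^sup>2 / (real n)\<^sup>2"
            using t elim x by (intro norm_triangle_mono approximant_estimates) auto
          also have "\<dots> = (2 * real n + 5) / (real n)\<^sup>2 * c"
            by (simp add: c_def add_divide_distrib[symmetric] algebra_simps)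
          finally show ?case using order_trans[OF P_le_norm[OF p]] P_nonneg[OF p] by simp
        qed
        have "(\<lambda>n. (2 * real n + 5) / (real n)\<^sup>2) \<longlonglongrightarrow> 0" by real_asymp
        then show "(\<lambda>n. (2 * real n + 5) / (real n)\<^sup>2 * c) \<longlonglongrightarrow> 0" by (rule tendsto_mult_left_zero)
      qed
    qed
  qed
  from limitin_add[OF this approximant_limit[OF t, of x]] show ?thesis by (simp add: T_def)
qed

lemma S_add: "S t (x + y) = S t x + S t y"
  and S_scl: "S t (scl c x) = scl c (S t x)"
proof -
  have "S t (x + y) = S t x + S t y \<and> S t (scl c x) = scl c (S t x)"
  proof (cases "t > 0")
    case True
    have "limitin \<tau> (\<lambda>n. V n (real n / t) (x + y)) (S t x + S t y) sequentially"
      using limitin_add[OF approximant_limit[OF True] approximant_limit[OF True], of x y]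
      by (simp add: blinfun.add_right)
    moreover have "limitin \<tau> (\<lambda>n. V n (real n / t) (scl c x)) (scl c (S t x)) sequentially"
    proof -
      have ev: "\<forall>\<^sub>F n in sequentially. V n (real n / t) (scl c x) = scl c (V n (real n / t) x)"
        using eventually_ge_at_top[of "n0 t"]
        by (rule eventually_mono) (use True in \<open>auto intro!: V_scl approximant_bounds(1)\<close>)
      show ?thesis
        unfolding limitin_iff
      proof
        fix p assume p: "p \<in> P"
        have "(\<lambda>n. p (scl c (V n (real n / t) x) - scl c (S t x))) \<longlonglongrightarrow> 0"
          by (rule limitinD[OF limitin_scl[OF approximant_limit[OF True]] p])
        then show "(\<lambda>n. p (V n (real n / t) (scl c x) - scl c (S t x))) \<longlonglongrightarrow> 0"
          by (rule Lim_transform_eventually) (use ev in \<open>auto elim: eventually_mono\<close>)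
      qed
    qed
    ultimately show ?thesis
      using limitin_unique[OF _ approximant_limit[OF True] sequentially_bot] by metis
  qed (simp add: S_def)
  then show "S t (x + y) = S t x + S t y" "S t (scl c x) = scl c (S t x)" by auto
qed

lemma S_scaleR: "S t (r *\<^sub>R x) = r *\<^sub>R S t x"
  using S_scl[of t "of_real r" x] by (simp add: scl_of_real)

lemma S_diff: "S t (x - y) = S t x - S t y"
  using S_add[of t x "- 1 *\<^sub>R y"] by (simp only: S_scaleR) simp

text \<open>The base is \<open>1 / (1 - \<omega> * t / n)\<close>. The crude constant
  \<open>K T\<close> would suffice for convergence, but the bound required in (a) needs this exact
  limit.\<close>

lemma approximation_rate_tendsto:
  "t > 0 \<Longrightarrow> (\<lambda>n. (real n / t / (real n / t - \<omega>)) ^ Suc n) \<longlonglongrightarrow> exp (\<omega> * t)"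
proof -
  assume t: "t > 0"
  have "(\<lambda>n. inverse ((1 + (- (\<omega> * t)) / real n) ^ n)) \<longlonglongrightarrow> inverse (exp (- (\<omega> * t)))"
    by (intro tendsto_inverse tendsto_exp_limit_sequentially) simp
  moreover have "(\<lambda>n. inverse (1 + (- (\<omega> * t)) / real n)) \<longlonglongrightarrow> 1"
    by real_asymp
  ultimately have "(\<lambda>n. inverse ((1 + (- (\<omega> * t)) / real n) ^ n) * inverse (1 + (- (\<omega> * t)) / real n)) \<longlonglongrightarrow>
      inverse (exp (- (\<omega> * t))) * 1"
    by (rule tendsto_mult)
  moreover have "\<forall>\<^sub>F n in sequentially. inverse ((1 + (- (\<omega> * t)) / real n) ^ n) * inverse (1 + (- (\<omega> * t)) / real n) =
      (real n / t / (real n / t - \<omega>)) ^ Suc n"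
    using eventually_gt_at_top[of 0]
  proof eventually_elim
    case (elim n)
    have "real n / t / (real n / t - \<omega>) = inverse (1 + (- (\<omega> * t)) / real n)"
      using elim t by (simp add: field_simps)
    then show ?case by (simp add: power_inverse)
  qed
  ultimately have "(\<lambda>n. (real n / t / (real n / t - \<omega>)) ^ Suc n) \<longlonglongrightarrow> inverse (exp (- (\<omega> * t))) * 1"
    by (rule Lim_transform_eventually)
  then show ?thesis by (simp add: exp_minus)
qed

lemma norm_S_le: "t \<ge> 0 \<Longrightarrow> norm (S t x) \<le> M * exp (\<omega> * t) * norm x"
proof (cases "t = 0")
  case True
  then show ?thesis using mult_right_mono[OF M, of "norm x"] by simp
next
  case False
  assume "t \<ge> 0"
  with False have t: "t > 0" by simp
  show ?thesis
  proof (rule norm_limitin_le[OF approximant_limit[OF t]])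
    show "\<forall>\<^sub>F n in sequentially. norm (V n (real n / t) x) \<le>
        M * (real n / t / (real n / t - \<omega>)) ^ Suc n * norm x"
      using eventually_ge_at_top[of "n0 t"]
    proof eventually_elim
      case (elim n)
      have "real n / t > \<omega>" by (rule approximant_bounds(1)[OF t order_refl elim, of 0]) simp
      from order_trans[OF norm_blinfun mult_right_mono[OF norm_V_le[OF this]]]
      show ?case by simp
    qed
    show "(\<lambda>n. M * (real n / t / (real n / t - \<omega>)) ^ Suc n * norm x) \<longlonglongrightarrow> M * exp (\<omega> * t) * norm x"
      by (intro tendsto_intros approximation_rate_tendsto t)
  qed simp
qed

lemma S_bounded_linear: "t \<ge> 0 \<Longrightarrow> bounded_linear (S t)"
  by (rule bounded_linear_intro[of _ "M * exp (\<omega> * t)"])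
     (auto simp: S_add S_scaleR norm_S_le mult.commute[of "norm _"])

lemma S_equicontinuous:
  assumes u: "bounded (range u)" "limitin \<tau> u x sequentially" and p: "p \<in> P" and e: "e > 0"
  obtains N where "\<And>i t. i \<ge> N \<Longrightarrow> 0 \<le> t \<Longrightarrow> t \<le> T \<Longrightarrow> p (S t (u i - x)) < e"
proof -
  obtain N where N: "\<And>i t n l k. i \<ge> N \<Longrightarrow> admissible T t n l k \<Longrightarrow> p (V k l (u i - x)) < e / 2"
    using admissible_equicontinuous[OF u p half_gt_zero[OF e], of T] by blast
  obtain N' where N': "\<And>i. i \<ge> N' \<Longrightarrow> p (u i - x) < e"
    using order_tendstoD(2)[OF limitinD[OF u(2) p] e] by (auto simp: eventually_sequentially)
  have "p (S t (u i - x)) < e" if i: "i \<ge> max N N'" and t: "0 \<le> t" "t \<le> T" for i t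
  proof (cases "t = 0")
    case True
    then show ?thesis using N' i by simp
  next
    case False
    then have t0: "t > 0" using t by simp
    \<comment> \<open>Strict inequalities become weak ones in the limit, so the approximants are
      controlled by half of \<open>e\<close>.\<close>
    have "p (S t (u i - x)) \<le> e / 2"
    proof (rule P_limitin_le[OF approximant_limit[OF t0] _ p])
      show "\<forall>\<^sub>F n in sequentially. p (V n (real n / t) (u i - x)) \<le> e / 2"
        using eventually_ge_at_top[of "n0 T"]
      proof eventually_elim
        case (elim n)
        have "admissible T t n (real n / t) n"
          using t t0 elim by (intro admissible_approximant) auto
        then show ?case using i by (intro less_imp_le[OF N]) auto
      qed
    qed simp
    then show ?thesis using e by simp
  qed
  then show ?thesis by (rule that)
qed

lemma bi_operator_S:
  assumes t: "t \<ge> 0"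
  shows "bi_operator (S t)"
  unfolding bi_operator_def limitin_iff
proof (intro conjI allI impI ballI)
  fix u x p assume u: "bounded (range u) \<and> (\<forall>p\<in>P. (\<lambda>i. p (u i - x)) \<longlonglongrightarrow> 0)" and p: "p \<in> P"
  show "(\<lambda>n. p (S t (u n) - S t x)) \<longlonglongrightarrow> 0"
  proof (rule tendstoI)
    fix e :: real assume e: "e > 0"
    obtain N where "\<And>i s. i \<ge> N \<Longrightarrow> 0 \<le> s \<Longrightarrow> s \<le> t \<Longrightarrow> p (S s (u i - x)) < e"
      using S_equicontinuous[of u x p e t] u p e by (auto simp: limitin_iff)
    then have "\<forall>n\<ge>N. dist (p (S t (u n) - S t x)) 0 < e"
      using t P_nonneg[OF p] by (simp add: S_diff)
    then show "\<forall>\<^sub>F n in sequentially. dist (p (S t (u n) - S t x)) 0 < e"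
      unfolding eventually_sequentially by blast
  qed
qed (rule S_bounded_linear[OF t])

lemma S_minus_id_le:
  assumes x: "x \<in> D" and t: "t \<ge> 0"
  shows "norm (S t x - x) \<le> 4 * (K t * norm (A x)) * t\<^sup>2"
proof (cases "t = 0")
  case False
  then have t: "t > 0" using t by simp
  have K0: "0 \<le> K t * norm (A x) * t\<^sup>2" using K_pos[of t] by simp
  show ?thesis
  proof (rule norm_limitin_le[OF limitin_diff[OF approximant_limit[OF t] limitin_const]])
    show "\<forall>\<^sub>F n in sequentially. norm (V n (real n / t) x - x) \<le> 4 * (K t * norm (A x)) * t\<^sup>2"
      using eventually_ge_at_top[of "n0 t"]
    proof eventually_elim
      case (elim n)
      have n: "n \<ge> 1" by (rule n0_pos[OF elim])
      have "norm (V n (real n / t) x - x) \<le> (real n + 1)\<^sup>2 * (K t * norm (A x)) * t\<^sup>2 / (real n)\<^sup>2"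
        using t elim x by (intro approximant_estimates) auto
      also have "\<dots> = ((real n + 1) / real n)\<^sup>2 * (K t * norm (A x) * t\<^sup>2)"
        by (simp add: power_divide)
      \<comment> \<open>The constant 4 of the statement is \<open>((n + 1) / n)\<^sup>2\<close> at
        its worst, \<open>n = 1\<close>.\<close>
      also have "\<dots> \<le> 2\<^sup>2 * (K t * norm (A x) * t\<^sup>2)"
        using n by (intro mult_right_mono power_mono K0) (auto simp: field_simps)
      finally show ?case by simp
    qed
  qed auto
qed simp

text \<open>The approximants are Lipschitz in time with a constant independent of \<open>n\<close>:
  their derivative is \<open>(n + 1) / r\<close> times a first difference of size
  \<open>(n + 2) * a * r\<^sup>2 / n\<^sup>2\<close>, and
  \<open>(n + 1) * (n + 2) \<le> 6 * n\<^sup>2\<close>.\<close>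

lemma S_Lipschitz:
  assumes x: "x \<in> D" and s: "0 < s" "s \<le> T" and t: "0 < t" "t \<le> T"
  shows "norm (S t x - S s x) \<le> 6 * T * (K T * norm (A x)) * \<bar>t - s\<bar>"
proof (rule norm_limitin_le[OF limitin_diff[OF approximant_limit[OF t(1)] approximant_limit[OF s(1)]]])
  define a where "a = K T * norm (A x)"
  have a: "a \<ge> 0" using K_pos[of T] by (simp add: a_def)
  show "\<forall>\<^sub>F n in sequentially. norm (V n (real n / t) x - V n (real n / s) x) \<le>
      6 * T * (K T * norm (A x)) * \<bar>t - s\<bar>"
    using eventually_ge_at_top[of "n0 T"]
  proof eventually_elim
    case (elim n)
    have n: "n \<ge> 1" by (rule n0_pos[OF elim])
    have "norm (V n (real n / t) x - V n (real n / s) x) \<le> (6 * T * a) * norm (t - s)"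
    proof (rule differentiable_bound[of "{0<..T}"])
      fix r assume r: "r \<in> {0<..T}"
      let ?d = "((real n + 1) / r) *\<^sub>R (V (n + 1) (real n / r) x - V n (real n / r) x)"
      have "real n / r > \<omega>" using r elim by (intro approximant_bounds(1)[of r T n 0]) auto
      from V_time_derivative[OF _ this, of n x] r
      show "((\<lambda>r. V n (real n / r) x) has_derivative (\<lambda>h. h *\<^sub>R ?d)) (at r within {0<..T})"
        unfolding has_vector_derivative_def by (auto intro: has_derivative_at_withinI)
      have "norm ?d \<le> (real n + 1) / r * ((real n + 2) * a * r\<^sup>2 / (real n)\<^sup>2)"
        unfolding a_def using r elim x
        by (simp only: norm_scaleR) (intro mult_mono approximant_estimates, auto)
      also have "\<dots> = ((real n + 1) * (real n + 2) / (real n)\<^sup>2) * (a * r)"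
        using r by (simp add: power2_eq_square)
      also have "\<dots> \<le> 6 * (a * T)"
      proof (rule mult_mono)
        have "real n \<ge> 1" using n by simp
        then have "1 \<le> (real n)\<^sup>2" "1 * real n \<le> real n * real n"
          by (simp, intro mult_right_mono) auto
        then have "(real n + 1) * (real n + 2) \<le> 6 * (real n)\<^sup>2"
          by (simp add: power2_eq_square algebra_simps)
        then show "(real n + 1) * (real n + 2) / (real n)\<^sup>2 \<le> 6" using n by (simp add: divide_le_eq)
      qed (use r a in \<open>auto intro: mult_left_mono\<close>)
      finally have "norm ?d \<le> 6 * T * a" by (simp add: mult_ac)
      then show "onorm (\<lambda>h. h *\<^sub>R ?d) \<le> 6 * T * a"
        by (rule onorm_scaleR_left_le)
    qed (use s t in auto)
    then show ?case by (simp add: a_def)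
  qed
qed auto

lemma S_continuous:
  assumes t: "t \<ge> 0" and p: "p \<in> P"
  shows "((\<lambda>s. p (S s x - S t x)) \<longlongrightarrow> 0) (at t within {0..})"
proof -
  have ev: "\<forall>\<^sub>F s in at t within {0..}. 0 \<le> s \<and> s \<le> t + 1"
    unfolding eventually_at by (intro exI[of _ 1]) (auto simp: dist_real_def)
  show ?thesis
  proof (rule equicontinuous_extension[where T = "\<lambda>s x. S s x - S t x", OF dense _ _ _ p])
    show "S s (x + y) - S t (x + y) = S s x - S t x + (S s y - S t y)" for s x y
      by (simp add: S_add)
    fix u x and e :: real assume u: "bounded (range u)" "limitin \<tau> u x sequentially" and e: "e > 0"
    obtain N where N: "\<And>i s. i \<ge> N \<Longrightarrow> 0 \<le> s \<Longrightarrow> s \<le> t + 1 \<Longrightarrow> p (S s (u i - x)) < e / 2"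
      using S_equicontinuous[OF u p half_gt_zero[OF e], of "t + 1"] by blast
    have "\<forall>\<^sub>F s in at t within {0..}. p (S s (u N - x) - S t (u N - x)) < e"
      using ev
    proof eventually_elim
      case (elim s)
      have "p (S s (u N - x) - S t (u N - x)) \<le> p (S s (u N - x)) + p (S t (u N - x))"
        using P_triangle_diff[OF p, of "S s (u N - x)" "S t (u N - x)" 0] P_minus[OF p] by simp
      also have "\<dots> < e / 2 + e / 2" using elim t by (intro add_strict_mono N) auto
      finally show ?case by simp
    qed
    then show "\<exists>i. \<forall>\<^sub>F s in at t within {0..}. p (S s (u i - x) - S t (u i - x)) < e" by blast
  next
    fix x assume x: "x \<in> D"
    \<comment> \<open>One constant for both situations: the first summand is the Lipschitz constant
      between positive times, the second covers comparison with time \<open>0\<close>, where the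
      quadratic bound is used with \<open>s\<^sup>2 \<le> (t + 1) * s\<close>.\<close>
    define c where "c = 6 * (t + 1) * (K (t + 1) * norm (A x)) + 4 * (K (t + 1) * norm (A x)) * (t + 1)"
    have K0: "0 \<le> K (t + 1) * norm (A x)" using K_pos[of "t + 1"] by simp
    have Kmono: "K s \<le> K (t + 1)" if "s \<le> t + 1" for s
      unfolding K_def using that M \<omega>_nonneg by (intro mult_left_mono) auto
    have zero: "norm (S s x - S 0 x) \<le> c * s" if s: "0 \<le> s" "s \<le> t + 1" for s
    proof -
      have "norm (S s x - S 0 x) \<le> 4 * (K s * norm (A x)) * s\<^sup>2"
        using S_minus_id_le[OF x s(1)] by simp
      also have "\<dots> \<le> 4 * (K (t + 1) * norm (A x)) * ((t + 1) * s)"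
      proof (rule mult_mono)
        show "4 * (K s * norm (A x)) \<le> 4 * (K (t + 1) * norm (A x))"
          using Kmono[OF s(2)] by (simp add: mult_right_mono)
        show "s\<^sup>2 \<le> (t + 1) * s" using s by (simp add: power2_eq_square mult_right_mono)
      qed (use K_pos[of "t + 1"] in \<open>auto simp: less_imp_le\<close>)
      also have "\<dots> \<le> c * s"
      proof -
        have "0 \<le> 6 * (t + 1) * (K (t + 1) * norm (A x)) * s"
          using s t K_pos[of "t + 1"] by simp
        then show ?thesis by (simp add: c_def algebra_simps)
      qed
      finally show ?thesis .
    qed
    have c: "norm (S s x - S t x) \<le> c * \<bar>s - t\<bar>" if s: "0 \<le> s" "s \<le> t + 1" for s
    proof -
      consider "s = 0" | "t = 0" | "s > 0" "t > 0" using s t by fastforce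
      then show ?thesis
      proof cases
        case 1
        then show ?thesis using zero[of t] t by (simp add: norm_minus_commute)
      next
        case 2
        then show ?thesis using zero[of s] s by simp
      next
        case 3
        have "norm (S s x - S t x) \<le> 6 * (t + 1) * (K (t + 1) * norm (A x)) * \<bar>s - t\<bar>"
          using 3 s by (intro S_Lipschitz[OF x]) auto
        also have "\<dots> \<le> c * \<bar>s - t\<bar>" using K0 t by (intro mult_right_mono) (auto simp: c_def)
        finally show ?thesis .
      qed
    qed
    show "((\<lambda>s. p (S s x - S t x)) \<longlongrightarrow> 0) (at t within {0..})"
    proof (rule Lim_null_comparison)
      show "\<forall>\<^sub>F s in at t within {0..}. norm (p (S s x - S t x)) \<le> c * \<bar>s - t\<bar>"
        using ev
      proof eventually_elim
        case (elim s)
        then show ?case using order_trans[OF P_le_norm[OF p] c[of s]] P_nonneg[OF p] by simp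
      qed
      have "((\<lambda>s. c * \<bar>s - t\<bar>) \<longlongrightarrow> c * \<bar>t - t\<bar>) (at t within {0..})"
        by (intro tendsto_intros)
      then show "((\<lambda>s. c * \<bar>s - t\<bar>) \<longlongrightarrow> 0) (at t within {0..})" by simp
    qed
  qed
qed

lemma exp_growth_S:
  assumes "bi_functional \<phi>"
  shows "exp_growth \<omega> (\<lambda>t. \<phi> (S t x))"
proof (rule exp_growth_functional[OF assms \<omega>_nonneg])
  fix t :: real assume t: "t \<ge> 0"
  show "norm (S t x) \<le> (M * norm x) * exp (\<omega> * t)" using norm_S_le[OF t, of x] by (simp only: mult_ac)
  fix p assume "p \<in> P"
  then show "((\<lambda>s. p (S s x - S t x)) \<longlongrightarrow> 0) (at t within {0..})" by (rule S_continuous[OF t])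
qed

text \<open>The offset \<open>n0 t\<close> makes the bound and \<open>l > \<omega>\<close> hold for
  every member of the sequence, not just eventually, since bi-closedness and bi-operators speak
  about sequences with bounded range.\<close>

lemma approximant_bounded_limit:
  assumes t: "t > 0"
  shows "bounded (range (\<lambda>i. V (i + n0 t) (real (i + n0 t) / t) x))"
    and "limitin \<tau> (\<lambda>i. V (i + n0 t) (real (i + n0 t) / t) x) (S t x) sequentially"
proof -
  show "bounded (range (\<lambda>i. V (i + n0 t) (real (i + n0 t) / t) x))"
    by (rule boundedI[where B = "K t * norm x"]) (use t in \<open>auto intro!: approximant_bounds(3) simp del: of_nat_add\<close>)
  show "limitin \<tau> (\<lambda>i. V (i + n0 t) (real (i + n0 t) / t) x) (S t x) sequentially"
    unfolding limitin_iff
  proof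
    fix p assume "p \<in> P"
    from LIMSEQ_ignore_initial_segment[OF limitinD[OF approximant_limit[OF t, of x] this], of "n0 t"]
    show "(\<lambda>i. p (V (i + n0 t) (real (i + n0 t) / t) x - S t x)) \<longlonglongrightarrow> 0" .
  qed
qed

text \<open>The approximants map \<open>D\<close> into itself and commute with \<open>A\<close>;
  bi-closedness of \<open>A\<close> passes both facts to the limit.\<close>

lemma S_commute:
  assumes x: "x \<in> D" and t: "t \<ge> 0"
  shows "S t x \<in> D" "A (S t x) = S t (A x)"
proof -
  have "S t x \<in> D \<and> A (S t x) = S t (A x)"
  proof (cases "t = 0")
    case False
    then have t: "t > 0" using t by simp
    let ?u = "\<lambda>i. V (i + n0 t) (real (i + n0 t) / t) x"
    have l: "real (i + n0 t) / t > \<omega>" for i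
      using t by (intro approximant_bounds(1)[of t t _ 0]) auto
    have AV: "A (?u i) = V (i + n0 t) (real (i + n0 t) / t) (A x)" and uD: "?u i \<in> D" for i
      using V_commute[OF l x] by auto
    show ?thesis
      using approximant_bounded_limit[OF t, of x] approximant_bounded_limit[OF t, of "A x"] uD
      unfolding AV[symmetric]
      by (intro closed[unfolded bi_closed_def, rule_format, of ?u] conjI allI)
  qed (use x in simp)
  then show "S t x \<in> D" "A (S t x) = S t (A x)" by auto
qed

text \<open>The member \<open>m = 0\<close> of the equicontinuous family is a multiple of the
  resolvent, since \<open>V 0 l = l\<^sup>2 *\<^sub>R Res l\<close>. Any exponent between \<omega>
  and \<open>l\<close> would do for \<alpha>.\<close>

lemma bi_operator_Res:
  assumes l: "l > \<omega>"
  shows "bi_operator (Res l)"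
  unfolding bi_operator_def limitin_iff
proof (intro conjI allI impI ballI)
  fix u x p assume u: "bounded (range u) \<and> (\<forall>p\<in>P. (\<lambda>i. p (u i - x)) \<longlonglongrightarrow> 0)" and p: "p \<in> P"
  define \<alpha> where "\<alpha> = (\<omega> + l) / 2"
  have \<alpha>: "\<alpha> > \<omega>" "l > \<alpha>" "l > 0" using l \<omega>_nonneg by (auto simp: \<alpha>_def)
  define r where "r = l / (l - \<alpha>)"
  have r: "r > 0" using \<alpha> by (simp add: r_def)
  show "(\<lambda>n. p (Res l (u n) - Res l x)) \<longlonglongrightarrow> 0"
  proof (rule tendstoI)
    fix e :: real assume e: "e > 0"
    have "e * l\<^sup>2 / r > 0" using e r \<alpha> by simp
    moreover have "bounded (range u)" "limitin \<tau> u x sequentially" using u by (simp_all add: limitin_iff)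
    ultimately obtain N where N: "\<And>i k m. i \<ge> N \<Longrightarrow> k > \<alpha> \<Longrightarrow>
        p (V m k (u i - x)) < (e * l\<^sup>2 / r) * (k / (k - \<alpha>)) ^ Suc m"
      using V_equicontinuous[of u x p "e * l\<^sup>2 / r" \<alpha>] p \<alpha>(1) by blast
    have "dist (p (Res l (u n) - Res l x)) 0 < e" if "n \<ge> N" for n
    proof -
      have "l\<^sup>2 * p (Res l (u n - x)) < e * l\<^sup>2 / r * r"
        using N[OF that \<alpha>(2), of 0] by (simp add: V_0 P_scaleR[OF p] r_def)
      then show ?thesis using r \<alpha> P_nonneg[OF p] by (simp add: blinfun.diff_right)
    qed
    then show "\<forall>\<^sub>F n in sequentially. dist (p (Res l (u n) - Res l x)) 0 < e"
      unfolding eventually_sequentially by blast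
  qed
qed (rule blinfun.bounded_linear_right)

lemma S_Res_commute:
  assumes l: "l > \<omega>" and t: "t \<ge> 0"
  shows "S t (Res l y) = Res l (S t y)"
proof (cases "t = 0")
  case False
  then have t: "t > 0" using t by simp
  have k: "real (i + n0 t) / t > \<omega>" for i
    using t by (intro approximant_bounds(1)[of t t _ 0]) auto
  have "limitin \<tau> (\<lambda>i. Res l (V (i + n0 t) (real (i + n0 t) / t) y)) (Res l (S t y)) sequentially"
    by (rule bi_operator_limitin[OF bi_operator_Res[OF l] approximant_bounded_limit[OF t]])
  then have "limitin \<tau> (\<lambda>i. V (i + n0 t) (real (i + n0 t) / t) (Res l y)) (Res l (S t y)) sequentially"
    by (simp only: V_Res_commute[OF k l])
  then show ?thesis
    by (rule limitin_unique[OF approximant_bounded_limit(2)[OF t] _ sequentially_bot])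
qed simp

end

context saks_seminorms
begin

lemma continuous_map_\<tau>_iff:
  "continuous_map (top_of_set X) \<tau> f \<longleftrightarrow>
    (\<forall>t\<in>X. \<forall>p\<in>P. ((\<lambda>s. p (f s - f t)) \<longlongrightarrow> 0) (at t within X))" for f :: "real \<Rightarrow> 'a"
proof
  assume c: "continuous_map (top_of_set X) \<tau> f"
  show "\<forall>t\<in>X. \<forall>p\<in>P. ((\<lambda>s. p (f s - f t)) \<longlongrightarrow> 0) (at t within X)"
  proof (intro ballI tendstoI)
    fix t p and e :: real assume t: "t \<in> X" and p: "p \<in> P" and e: "e > 0"
    have "openin (top_of_set X) {s \<in> X. f s \<in> {y. p (y - f t) < e}}"
    proof -
      have "openin (top_of_set X) {s \<in> topspace (top_of_set X). f s \<in> {y. p (y - f t) < e}}"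
        using c openin_P_ball[OF p, of "f t" e] unfolding continuous_map by blast
      then show ?thesis by simp
    qed
    moreover have "t \<in> {s \<in> X. f s \<in> {y. p (y - f t) < e}}" using t e P_zero[OF p] by simp
    ultimately obtain d where d: "d > 0" "\<And>s. s \<in> X \<Longrightarrow> dist s t < d \<Longrightarrow> p (f s - f t) < e"
      unfolding openin_euclidean_subtopology_iff by blast
    then show "\<forall>\<^sub>F s in at t within X. dist (p (f s - f t)) 0 < e"
      unfolding eventually_at using P_nonneg[OF p] by (intro exI[of _ d]) auto
  qed
next
  assume c: "\<forall>t\<in>X. \<forall>p\<in>P. ((\<lambda>s. p (f s - f t)) \<longlongrightarrow> 0) (at t within X)"
  show "continuous_map (top_of_set X) \<tau> f"
    unfolding continuous_map
  proof (intro conjI allI impI)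
    fix U assume U: "openin \<tau> U"
    show "openin (top_of_set X) {s \<in> topspace (top_of_set X). f s \<in> U}"
      unfolding openin_euclidean_subtopology_iff
    proof (intro conjI ballI)
      fix t assume t: "t \<in> {s \<in> topspace (top_of_set X). f s \<in> U}"
      then obtain p e where p: "p \<in> P" "e > 0" "{y. p (y - f t) < e} \<subseteq> U"
        using U unfolding openin_\<tau> by blast
      have "\<forall>\<^sub>F s in at t within X. p (f s - f t) < e"
        using c t p by (intro order_tendstoD(2)[of _ 0]) auto
      then obtain d where d: "d > 0" "\<And>s. s \<in> X \<Longrightarrow> s \<noteq> t \<Longrightarrow> dist s t < d \<Longrightarrow> p (f s - f t) < e"
        unfolding eventually_at by blast
      have "f s \<in> U" if "s \<in> X" "dist s t < d" for s
        using d(2)[OF that(1) _ that(2)] p(3) t by (cases "s = t") auto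
      then show "\<exists>d>0. \<forall>s\<in>X. dist s t < d \<longrightarrow> s \<in> {s \<in> topspace (top_of_set X). f s \<in> U}"
        using d(1) by (intro exI[of _ d]) auto
    qed auto
  qed auto
qed

end

text \<open>The kernel \<open>t - s\<close> has mass \<open>t\<^sup>2 / 2\<close>, the inverse of
  the factor in the definition of the bi-generator: the difference quotient is an average of second
  derivatives.\<close>

lemma weighted_integral_bound:
  fixes k :: "real \<Rightarrow> real"
  assumes int: "((\<lambda>s. (t - s) * k s) has_integral I) {0..t}" and t: "t \<ge> 0"
    and le: "\<And>s. 0 \<le> s \<Longrightarrow> s \<le> t \<Longrightarrow> \<bar>k s - k0\<bar> \<le> e"
  shows "\<bar>I - t\<^sup>2 / 2 * k0\<bar> \<le> t\<^sup>2 / 2 * e"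
proof -
  have c: "((\<lambda>s. (t - s) * c) has_integral t\<^sup>2 / 2 * c) {0..t}" for c
  proof -
    have "((\<lambda>s. (t - s) * c) has_integral (t * t - t\<^sup>2 / 2) * c - (t * 0 - 0\<^sup>2 / 2) * c) {0..t}"
    proof (rule fundamental_theorem_of_calculus[OF t])
      fix s
      have "((\<lambda>s. (t * s - s\<^sup>2 / 2) * c) has_real_derivative (t - s) * c) (at s within {0..t})"
        by (auto intro!: derivative_eq_intros)
      then show "((\<lambda>s. (t * s - s\<^sup>2 / 2) * c) has_vector_derivative (t - s) * c) (at s within {0..t})"
        by (simp add: has_real_derivative_iff_has_vector_derivative)
    qed
    then show ?thesis by (simp add: power2_eq_square field_simps)
  qed
  have "I \<le> t\<^sup>2 / 2 * (k0 + e)"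
  proof (rule has_integral_le[OF int c])
    fix s assume "s \<in> {0..t}"
    then show "(t - s) * k s \<le> (t - s) * (k0 + e)"
      using le[of s] by (intro mult_left_mono) auto
  qed
  moreover have "t\<^sup>2 / 2 * (k0 - e) \<le> I"
  proof (rule has_integral_le[OF c int])
    fix s assume "s \<in> {0..t}"
    then show "(t - s) * (k0 - e) \<le> (t - s) * k s"
      using le[of s] by (intro mult_left_mono) auto
  qed
  ultimately show ?thesis
    unfolding abs_le_iff by (simp add: distrib_left right_diff_distrib)
qed

section \<open>The integral equation, the cosine law and the bi-generator\<close>

context hille_yosida
begin

text \<open>Taylor's formula with integral remainder at \<open>0\<close>, with vanishing initial
  slope. The parameter \<open>n / s\<close> degenerates at \<open>s = 0\<close>; there the
  antiderivative \<open>q\<close> is given its limit \<phi> \<open>x\<close>, and the estimates of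
  the first differences make it continuous.\<close>

lemma approximant_integral:
  assumes x: "x \<in> D" and \<phi>: "bi_functional \<phi>" and t: "t > 0" and n: "n \<ge> n0 t"
  shows "((\<lambda>s. (t - s) * ((real n + 1) * (real n + 2) / (real n)\<^sup>2 * \<phi> (V (n + 2) (real n / s) (A x))))
    has_integral \<phi> (V n (real n / t) x) - \<phi> x) {0..t}"
proof -
  interpret \<phi>: bounded_linear \<phi> using \<phi> by (rule bi_functional_linear)
  obtain B where B: "B \<ge> 0" "\<And>y. \<bar>\<phi> y\<bar> \<le> norm y * B" using \<phi>.nonneg_bounded by auto
  define w where "w s = V n (real n / s) x" for s
  define w1 where "w1 s = ((real n + 1) / s) *\<^sub>R (V (n + 1) (real n / s) x - V n (real n / s) x)" for s
  define c where "c = (real n + 1) * (real n + 2) / (real n)\<^sup>2"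
  define a where "a = K t * norm (A x)"
  define q where "q s = (if s = 0 then \<phi> x else (t - s) * \<phi> (w1 s) + \<phi> (w s))" for s
  have a: "a \<ge> 0" using K_pos[of t] by (simp add: a_def)
  have c0: "c \<ge> 0" by (simp add: c_def)
  have q': "(q has_real_derivative (t - s) * (c * \<phi> (V (n + 2) (real n / s) (A x)))) (at s)"
    if s: "0 < s" "s \<le> t" for s
  proof -
    have l: "real n / s > \<omega>" by (rule approximant_bounds(1)[OF s n, of 0]) simp
    have "(w has_vector_derivative w1 s) (at s)"
      unfolding w_def w1_def by (rule V_time_derivative[OF s(1) l])
    then have dw: "((\<lambda>s. \<phi> (w s)) has_real_derivative \<phi> (w1 s)) (at s)"
      unfolding has_real_derivative_iff_has_vector_derivative by (rule \<phi>.has_vector_derivative)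
    have "(w1 has_vector_derivative c *\<^sub>R V (n + 2) (real n / s) (A x)) (at s)"
      unfolding w1_def c_def by (rule V_time_second_derivative[OF s(1) l x])
    then have dw1: "((\<lambda>s. \<phi> (w1 s)) has_real_derivative c * \<phi> (V (n + 2) (real n / s) (A x))) (at s)"
      unfolding has_real_derivative_iff_has_vector_derivative
      using \<phi>.has_vector_derivative by (fastforce simp: \<phi>.scaleR)
    have "((\<lambda>s. (t - s) * \<phi> (w1 s) + \<phi> (w s)) has_real_derivative
        (t - s) * (c * \<phi> (V (n + 2) (real n / s) (A x)))) (at s)"
      by (rule derivative_eq_intros dw dw1 refl)+ simp
    then show ?thesis
      by (rule has_field_derivative_transform_within_open[where S = "{0<..}"]) (use s in \<open>auto simp: q_def\<close>)
  qed
  have q0: "\<bar>q s - q 0\<bar> \<le> (2 * t * B * c * a) * s" if s: "0 < s" "s \<le> t" for s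
  proof -
    have "norm (w1 s) \<le> (real n + 1) / s * ((real n + 2) * a * s\<^sup>2 / (real n)\<^sup>2)"
      unfolding w1_def a_def norm_scaleR using s n x by (intro mult_mono approximant_estimates) auto
    also have "\<dots> = c * a * s" using s by (simp add: c_def power2_eq_square)
    finally have w1: "norm (w1 s) \<le> c * a * s" .
    have "norm (w s - x) \<le> (real n + 1)\<^sup>2 * a * s\<^sup>2 / (real n)\<^sup>2"
      unfolding w_def a_def using s n x by (intro approximant_estimates) auto
    also have "\<dots> = ((real n + 1)\<^sup>2 / (real n)\<^sup>2) * (a * (s * s))" by (simp add: power2_eq_square)
    also have "\<dots> \<le> c * (a * (t * s))"
      using s a by (intro mult_mono) (auto simp: c_def power2_eq_square divide_right_mono mult_left_mono)
    finally have w: "norm (w s - x) \<le> c * a * t * s" by (simp add: mult_ac)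
    have "\<bar>q s - q 0\<bar> \<le> (t - s) * \<bar>\<phi> (w1 s)\<bar> + \<bar>\<phi> (w s - x)\<bar>"
      using s abs_triangle_ineq[of "(t - s) * \<phi> (w1 s)" "\<phi> (w s - x)"] by (simp add: q_def \<phi>.diff abs_mult)
    also have "\<dots> \<le> t * (c * a * s * B) + c * a * t * s * B"
      using s w w1 B t a c0
      by (intro add_mono mult_mono order_trans[OF B(2)] mult_right_mono) auto
    finally show ?thesis by (simp add: mult_ac)
  qed
  have "continuous_on {0..t} q"
    unfolding continuous_on_eq_continuous_within
  proof
    fix s assume s: "s \<in> {0..t}"
    show "continuous (at s within {0..t}) q"
    proof (cases "s = 0")
      case False
      then show ?thesis using q'[of s] s by (auto intro: continuous_at_imp_continuous_within DERIV_isCont)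
    next
      case True
      have "((\<lambda>s. q s - q 0) \<longlongrightarrow> 0) (at 0 within {0..t})"
      proof (rule Lim_null_comparison)
        show "\<forall>\<^sub>F s in at 0 within {0..t}. norm (q s - q 0) \<le> (2 * t * B * c * a) * s"
          unfolding eventually_at_filter using q0 by (intro always_eventually) auto
        show "((\<lambda>s. (2 * t * B * c * a) * s) \<longlongrightarrow> 0) (at 0 within {0..t})"
          by (rule tendsto_eq_intros refl tendsto_ident_at)+ simp
      qed
      then show ?thesis using True by (simp add: continuous_within LIM_zero_iff)
    qed
  qed
  then have "((\<lambda>s. (t - s) * (c * \<phi> (V (n + 2) (real n / s) (A x)))) has_integral q t - q 0) {0..t}"
    using t q' by (intro fundamental_theorem_of_calculus_interior)
      (auto simp: has_real_derivative_iff_has_vector_derivative)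
  then show ?thesis using t by (simp add: q_def c_def w_def)
qed

text \<open>The weak integrated form of \<open>u'' = A u\<close> with \<open>u 0 = x\<close> and
  \<open>u' 0 = 0\<close>. It arises from the approximants by dominated convergence, their
  coefficient being at most 6 and tending to 1.\<close>

lemma S_integral:
  assumes x: "x \<in> D" and \<phi>: "bi_functional \<phi>" and t: "t \<ge> 0"
  shows "((\<lambda>s. (t - s) * \<phi> (S s (A x))) has_integral \<phi> (S t x) - \<phi> x) {0..t}"
proof (cases "t = 0")
  case True
  then show ?thesis by (simp add: has_integral_refl)
next
  case False
  then have t: "t > 0" using t by simp
  interpret \<phi>: bounded_linear \<phi> using \<phi> by (rule bi_functional_linear)
  obtain B where B: "B \<ge> 0" "\<And>y. \<bar>\<phi> y\<bar> \<le> norm y * B" using \<phi>.nonneg_bounded by auto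
  define N where "N = n0 t"
  define c where "c n = (real n + 1) * (real n + 2) / (real n)\<^sup>2" for n
  \<comment> \<open>At \<open>s = 0\<close> the quotient \<open>n / s\<close> takes a default value
    that says nothing about the limit; the integrands are redefined on this null set so that they
    converge everywhere.\<close>
  define f where "f i s = (if s = 0 then 0 else (t - s) * (c (i + N) * \<phi> (V (i + N + 2) (real (i + N) / s) (A x))))" for i s
  define g where "g s = (if s = 0 then 0 else (t - s) * \<phi> (S s (A x)))" for s
  have c6: "c n \<le> 6" if "n \<ge> 1" for n
  proof -
    have "real n \<ge> 1" using that by simp
    then have "1 \<le> (real n)\<^sup>2" "1 * real n \<le> real n * real n" by (simp, intro mult_right_mono) auto
    then have "(real n + 1) * (real n + 2) \<le> 6 * (real n)\<^sup>2"
      by (simp add: power2_eq_square algebra_simps)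
    then show ?thesis using that by (simp add: c_def divide_le_eq)
  qed
  have VN: "norm (V (i + N + 2) (real (i + N) / s) y) \<le> K t * norm y" if "0 < s" "s \<le> t" for i s y
    using that by (intro approximant_bounds(3)) (auto simp: N_def)
  have "(g has_integral \<phi> (S t x) - \<phi> x) {0..t}"
  proof (rule has_integral_dominated_convergence)
    show "(f i has_integral \<phi> (V (i + N) (real (i + N) / t) x) - \<phi> x) {0..t}" for i
      by (rule has_integral_spike[OF _ _ approximant_integral[OF x \<phi> t, of "i + N"], of "{0}"])
         (auto simp: f_def c_def N_def)
    show "(\<lambda>s. t * (6 * (K t * norm (A x) * B))) integrable_on {0..t}"
      by (rule integrable_const_ivl)
    show "\<forall>s\<in>{0..t}. norm (f i s) \<le> t * (6 * (K t * norm (A x) * B))" for i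
    proof
      fix s assume s: "s \<in> {0..t}"
      show "norm (f i s) \<le> t * (6 * (K t * norm (A x) * B))"
      proof (cases "s = 0")
        case True
        then show ?thesis using B t K_pos[of t] by (simp add: f_def)
      next
        case False
        have "norm (f i s) = (t - s) * (c (i + N) * \<bar>\<phi> (V (i + N + 2) (real (i + N) / s) (A x))\<bar>)"
          using s False by (simp add: f_def abs_mult c_def)
        also have "\<dots> \<le> t * (6 * (K t * norm (A x) * B))"
        proof (intro mult_mono)
          show "c (i + N) \<le> 6" by (rule c6) (simp add: N_def n0_def)
          have "\<bar>\<phi> (V (i + N + 2) (real (i + N) / s) (A x))\<bar> \<le> norm (V (i + N + 2) (real (i + N) / s) (A x)) * B"
            by (rule B(2))
          also have "\<dots> \<le> K t * norm (A x) * B"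
            using s False B by (intro mult_right_mono VN) auto
          finally show "\<bar>\<phi> (V (i + N + 2) (real (i + N) / s) (A x))\<bar> \<le> K t * norm (A x) * B" .
        qed (use s t in \<open>auto simp: c_def\<close>)
        finally show ?thesis .
      qed
    qed
    show "\<forall>s\<in>{0..t}. (\<lambda>i. f i s) \<longlonglongrightarrow> g s"
    proof
      fix s assume s: "s \<in> {0..t}"
      show "(\<lambda>i. f i s) \<longlonglongrightarrow> g s"
      proof (cases "s = 0")
        case False
        then have s0: "s > 0" using s by simp
        have "c \<longlonglongrightarrow> 1" unfolding c_def by real_asymp
        then have cl: "(\<lambda>i. c (i + N)) \<longlonglongrightarrow> 1" by (rule LIMSEQ_ignore_initial_segment)
        have "(\<lambda>i. \<phi> (V (i + N + 2) (real (i + N) / s) (A x))) \<longlonglongrightarrow> \<phi> (S s (A x))"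
        proof (rule bi_functional_tendsto[OF \<phi>])
          show "bounded (range (\<lambda>i. V (i + N + 2) (real (i + N) / s) (A x)))"
            using s s0 by (intro boundedI[where B = "K t * norm (A x)"]) (auto intro!: VN simp del: of_nat_add add_2_eq_Suc')
          show "limitin \<tau> (\<lambda>i. V (i + N + 2) (real (i + N) / s) (A x)) (S s (A x)) sequentially"
            unfolding limitin_iff
          proof
            fix p assume "p \<in> P"
            from LIMSEQ_ignore_initial_segment[OF limitinD[OF approximant_limit_2[OF s0, of "A x"] this], of N]
            show "(\<lambda>i. p (V (i + N + 2) (real (i + N) / s) (A x) - S s (A x))) \<longlonglongrightarrow> 0" .
          qed
        qed
        from tendsto_mult[OF tendsto_const[of "t - s"] tendsto_mult[OF cl this]]
        show ?thesis using False by (simp add: f_def g_def)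
      qed (simp add: f_def g_def)
    qed
    show "(\<lambda>i. \<phi> (V (i + N) (real (i + N) / t) x) - \<phi> x) \<longlonglongrightarrow> \<phi> (S t x) - \<phi> x"
      unfolding N_def
      by (intro tendsto_diff tendsto_const bi_functional_tendsto[OF \<phi>] approximant_bounded_limit t)
  qed
  then show ?thesis
    by (rule has_integral_spike[of "{0}", rotated 2]) (auto simp: g_def)
qed

text \<open>For \<open>x = Res l y\<close> the sum of both shifts is a solution of
  \<open>U'' = U (A x)\<close> whose slope at \<open>0\<close> vanishes by oddness and whose initial
  value is twice \<phi> \<open>(S \<bar>r\<bar> x)\<close>. Transforming the second derivative gives
  \<open>l\<close> times this value, while \<open>y = l\<^sup>2 *\<^sub>R x - A x\<close>
  reassembles the left-hand side.\<close>

lemma S_laplace_shift: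
  assumes \<phi>: "bi_functional \<phi>" and l: "l > \<omega>"
  shows "laplace (\<lambda>t. \<phi> (S \<bar>t + r\<bar> y) + \<phi> (S \<bar>t + (- r)\<bar> y)) l = 2 * l * \<phi> (S \<bar>r\<bar> (Res l y))"
proof -
  interpret \<phi>: bounded_linear \<phi> using \<phi> by (rule bi_functional_linear)
  define x where "x = Res l y"
  have x: "x \<in> D" unfolding x_def by (rule Res_in_D[OF l])
  have yx: "y = l\<^sup>2 *\<^sub>R x - A x" unfolding x_def by (rule Res_right[OF l, symmetric])
  define U where "U z t = \<phi> (S \<bar>t + r\<bar> z) + \<phi> (S \<bar>t + (- r)\<bar> z)" for z t
  have gU: "exp_growth \<omega> (U z)" for z
    unfolding U_def by (intro exp_growth_add exp_growth_shift[where g = "\<lambda>t. \<phi> (S t z)"] exp_growth_S \<phi> \<omega>_nonneg)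
  obtain g1 where g1: "\<And>t. ((\<lambda>t. \<phi> (S \<bar>t\<bar> x)) has_real_derivative g1 t) (at t)"
    "\<And>t. (g1 has_real_derivative \<phi> (S \<bar>t\<bar> (A x))) (at t)" "\<And>t. g1 (- t) = - g1 t"
  proof (rule even_extension_derivatives[OF exp_growth_continuous[OF exp_growth_S[OF \<phi>]], of "A x" "\<lambda>t. \<phi> (S t x)"])
    fix t :: real assume "t \<ge> 0"
    from S_integral[OF x \<phi> this]
    show "((\<lambda>s. (t - s) * \<phi> (S s (A x))) has_integral \<phi> (S t x) - \<phi> (S 0 x)) {0..t}" by simp
  qed (rule that)
  have "l\<^sup>2 * laplace (U x) l - laplace (U (A x)) l = l * U x 0"
  proof (rule laplace_second_derivative[where ?U1.0 = "\<lambda>t. g1 (t + r) + g1 (t + (- r))", OF _ _ _ gU gU \<omega>_nonneg l])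
    fix t :: real
    show "(U x has_real_derivative g1 (t + r) + g1 (t + (- r))) (at t within {0..})"
      unfolding U_def
      by (rule has_field_derivative_at_within, rule DERIV_add) (rule iffD1[OF DERIV_shift g1(1)])+
    show "((\<lambda>t. g1 (t + r) + g1 (t + (- r))) has_real_derivative U (A x) t) (at t within {0..})"
      unfolding U_def
      by (rule has_field_derivative_at_within, rule DERIV_add) (rule iffD1[OF DERIV_shift g1(2)])+
  qed (simp add: g1(3))
  moreover have "laplace (U y) l = l\<^sup>2 * laplace (U x) l - laplace (U (A x)) l"
  proof -
    have "U y = (\<lambda>t. l\<^sup>2 * U x t - U (A x) t)"
    proof
      fix t
      have "\<phi> (S q y) = l\<^sup>2 * \<phi> (S q x) - \<phi> (S q (A x))" for q
        by (simp only: yx S_diff S_scaleR \<phi>.diff \<phi>.scaleR real_scaleR_def)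
      then show "U y t = l\<^sup>2 * U x t - U (A x) t"
        by (simp only: U_def distrib_left)
    qed
    then show ?thesis
      using laplace_diff[OF exp_growth_cmult[OF gU] gU l] by (simp add: laplace_cmult)
  qed
  ultimately have "laplace (U y) l = l * U x 0" by (simp only:)
  then show ?thesis unfolding U_def x_def by simp
qed

text \<open>The shift \<open>0\<close> gives the transform of the family itself. Hence both sides,
  as functions of \<open>t\<close>, have the transform \<open>2 * l\<close> times \<phi>
  \<open>(S r (Res l y))\<close>; commutation of \<open>S r\<close> with the resolvent brings the
  left one into this form.\<close>

lemma S_cosine:
  assumes t: "t \<ge> 0" and r: "r \<ge> 0"
  shows "2 *\<^sub>R S t (S r y) = S (t + r) y + S \<bar>t - r\<bar> y"
proof (rule bi_functional_eqI)
  fix \<phi> assume \<phi>: "bi_functional \<phi>"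
  interpret \<phi>: bounded_linear \<phi> using \<phi> by (rule bi_functional_linear)
  have L: "laplace (\<lambda>t. \<phi> (S t z)) l = l * \<phi> (Res l z)" if l: "l > \<omega>" for l z
  proof -
    have "2 * laplace (\<lambda>t. \<phi> (S t z)) l = laplace (\<lambda>t. \<phi> (S \<bar>t + 0\<bar> z) + \<phi> (S \<bar>t + (- 0)\<bar> z)) l"
      unfolding laplace_cmult[symmetric] by (intro laplace_cong) auto
    also have "\<dots> = 2 * l * \<phi> (Res l z)"
      unfolding S_laplace_shift[OF \<phi> l] by simp
    finally show ?thesis by simp
  qed
  have "2 * \<phi> (S t (S r y)) = \<phi> (S \<bar>t + r\<bar> y) + \<phi> (S \<bar>t + (- r)\<bar> y)"
  proof (rule laplace_unique[OF _ _ _ t])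
    show "exp_growth \<omega> (\<lambda>t. 2 * \<phi> (S t (S r y)))"
      by (intro exp_growth_cmult exp_growth_S \<phi>)
    show "exp_growth \<omega> (\<lambda>t. \<phi> (S \<bar>t + r\<bar> y) + \<phi> (S \<bar>t + (- r)\<bar> y))"
      by (intro exp_growth_add exp_growth_shift[where g = "\<lambda>t. \<phi> (S t y)"] exp_growth_S \<phi> \<omega>_nonneg)
    fix l assume l: "l > \<omega>"
    show "laplace (\<lambda>t. 2 * \<phi> (S t (S r y))) l = laplace (\<lambda>t. \<phi> (S \<bar>t + r\<bar> y) + \<phi> (S \<bar>t + (- r)\<bar> y)) l"
      using r by (simp only: laplace_cmult L[OF l] S_laplace_shift[OF \<phi> l] abs_of_nonneg S_Res_commute[OF l r])
  qed
  then show "\<phi> (2 *\<^sub>R S t (S r y)) = \<phi> (S (t + r) y + S \<bar>t - r\<bar> y)"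
    using t r by (simp add: \<phi>.add \<phi>.scaleR)
qed

lemma S_generator_tendsto:
  assumes x: "x \<in> D"
  shows "limitin \<tau> (\<lambda>t. (2 / t\<^sup>2) *\<^sub>R (S t x - x)) (A x) (at_right 0)"
  unfolding limitin_iff
proof (intro ballI tendstoI)
  fix p and e :: real assume p: "p \<in> P" and e: "e > 0"
  have "\<forall>\<^sub>F s in at 0 within {0..}. p (S s (A x) - A x) < e / 2"
    using order_tendstoD(2)[OF S_continuous[OF order_refl p, of "A x"] half_gt_zero[OF e]] by simp
  then obtain d where d: "d > 0" "\<And>s. s \<ge> 0 \<Longrightarrow> s \<noteq> 0 \<Longrightarrow> s < d \<Longrightarrow> p (S s (A x) - A x) < e / 2"
    unfolding eventually_at by (auto simp: dist_real_def)
  have d': "p (S s (A x) - A x) \<le> e / 2" if "0 \<le> s" "s < d" for s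
    using d(2)[of s] that e P_zero[OF p] by (cases "s = 0") auto
  have "p ((2 / t\<^sup>2) *\<^sub>R (S t x - x) - A x) < e" if t: "0 < t" "t < d" for t
  proof -
    have "p ((2 / t\<^sup>2) *\<^sub>R (S t x - x) - A x) \<le> e / 2"
    proof (rule P_le_functional[OF p])
      fix \<phi> assume \<phi>: "bi_functional \<phi>" and le: "\<And>y. \<bar>\<phi> y\<bar> \<le> p y"
      interpret \<phi>: bounded_linear \<phi> using \<phi> by (rule bi_functional_linear)
      have "\<bar>\<phi> (S t x) - \<phi> x - t\<^sup>2 / 2 * \<phi> (A x)\<bar> \<le> t\<^sup>2 / 2 * (e / 2)"
      proof (rule weighted_integral_bound[OF S_integral[OF x \<phi>]])
        fix s assume "0 \<le> s" "s \<le> t"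
        then show "\<bar>\<phi> (S s (A x)) - \<phi> (A x)\<bar> \<le> e / 2"
          using order_trans[OF le[of "S s (A x) - A x"] d'[of s]] t by (simp add: \<phi>.diff)
      qed (use t in auto)
      then have "(2 / t\<^sup>2) * \<bar>\<phi> (S t x) - \<phi> x - t\<^sup>2 / 2 * \<phi> (A x)\<bar> \<le> (2 / t\<^sup>2) * (t\<^sup>2 / 2 * (e / 2))"
        by (rule mult_left_mono) simp
      also have "\<dots> = e / 2" using t by simp
      also have "(2 / t\<^sup>2) * \<bar>\<phi> (S t x) - \<phi> x - t\<^sup>2 / 2 * \<phi> (A x)\<bar> =
          \<bar>(2 / t\<^sup>2) * (\<phi> (S t x) - \<phi> x - t\<^sup>2 / 2 * \<phi> (A x))\<bar>"
        by (simp only: abs_mult) simp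
      also have "(2 / t\<^sup>2) * (\<phi> (S t x) - \<phi> x - t\<^sup>2 / 2 * \<phi> (A x)) = \<phi> ((2 / t\<^sup>2) *\<^sub>R (S t x - x) - A x)"
        using t by (simp add: \<phi>.diff \<phi>.scaleR right_diff_distrib)
      finally show "\<bar>\<phi> ((2 / t\<^sup>2) *\<^sub>R (S t x - x) - A x)\<bar> \<le> e / 2" .
    qed
    then show ?thesis using e by simp
  qed
  then show "\<forall>\<^sub>F t in at_right 0. dist (p ((2 / t\<^sup>2) *\<^sub>R (S t x - x) - A x)) 0 < e"
    unfolding eventually_at using d(1) P_nonneg[OF p] by (intro exI[of _ d]) (auto simp: dist_real_def)
qed

lemma S_generator_bounded:
  assumes x: "x \<in> D" and t: "0 < t" "t \<le> 1"
  shows "2 / t\<^sup>2 * norm (S t x - x) \<le> M * exp \<omega> * norm (A x)"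
proof -
  define b where "b = M * exp \<omega> * norm (A x)"
  have "norm (S t x - x) \<le> t\<^sup>2 / 2 * b"
  proof (rule norm_le_functional)
    fix \<phi> assume \<phi>: "bi_functional \<phi>" and le: "\<And>y. \<bar>\<phi> y\<bar> \<le> norm y"
    interpret \<phi>: bounded_linear \<phi> using \<phi> by (rule bi_functional_linear)
    have "\<bar>\<phi> (S t x) - \<phi> x - t\<^sup>2 / 2 * 0\<bar> \<le> t\<^sup>2 / 2 * b"
    proof (rule weighted_integral_bound[OF S_integral[OF x \<phi>]])
      fix s assume s: "0 \<le> s" "s \<le> t"
      have "\<bar>\<phi> (S s (A x))\<bar> \<le> M * exp (\<omega> * s) * norm (A x)"
        by (rule order_trans[OF le norm_S_le[OF s(1)]])
      also have "\<dots> \<le> b"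
        unfolding b_def using s t M \<omega>_nonneg
        by (intro mult_right_mono mult_left_mono) (auto intro: mult_left_le)
      finally show "\<bar>\<phi> (S s (A x)) - 0\<bar> \<le> b" by simp
    qed (use t in auto)
    then show "\<bar>\<phi> (S t x - x)\<bar> \<le> t\<^sup>2 / 2 * b" by (simp add: \<phi>.diff)
  qed
  then show ?thesis using t by (simp add: b_def field_simps)
qed

text \<open>The domain is not larger than \<open>D\<close>: applying the resolvent to the difference
  quotients of \<open>x\<close> gives \<open>Res l y = A (Res l x)\<close>, so
  \<open>x = Res l (l\<^sup>2 *\<^sub>R x - y)\<close>. The norm bound in the definition of the
  bi-generator makes the quotients a bounded sequence, as needed for applying the resolvent to a
  \<tau>-limit.\<close>

lemma bi_generator_domain_subset:
  assumes lim: "limitin \<tau> (\<lambda>t. (2 / t\<^sup>2) *\<^sub>R (S t x - x)) y (at_right 0)"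
    and bdd: "bdd_above ((\<lambda>t. 2 / t\<^sup>2 * norm (S t x - x)) ` {0<..1})"
  shows "x \<in> D"
proof -
  define l where "l = \<omega> + 1"
  have l: "l > \<omega>" by (simp add: l_def)
  define h where "h i = inverse (real (Suc i))" for i
  have h: "h i > 0" "h i \<le> 1" for i by (auto simp: h_def field_simps)
  have h0: "filterlim h (at_right 0) sequentially"
    unfolding filterlim_at h_def using LIMSEQ_inverse_real_of_nat by (auto intro!: always_eventually)
  let ?u = "\<lambda>i. (2 / (h i)\<^sup>2) *\<^sub>R (S (h i) x - x)"
  obtain b where b: "\<forall>z\<in>(\<lambda>t. 2 / t\<^sup>2 * norm (S t x - x)) ` {0<..1}. z \<le> b"
    using bdd unfolding bdd_above_def by (elim exE)
  have bu: "bounded (range ?u)"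
  proof (rule boundedI)
    fix z assume "z \<in> range ?u"
    then obtain i where i: "z = ?u i" by blast
    have "2 / (h i)\<^sup>2 * norm (S (h i) x - x) \<le> b"
      by (rule b[rule_format]) (rule imageI, use h in simp)
    then show "norm z \<le> b" by (simp add: i)
  qed
  have lu: "limitin \<tau> ?u y sequentially"
    unfolding limitin_iff by (intro ballI filterlim_compose[OF limitinD[OF lim] h0])
  have 1: "limitin \<tau> (\<lambda>i. Res l (?u i)) (Res l y) sequentially"
    by (rule bi_operator_limitin[OF bi_operator_Res[OF l] bu lu])
  have "(\<lambda>i. Res l (?u i)) = (\<lambda>i. (2 / (h i)\<^sup>2) *\<^sub>R (S (h i) (Res l x) - Res l x))"
    using S_Res_commute[OF l less_imp_le[OF h(1)]] by (simp add: blinfun.bilinear_simps fun_eq_iff)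
  moreover have "limitin \<tau> (\<lambda>i. (2 / (h i)\<^sup>2) *\<^sub>R (S (h i) (Res l x) - Res l x)) (A (Res l x)) sequentially"
    unfolding limitin_iff by (intro ballI filterlim_compose[OF limitinD[OF S_generator_tendsto[OF Res_in_D[OF l]]] h0])
  ultimately have "limitin \<tau> (\<lambda>i. Res l (?u i)) (A (Res l x)) sequentially" by (simp only:)
  then have "A (Res l x) = Res l y" by (rule limitin_unique[OF _ 1 sequentially_bot])
  then have Ry: "Res l y = l\<^sup>2 *\<^sub>R Res l x - x" by (simp only: A_Res[OF l])
  have "Res l (l\<^sup>2 *\<^sub>R x - y) = x"
    by (simp add: blinfun.diff_right blinfun.scaleR_right Ry)
  then show ?thesis by (rule subst) (rule Res_in_D[OF l])
qed

theorem generates_cosine_family: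
  "cosine_family scl S" "locally_bi_continuous scl \<tau> S" "exponentially_bounded S"
  "is_bi_generator \<tau> S D A" "t \<ge> 0 \<Longrightarrow> onorm (S t) \<le> M * exp (\<omega> * t)"
proof -
  have lin: "Vector_Spaces.linear scl scl (S t)" for t
    by unfold_locales (simp_all add: S_add S_scl)
  have onorm: "onorm (S t) \<le> M * exp (\<omega> * t)" if "t \<ge> 0" for t
    using M by (intro onorm_bound norm_S_le that) auto
  then show "t \<ge> 0 \<Longrightarrow> onorm (S t) \<le> M * exp (\<omega> * t)" .
  show "cosine_family scl S"
    unfolding cosine_family_def using lin S_cosine by (auto simp: fun_eq_iff)
  show "locally_bi_continuous scl \<tau> S"
    unfolding locally_bi_continuous_def
  proof (intro conjI allI impI)
    fix t :: real assume "t \<ge> 0"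
    then show "S t \<in> bounded_operators scl"
      using lin S_bounded_linear by (auto simp: bounded_operators_def)
  next
    fix x
    show "continuous_map (top_of_set {0..}) \<tau> (\<lambda>t. S t x)"
      unfolding continuous_map_\<tau>_iff using S_continuous by auto
  next
    fix N assume N: "compact N \<and> N \<subseteq> {0::real..}"
    then obtain T where T: "\<And>t. t \<in> N \<Longrightarrow> 0 \<le> t" "\<And>t. t \<in> N \<Longrightarrow> t \<le> T"
      using compact_imp_bounded[of N] by (force simp: bounded_iff abs_le_iff)
    show "bdd_above ((\<lambda>t. onorm (S t)) ` N)"
    proof (rule bdd_aboveI2)
      fix t assume t: "t \<in> N"
      have "onorm (S t) \<le> M * exp (\<omega> * t)" by (rule onorm[OF T(1)[OF t]])
      also have "\<dots> \<le> M * exp (\<omega> * T)"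
        using M \<omega>_nonneg T(2)[OF t] by (intro mult_left_mono) (auto intro: mult_left_mono)
      finally show "onorm (S t) \<le> M * exp (\<omega> * T)" .
    qed
    show "bi_equicontinuous \<tau> N S"
      unfolding bi_equicontinuous_iff
    proof (intro allI impI ballI)
      fix u x p and e :: real
      assume "bounded (range u)" "limitin \<tau> u x sequentially" "p \<in> P" "e > 0"
      then obtain k where "\<And>i t. i \<ge> k \<Longrightarrow> 0 \<le> t \<Longrightarrow> t \<le> T \<Longrightarrow> p (S t (u i - x)) < e"
        using S_equicontinuous[of u x p e T] by metis
      then show "\<exists>k. \<forall>n\<ge>k. \<forall>t\<in>N. p (S t (u n - x)) < e"
        using T by (intro exI[of _ k]) auto
    qed
  qed
  show "exponentially_bounded S"
    unfolding exponentially_bounded_def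
  proof (intro exI[of _ "- \<omega>"] bdd_aboveI2)
    fix t :: real assume "t \<in> {0..}"
    then have t: "t \<ge> 0" by simp
    show "onorm (\<lambda>x. exp (- \<omega> * t) *\<^sub>R S t x) \<le> M"
    proof (rule onorm_bound)
      fix x
      have "norm (exp (- \<omega> * t) *\<^sub>R S t x) \<le> exp (- \<omega> * t) * (M * exp (\<omega> * t) * norm x)"
        using norm_S_le[OF t, of x] by simp
      also have "\<dots> = M * norm x" by (simp add: exp_minus)
      finally show "norm (exp (- \<omega> * t) *\<^sub>R S t x) \<le> M * norm x" .
    qed (use M in simp)
  qed
  have "x \<in> bi_generator_domain \<tau> S" if x: "x \<in> D" for x
    unfolding bi_generator_domain_def
    using S_generator_tendsto[OF x] S_generator_bounded[OF x]
    by (auto intro!: bdd_aboveI2[where M = "M * exp \<omega> * norm (A x)"])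
  moreover have "x \<in> D" if "x \<in> bi_generator_domain \<tau> S" for x
    using that bi_generator_domain_subset by (auto simp: bi_generator_domain_def)
  ultimately show "is_bi_generator \<tau> S D A"
    unfolding is_bi_generator_def using S_generator_tendsto by auto
qed

end

section \<open>Weak integrals\<close>

lemma Riemann_sum_bound:
  fixes g :: "real \<Rightarrow> real"
  assumes g: "continuous_on {0..T} g" and T: "T \<ge> 0" and n: "n \<ge> 1"
    and osc: "\<And>s t. s \<in> {0..T} \<Longrightarrow> t \<in> {0..T} \<Longrightarrow> \<bar>s - t\<bar> \<le> T / real n \<Longrightarrow> \<bar>g s - g t\<bar> \<le> e"
  shows "\<bar>(T / real n) * (\<Sum>k<n. g (real k * T / real n)) - integral {0..T} g\<bar> \<le> T * e"
proof -
  define h where "h = T / real n"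
  have n0: "real n > 0" using n by simp
  have h: "h \<ge> 0" "real n * h = T" using T n0 by (auto simp: h_def)
  have hk: "real k * h \<le> T" if "k \<le> n" for k
    using mult_right_mono[of "real k" "real n" h] that h by simp
  have "\<bar>h * (\<Sum>k<m. g (real k * h)) - integral {0..real m * h} g\<bar> \<le> real m * h * e" if "m \<le> n" for m
    using that
  proof (induction m)
    case (Suc m)
    let ?a = "real m * h" and ?b = "real (Suc m) * h"
    have ab: "0 \<le> ?a" "?a \<le> ?b" "?b \<le> T" using h hk[OF Suc.prems] by (auto simp: distrib_right)
    have int: "g integrable_on {c..d}" if "0 \<le> c" "d \<le> T" for c d
      by (rule integrable_continuous_interval[OF continuous_on_subset[OF g]]) (use that in auto)
    have "\<bar>h * g ?a - integral {?a..?b} g\<bar> \<le> h * e"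
    proof -
      have "norm (integral {?a..?b} (\<lambda>t. g t - g ?a)) \<le> integral {?a..?b} (\<lambda>t. e)"
      proof (rule integral_norm_bound_integral)
        show "(\<lambda>t. g t - g ?a) integrable_on {?a..?b}"
          using int[OF ab(1,3)] by (intro integrable_diff integrable_const_ivl)
        fix t assume t: "t \<in> {?a..?b}"
        have "t \<in> {0..T}" using t ab unfolding atLeastAtMost_iff by linarith
        then have "\<bar>g t - g ?a\<bar> \<le> e"
          by (rule osc) (use t ab in \<open>auto simp: h_def[symmetric] distrib_right\<close>)
        then show "norm (g t - g ?a) \<le> e" by simp
      qed (rule integrable_const_ivl)
      moreover have "integral {?a..?b} (\<lambda>t. g t - g ?a) = integral {?a..?b} g - h * g ?a"
        using int[OF ab(1,3)] ab(2) by (subst integral_diff) (auto simp: distrib_right)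
      moreover have "integral {?a..?b} (\<lambda>t. e) = h * e" using ab(2) by (simp add: distrib_right)
      ultimately show ?thesis by (simp only: real_norm_def abs_minus_commute)
    qed
    moreover have "integral {0..?b} g = integral {0..?a} g + integral {?a..?b} g"
      using Henstock_Kurzweil_Integration.integral_combine[OF ab(1,2) int] ab by simp
    moreover have "\<bar>h * (\<Sum>k<m. g (real k * h)) - integral {0..?a} g\<bar> \<le> ?a * e"
      using Suc by simp
    ultimately show ?case by (simp add: distrib_left distrib_right)
  qed simp
  from this[of n] show ?thesis using h by (simp add: h_def)
qed

context saks_seminorms
begin

lemma bi_operator_scl: "bi_operator (scl c)"
  unfolding bi_operator_def
proof (intro conjI allI impI)
  have "r *\<^sub>R scl c y = scl c (r *\<^sub>R y)" for r y
    by (simp add: scl_of_real[symmetric] mult.commute)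
  then show "bounded_linear (scl c)"
    by (intro bounded_linear_intro[of _ "norm c"]) (auto simp: scale_right_distrib norm_scl mult.commute)
qed (auto intro: limitin_scl)

text \<open>The distance \<open>p (f s - f t)\<close> is a continuous real function on a compact
  square, so uniform continuity for real functions applies; comparing \<open>(s, t)\<close> with the
  diagonal point \<open>(t, t)\<close>, where it vanishes, gives the claim.\<close>

lemma P_uniformly_continuous:
  fixes f :: "real \<Rightarrow> 'a"
  assumes cont: "\<And>t. t \<ge> 0 \<Longrightarrow> ((\<lambda>s. p (f s - f t)) \<longlongrightarrow> 0) (at t within {0..})"
    and p: "p \<in> P" and e: "e > 0"
  obtains d where "d > 0" "\<And>s t. s \<in> {0..T} \<Longrightarrow> t \<in> {0..T} \<Longrightarrow> \<bar>s - t\<bar> < d \<Longrightarrow> p (f s - f t) < e"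
proof -
  define q where "q z = p (f (fst z) - f (snd z))" for z :: "real \<times> real"
  have "continuous_on ({0..T} \<times> {0..T}) q"
    unfolding continuous_on_def
  proof
    fix z assume z: "z \<in> {0..T} \<times> {0..T}"
    let ?F = "at z within {0..T} \<times> {0..T}"
    obtain a b where ab: "z = (a, b)" "a \<ge> 0" "b \<ge> 0" using z by (cases z) auto
    have sub: "((\<lambda>s. p (f s - f t)) \<longlongrightarrow> 0) (at t within {0..T})" if "t \<ge> 0" for t
      by (rule tendsto_within_subset[OF cont[OF that]]) auto
    have ev: "\<exists>d>0. \<forall>s\<in>{0..T}. \<bar>s - t\<bar> < d \<longrightarrow> p (f s - f t) < r" if "t \<ge> 0" "r > 0" for t r
    proof -
      have "\<forall>\<^sub>F s in at t within {0..T}. p (f s - f t) < r"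
        by (rule order_tendstoD(2)[OF sub[OF that(1)] that(2)])
      then obtain d where "d > 0" "\<And>s. s \<in> {0..T} \<Longrightarrow> s \<noteq> t \<Longrightarrow> dist s t < d \<Longrightarrow> p (f s - f t) < r"
        unfolding eventually_at by blast
      then show ?thesis using P_zero[OF p] that(2)
        by (intro exI[of _ d]) (metis diff_self dist_real_def)
    qed
    show "(q \<longlongrightarrow> q z) ?F"
    proof (rule tendstoI)
      fix r :: real assume r: "r > 0"
      obtain d1 where d1: "d1 > 0" "\<And>s. s \<in> {0..T} \<Longrightarrow> \<bar>s - a\<bar> < d1 \<Longrightarrow> p (f s - f a) < r / 2"
        using ev[OF ab(2) half_gt_zero[OF r]] by blast
      obtain d2 where d2: "d2 > 0" "\<And>s. s \<in> {0..T} \<Longrightarrow> \<bar>s - b\<bar> < d2 \<Longrightarrow> p (f s - f b) < r / 2"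
        using ev[OF ab(3) half_gt_zero[OF r]] by blast
      have "dist (q w) (q z) < r" if w: "w \<in> {0..T} \<times> {0..T}" "dist w z < min d1 d2" for w
      proof -
        obtain s t where st: "w = (s, t)" "s \<in> {0..T}" "t \<in> {0..T}" using w by auto
        have "\<bar>s - a\<bar> < d1" "\<bar>t - b\<bar> < d2"
          using w(2) dist_fst_le[of w z] dist_snd_le[of w z] by (auto simp: st ab dist_real_def)
        then have "p (f s - f a) < r / 2" "p (f t - f b) < r / 2" using d1 d2 st by auto
        moreover have "\<bar>q w - q z\<bar> \<le> p ((f s - f t) - (f a - f b))"
          using P_abs_diff[OF p] by (simp add: q_def st ab)
        moreover have "(f s - f t) - (f a - f b) = (f s - f a) - (f t - f b)" by simp
        moreover have "p ((f s - f a) - (f t - f b)) \<le> p (f s - f a) + p (f t - f b)"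
          using P_triangle[OF p, of "f s - f a" "- (f t - f b)"] unfolding P_minus[OF p]
          by (simp only: diff_conv_add_uminus)
        ultimately show ?thesis by (simp add: dist_real_def)
      qed
      then show "\<forall>\<^sub>F w in ?F. dist (q w) (q z) < r"
        unfolding eventually_at using d1 d2 by (intro exI[of _ "min d1 d2"]) auto
    qed
  qed
  then have "uniformly_continuous_on ({0..T} \<times> {0..T}) q"
    by (rule compact_uniformly_continuous) (intro compact_Times compact_Icc)
  then obtain d where d: "d > 0" "\<And>w z. w \<in> {0..T} \<times> {0..T} \<Longrightarrow> z \<in> {0..T} \<times> {0..T} \<Longrightarrow> dist w z < d \<Longrightarrow> dist (q w) (q z) < e"
    using e unfolding uniformly_continuous_on_def by metis
  have "p (f s - f t) < e" if "s \<in> {0..T}" "t \<in> {0..T}" "\<bar>s - t\<bar> < d" for s t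
    using d(2)[of "(s, t)" "(t, t)"] that P_nonneg[OF p] P_zero[OF p]
    by (simp add: q_def dist_Pair_Pair dist_real_def)
  then show ?thesis using d(1) that by blast
qed

text \<open>Riemann sums form a bounded sequence that is Cauchy for each seminorm, so sequential
  completeness supplies the integral; its values under functionals are the scalar integrals.\<close>

lemma weak_integral_exists:
  assumes cont: "\<And>t p. t \<ge> 0 \<Longrightarrow> p \<in> P \<Longrightarrow> ((\<lambda>s. p (f s - f t)) \<longlongrightarrow> 0) (at t within {0..})"
    and b: "b \<ge> 0" and bound: "\<And>t. t \<ge> 0 \<Longrightarrow> norm (f t) \<le> c * exp (b * t)"
    and T: "T \<ge> 0"
  obtains I where "\<And>\<phi>. bi_functional \<phi> \<Longrightarrow> \<phi> I = integral {0..T} (\<lambda>t. \<phi> (f t))"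
proof -
  define u where "u n = (T / real (Suc n)) *\<^sub>R (\<Sum>k<Suc n. f (real k * T / real (Suc n)))" for n
  have c: "c \<ge> 0" using bound[of 0] norm_ge_zero[of "f 0"] by (simp del: norm_ge_zero)
  have ub: "norm (u n) \<le> T * (c * exp (b * T))" for n
  proof -
    have "norm (\<Sum>k<Suc n. f (real k * T / real (Suc n))) \<le> (\<Sum>k<Suc n. c * exp (b * T))"
    proof (rule sum_norm_le)
      fix k assume "k \<in> {..<Suc n}"
      then have "real k * T / real (Suc n) \<le> T" "real k * T / real (Suc n) \<ge> 0"
        using T mult_right_mono[of "real k" "real (Suc n)" T] by (auto simp: divide_le_eq mult.commute)
      moreover from this have "b * (real k * T / real (Suc n)) \<le> b * T"
        using b by (intro mult_left_mono) auto
      ultimately show "norm (f (real k * T / real (Suc n))) \<le> c * exp (b * T)"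
        using c by (intro order_trans[OF bound] mult_left_mono) auto
    qed
    then have "norm (u n) \<le> (T / real (Suc n)) * (real (Suc n) * (c * exp (b * T)))"
      unfolding u_def norm_scaleR using T by (intro mult_mono) auto
    also have "\<dots> = T * (c * exp (b * T))" by simp
    finally show ?thesis .
  qed
  have cont\<phi>: "continuous_on {0..T} (\<lambda>t. \<phi> (f t))" if "bi_functional \<phi>" for \<phi>
    by (rule continuous_on_subset[OF exp_growth_continuous[OF exp_growth_functional[OF that b cont bound]]]) auto
  have \<phi>u: "\<phi> (u n) = (T / real (Suc n)) * (\<Sum>k<Suc n. \<phi> (f (real k * T / real (Suc n))))"
    if "bi_functional \<phi>" for \<phi> n
  proof -
    interpret \<phi>: bounded_linear \<phi> using that by (rule bi_functional_linear)
    show ?thesis by (simp add: u_def \<phi>.scaleR \<phi>.sum \<phi>.add)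
  qed
  \<comment> \<open>The index \<open>N\<close> depends on \<open>p\<close> and \<open>e\<close> but
    not on the functional. This uniformity is what \<open>P_le_functional\<close> turns into the
    Cauchy property for \<open>p\<close>.\<close>
  have near: "\<exists>N. \<forall>n\<ge>N. \<forall>\<phi>. bi_functional \<phi> \<longrightarrow> (\<forall>y. \<bar>\<phi> y\<bar> \<le> p y) \<longrightarrow>
      \<bar>\<phi> (u n) - integral {0..T} (\<lambda>t. \<phi> (f t))\<bar> \<le> T * e" if p: "p \<in> P" and e: "e > 0" for p e
  proof -
    obtain d where d: "d > 0" "\<And>s t. s \<in> {0..T} \<Longrightarrow> t \<in> {0..T} \<Longrightarrow> \<bar>s - t\<bar> < d \<Longrightarrow> p (f s - f t) < e"
      using P_uniformly_continuous[OF cont[OF _ p] p e, of T] by blast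
    obtain N where N: "T / d < real N" using reals_Archimedean2 by blast
    have "\<bar>\<phi> (u n) - integral {0..T} (\<lambda>t. \<phi> (f t))\<bar> \<le> T * e"
      if n: "n \<ge> N" and \<phi>: "bi_functional \<phi>" "\<And>y. \<bar>\<phi> y\<bar> \<le> p y" for n \<phi>
    proof -
      interpret \<phi>: bounded_linear \<phi> using \<phi>(1) by (rule bi_functional_linear)
      have "T / d < real (Suc n)" using N n by simp
      then have Tn: "T / real (Suc n) < d" using d(1) by (simp add: field_simps)
      show ?thesis
        unfolding \<phi>u[OF \<phi>(1)]
      proof (rule Riemann_sum_bound[OF cont\<phi>[OF \<phi>(1)] T])
        fix s t assume st: "s \<in> {0..T}" "t \<in> {0..T}" "\<bar>s - t\<bar> \<le> T / real (Suc n)"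
        have "\<bar>\<phi> (f s - f t)\<bar> \<le> p (f s - f t)" by (rule \<phi>(2))
        also have "\<dots> < e" using st Tn by (intro d(2)) auto
        finally show "\<bar>\<phi> (f s) - \<phi> (f t)\<bar> \<le> e" by (simp add: \<phi>.diff)
      qed simp
    qed
    then show ?thesis by blast
  qed
  obtain I where I: "limitin \<tau> u I sequentially"
  proof (rule Cauchy_convergent)
    show "\<forall>\<^sub>F n in sequentially. norm (u n) \<le> T * (c * exp (b * T))" using ub by simp
    fix p and e :: real assume p: "p \<in> P" and e: "e > 0"
    define r where "r = e / (3 * (T + 1))"
    have T1: "T + 1 > 0" using T by simp
    have r0: "r > 0" unfolding r_def using e T1 by simp
    have "(T + 1) * r = e / 3" using T1 by (simp add: r_def field_simps)
    then have r: "r > 0" "2 * (T * r) < e" using r0 e by (auto simp: distrib_right)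
    obtain N where N: "\<And>n \<phi>. n \<ge> N \<Longrightarrow> bi_functional \<phi> \<Longrightarrow> (\<And>y. \<bar>\<phi> y\<bar> \<le> p y) \<Longrightarrow>
        \<bar>\<phi> (u n) - integral {0..T} (\<lambda>t. \<phi> (f t))\<bar> \<le> T * r"
      using near[OF p r(1)] by blast
    have "p (u m - u n) < e" if "m \<ge> N" "n \<ge> N" for m n
    proof -
      have "p (u m - u n) \<le> 2 * (T * r)"
      proof (rule P_le_functional[OF p])
        fix \<phi> assume \<phi>: "bi_functional \<phi>" "\<And>y. \<bar>\<phi> y\<bar> \<le> p y"
        have "\<phi> (u m - u n) = \<phi> (u m) - \<phi> (u n)"
          by (rule linear_diff[OF bounded_linear.linear[OF bi_functional_linear[OF \<phi>(1)]]])
        then show "\<bar>\<phi> (u m - u n)\<bar> \<le> 2 * (T * r)"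
          using N[OF that(1) \<phi>] N[OF that(2) \<phi>] by linarith
      qed
      then show ?thesis using r(2) by linarith
    qed
    then show "\<exists>N. \<forall>m\<ge>N. \<forall>n\<ge>N. p (u m - u n) < e" by blast
  qed
  have "\<phi> I = integral {0..T} (\<lambda>t. \<phi> (f t))" if \<phi>: "bi_functional \<phi>" for \<phi>
  proof (rule LIMSEQ_unique)
    show "(\<lambda>n. \<phi> (u n)) \<longlonglongrightarrow> \<phi> I"
      using ub by (intro bi_functional_tendsto[OF \<phi> _ I] boundedI[of _ "T * (c * exp (b * T))"]) auto
    show "(\<lambda>n. \<phi> (u n)) \<longlonglongrightarrow> integral {0..T} (\<lambda>t. \<phi> (f t))"
    proof (rule tendstoI)
      fix e :: real assume e: "e > 0"
      define r where "r = e / (2 * (T + 1))"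
      have T1: "T + 1 > 0" using T by simp
      have r0: "r > 0" unfolding r_def using e T1 by simp
      have "(T + 1) * r = e / 2" using T1 by (simp add: r_def field_simps)
      then have r: "r > 0" "T * r < e" using r0 e by (auto simp: distrib_right)
      \<comment> \<open>Here the functional is an arbitrary one, not necessarily below a seminorm,
        so the modulus of continuity comes from the scalar function itself.\<close>
      have "uniformly_continuous_on {0..T} (\<lambda>t. \<phi> (f t))"
        by (rule compact_uniformly_continuous[OF cont\<phi>[OF \<phi>] compact_Icc])
      then obtain d where d: "d > 0" "\<And>s t. s \<in> {0..T} \<Longrightarrow> t \<in> {0..T} \<Longrightarrow> dist s t < d \<Longrightarrow> dist (\<phi> (f s)) (\<phi> (f t)) < r"
        using r(1) unfolding uniformly_continuous_on_def by metis
      obtain N where N: "T / d < real N" using reals_Archimedean2 by blast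
      have "dist (\<phi> (u n)) (integral {0..T} (\<lambda>t. \<phi> (f t))) < e" if n: "n \<ge> N" for n
      proof -
        have "T / d < real (Suc n)" using N n by simp
        then have Tn: "T / real (Suc n) < d" using d(1) by (simp add: field_simps)
        have "\<bar>\<phi> (u n) - integral {0..T} (\<lambda>t. \<phi> (f t))\<bar> \<le> T * r"
          unfolding \<phi>u[OF \<phi>]
        proof (rule Riemann_sum_bound[OF cont\<phi>[OF \<phi>] T])
          fix s t assume st: "s \<in> {0..T}" "t \<in> {0..T}" "\<bar>s - t\<bar> \<le> T / real (Suc n)"
          then show "\<bar>\<phi> (f s) - \<phi> (f t)\<bar> \<le> r"
            using d(2)[OF st(1,2)] Tn by (simp add: dist_real_def)
        qed simp
        then show ?thesis using r(2) by (simp add: dist_real_def)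
      qed
      then show "\<forall>\<^sub>F n in sequentially. dist (\<phi> (u n)) (integral {0..T} (\<lambda>t. \<phi> (f t))) < e"
        unfolding eventually_sequentially by blast
    qed
  qed
  then show ?thesis by (rule that)
qed

text \<open>The integrals over \<open>[0, n]\<close> are even Cauchy in norm, because the tail is
  dominated by a convergent scalar integral; the norm estimate is read off functional by
  functional.\<close>

lemma weak_laplace_exists:
  assumes cont: "\<And>t p. t \<ge> 0 \<Longrightarrow> p \<in> P \<Longrightarrow> ((\<lambda>s. p (f s - f t)) \<longlongrightarrow> 0) (at t within {0..})"
    and b: "b \<ge> 0" and bound: "\<And>t. t \<ge> 0 \<Longrightarrow> norm (f t) \<le> c * exp (b * t)"
    and l: "l > b"
  obtains I where "\<And>\<phi>. bi_functional \<phi> \<Longrightarrow> \<phi> I = laplace (\<lambda>t. \<phi> (f t)) l"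
proof -
  define w where "w t = exp (- l * t) *\<^sub>R f t" for t
  have c: "c \<ge> 0" using bound[of 0] norm_ge_zero[of "f 0"] by (simp del: norm_ge_zero)
  have wb: "norm (w t) \<le> c * exp (- (l - b) * t)" if "t \<ge> 0" for t
  proof -
    have "norm (w t) \<le> exp (- l * t) * (c * exp (b * t))"
      unfolding w_def norm_scaleR using bound[OF that] by (intro mult_mono) auto
    also have "\<dots> = c * exp (- (l - b) * t)" by (simp add: exp_add[symmetric] algebra_simps)
    finally show ?thesis .
  qed
  \<comment> \<open>The existence lemma on compact intervals asks for a nonnegative exponent, so the
    decaying bound is relaxed to a constant.\<close>
  have wb0: "norm (w t) \<le> c * exp (0 * t)" if "t \<ge> 0" for t
  proof -
    have "c * exp (- (l - b) * t) \<le> c * exp (0 * t)"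
      using l that c by (intro mult_left_mono) (auto simp: mult_le_0_iff)
    then show ?thesis using wb[OF that] by linarith
  qed
  have wcont: "((\<lambda>s. p (w s - w t)) \<longlongrightarrow> 0) (at t within {0..})" if t: "t \<ge> 0" and p: "p \<in> P" for t p
  proof (rule Lim_null_comparison)
    show "\<forall>\<^sub>F s in at t within {0..}. norm (p (w s - w t)) \<le>
        exp (- l * s) * p (f s - f t) + \<bar>exp (- l * s) - exp (- l * t)\<bar> * p (f t)"
    proof (intro always_eventually allI)
      fix s
      have "w s - w t = exp (- l * s) *\<^sub>R (f s - f t) + (exp (- l * s) - exp (- l * t)) *\<^sub>R f t"
        by (simp add: w_def scaleR_diff_right scaleR_diff_left)
      then show "norm (p (w s - w t)) \<le>
        exp (- l * s) * p (f s - f t) + \<bar>exp (- l * s) - exp (- l * t)\<bar> * p (f t)"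
        using P_triangle[OF p, of "exp (- l * s) *\<^sub>R (f s - f t)" "(exp (- l * s) - exp (- l * t)) *\<^sub>R f t"]
          P_nonneg[OF p] by (simp add: P_scaleR[OF p])
    qed
    have "((\<lambda>s. exp (- l * s) * p (f s - f t) + \<bar>exp (- l * s) - exp (- l * t)\<bar> * p (f t)) \<longlongrightarrow>
        exp (- l * t) * 0 + \<bar>exp (- l * t) - exp (- l * t)\<bar> * p (f t)) (at t within {0..})"
      by (intro tendsto_intros cont t p)
    then show "((\<lambda>s. exp (- l * s) * p (f s - f t) + \<bar>exp (- l * s) - exp (- l * t)\<bar> * p (f t)) \<longlongrightarrow> 0) (at t within {0..})"
      by simp
  qed
  have "\<exists>I. \<forall>\<phi>. bi_functional \<phi> \<longrightarrow> \<phi> I = integral {0..real n} (\<lambda>t. \<phi> (w t))" for n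
    using weak_integral_exists[of w 0 c "real n", OF wcont _ wb0] by (metis of_nat_0_le_iff order_refl)
  then obtain u where u: "\<And>n \<phi>. bi_functional \<phi> \<Longrightarrow> \<phi> (u n) = integral {0..real n} (\<lambda>t. \<phi> (w t))" by metis
  have \<phi>int: "set_integrable lborel {0..} (\<lambda>t. \<phi> (w t))"
    and \<phi>lim: "(\<lambda>n. \<phi> (u n)) \<longlonglongrightarrow> laplace (\<lambda>t. \<phi> (f t)) l"
    and \<phi>loc: "\<And>m n. (\<lambda>t. \<phi> (w t)) integrable_on {real m..n}"
    if \<phi>: "bi_functional \<phi>" for \<phi>
  proof -
    have eq: "\<phi> (w t) = exp (- l * t) * \<phi> (f t)" for t
      unfolding w_def by (simp add: linear_scale[OF bounded_linear.linear[OF bi_functional_linear[OF \<phi>]]])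
    show int: "set_integrable lborel {0..} (\<lambda>t. \<phi> (w t))"
      unfolding eq by (rule laplace_integrable[OF exp_growth_functional[OF \<phi> b cont bound] l])
    have sub: "set_integrable lborel {0..real n} (\<lambda>t. \<phi> (w t))" for n
      by (rule set_integrable_subset[OF int]) auto
    show "(\<lambda>t. \<phi> (w t)) integrable_on {real m..n}" for m n
      by (rule set_borel_integral_eq_integral, rule set_integrable_subset[OF int]) auto
    have "((\<lambda>T. LINT t:{0..T}|lborel. \<phi> (w t)) \<longlongrightarrow> laplace (\<lambda>t. \<phi> (f t)) l) at_top"
      unfolding laplace_def eq[symmetric] by (rule tendsto_set_lebesgue_integral_at_top[OF _ int]) simp
    from filterlim_compose[OF this filterlim_real_sequentially]
    show "(\<lambda>n. \<phi> (u n)) \<longlonglongrightarrow> laplace (\<lambda>t. \<phi> (f t)) l"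
      unfolding u[OF \<phi>] set_borel_integral_eq_integral(2)[OF sub] .
  qed
  \<comment> \<open>The integral of the majorant \<open>c * exp (- (l - b) * t)\<close> over
    \<open>[0, n]\<close>.\<close>
  define H where "H n = c / (l - b) * (1 - exp (- (l - b) * real n))" for n
  have gen: "((\<lambda>t. - c / r * exp (- r * t)) has_real_derivative c * exp (- r * t)) (at t within X)"
    if "r \<noteq> 0" for r t and X :: "real set"
    using that by (auto intro!: derivative_eq_intros)
  have Hint: "((\<lambda>t. c * exp (- (l - b) * t)) has_integral H n - H m) {real m..real n}" if "m \<le> n" for m n
  proof -
    have "((\<lambda>t. c * exp (- (l - b) * t)) has_integral
        (- c / (l - b) * exp (- (l - b) * real n)) - (- c / (l - b) * exp (- (l - b) * real m))) {real m..real n}"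
    proof (rule fundamental_theorem_of_calculus)
      fix t
      have "((\<lambda>t. - c / (l - b) * exp (- (l - b) * t)) has_real_derivative c * exp (- (l - b) * t)) (at t within {real m..real n})"
        by (rule gen) (use l in simp)
      then show "((\<lambda>t. - c / (l - b) * exp (- (l - b) * t)) has_vector_derivative c * exp (- (l - b) * t)) (at t within {real m..real n})"
        by (simp only: has_real_derivative_iff_has_vector_derivative)
    qed (use that in simp)
    then show ?thesis by (simp add: H_def algebra_simps)
  qed
  have diff: "\<bar>\<phi> (u n) - \<phi> (u m)\<bar> \<le> H n - H m"
    if \<phi>: "bi_functional \<phi>" "\<And>y. \<bar>\<phi> y\<bar> \<le> norm y" and mn: "m \<le> n" for \<phi> m n
  proof -
    have "integral {0..real n} (\<lambda>t. \<phi> (w t)) = integral {0..real m} (\<lambda>t. \<phi> (w t)) + integral {real m..real n} (\<lambda>t. \<phi> (w t))"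
      using mn \<phi>loc[OF \<phi>(1), of 0 "real n"]
      by (intro Henstock_Kurzweil_Integration.integral_combine[symmetric]) auto
    then have "\<phi> (u n) - \<phi> (u m) = integral {real m..real n} (\<lambda>t. \<phi> (w t))"
      by (simp add: u[OF \<phi>(1)])
    also have "norm \<dots> \<le> integral {real m..real n} (\<lambda>t. c * exp (- (l - b) * t))"
    proof (rule integral_norm_bound_integral)
      show "(\<lambda>t. c * exp (- (l - b) * t)) integrable_on {real m..real n}" using Hint[OF mn] by blast
      fix t assume "t \<in> {real m..real n}"
      then have "t \<ge> 0" by (simp add: order_trans[of 0 "real m"])
      then show "norm (\<phi> (w t)) \<le> c * exp (- (l - b) * t)" using \<phi>(2)[of "w t"] wb by fastforce
    qed (rule \<phi>loc[OF \<phi>(1)])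
    also have "\<dots> = H n - H m" using Hint[OF mn] by (rule integral_unique)
    finally show ?thesis by simp
  qed
  have le: "norm (u n - u m) \<le> H n - H m" if "m \<le> n" for m n
  proof (rule norm_le_functional)
    fix \<phi> assume \<phi>: "bi_functional \<phi>" "\<And>y. \<bar>\<phi> y\<bar> \<le> norm y"
    show "\<bar>\<phi> (u n - u m)\<bar> \<le> H n - H m"
      using diff[OF \<phi> that] by (simp add: linear_diff[OF bounded_linear.linear[OF bi_functional_linear[OF \<phi>(1)]]])
  qed
  have u0: "u 0 = 0"
    by (rule bi_functional_eqI) (simp add: u linear_0[OF bounded_linear.linear[OF bi_functional_linear]])
  have H0: "H 0 = 0" by (simp add: H_def)
  have Hle: "H n \<le> c / (l - b)" for n
  proof -
    have "H n \<le> c / (l - b) * 1"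
      unfolding H_def using l c by (intro mult_left_mono) auto
    then show ?thesis by simp
  qed
  have ub: "norm (u n) \<le> c / (l - b)" for n
    using le[of 0 n] Hle[of n] by (simp add: u0 H0)
  have Hlim: "H \<longlonglongrightarrow> c / (l - b)"
  proof -
    have "(\<lambda>n. exp (- (l - b) * real n)) \<longlonglongrightarrow> 0"
      using l by real_asymp
    then have "H \<longlonglongrightarrow> c / (l - b) * (1 - 0)" unfolding H_def by (intro tendsto_intros)
    then show ?thesis by simp
  qed
  obtain I where I: "limitin \<tau> u I sequentially"
  proof (rule Cauchy_convergent)
    show "\<forall>\<^sub>F n in sequentially. norm (u n) \<le> c / (l - b)" using ub by simp
    fix p and e :: real assume p: "p \<in> P" and e: "e > 0"
    obtain N where N: "\<And>m n. m \<ge> N \<Longrightarrow> n \<ge> N \<Longrightarrow> \<bar>H m - H n\<bar> < e"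
      using LIMSEQ_imp_Cauchy[OF Hlim] e unfolding Cauchy_def dist_real_def by metis
    have "p (u m - u n) < e" if mn: "m \<ge> N" "n \<ge> N" for m n
    proof -
      have "norm (u m - u n) \<le> \<bar>H m - H n\<bar>"
        using le[of m n] le[of n m] by (cases m n rule: le_cases) (auto simp: norm_minus_commute)
      then show ?thesis using N[OF mn] P_le_norm[OF p, of "u m - u n"] by linarith
    qed
    then show "\<exists>N. \<forall>m\<ge>N. \<forall>n\<ge>N. p (u m - u n) < e" by blast
  qed
  have "\<phi> I = laplace (\<lambda>t. \<phi> (f t)) l" if \<phi>: "bi_functional \<phi>" for \<phi>
  proof (rule LIMSEQ_unique[OF bi_functional_tendsto[OF \<phi> _ I] \<phi>lim[OF \<phi>]])
    show "bounded (range u)" using ub by (intro boundedI[of _ "c / (l - b)"]) auto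
  qed
  then show ?thesis by (rule that)
qed

end

section \<open>Estimates for the hyperbolic kernels\<close>

lemma sinh_integral_bound:
  fixes g :: "real \<Rightarrow> real"
  assumes g: "continuous_on {0..} g" and h: "h \<ge> 0" and l: "l > 0"
    and le: "\<And>t. 0 \<le> t \<Longrightarrow> t \<le> h \<Longrightarrow> \<bar>g t - g0\<bar> \<le> e"
  shows "\<bar>(LINT t:{0..h}|lborel. sinh (l * (h - t)) * g t) - (cosh (l * h) - 1) / l * g0\<bar> \<le> (cosh (l * h) - 1) / l * e"
proof -
  define q where "q t = sinh (l * (h - t)) * g t" for t
  have cont: "continuous_on {0..h} q"
    unfolding q_def by (intro continuous_intros continuous_on_subset[OF g]) auto
  have "(LINT t:{0..h}|lborel. q t) = integral {0..h} q"
    by (rule set_borel_integral_eq_integral(2)[OF borel_integrable_atLeastAtMost'[OF cont]])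
  then have int: "(q has_integral (LINT t:{0..h}|lborel. q t)) {0..h}"
    using integrable_continuous_interval[OF cont] by (simp add: has_integral_integral)
  have c: "((\<lambda>t. sinh (l * (h - t)) * c) has_integral (cosh (l * h) - 1) / l * c) {0..h}" for c
  proof -
    have "((\<lambda>t. sinh (l * (h - t)) * c) has_integral
        (- cosh (l * (h - h)) / l * c) - (- cosh (l * (h - 0)) / l * c)) {0..h}"
    proof (rule fundamental_theorem_of_calculus[OF h])
      fix t
      have "((\<lambda>t. - cosh (l * (h - t)) / l * c) has_real_derivative sinh (l * (h - t)) * c) (at t within {0..h})"
        using l by (auto intro!: derivative_eq_intros)
      then show "((\<lambda>t. - cosh (l * (h - t)) / l * c) has_vector_derivative sinh (l * (h - t)) * c) (at t within {0..h})"
        by (simp only: has_real_derivative_iff_has_vector_derivative)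
    qed
    then show ?thesis by (simp add: diff_divide_distrib left_diff_distrib)
  qed
  have sinh: "sinh (l * (h - t)) \<ge> 0" if "t \<in> {0..h}" for t
    using that l by simp
  have "(LINT t:{0..h}|lborel. q t) \<le> (cosh (l * h) - 1) / l * (g0 + e)"
  proof (rule has_integral_le[OF int c])
    fix t assume "t \<in> {0..h}"
    then show "q t \<le> sinh (l * (h - t)) * (g0 + e)"
      unfolding q_def using le[of t] sinh[of t] by (intro mult_left_mono) auto
  qed
  moreover have "(cosh (l * h) - 1) / l * (g0 - e) \<le> (LINT t:{0..h}|lborel. q t)"
  proof (rule has_integral_le[OF c int])
    fix t assume "t \<in> {0..h}"
    then show "sinh (l * (h - t)) * (g0 - e) \<le> q t"
      unfolding q_def using le[of t] sinh[of t] by (intro mult_left_mono) auto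
  qed
  ultimately show ?thesis
    unfolding q_def abs_le_iff by (simp only: distrib_left right_diff_distrib) linarith
qed

lemma cosh_quotient_tendsto:
  assumes l: "l > 0"
  shows "((\<lambda>h. (2 * cosh (l * h) - 2) / h\<^sup>2) \<longlongrightarrow> l\<^sup>2) (at_right (0::real))"
proof -
  have "((\<lambda>h. (2 * cosh (l * h) - 2) / h\<^sup>2) \<longlongrightarrow> l * l) (at_right (0::real))"
    using l by real_asymp
  then show ?thesis by (simp only: power2_eq_square)
qed

text \<open>Taylor's formula writes \<open>cosh (l * h) - 1\<close> as the integral of
  \<open>(h - s) * (l\<^sup>2 * cosh (l * s))\<close>, and \<open>s \<le> h \<le> 1\<close>. This
  uniform bound serves the norm condition in the domain of the bi-generator, where a limit at
  \<open>0\<close> is not enough.\<close>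

lemma cosh_quotient_le:
  assumes l: "l > 0" and h: "0 < h" "h \<le> (1::real)"
  shows "0 \<le> (2 * cosh (l * h) - 2) / h\<^sup>2" "(2 * cosh (l * h) - 2) / h\<^sup>2 \<le> l\<^sup>2 * cosh l"
proof -
  show "0 \<le> (2 * cosh (l * h) - 2) / h\<^sup>2" using cosh_real_ge_1[of "l * h"] by simp
  have "((\<lambda>s. (h - s) * (l\<^sup>2 * cosh (l * s))) has_integral
      ((h - h) * (l * sinh (l * h)) + cosh (l * h)) - ((h - 0) * (l * sinh (l * 0)) + cosh (l * 0))) {0..h}"
  proof (rule fundamental_theorem_of_calculus)
    fix s
    have "((\<lambda>s. (h - s) * (l * sinh (l * s)) + cosh (l * s)) has_real_derivative (h - s) * (l\<^sup>2 * cosh (l * s))) (at s within {0..h})"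
      by (rule derivative_eq_intros refl)+ (simp add: power2_eq_square algebra_simps)
    then show "((\<lambda>s. (h - s) * (l * sinh (l * s)) + cosh (l * s)) has_vector_derivative (h - s) * (l\<^sup>2 * cosh (l * s))) (at s within {0..h})"
      by (simp only: has_real_derivative_iff_has_vector_derivative)
  qed (use h in simp)
  then have "\<bar>(cosh (l * h) - 1) - h\<^sup>2 / 2 * 0\<bar> \<le> h\<^sup>2 / 2 * (l\<^sup>2 * cosh l)"
  proof (intro weighted_integral_bound)
    fix s assume "0 \<le> s" "s \<le> h"
    then have "cosh (l * s) \<le> cosh l" using l h by (subst cosh_real_nonneg_le_iff) (auto simp: mult_left_le)
    then show "\<bar>l\<^sup>2 * cosh (l * s) - 0\<bar> \<le> l\<^sup>2 * cosh l"
      using cosh_real_pos[of "l * s"] by (simp add: abs_mult mult_left_mono)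
  qed (use h in auto)
  then have "cosh (l * h) - 1 \<le> h\<^sup>2 / 2 * (l\<^sup>2 * cosh l)" unfolding abs_le_iff by simp
  then have "2 * cosh (l * h) - 2 \<le> l\<^sup>2 * cosh l * h\<^sup>2" by (simp add: mult_ac)
  then show "(2 * cosh (l * h) - 2) / h\<^sup>2 \<le> l\<^sup>2 * cosh l" using h by (simp add: divide_le_eq)
qed

section \<open>The resolvent of the bi-generator\<close>

locale bi_cosine_family = saks_seminorms scl \<tau> P
  for scl :: "'k::{real_normed_field,euclidean_space} \<Rightarrow> 'a::real_normed_vector \<Rightarrow> 'a"
    and \<tau> :: "'a topology" and P :: "('a \<Rightarrow> real) set" +
  fixes S :: "real \<Rightarrow> 'a \<Rightarrow> 'a" and D :: "'a set" and A :: "'a \<Rightarrow> 'a" and \<omega> M :: real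
  assumes cosine: "cosine_family scl S"
    and bi_continuous: "locally_bi_continuous scl \<tau> S"
    and generator: "is_bi_generator \<tau> S D A"
    and onorm_S: "t \<ge> 0 \<Longrightarrow> onorm (S t) \<le> M * exp (\<omega> * t)"
    and linop: "linear_operator scl D A"
    and \<omega>_nonneg: "\<omega> \<ge> 0" and M: "M \<ge> 1"
begin

section \<open>Growth, equicontinuity and commutation of the given family\<close>

lemma S_0: "S 0 x = x"
  using cosine by (simp add: cosine_family_def)

lemma S_bounded_linear: "t \<ge> 0 \<Longrightarrow> bounded_linear (S t)"
  using bi_continuous by (auto simp: locally_bi_continuous_def bounded_operators_def)

lemma S_scl: "t \<ge> 0 \<Longrightarrow> S t (scl c x) = scl c (S t x)"
proof -
  assume "t \<ge> 0"
  then interpret Vector_Spaces.linear scl scl "S t" using cosine by (simp add: cosine_family_def)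
  show ?thesis by (rule scale)
qed

lemma S_law: "0 \<le> s \<Longrightarrow> s \<le> t \<Longrightarrow> 2 *\<^sub>R S t (S s x) = S (t + s) x + S (t - s) x"
  using cosine by (simp add: cosine_family_def)

lemma norm_S_le:
  assumes "t \<ge> 0"
  shows "norm (S t x) \<le> M * exp (\<omega> * t) * norm x"
  using order_trans[OF onorm[OF S_bounded_linear[OF assms], of x] mult_right_mono[OF onorm_S[OF assms]]]
  by simp

lemma norm_S_le': "t \<ge> 0 \<Longrightarrow> norm (S t x) \<le> (M * norm x) * exp (\<omega> * t)"
  using norm_S_le[of t x] by (simp add: mult_ac)

lemma S_continuous: "t \<ge> 0 \<Longrightarrow> p \<in> P \<Longrightarrow> ((\<lambda>s. p (S s x - S t x)) \<longlongrightarrow> 0) (at t within {0..})"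
proof -
  have "continuous_map (top_of_set {0..}) \<tau> (\<lambda>t. S t x)"
    using bi_continuous by (simp add: locally_bi_continuous_def)
  then show "t \<ge> 0 \<Longrightarrow> p \<in> P \<Longrightarrow> ((\<lambda>s. p (S s x - S t x)) \<longlongrightarrow> 0) (at t within {0..})"
    unfolding continuous_map_\<tau>_iff by simp
qed

lemma S_equicontinuous_compact:
  assumes "compact N" "N \<subseteq> {0..}"
  shows "bi_equicontinuous \<tau> N S"
  using bi_continuous assms by (simp add: locally_bi_continuous_def)

text \<open>Local equicontinuity becomes global with an exponential weight. Up to a time
  \<open>T\<close> the compact interval is used; afterwards the norm bound
  \<open>M * C * exp (\<omega> * t)\<close> is already below \<open>e * exp (\<alpha> * t)\<close>
  because \<alpha> exceeds \<omega>.\<close>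

lemma S_equicontinuous:
  assumes u: "bounded (range u)" "limitin \<tau> u x sequentially" and p: "p \<in> P" and e: "e > 0" and \<alpha>: "\<alpha> > \<omega>"
  obtains N where "\<And>i t. i \<ge> N \<Longrightarrow> t \<ge> 0 \<Longrightarrow> p (S t (u i - x)) \<le> e * exp (\<alpha> * t)"
proof -
  obtain B where B: "\<And>i. norm (u i) \<le> B" using u(1) by (auto simp: bounded_iff)
  define C where "C = B + norm x + 1"
  have B0: "B \<ge> 0" using B[of 0] norm_ge_zero[of "u 0"] by linarith
  have C: "C > 0" "norm (u i - x) \<le> C" for i
    using B0 B[of i] norm_triangle_ineq4[of "u i" x] norm_ge_zero[of x] by (auto simp: C_def simp del: norm_ge_zero)
  define T where "T = max 0 (ln (M * C / e) / (\<alpha> - \<omega>))"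
  have late: "M * C \<le> e * exp ((\<alpha> - \<omega>) * t)" if t: "t > T" for t
  proof -
    have MC: "M * C / e > 0" using M C(1) e by simp
    have "ln (M * C / e) / (\<alpha> - \<omega>) < t" using t by (simp add: T_def)
    then have "ln (M * C / e) \<le> (\<alpha> - \<omega>) * t" using \<alpha> by (simp add: divide_less_eq mult.commute)
    then have "exp (ln (M * C / e)) \<le> exp ((\<alpha> - \<omega>) * t)" by simp
    then have "M * C / e \<le> exp ((\<alpha> - \<omega>) * t)" unfolding exp_ln[OF MC] .
    then show ?thesis using e by (simp add: divide_le_eq mult.commute)
  qed
  obtain N where N: "\<And>n t. n \<ge> N \<Longrightarrow> t \<in> {0..T} \<Longrightarrow> p (S t (u n - x)) < e"
    using bi_equicontinuousD[OF S_equicontinuous_compact[of "{0..T}"] u p e] by auto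
  have "p (S t (u i - x)) \<le> e * exp (\<alpha> * t)" if i: "i \<ge> N" and t: "t \<ge> 0" for i t
  proof (cases "t \<le> T")
    case True
    have "0 \<le> \<alpha> * t" using \<alpha> \<omega>_nonneg t by simp
    then have "e * 1 \<le> e * exp (\<alpha> * t)" using e by (intro mult_left_mono) auto
    then show ?thesis using N[OF i, of t] True t by simp
  next
    case False
    have "p (S t (u i - x)) \<le> norm (S t (u i - x))" by (rule P_le_norm[OF p])
    also have "\<dots> \<le> M * exp (\<omega> * t) * norm (u i - x)" by (rule norm_S_le[OF t])
    also have "\<dots> \<le> M * exp (\<omega> * t) * C" using M C(2) by (intro mult_left_mono) auto
    also have "\<dots> = (M * C) * exp (\<omega> * t)" by simp
    also have "\<dots> \<le> (e * exp ((\<alpha> - \<omega>) * t)) * exp (\<omega> * t)"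
      using late[of t] False by (intro mult_right_mono) auto
    also have "\<dots> = e * exp (\<alpha> * t)" by (simp add: exp_add[symmetric] algebra_simps)
    finally show ?thesis .
  qed
  then show ?thesis by (rule that)
qed

lemma bi_operator_S: "t \<ge> 0 \<Longrightarrow> bi_operator (S t)"
  unfolding bi_operator_def
proof (intro conjI allI impI)
  assume t: "t \<ge> 0"
  show bl: "bounded_linear (S t)" by (rule S_bounded_linear[OF t])
  fix u x assume u: "bounded (range u) \<and> limitin \<tau> u x sequentially"
  show "limitin \<tau> (\<lambda>n. S t (u n)) (S t x) sequentially"
    unfolding limitin_iff
  proof (intro ballI tendstoI)
    fix p and e :: real assume p: "p \<in> P" and e: "e > 0"
    obtain N where N: "\<And>n s. n \<ge> N \<Longrightarrow> s \<in> {t} \<Longrightarrow> p (S s (u n - x)) < e"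
      using bi_equicontinuousD[OF S_equicontinuous_compact[of "{t}"] _ _ p e, of u x] u t by auto
    have "dist (p (S t (u n) - S t x)) 0 < e" if "n \<ge> N" for n
      using N[OF that, of t] P_nonneg[OF p] linear_diff[OF bounded_linear.linear[OF bl], of "u n" x] by simp
    then show "\<forall>\<^sub>F n in sequentially. dist (p (S t (u n) - S t x)) 0 < e"
      unfolding eventually_sequentially by blast
  qed
qed

text \<open>The cosine law gives the recursion
  \<open>S ((n + 2) h) = 2 S ((n + 1) h) S h - S (n h)\<close>, so commuting with \<open>S h\<close>
  propagates to all multiples of \<open>h\<close>.\<close>

lemma commute_multiples:
  assumes h: "h \<ge> 0" and T: "linear T" and comm: "\<And>x. T (S h x) = S h (T x)"
  shows "T (S (real n * h) x) = S (real n * h) (T x)"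
proof (induction n arbitrary: x rule: induct_nat_012)
  case 0
  show ?case by (simp add: S_0)
next
  case 1
  show ?case using comm by simp
next
  case (ge2 n)
  have step: "S (real (Suc (Suc n)) * h) y = 2 *\<^sub>R S (real (Suc n) * h) (S h y) - S (real n * h) y" for y
  proof -
    have "h \<le> real (Suc n) * h" using h by (simp add: distrib_right)
    from S_law[OF h this, of y] show ?thesis by (simp add: algebra_simps)
  qed
  show ?case
    unfolding step linear_diff[OF T] linear_scale[OF T] ge2 comm ..
qed

text \<open>The law is assumed only for \<open>s \<le> t\<close> and fixes only the product
  \<open>S t (S s x)\<close>, so commutation has to be proved. It holds for commensurable times by
  the recursion, and continuity extends it.\<close>

lemma S_commute:
  assumes s: "s \<ge> 0" and t: "t \<ge> 0"
  shows "S s (S t x) = S t (S s x)"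
proof (cases "s = 0")
  case True
  then show ?thesis by (simp add: S_0)
next
  case False
  then have s0: "s > 0" using s by simp
  \<comment> \<open>The step divides \<open>s\<close> exactly, and \<open>r k\<close> is the largest
    multiple of it not exceeding \<open>t\<close>. Multiples commute with \<open>S h\<close>,
    therefore \<open>S s\<close> does, therefore \<open>S s\<close> commutes with
    \<open>S (r k)\<close>.\<close>
  define h where "h k = s / real (Suc k)" for k
  define n where "n k = nat \<lfloor>t / h k\<rfloor>" for k
  define r where "r k = real (n k) * h k" for k
  have h: "h k > 0" "s = real (Suc k) * h k" for k using s0 by (auto simp: h_def)
  have comm: "S s (S (r k) y) = S (r k) (S s y)" for k y
  proof -
    have lin: "linear (S (h k))" for k
      by (rule bounded_linear.linear[OF S_bounded_linear]) (use h less_imp_le in blast)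
    have "S (h k) (S (real (Suc k) * h k) y) = S (real (Suc k) * h k) (S (h k) y)" for y
      by (rule commute_multiples[OF less_imp_le[OF h(1)] lin refl])
    then have "S s (S (h k) y) = S (h k) (S s y)" for y
      using h(2)[of k] by simp
    then show ?thesis
      unfolding r_def by (rule commute_multiples[OF less_imp_le[OF h(1)] bounded_linear.linear[OF S_bounded_linear[OF s]]])
  qed
  have r: "0 \<le> r k" "r k \<le> t" "t - h k \<le> r k" for k
  proof -
    have th: "t / h k \<ge> 0" using t h(1)[of k] by simp
    then have nr: "real (n k) = of_int \<lfloor>t / h k\<rfloor>" by (simp add: n_def)
    have "real (n k) \<le> t / h k" "t / h k \<le> real (n k) + 1" unfolding nr by linarith+
    then show "r k \<le> t" "t - h k \<le> r k" using h(1)[of k] by (auto simp: r_def field_simps)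
    show "0 \<le> r k" using h(1)[of k] by (simp add: r_def)
  qed
  have "h \<longlonglongrightarrow> 0"
    unfolding h_def using LIMSEQ_inverse_real_of_nat by (auto simp: divide_inverse intro: tendsto_mult_right_zero)
  then have "(\<lambda>k. t - h k) \<longlonglongrightarrow> t - 0" by (intro tendsto_intros)
  then have "r \<longlonglongrightarrow> t"
    using r by (intro tendsto_sandwich[of "\<lambda>k. t - h k" r sequentially "\<lambda>_. t" t]) auto
  have lim: "limitin \<tau> (\<lambda>k. S (r k) y) (S t y) sequentially" for y
    unfolding limitin_iff
  proof
    fix p assume p: "p \<in> P"
    have "((\<lambda>q. p (S q y - S t y)) \<longlongrightarrow> p (S t y - S t y)) (at t within {0..})"
      using S_continuous[OF t p, of y] P_zero[OF p] by simp
    then have "continuous (at t within {0..}) (\<lambda>q. p (S q y - S t y))"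
      by (simp add: continuous_within)
    then have "(\<lambda>k. p (S (r k) y - S t y)) \<longlonglongrightarrow> p (S t y - S t y)"
      using \<open>r \<longlonglongrightarrow> t\<close> r(1) unfolding continuous_within_sequentially comp_def by auto
    then show "(\<lambda>k. p (S (r k) y - S t y)) \<longlonglongrightarrow> 0" using P_zero[OF p] by simp
  qed
  have bdd: "bounded (range (\<lambda>k. S (r k) x))"
  proof (rule boundedI)
    fix z assume "z \<in> range (\<lambda>k. S (r k) x)"
    then obtain k where z: "z = S (r k) x" by blast
    have "norm z \<le> (M * norm x) * exp (\<omega> * r k)" unfolding z by (rule norm_S_le'[OF r(1)])
    also have "\<dots> \<le> (M * norm x) * exp (\<omega> * t)"
      using M \<omega>_nonneg r(2)[of k] by (intro mult_left_mono) (auto intro: mult_left_mono)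
    finally show "norm z \<le> (M * norm x) * exp (\<omega> * t)" .
  qed
  have "limitin \<tau> (\<lambda>k. S s (S (r k) x)) (S s (S t x)) sequentially"
    by (rule bi_operator_limitin[OF bi_operator_S[OF s] bdd lim])
  then show ?thesis
    unfolding comm by (rule limitin_unique[OF _ lim sequentially_bot])
qed

lemma S_cosine:
  assumes h: "h \<ge> 0" and t: "t \<ge> 0"
  shows "2 *\<^sub>R S h (S t x) = S (t + h) x + S \<bar>t - h\<bar> x"
proof (cases "h \<le> t")
  case True
  then show ?thesis using S_law[OF h True, of x] S_commute[OF h t, of x] by simp
next
  case False
  then show ?thesis using S_law[OF t, of h x] by (simp add: add.commute abs_minus_commute)
qed

lemma exp_growth_S:
  assumes "bi_functional \<phi>"
  shows "exp_growth \<omega> (\<lambda>t. \<phi> (S t x))"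
  by (rule exp_growth_functional[OF assms \<omega>_nonneg S_continuous norm_S_le'])

lemma domain_scaleR: "x \<in> D \<Longrightarrow> r *\<^sub>R x \<in> D"
  and generator_scaleR: "x \<in> D \<Longrightarrow> A (r *\<^sub>R x) = r *\<^sub>R A x"
proof -
  have "scl (of_real r) x \<in> D" "A (scl (of_real r) x) = scl (of_real r) (A x)" if "x \<in> D" for x
    using linop that by (auto simp: linear_operator_def subspace_def)
  then show "x \<in> D \<Longrightarrow> r *\<^sub>R x \<in> D" "x \<in> D \<Longrightarrow> A (r *\<^sub>R x) = r *\<^sub>R A x"
    by (simp_all add: scl_of_real)
qed

text \<open>The weak integral of \<open>exp (- l * t) *\<^sub>R S t x\<close> over \<open>[0, \<infinity>)\<close>; it turns out to be \<open>l * R (l\<^sup>2) x\<close>.\<close>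

definition F :: "real \<Rightarrow> 'a \<Rightarrow> 'a"
  where "F l x = (SOME I. \<forall>\<phi>. bi_functional \<phi> \<longrightarrow> \<phi> I = laplace (\<lambda>t. \<phi> (S t x)) l)"

context
  fixes l assumes l: "l > \<omega>"
begin

lemma l_pos: "l > 0" using l \<omega>_nonneg by simp

lemma F_weak:
  assumes "bi_functional \<phi>"
  shows "\<phi> (F l x) = laplace (\<lambda>t. \<phi> (S t x)) l"
proof -
  obtain I where "\<And>\<phi>. bi_functional \<phi> \<Longrightarrow> \<phi> I = laplace (\<lambda>t. \<phi> (S t x)) l"
    using weak_laplace_exists[OF S_continuous \<omega>_nonneg norm_S_le' l, of x] by blast
  then have "\<forall>\<phi>. bi_functional \<phi> \<longrightarrow> \<phi> (F l x) = laplace (\<lambda>t. \<phi> (S t x)) l"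
    unfolding F_def by (intro someI_ex[of "\<lambda>I. \<forall>\<phi>. bi_functional \<phi> \<longrightarrow> \<phi> I = laplace (\<lambda>t. \<phi> (S t x)) l"]) blast
  then show ?thesis using assms by blast
qed

lemma F_add: "F l (x + y) = F l x + F l y"
proof (rule bi_functional_eqI)
  fix \<phi> assume \<phi>: "bi_functional \<phi>"
  interpret \<phi>: bounded_linear \<phi> using \<phi> by (rule bi_functional_linear)
  have "laplace (\<lambda>t. \<phi> (S t (x + y))) l = laplace (\<lambda>t. \<phi> (S t x) + \<phi> (S t y)) l"
    by (rule laplace_cong) (simp add: linear_add[OF bounded_linear.linear[OF S_bounded_linear]] \<phi>.add)
  then show "\<phi> (F l (x + y)) = \<phi> (F l x + F l y)"
    by (simp add: F_weak[OF \<phi>] \<phi>.add laplace_add[OF exp_growth_S[OF \<phi>] exp_growth_S[OF \<phi>] l])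
qed

lemma F_scl: "F l (scl c x) = scl c (F l x)"
proof (rule bi_functional_eqI)
  fix \<phi> assume \<phi>: "bi_functional \<phi>"
  have "laplace (\<lambda>t. \<phi> (S t (scl c x))) l = laplace (\<lambda>t. \<phi> (scl c (S t x))) l"
    by (rule laplace_cong) (simp add: S_scl)
  then show "\<phi> (F l (scl c x)) = \<phi> (scl c (F l x))"
    by (simp add: F_weak[OF \<phi>] F_weak[OF bi_functional_compose[OF \<phi> bi_operator_scl]])
qed

lemma F_scaleR: "F l (r *\<^sub>R x) = r *\<^sub>R F l x"
  using F_scl[of "of_real r" x] by (simp add: scl_of_real)

lemma norm_F_le: "norm (F l x) \<le> M / (l - \<omega>) * norm x"
proof (rule norm_le_functional)
  fix \<phi> assume \<phi>: "bi_functional \<phi>" and le: "\<And>y. \<bar>\<phi> y\<bar> \<le> norm y"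
  have "\<bar>\<phi> (F l x)\<bar> \<le> laplace (\<lambda>t. (M * norm x) * exp (\<omega> * t)) l"
    unfolding F_weak[OF \<phi>]
    by (rule laplace_abs_le[OF exp_growth_S[OF \<phi>] exp_growth_cmult[OF exp_growth_exp[OF order_refl]] l])
       (rule order_trans[OF le norm_S_le'])
  also have "\<dots> = M / (l - \<omega>) * norm x" by (simp add: laplace_cmult laplace_exp[OF l])
  finally show "\<bar>\<phi> (F l x)\<bar> \<le> M / (l - \<omega>) * norm x" .
qed

lemma F_bounded_linear: "bounded_linear (F l)"
proof (rule bounded_linear_intro[of _ "M / (l - \<omega>)"])
  show "norm (F l x) \<le> norm x * (M / (l - \<omega>))" for x
    using norm_F_le[of x] by (simp only: mult.commute)
qed (simp_all add: F_add F_scaleR)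

lemma S_F_commute: "h \<ge> 0 \<Longrightarrow> S h (F l x) = F l (S h x)"
proof (rule bi_functional_eqI)
  fix \<phi> assume h: "h \<ge> 0" and \<phi>: "bi_functional \<phi>"
  have "\<phi> (S h (F l x)) = laplace (\<lambda>t. \<phi> (S h (S t x))) l"
    by (rule F_weak[OF bi_functional_compose[OF \<phi> bi_operator_S[OF h]]])
  also have "\<dots> = laplace (\<lambda>t. \<phi> (S t (S h x))) l"
    by (rule laplace_cong) (simp add: S_commute[OF h])
  finally show "\<phi> (S h (F l x)) = \<phi> (F l (S h x))" by (simp add: F_weak[OF \<phi>])
qed

lemma bi_operator_F: "bi_operator (F l)"
  unfolding bi_operator_def limitin_iff
proof (intro conjI allI impI ballI)
  show "bounded_linear (F l)" by (rule F_bounded_linear)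
  fix u x p assume u: "bounded (range u) \<and> (\<forall>p\<in>P. (\<lambda>i. p (u i - x)) \<longlonglongrightarrow> 0)" and p: "p \<in> P"
  define \<alpha> where "\<alpha> = (\<omega> + l) / 2"
  have \<alpha>: "\<alpha> > \<omega>" "l > \<alpha>" using l by (auto simp: \<alpha>_def)
  show "(\<lambda>n. p (F l (u n) - F l x)) \<longlonglongrightarrow> 0"
  proof (rule tendstoI)
    fix e :: real assume e: "e > 0"
    define e' where "e' = e * (l - \<alpha>) / 2"
    have e': "e' > 0" using e \<alpha> by (simp add: e'_def)
    have "bounded (range u)" "limitin \<tau> u x sequentially" using u by (simp_all add: limitin_iff)
    then obtain N where N: "\<And>i t. i \<ge> N \<Longrightarrow> t \<ge> 0 \<Longrightarrow> p (S t (u i - x)) \<le> e' * exp (\<alpha> * t)"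
      using S_equicontinuous[OF _ _ p e' \<alpha>(1)] by blast
    have "dist (p (F l (u n) - F l x)) 0 < e" if n: "n \<ge> N" for n
    proof -
      have "p (F l (u n - x)) \<le> e / 2"
      proof (rule P_le_functional[OF p])
        fix \<phi> assume \<phi>: "bi_functional \<phi>" and le: "\<And>y. \<bar>\<phi> y\<bar> \<le> p y"
        have "\<bar>\<phi> (F l (u n - x))\<bar> \<le> laplace (\<lambda>t. e' * exp (\<alpha> * t)) l"
          unfolding F_weak[OF \<phi>]
          by (rule laplace_abs_le[OF exp_growth_weaken[OF exp_growth_S[OF \<phi>] less_imp_le[OF \<alpha>(1)]]
                exp_growth_cmult[OF exp_growth_exp[OF order_refl]] \<alpha>(2)])
             (rule order_trans[OF le N[OF n]])
        also have "\<dots> = e' * (1 / (l - \<alpha>))" by (simp only: laplace_cmult laplace_exp[OF \<alpha>(2)])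
        also have "\<dots> = e / 2" using \<alpha> by (simp add: e'_def field_simps)
        finally show "\<bar>\<phi> (F l (u n - x))\<bar> \<le> e / 2" .
      qed
      then show ?thesis
        using e P_nonneg[OF p] linear_diff[OF bounded_linear.linear[OF F_bounded_linear], of "u n" x] by simp
    qed
    then show "\<forall>\<^sub>F n in sequentially. dist (p (F l (u n) - F l x)) 0 < e"
      unfolding eventually_sequentially by blast
  qed
qed

text \<open>A functional composed with \<open>S h\<close> is again a bi-functional, which moves
  \<open>S h\<close> under the transform; the cosine law and \<open>laplace_cosine_shift\<close>
  then give a closed formula.\<close>

lemma F_difference:
  assumes \<phi>: "bi_functional \<phi>" and h: "h > 0"
  shows "\<phi> ((2 / h\<^sup>2) *\<^sub>R (S h (F l x) - F l x)) =
    (2 * cosh (l * h) - 2) / h\<^sup>2 * \<phi> (F l x) -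
    (2 / h\<^sup>2) * (LINT t:{0..h}|lborel. sinh (l * (h - t)) * \<phi> (S t x))"
proof -
  interpret \<phi>: bounded_linear \<phi> using \<phi> by (rule bi_functional_linear)
  have "2 * \<phi> (S h (F l x)) = laplace (\<lambda>t. 2 * \<phi> (S h (S t x))) l"
    using h by (simp add: laplace_cmult F_weak[OF bi_functional_compose[OF \<phi> bi_operator_S]])
  also have "\<dots> = laplace (\<lambda>t. \<phi> (S (t + h) x) + \<phi> (S \<bar>t - h\<bar> x)) l"
  proof (rule laplace_cong)
    fix t :: real assume t: "t \<ge> 0"
    have "2 * \<phi> (S h (S t x)) = \<phi> (2 *\<^sub>R S h (S t x))" by (simp add: \<phi>.scaleR)
    also have "\<dots> = \<phi> (S (t + h) x) + \<phi> (S \<bar>t - h\<bar> x)"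
      using S_cosine[OF less_imp_le[OF h] t, of x] by (simp add: \<phi>.add)
    finally show "2 * \<phi> (S h (S t x)) = \<phi> (S (t + h) x) + \<phi> (S \<bar>t - h\<bar> x)" .
  qed
  also have "\<dots> = 2 * cosh (l * h) * \<phi> (F l x) - 2 * (LINT t:{0..h}|lborel. sinh (l * (h - t)) * \<phi> (S t x))"
    unfolding F_weak[OF \<phi>] by (rule laplace_cosine_shift[OF exp_growth_S[OF \<phi>] \<omega>_nonneg l less_imp_le[OF h]])
  finally have eq: "2 * \<phi> (S h (F l x)) - 2 * \<phi> (F l x) =
      (2 * cosh (l * h) - 2) * \<phi> (F l x) - 2 * (LINT t:{0..h}|lborel. sinh (l * (h - t)) * \<phi> (S t x))"
    by (simp add: algebra_simps)
  have "\<phi> ((2 / h\<^sup>2) *\<^sub>R (S h (F l x) - F l x)) = (2 * \<phi> (S h (F l x)) - 2 * \<phi> (F l x)) / h\<^sup>2"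
    by (simp add: \<phi>.scaleR \<phi>.diff diff_divide_distrib right_diff_distrib)
  then show ?thesis
    unfolding eq diff_divide_distrib[of "(2 * cosh (l * h) - 2) * \<phi> (F l x)"] by (simp only: times_divide_eq_left)
qed

text \<open>The reference point \<open>z\<close> serves two purposes: \<open>z = x\<close> gives the
  limit of the difference quotients, \<open>z = 0\<close> their norm bound. The factor
  \<open>c / l\<close> is the mass of the rescaled \<open>sinh\<close> kernel.\<close>

lemma F_difference_bound:
  assumes p: "p \<in> P" and h: "h > 0" and e: "\<And>t. 0 \<le> t \<Longrightarrow> t \<le> h \<Longrightarrow> p (S t x - z) \<le> e"
  defines "c \<equiv> (2 * cosh (l * h) - 2) / h\<^sup>2"
  shows "p ((2 / h\<^sup>2) *\<^sub>R (S h (F l x) - F l x) - (c *\<^sub>R F l x - (c / l) *\<^sub>R z)) \<le> c / l * e"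
proof (rule P_le_functional[OF p])
  fix \<phi> assume \<phi>: "bi_functional \<phi>" and le: "\<And>y. \<bar>\<phi> y\<bar> \<le> p y"
  interpret \<phi>: bounded_linear \<phi> using \<phi> by (rule bi_functional_linear)
  let ?J = "LINT t:{0..h}|lborel. sinh (l * (h - t)) * \<phi> (S t x)"
  have "\<bar>?J - (cosh (l * h) - 1) / l * \<phi> z\<bar> \<le> (cosh (l * h) - 1) / l * e"
  proof (rule sinh_integral_bound[OF exp_growth_continuous[OF exp_growth_S[OF \<phi>]] less_imp_le[OF h] l_pos])
    fix t assume t: "0 \<le> t" "t \<le> h"
    show "\<bar>\<phi> (S t x) - \<phi> z\<bar> \<le> e"
      using order_trans[OF le[of "S t x - z"] e[OF t]] by (simp add: \<phi>.diff)
  qed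
  then have "(2 / h\<^sup>2) * \<bar>?J - (cosh (l * h) - 1) / l * \<phi> z\<bar> \<le> (2 / h\<^sup>2) * ((cosh (l * h) - 1) / l * e)"
    by (rule mult_left_mono) simp
  also have "(2 / h\<^sup>2) * ((cosh (l * h) - 1) / l * e) = c / l * e"
    by (simp add: c_def field_simps)
  also have "(2 / h\<^sup>2) * \<bar>?J - (cosh (l * h) - 1) / l * \<phi> z\<bar> =
      \<bar>(2 / h\<^sup>2) * (?J - (cosh (l * h) - 1) / l * \<phi> z)\<bar>"
    by (simp only: abs_mult) simp
  also have "(2 / h\<^sup>2) * (?J - (cosh (l * h) - 1) / l * \<phi> z) = (2 / h\<^sup>2) * ?J - c / l * \<phi> z"
  proof -
    have c: "c = (2 / h\<^sup>2) * (cosh (l * h) - 1)"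
      by (simp add: c_def right_diff_distrib diff_divide_distrib)
    show ?thesis unfolding c right_diff_distrib[of "2 / h\<^sup>2" ?J] by (simp only: mult.assoc times_divide_eq_left times_divide_eq_right)
  qed
  also have "\<dots> = - \<phi> ((2 / h\<^sup>2) *\<^sub>R (S h (F l x) - F l x) - (c *\<^sub>R F l x - (c / l) *\<^sub>R z))"
    unfolding \<phi>.diff[of "(2 / h\<^sup>2) *\<^sub>R (S h (F l x) - F l x)"] F_difference[OF \<phi> h]
    by (simp add: \<phi>.diff \<phi>.scaleR c_def)
  finally show "\<bar>\<phi> ((2 / h\<^sup>2) *\<^sub>R (S h (F l x) - F l x) - (c *\<^sub>R F l x - (c / l) *\<^sub>R z))\<bar> \<le> c / l * e"
    by simp
qed

lemma F_generator_tendsto: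
  "limitin \<tau> (\<lambda>h. (2 / h\<^sup>2) *\<^sub>R (S h (F l x) - F l x)) (l\<^sup>2 *\<^sub>R F l x - l *\<^sub>R x) (at_right 0)"
proof -
  define c where "c h = (2 * cosh (l * h) - 2) / h\<^sup>2" for h
  define y where "y h = c h *\<^sub>R F l x - (c h / l) *\<^sub>R x" for h
  have c: "(c \<longlongrightarrow> l\<^sup>2) (at_right 0)"
    unfolding c_def by (rule cosh_quotient_tendsto[OF l_pos])
  have "(y \<longlongrightarrow> l\<^sup>2 *\<^sub>R F l x - (l\<^sup>2 / l) *\<^sub>R x) (at_right 0)"
    unfolding y_def using l_pos by (intro tendsto_intros c) auto
  then have y: "limitin \<tau> y (l\<^sup>2 *\<^sub>R F l x - l *\<^sub>R x) (at_right 0)"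
    using l_pos by (intro limitin_norm) (simp add: power2_eq_square)
  have "limitin \<tau> (\<lambda>h. (2 / h\<^sup>2) *\<^sub>R (S h (F l x) - F l x) - y h) 0 (at_right 0)"
    unfolding limitin_iff diff_zero
  proof
    fix p assume p: "p \<in> P"
    show "((\<lambda>h. p ((2 / h\<^sup>2) *\<^sub>R (S h (F l x) - F l x) - y h)) \<longlongrightarrow> 0) (at_right 0)"
    proof (rule tendstoI)
      fix e :: real assume e: "e > 0"
      \<comment> \<open>Eventually \<open>c h < l\<^sup>2 + 1\<close>, so \<open>k\<close> bounds
        \<open>c h / l\<close> near \<open>0\<close>.\<close>
      define k where "k = (l\<^sup>2 + 1) / l"
      have k: "k > 0" unfolding k_def using l_pos by (intro divide_pos_pos add_nonneg_pos) auto
      define r where "r = e / (2 * k)"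
      have r: "r > 0" "k * r = e / 2" using e k by (simp_all add: r_def)
      have "\<forall>\<^sub>F t in at 0 within {0..}. p (S t x - S 0 x) < r"
        by (rule order_tendstoD(2)[OF S_continuous[OF order_refl p] r(1)])
      then obtain d where d: "d > 0" "\<And>t. t \<in> {0..} \<Longrightarrow> t \<noteq> 0 \<Longrightarrow> dist t 0 < d \<Longrightarrow> p (S t x - S 0 x) < r"
        unfolding eventually_at by blast
      have d': "p (S t x - x) \<le> r" if "0 \<le> t" "t < d" for t
        using d(2)[of t] that r P_zero[OF p] by (cases "t = 0") (auto simp: S_0 dist_real_def)
      have "\<forall>\<^sub>F h in at_right 0. h < d" using d(1) unfolding eventually_at_right_field by blast
      moreover have "\<forall>\<^sub>F h in at_right 0. c h < l\<^sup>2 + 1"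
        by (rule order_tendstoD(2)[OF c]) simp
      moreover have "\<forall>\<^sub>F h in at_right (0::real). h > 0" by (rule eventually_at_right_less)
      ultimately show "\<forall>\<^sub>F h in at_right 0. dist (p ((2 / h\<^sup>2) *\<^sub>R (S h (F l x) - F l x) - y h)) 0 < e"
      proof eventually_elim
        case (elim h)
        have "p ((2 / h\<^sup>2) *\<^sub>R (S h (F l x) - F l x) - y h) \<le> c h / l * r"
          unfolding y_def c_def
          by (rule F_difference_bound[OF p]) (use elim d' in auto)
        also have "\<dots> \<le> (l\<^sup>2 + 1) / l * r"
          using elim l_pos r by (intro mult_right_mono divide_right_mono) auto
        also have "\<dots> = e / 2" using r(2) by (simp only: k_def)
        finally show ?case using e P_nonneg[OF p] by simp
      qed
    qed
  qed
  from limitin_add[OF this y] show ?thesis by simp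
qed

lemma F_generator_bounded:
  assumes h: "0 < h" "h \<le> 1"
  shows "2 / h\<^sup>2 * norm (S h (F l x) - F l x) \<le>
    l\<^sup>2 * cosh l / l * (M * norm x * exp \<omega>) + l\<^sup>2 * cosh l * norm (F l x)"
proof -
  define c where "c = (2 * cosh (l * h) - 2) / h\<^sup>2"
  have c: "0 \<le> c" "c \<le> l\<^sup>2 * cosh l" unfolding c_def using cosh_quotient_le[OF l_pos h] by auto
  define b where "b = M * norm x * exp \<omega>"
  have b: "b \<ge> 0" using M by (simp add: b_def)
  have Sb: "norm (S t x) \<le> b" if "0 \<le> t" "t \<le> h" for t
  proof -
    have "norm (S t x) \<le> (M * norm x) * exp (\<omega> * t)" by (rule norm_S_le'[OF that(1)])
    also have "\<dots> \<le> b"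
      unfolding b_def using that h M \<omega>_nonneg by (intro mult_left_mono) (auto intro: mult_left_le)
    finally show ?thesis .
  qed
  let ?z = "(2 / h\<^sup>2) *\<^sub>R (S h (F l x) - F l x)"
  have "norm (?z - (c *\<^sub>R F l x - (c / l) *\<^sub>R 0)) \<le> c / l * b"
  proof (rule norm_le_P)
    fix p assume p: "p \<in> P"
    show "p (?z - (c *\<^sub>R F l x - (c / l) *\<^sub>R 0)) \<le> c / l * b"
      unfolding c_def
      by (rule F_difference_bound[OF p h(1)]) (use Sb order_trans[OF P_le_norm[OF p]] in simp)
  qed
  also have "\<dots> \<le> l\<^sup>2 * cosh l / l * b"
    using c b l_pos by (intro mult_right_mono divide_right_mono) auto
  finally have "norm (?z - c *\<^sub>R F l x) \<le> l\<^sup>2 * cosh l / l * b" by simp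
  moreover have "norm (c *\<^sub>R F l x) \<le> l\<^sup>2 * cosh l * norm (F l x)"
    unfolding norm_scaleR using c by (intro mult_right_mono) auto
  ultimately have "norm (?z - c *\<^sub>R F l x + c *\<^sub>R F l x) \<le> l\<^sup>2 * cosh l / l * b + l\<^sup>2 * cosh l * norm (F l x)"
    by (intro norm_triangle_mono)
  then show ?thesis using h by (simp add: b_def)
qed

lemma F_in_D: "F l x \<in> D"
  and A_F: "A (F l x) = l\<^sup>2 *\<^sub>R F l x - l *\<^sub>R x"
proof -
  have "F l x \<in> bi_generator_domain \<tau> S"
    unfolding bi_generator_domain_def
    using F_generator_tendsto[of x] F_generator_bounded[of _ x]
    by (auto intro!: bdd_aboveI2[where M = "l\<^sup>2 * cosh l / l * (M * norm x * exp \<omega>) + l\<^sup>2 * cosh l * norm (F l x)"])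
  then show D: "F l x \<in> D" using generator by (simp add: is_bi_generator_def)
  then have "limitin \<tau> (\<lambda>h. (2 / h\<^sup>2) *\<^sub>R (S h (F l x) - F l x)) (A (F l x)) (at_right 0)"
    using generator by (simp add: is_bi_generator_def)
  then show "A (F l x) = l\<^sup>2 *\<^sub>R F l x - l *\<^sub>R x"
    by (rule limitin_unique[OF _ F_generator_tendsto trivial_limit_at_right_real])
qed

text \<open>\<open>F l\<close> commutes with the difference quotients of \<open>x\<close> and
  respects their bounded \<tau>-limit, so the limit already computed for \<open>F l x\<close> can be
  compared. This gives the left inverse; \<open>A_F\<close> gives the right one.\<close>

lemma F_A:
  assumes x: "x \<in> D"
  shows "F l (A x) = l\<^sup>2 *\<^sub>R F l x - l *\<^sub>R x"
proof -
  interpret F: bounded_linear "F l" by (rule F_bounded_linear)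
  define h where "h i = inverse (real (Suc i))" for i
  have h: "h i > 0" "h i \<le> 1" for i by (auto simp: h_def field_simps)
  have h0: "filterlim h (at_right 0) sequentially"
    unfolding filterlim_at h_def using LIMSEQ_inverse_real_of_nat by (auto intro!: always_eventually)
  let ?u = "\<lambda>i. (2 / (h i)\<^sup>2) *\<^sub>R (S (h i) x - x)"
  have xd: "x \<in> bi_generator_domain \<tau> S" and lim: "limitin \<tau> (\<lambda>h. (2 / h\<^sup>2) *\<^sub>R (S h x - x)) (A x) (at_right 0)"
    using generator x by (auto simp: is_bi_generator_def)
  then have "bdd_above ((\<lambda>t. 2 / t\<^sup>2 * norm (S t x - x)) ` {0<..1})"
    by (simp add: bi_generator_domain_def)
  then obtain b where b: "\<forall>z\<in>(\<lambda>t. 2 / t\<^sup>2 * norm (S t x - x)) ` {0<..1}. z \<le> b"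
    unfolding bdd_above_def by (elim exE)
  have bu: "bounded (range ?u)"
  proof (rule boundedI)
    fix z assume "z \<in> range ?u"
    then obtain i where i: "z = ?u i" by blast
    have "2 / (h i)\<^sup>2 * norm (S (h i) x - x) \<le> b"
      by (rule b[rule_format]) (rule imageI, use h in simp)
    then show "norm z \<le> b" by (simp add: i)
  qed
  have lu: "limitin \<tau> ?u (A x) sequentially"
    unfolding limitin_iff by (intro ballI filterlim_compose[OF limitinD[OF lim] h0])
  have "limitin \<tau> (\<lambda>i. F l (?u i)) (F l (A x)) sequentially"
    by (rule bi_operator_limitin[OF bi_operator_F bu lu])
  moreover have "(\<lambda>i. F l (?u i)) = (\<lambda>i. (2 / (h i)\<^sup>2) *\<^sub>R (S (h i) (F l x) - F l x))"
    using S_F_commute[OF less_imp_le[OF h(1)]] by (simp add: F.diff F.scaleR fun_eq_iff)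
  ultimately have "limitin \<tau> (\<lambda>i. (2 / (h i)\<^sup>2) *\<^sub>R (S (h i) (F l x) - F l x)) (F l (A x)) sequentially"
    by (simp only:)
  moreover have "limitin \<tau> (\<lambda>i. (2 / (h i)\<^sup>2) *\<^sub>R (S (h i) (F l x) - F l x)) (l\<^sup>2 *\<^sub>R F l x - l *\<^sub>R x) sequentially"
    unfolding limitin_iff by (intro ballI filterlim_compose[OF limitinD[OF F_generator_tendsto] h0])
  ultimately show ?thesis by (rule limitin_unique[OF _ _ sequentially_bot])
qed

lemma resolvent_left:
  assumes "x \<in> D"
  shows "(1 / l) *\<^sub>R F l (l\<^sup>2 *\<^sub>R x - A x) = x"
proof -
  interpret F: bounded_linear "F l" by (rule F_bounded_linear)
  show ?thesis using F_A[OF assms] l_pos by (simp add: F.diff F.scaleR)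
qed

lemma resolvent_right: "l\<^sup>2 *\<^sub>R ((1 / l) *\<^sub>R F l y) - A ((1 / l) *\<^sub>R F l y) = y"
  using l_pos by (simp add: generator_scaleR[OF F_in_D] A_F scaleR_diff_right)

lemma resolvent_bij: "bij_betw (\<lambda>x. scl (of_real (l\<^sup>2)) x - A x) D UNIV"
  unfolding scl_of_real
  by (rule bij_betw_byWitness[where f' = "\<lambda>y. (1 / l) *\<^sub>R F l y"])
     (intro ballI image_subsetI resolvent_left resolvent_right domain_scaleR[OF F_in_D] subset_UNIV, assumption?)+

lemma resolvent_eq: "resolvent scl D A (of_real (l\<^sup>2)) = (\<lambda>y. (1 / l) *\<^sub>R F l y)"
proof
  fix y
  show "resolvent scl D A (of_real (l\<^sup>2)) y = (1 / l) *\<^sub>R F l y"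
    unfolding resolvent_def
  proof (rule inv_into_f_eq)
    show "inj_on (\<lambda>x. scl (of_real (l\<^sup>2)) x - A x) D" using resolvent_bij by (rule bij_betw_imp_inj_on)
    show "(1 / l) *\<^sub>R F l y \<in> D" by (rule domain_scaleR[OF F_in_D])
    show "scl (of_real (l\<^sup>2)) ((1 / l) *\<^sub>R F l y) - A ((1 / l) *\<^sub>R F l y) = y"
      unfolding scl_of_real by (rule resolvent_right)
  qed
qed

lemma resolvent_bounded: "bounded_linear (\<lambda>y. (1 / l) *\<^sub>R F l y)"
  by (intro bounded_linear_compose[OF bounded_linear_scaleR_right F_bounded_linear])

lemma in_resolvent_set: "of_real (l\<^sup>2) \<in> resolvent_set scl D A"
proof -
  have "Vector_Spaces.linear scl scl (\<lambda>y. (1 / l) *\<^sub>R F l y)"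
  proof unfold_locales
    show "(1 / l) *\<^sub>R F l (x + y) = (1 / l) *\<^sub>R F l x + (1 / l) *\<^sub>R F l y" for x y
      by (simp add: F_add scaleR_add_right)
    show "(1 / l) *\<^sub>R F l (scl c x) = scl c ((1 / l) *\<^sub>R F l x)" for c x
      by (simp add: F_scl scl_of_real[symmetric] mult.commute)
  qed
  then show ?thesis
    using resolvent_bij resolvent_bounded
    unfolding resolvent_set_def resolvent_eq bounded_operators_def mem_Collect_eq by blast
qed

lemma resolvent_norm: "norm (Blinfun (resolvent scl D A (of_real (l\<^sup>2)))) \<le> M / (l * (l - \<omega>))"
proof (rule norm_blinfun_bound)
  show "0 \<le> M / (l * (l - \<omega>))" using M l l_pos by simp
  fix x
  have "norm ((1 / l) *\<^sub>R F l x) \<le> (1 / l) * (M / (l - \<omega>) * norm x)"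
    using l_pos mult_left_mono[OF norm_F_le, of "1 / l" x] by simp
  then show "norm (Blinfun (resolvent scl D A (of_real (l\<^sup>2))) x) \<le> M / (l * (l - \<omega>)) * norm x"
    unfolding resolvent_eq bounded_linear_Blinfun_apply[OF resolvent_bounded] by simp
qed

end

text \<open>Every number above \<open>\<omega>\<^sup>2\<close> is the square of some
  \<open>l > \<omega>\<close>, so the resolvent found through \<open>F\<close> covers the required
  half line. From here on \<open>V\<close> and its derivative formulas apply to the
  generator.\<close>

sublocale cosine_resolvent scl \<tau> P D A \<omega> M
proof unfold_locales
  show "linear_operator scl D A" by (rule linop)
  show "\<omega> \<ge> 0" by (rule \<omega>_nonneg)
  show "of_real ` {\<omega>\<^sup>2<..} \<subseteq> resolvent_set scl D A"
  proof (rule image_subsetI)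
    fix m :: real assume m: "m \<in> {\<omega>\<^sup>2<..}"
    then have "\<omega>\<^sup>2 < m" by simp
    then have "\<omega> < sqrt m" by (rule real_less_rsqrt)
    moreover have "m > 0" using \<open>\<omega>\<^sup>2 < m\<close> zero_le_power2[of \<omega>] by linarith
    ultimately show "of_real m \<in> resolvent_set scl D A"
      using in_resolvent_set[of "sqrt m"] by simp
  qed
qed (rule resolvent_norm)

end

section \<open>The bounds in (b), density of the domain and closedness\<close>

context bi_cosine_family
begin

lemma Res_eq_F: "l > \<omega> \<Longrightarrow> Res l y = (1 / l) *\<^sub>R F l y"
  unfolding Res_def resolvent_eq bounded_linear_Blinfun_apply[OF resolvent_bounded] ..

text \<open>The weight \<open>l ^ (m + 1) * t ^ m * exp (- l * t) / m!\<close> is a gamma density.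
  The induction compares two derivatives in \<open>l\<close>: by \<open>V_has_derivative\<close> on
  one side and under the integral on the other, and solves for \<open>V (m + 1)\<close>.\<close>

lemma V_weak:
  assumes \<phi>: "bi_functional \<phi>"
  shows "l > \<omega> \<Longrightarrow> \<phi> (V m l x) = l ^ Suc m / fact m * laplace (\<lambda>t. t ^ m * \<phi> (S t x)) l"
proof (induction m arbitrary: l)
  case 0
  interpret \<phi>: bounded_linear \<phi> using \<phi> by (rule bi_functional_linear)
  have "l > 0" using 0 \<omega>_nonneg by simp
  then show ?case
    by (simp add: V_0 Res_eq_F[OF 0] \<phi>.scaleR F_weak[OF 0 \<phi>] power2_eq_square)
next
  case (Suc m)
  interpret \<phi>: bounded_linear \<phi> using \<phi> by (rule bi_functional_linear)
  have lp: "l > 0" using Suc.prems \<omega>_nonneg by simp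
  define g where "g t = t ^ m * \<phi> (S t x)" for t
  have g: "exp_growth \<omega> g" unfolding g_def by (rule exp_growth_power[OF exp_growth_S[OF \<phi>]])
  define a b L L' where "a = \<phi> (V m l x)" and "b = \<phi> (V (Suc m) l x)"
    and "L = laplace g l" and "L' = laplace (\<lambda>t. t * g t) l"
  have "((\<lambda>l. V m l x) has_vector_derivative ((real m + 1) / l) *\<^sub>R (V m l x - V (m + 1) l x)) (at l)"
    using bounded_linear.has_vector_derivative[OF blinfun.bounded_linear_left[of x] V_has_derivative[OF Suc.prems, of m]]
    by (simp add: blinfun.bilinear_simps)
  from \<phi>.has_vector_derivative[OF this]
  have "((\<lambda>l. \<phi> (V m l x)) has_real_derivative (real m + 1) / l * (a - b)) (at l)"
    by (simp add: has_real_derivative_iff_has_vector_derivative \<phi>.scaleR \<phi>.diff a_def b_def)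
  then have "((\<lambda>l. l ^ Suc m / fact m * laplace g l) has_real_derivative (real m + 1) / l * (a - b)) (at l)"
    by (rule has_field_derivative_transform_within_open[where S = "{\<omega><..}"])
       (use Suc in \<open>auto simp: g_def[abs_def]\<close>)
  moreover have "((\<lambda>l. l ^ Suc m / fact m * laplace g l) has_real_derivative
      (real m + 1) * l ^ m / fact m * L + l ^ Suc m / fact m * (- L')) (at l)"
  proof -
    have "((\<lambda>l. l ^ Suc m / fact m) has_real_derivative (real m + 1) * l ^ m / fact m) (at l)"
      by (auto intro!: derivative_eq_intros simp: field_simps simp del: power_Suc)
    from DERIV_mult[OF this laplace_DERIV[OF g Suc.prems]]
    show ?thesis by (simp only: L_def L'_def mult.commute)
  qed
  ultimately have eq: "(real m + 1) / l * (a - b) = (real m + 1) * l ^ m / fact m * L + l ^ Suc m / fact m * (- L')"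
    by (rule DERIV_unique)
  have "a = l ^ Suc m / fact m * L" using Suc by (simp add: a_def L_def g_def[abs_def])
  then have "(real m + 1) / l * a = (real m + 1) * l ^ m / fact m * L" using lp by simp
  then have "(real m + 1) / l * b = l ^ Suc m / fact m * L'" using eq by (simp add: right_diff_distrib)
  then have "l * (l ^ Suc m / fact m * L') = l * ((real m + 1) / l * b)" by (simp only:)
  also have "\<dots> = (real m + 1) * b" using lp by simp
  finally have "b = l * (l ^ Suc m / fact m * L') / (real m + 1)" by simp
  also have "\<dots> = l ^ Suc (Suc m) / fact (Suc m) * L'" by (simp add: ac_simps)
  finally have "b = l ^ Suc (Suc m) / fact (Suc m) * L'" .
  then show ?case by (simp add: b_def L'_def g_def[abs_def] mult.assoc)
qed

text \<open>Averaging \<open>exp (\<alpha> * t)\<close> against the gamma density gives exactly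
  \<open>(l / (l - \<alpha>)) ^ (m + 1)\<close>, the factor that the weights in (b) remove.\<close>

lemma V_functional_le:
  assumes \<phi>: "bi_functional \<phi>" and l: "l > \<alpha>" and \<alpha>: "\<alpha> \<ge> \<omega>"
    and le: "\<And>t. t \<ge> 0 \<Longrightarrow> \<bar>\<phi> (S t x)\<bar> \<le> c * exp (\<alpha> * t)"
  shows "\<bar>\<phi> (V m l x)\<bar> \<le> c * (l / (l - \<alpha>)) ^ Suc m"
proof -
  have lw: "l > \<omega>" and lp: "l > 0" using l \<alpha> \<omega>_nonneg by auto
  have "\<bar>laplace (\<lambda>t. t ^ m * \<phi> (S t x)) l\<bar> \<le> laplace (\<lambda>t. c * (t ^ m * exp (\<alpha> * t))) l"
  proof (rule laplace_abs_le)
    show "exp_growth \<alpha> (\<lambda>t. t ^ m * \<phi> (S t x))"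
      by (rule exp_growth_weaken[OF exp_growth_power[OF exp_growth_S[OF \<phi>]] \<alpha>])
    show "exp_growth \<alpha> (\<lambda>t. c * (t ^ m * exp (\<alpha> * t)))"
      by (intro exp_growth_cmult exp_growth_power exp_growth_exp order_refl)
    fix t :: real assume t: "t \<ge> 0"
    then show "\<bar>t ^ m * \<phi> (S t x)\<bar> \<le> c * (t ^ m * exp (\<alpha> * t))"
      using mult_left_mono[OF le[OF t], of "t ^ m"] by (simp add: abs_mult mult_ac)
  qed (rule l)
  also have "\<dots> = c * (fact m / (l - \<alpha>) ^ Suc m)"
    by (simp only: laplace_cmult laplace_power_exp[OF l])
  finally have "l ^ Suc m / fact m * \<bar>laplace (\<lambda>t. t ^ m * \<phi> (S t x)) l\<bar> \<le>
      l ^ Suc m / fact m * (c * (fact m / (l - \<alpha>) ^ Suc m))"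
    using lp by (intro mult_left_mono) auto
  also have "\<dots> = c * (l / (l - \<alpha>)) ^ Suc m" by (simp add: power_divide)
  finally show ?thesis using lp by (simp add: V_weak[OF \<phi> lw] abs_mult)
qed

lemma norm_V_le:
  assumes l: "l > \<omega>"
  shows "norm (V m l) \<le> M * (l / (l - \<omega>)) ^ Suc m"
proof (rule norm_blinfun_bound)
  have "l > 0" using l \<omega>_nonneg by simp
  then show "0 \<le> M * (l / (l - \<omega>)) ^ Suc m" using M l by simp
  fix x
  have "norm (V m l x) \<le> (M * norm x) * (l / (l - \<omega>)) ^ Suc m"
  proof (rule norm_le_functional)
    fix \<phi> assume \<phi>: "bi_functional \<phi>" and le: "\<And>y. \<bar>\<phi> y\<bar> \<le> norm y"
    show "\<bar>\<phi> (V m l x)\<bar> \<le> (M * norm x) * (l / (l - \<omega>)) ^ Suc m"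
      by (rule V_functional_le[OF \<phi> l order_refl order_trans[OF le norm_S_le']])
  qed
  then show "norm (V m l x) \<le> M * (l / (l - \<omega>)) ^ Suc m * norm x" by (simp only: mult_ac)
qed

lemma hille_yosida_bound:
  assumes l: "l > \<omega>"
  shows "norm (hille_yosida_term scl D A \<omega> l m) \<le> M"
proof -
  have l0: "l > 0" "l - \<omega> > 0" using l \<omega>_nonneg by auto
  have "norm (hille_yosida_term scl D A \<omega> l m) = ((l - \<omega>) / l) ^ Suc m * norm (V m l)"
    using l0 by (simp add: hille_yosida_term_eq[OF l] abs_mult power_abs)
  also have "\<dots> \<le> ((l - \<omega>) / l) ^ Suc m * (M * (l / (l - \<omega>)) ^ Suc m)"
    using l0 by (intro mult_left_mono norm_V_le[OF l]) auto
  also have "\<dots> = M * (((l - \<omega>) / l) * (l / (l - \<omega>))) ^ Suc m"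
    unfolding power_mult_distrib by (simp only: mult_ac)
  also have "\<dots> = M" using l0 by simp
  finally show ?thesis .
qed

lemma hille_yosida_equicontinuous:
  assumes \<alpha>: "\<alpha> > \<omega>"
  shows "bi_equicontinuous \<tau> ({\<alpha><..} \<times> UNIV) (\<lambda>(l, m). blinfun_apply (hille_yosida_term scl D A \<alpha> l m))"
  unfolding bi_equicontinuous_iff
proof (intro allI impI ballI)
  fix u x p and e :: real
  assume u: "bounded (range u)" "limitin \<tau> u x sequentially" and p: "p \<in> P" and e: "e > 0"
  \<comment> \<open>Half of \<open>e\<close> compensates for the weak inequalities in the estimate
    of the averages.\<close>
  obtain N where N: "\<And>i t. i \<ge> N \<Longrightarrow> t \<ge> 0 \<Longrightarrow> p (S t (u i - x)) \<le> e / 2 * exp (\<alpha> * t)"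
    using S_equicontinuous[OF u p half_gt_zero[OF e] \<alpha>] by blast
  have "p (hille_yosida_term scl D A \<alpha> l m (u n - x)) < e" if n: "n \<ge> N" and l: "l > \<alpha>" for n l m
  proof -
    have l0: "l > 0" "l - \<alpha> > 0" "l > \<omega>" using l \<alpha> \<omega>_nonneg by auto
    have "p (V m l (u n - x)) \<le> e / 2 * (l / (l - \<alpha>)) ^ Suc m"
    proof (rule P_le_functional[OF p])
      fix \<phi> assume \<phi>: "bi_functional \<phi>" and le: "\<And>y. \<bar>\<phi> y\<bar> \<le> p y"
      show "\<bar>\<phi> (V m l (u n - x))\<bar> \<le> e / 2 * (l / (l - \<alpha>)) ^ Suc m"
        by (rule V_functional_le[OF \<phi> l less_imp_le[OF \<alpha>] order_trans[OF le N[OF n]]])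
    qed
    then have "((l - \<alpha>) / l) ^ Suc m * p (V m l (u n - x)) \<le> ((l - \<alpha>) / l) ^ Suc m * (e / 2 * (l / (l - \<alpha>)) ^ Suc m)"
      using l0 by (intro mult_left_mono) auto
    also have "\<dots> = e / 2 * (((l - \<alpha>) / l) * (l / (l - \<alpha>))) ^ Suc m"
      unfolding power_mult_distrib by (simp only: mult_ac)
    also have "\<dots> = e / 2" using l0 by simp
    also have "((l - \<alpha>) / l) ^ Suc m * p (V m l (u n - x)) = p (hille_yosida_term scl D A \<alpha> l m (u n - x))"
      using l0 by (simp add: hille_yosida_term_eq blinfun.scaleR_left P_scaleR[OF p] abs_mult power_abs)
    finally show ?thesis using e by simp
  qed
  then show "\<exists>N. \<forall>n\<ge>N. \<forall>j\<in>{\<alpha><..} \<times> UNIV.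
      p ((case j of (l, m) \<Rightarrow> blinfun_apply (hille_yosida_term scl D A \<alpha> l m)) (u n - x)) < e"
    by (intro exI[of _ N]) auto
qed

text \<open>The kernel \<open>l * exp (- l * t)\<close> concentrates at \<open>0\<close>. Below
  \<open>d\<close> the difference \<open>S t x - x\<close> is small; above \<open>d\<close> the
  factor \<open>1\<close> is replaced by \<open>t / d\<close>, and the additional \<open>t\<close>
  makes that contribution to \<open>l *\<^sub>R F l x\<close> of order \<open>1 / l\<close>.\<close>

lemma F_approximate_identity:
  assumes p: "p \<in> P"
  shows "((\<lambda>l. p (l *\<^sub>R F l x - x)) \<longlongrightarrow> 0) at_top"
proof (rule tendstoI)
  fix e :: real assume e: "e > 0"
  define C where "C = (M + 1) * norm x"
  have C: "C \<ge> 0" using M by (simp add: C_def)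
  have SC: "p (S t x - x) \<le> C * exp (\<omega> * t)" if t: "t \<ge> 0" for t
  proof -
    have "1 \<le> exp (\<omega> * t)" using \<omega>_nonneg t by simp
    then have "norm x * 1 \<le> norm x * exp (\<omega> * t)" by (intro mult_left_mono) auto
    moreover have "p (S t x - x) \<le> norm (S t x) + norm x"
      by (rule order_trans[OF P_le_norm[OF p] norm_triangle_ineq4])
    ultimately show ?thesis
      using norm_S_le'[OF t, of x] by (simp add: C_def algebra_simps)
  qed
  have "\<forall>\<^sub>F t in at 0 within {0..}. p (S t x - S 0 x) < e / 2"
    by (rule order_tendstoD(2)[OF S_continuous[OF order_refl p] half_gt_zero[OF e]])
  then obtain d where d: "d > 0" "\<And>t. t \<in> {0..} \<Longrightarrow> t \<noteq> 0 \<Longrightarrow> dist t 0 < d \<Longrightarrow> p (S t x - S 0 x) < e / 2"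
    unfolding eventually_at by blast
  have le: "p (S t x - x) \<le> e / 2 * exp (0 * t) + C / d * (t ^ 1 * exp (\<omega> * t))" if t: "t \<ge> 0" for t
  proof (cases "t < d")
    case True
    have "p (S t x - x) \<le> e / 2"
      using d(2)[of t] True t e P_zero[OF p] by (cases "t = 0") (auto simp: S_0 dist_real_def)
    moreover have "0 \<le> C / d * (t ^ 1 * exp (\<omega> * t))" using C d(1) t by simp
    ultimately show ?thesis by simp
  next
    case False
    have "C * exp (\<omega> * t) = C / d * (d * exp (\<omega> * t))" using d(1) by simp
    also have "\<dots> \<le> C / d * (t * exp (\<omega> * t))"
      using False C d(1) by (intro mult_left_mono mult_right_mono) auto
    finally show ?thesis using SC[OF t] e by simp
  qed
  have bound: "p (l *\<^sub>R F l x - x) \<le> e / 2 + l * (C / d / (l - \<omega>)\<^sup>2)" if l: "l > \<omega>" for l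
  proof (rule P_le_functional[OF p])
    fix \<phi> assume \<phi>: "bi_functional \<phi>" and \<phi>le: "\<And>y. \<bar>\<phi> y\<bar> \<le> p y"
    interpret \<phi>: bounded_linear \<phi> using \<phi> by (rule bi_functional_linear)
    have lp: "l > 0" using l \<omega>_nonneg by simp
    have const: "laplace (\<lambda>t. \<phi> x) l = \<phi> x / l"
      using laplace_cmult[of "\<phi> x" "\<lambda>t. exp (0 * t)" l] laplace_exp[of 0 l] lp by simp
    have g: "exp_growth \<omega> (\<lambda>t. \<phi> (S t x) - \<phi> x)"
      by (intro exp_growth_diff exp_growth_S \<phi> exp_growth_const \<omega>_nonneg)
    have "\<phi> (l *\<^sub>R F l x - x) = l * laplace (\<lambda>t. \<phi> (S t x) - \<phi> x) l"
      using lp by (simp add: \<phi>.diff \<phi>.scaleR F_weak[OF l \<phi>] right_diff_distrib const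
          laplace_diff[OF exp_growth_S[OF \<phi>] exp_growth_const[OF \<omega>_nonneg] l])
    moreover have "\<bar>laplace (\<lambda>t. \<phi> (S t x) - \<phi> x) l\<bar> \<le>
        laplace (\<lambda>t. e / 2 * exp (0 * t) + C / d * (t ^ 1 * exp (\<omega> * t))) l"
    proof (rule laplace_abs_le[OF g _ l])
      show "exp_growth \<omega> (\<lambda>t. e / 2 * exp (0 * t) + C / d * (t ^ 1 * exp (\<omega> * t)))"
        by (intro exp_growth_add exp_growth_cmult exp_growth_power exp_growth_exp order_refl \<omega>_nonneg)
      fix t :: real assume t: "t \<ge> 0"
      show "\<bar>\<phi> (S t x) - \<phi> x\<bar> \<le> e / 2 * exp (0 * t) + C / d * (t ^ 1 * exp (\<omega> * t))"
        using order_trans[OF \<phi>le[of "S t x - x"] le[OF t]] by (simp add: \<phi>.diff)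
    qed
    moreover have "laplace (\<lambda>t. e / 2 * exp (0 * t) + C / d * (t ^ 1 * exp (\<omega> * t))) l =
        e / 2 * (1 / (l - 0)) + C / d * (fact 1 / (l - \<omega>) ^ Suc 1)"
      unfolding laplace_power_exp[OF l, of 1, symmetric] laplace_exp[OF lp, symmetric] laplace_cmult[symmetric]
      by (rule laplace_add[OF _ _ l]) (intro exp_growth_cmult exp_growth_power exp_growth_exp order_refl \<omega>_nonneg)+
    ultimately have "\<bar>\<phi> (l *\<^sub>R F l x - x)\<bar> \<le> l * (e / 2 * (1 / (l - 0)) + C / d * (fact 1 / (l - \<omega>) ^ Suc 1))"
      using lp by (simp only: abs_mult abs_of_pos) (intro mult_left_mono, auto)
    also have "\<dots> = e / 2 + l * (C / d / (l - \<omega>)\<^sup>2)"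
      using lp by (simp add: distrib_left power2_eq_square)
    finally show "\<bar>\<phi> (l *\<^sub>R F l x - x)\<bar> \<le> e / 2 + l * (C / d / (l - \<omega>)\<^sup>2)" .
  qed
  have "((\<lambda>l. l * (C / d / (l - \<omega>)\<^sup>2)) \<longlongrightarrow> 0) at_top"
  proof -
    have "((\<lambda>l. C / d * (l / (l - \<omega>)\<^sup>2)) \<longlongrightarrow> 0) at_top"
      by (rule tendsto_mult_right_zero) real_asymp
    then show ?thesis by (simp add: mult_ac)
  qed
  then have "\<forall>\<^sub>F l in at_top. l * (C / d / (l - \<omega>)\<^sup>2) < e / 2"
    by (rule order_tendstoD(2)[OF _ half_gt_zero[OF e]])
  then show "\<forall>\<^sub>F l in at_top. dist (p (l *\<^sub>R F l x - x)) 0 < e"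
    using eventually_gt_at_top[of \<omega>]
  proof eventually_elim
    case (elim l)
    show ?case
      using bound[OF elim(2)] elim(1) P_nonneg[OF p, of "l *\<^sub>R F l x - x"] unfolding dist_real_def by linarith
  qed
qed

lemma D_bi_dense: "bi_densely_defined \<tau> D"
  unfolding bi_densely_defined_def
proof
  fix x
  define l where "l i = \<omega> + 1 + real i" for i
  have l: "l i > \<omega>" "l i > 0" for i using \<omega>_nonneg by (auto simp: l_def)
  let ?u = "\<lambda>i. l i *\<^sub>R F (l i) x"
  have "\<forall>i. ?u i \<in> D" by (intro allI D_scaleR F_in_D l(1))
  moreover have "bounded (range ?u)"
  proof (rule boundedI)
    fix z assume "z \<in> range ?u"
    then obtain i where z: "z = ?u i" by blast
    have "norm z \<le> l i * (M / (l i - \<omega>) * norm x)"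
      unfolding z norm_scaleR using norm_F_le[OF l(1), of i x] l(2)[of i] by (intro mult_mono) auto
    also have "\<dots> = (l i / (l i - \<omega>)) * (M * norm x)" by simp
    \<comment> \<open>The quotient is \<open>(\<omega> + 1 + i) / (1 + i)\<close>, largest for
      \<open>i = 0\<close>.\<close>
    also have "\<dots> \<le> (\<omega> + 1) * (M * norm x)"
    proof (rule mult_right_mono)
      have "l i \<le> (\<omega> + 1) * (real i + 1)"
        using \<omega>_nonneg by (simp add: l_def algebra_simps)
      then show "l i / (l i - \<omega>) \<le> \<omega> + 1" by (simp add: l_def divide_le_eq add.commute)
    qed (use M in simp)
    finally show "norm z \<le> (\<omega> + 1) * (M * norm x)" .
  qed
  moreover have "limitin \<tau> ?u x sequentially"
    unfolding limitin_iff
  proof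
    fix p assume p: "p \<in> P"
    have "filterlim l at_top sequentially" unfolding l_def by real_asymp
    from filterlim_compose[OF F_approximate_identity[OF p] this]
    show "(\<lambda>i. p (l i *\<^sub>R F (l i) x - x)) \<longlonglongrightarrow> 0" .
  qed
  ultimately show "\<exists>u. (\<forall>i::nat. u i \<in> D) \<and> bounded (range u) \<and> limitin \<tau> u x sequentially"
    by (intro exI[of _ ?u] conjI)
qed

text \<open>The identity \<open>u i = (1 / l) *\<^sub>R F l (l\<^sup>2 *\<^sub>R u i - A (u
  i))\<close> passes to the limit because \<open>F l\<close> respects bounded \<tau>-limits, and it
  exhibits \<open>x\<close> as a value of the resolvent.\<close>

lemma A_bi_closed: "bi_closed \<tau> D A"
  unfolding bi_closed_def
proof (intro allI impI)
  fix u x y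
  assume asm: "(\<forall>i::nat. u i \<in> D) \<and> bounded (range u) \<and> bounded (range (\<lambda>i. A (u i))) \<and>
    limitin \<tau> u x sequentially \<and> limitin \<tau> (\<lambda>i. A (u i)) y sequentially"
  then have u: "limitin \<tau> u x sequentially" and Au: "limitin \<tau> (\<lambda>i. A (u i)) y sequentially"
    and uD: "u i \<in> D" for i by simp_all
  define l where "l = \<omega> + 1"
  have l: "l > \<omega>" and lp: "l > 0" using \<omega>_nonneg by (auto simp: l_def)
  let ?v = "\<lambda>i. l\<^sup>2 *\<^sub>R u i - A (u i)"
  have "bounded (range ?v)"
  proof -
    have "bounded (range (\<lambda>i. l\<^sup>2 *\<^sub>R u i))"
      by (rule bounded_range_linear_image[OF bounded_linear_scaleR_right]) (simp add: asm)
    then show ?thesis by (rule bounded_minus_comp) (simp add: asm)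
  qed
  moreover have "limitin \<tau> ?v (l\<^sup>2 *\<^sub>R x - y) sequentially"
    by (rule limitin_diff[OF limitin_scaleR[OF u] Au])
  ultimately have "limitin \<tau> (\<lambda>i. F l (?v i)) (F l (l\<^sup>2 *\<^sub>R x - y)) sequentially"
    by (rule bi_operator_limitin[OF bi_operator_F[OF l]])
  then have "limitin \<tau> (\<lambda>i. (1 / l) *\<^sub>R F l (?v i)) ((1 / l) *\<^sub>R F l (l\<^sup>2 *\<^sub>R x - y)) sequentially"
    by (rule limitin_scaleR)
  moreover have "(\<lambda>i. (1 / l) *\<^sub>R F l (?v i)) = u"
    by (intro ext resolvent_left[OF l] uD)
  ultimately have "limitin \<tau> u ((1 / l) *\<^sub>R F l (l\<^sup>2 *\<^sub>R x - y)) sequentially"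
    by (simp only:)
  from limitin_unique[OF this u] have x: "(1 / l) *\<^sub>R F l (l\<^sup>2 *\<^sub>R x - y) = x"
    by simp
  have "(1 / l) *\<^sub>R F l (l\<^sup>2 *\<^sub>R x - y) \<in> D" by (rule D_scaleR[OF F_in_D[OF l]])
  moreover have "l\<^sup>2 *\<^sub>R ((1 / l) *\<^sub>R F l (l\<^sup>2 *\<^sub>R x - y)) - A ((1 / l) *\<^sub>R F l (l\<^sup>2 *\<^sub>R x - y)) = l\<^sup>2 *\<^sub>R x - y"
    by (rule resolvent_right[OF l])
  ultimately show "x \<in> D \<and> A x = y" unfolding x by simp
qed

end

theorem proposition6p12:
  fixes scl :: "'k::{real_normed_field,euclidean_space} \<Rightarrow> 'a::real_normed_vector \<Rightarrow> 'a"
    and \<tau> :: "'a topology"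
    and D :: "'a set" and A :: "'a \<Rightarrow> 'a"
    and \<omega> M :: real
  assumes "saks_space scl \<tau>"
    and "sequentially_complete_saks scl \<tau>"
    and "C_sequential_saks scl \<tau>"
    and "linear_operator scl D A"
    and "\<omega> \<ge> 0" and "M \<ge> 1"
  shows
    "(\<exists>S. cosine_family scl S \<and> locally_bi_continuous scl \<tau> S \<and> exponentially_bounded S \<and>
          is_bi_generator \<tau> S D A \<and>
          (\<forall>t\<ge>0. onorm (S t) \<le> M * exp (\<omega> * t)))
     \<longleftrightarrow>
     (bi_densely_defined \<tau> D \<and> bi_closed \<tau> D A \<and>
      of_real ` {\<omega>\<^sup>2<..} \<subseteq> resolvent_set scl D A \<and>
      (\<forall>\<mu>>\<omega>. \<forall>m. norm (hille_yosida_term scl D A \<omega> \<mu> m) \<le> M) \<and>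
      (\<forall>\<alpha>>\<omega>. bi_equicontinuous \<tau> ({\<alpha><..} \<times> UNIV)
         (\<lambda>(\<mu>, m). blinfun_apply (hille_yosida_term scl D A \<alpha> \<mu> m))))"
  (is "?a \<longleftrightarrow> ?b")
proof -
  obtain P where P: "saks_seminorms scl \<tau> P"
    using saks_seminorms_exist[OF assms(1,2)] by blast
  show ?thesis
  proof
    assume ?a
    then obtain S where S: "cosine_family scl S" "locally_bi_continuous scl \<tau> S" "is_bi_generator \<tau> S D A"
      "\<And>t. t \<ge> 0 \<Longrightarrow> onorm (S t) \<le> M * exp (\<omega> * t)" by blast
    interpret bi_cosine_family scl \<tau> P S D A \<omega> M
      by (intro bi_cosine_family.intro P bi_cosine_family_axioms.intro S assms)
    show ?b
      using D_bi_dense A_bi_closed resolvent_set hille_yosida_bound hille_yosida_equicontinuous by blast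
  next
    assume b: ?b
    \<comment> \<open>The derivative of order \<open>0\<close> is the function itself, so this bound
      can be extracted before differentiability is known; it is what opens the locale in which
      differentiability is proved.\<close>
    have bound: "norm (Blinfun (resolvent scl D A (of_real (l\<^sup>2)))) \<le> M / (l * (l - \<omega>))" if l: "l > \<omega>" for l
    proof -
      have l0: "l > 0" "l - \<omega> > 0" using l assms(5) by auto
      have "norm (hille_yosida_term scl D A \<omega> l 0) \<le> M" using b l by blast
      then have "(l - \<omega>) * (l * norm (Blinfun (resolvent scl D A (of_real (l\<^sup>2))))) \<le> M"
        using l0 by (simp add: hille_yosida_term_def higher_vector_derivative_def lambda_resolvent_def)
      then show ?thesis using l0 by (simp add: pos_le_divide_eq mult_ac)
    qed
    interpret hille_yosida scl \<tau> P D A \<omega> M M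
    proof (intro hille_yosida.intro cosine_resolvent.intro P cosine_resolvent_axioms.intro
        hille_yosida_axioms.intro assms bound)
      fix \<alpha> assume "\<alpha> > \<omega>"
      then show "bi_equicontinuous \<tau> ({\<alpha><..} \<times> UNIV)
          (\<lambda>(l, m). blinfun_apply (hille_yosida_term scl D A \<alpha> l m))"
        using b by blast
    qed (use b in blast)+
    show ?a
      using generates_cosine_family by blast
  qed
qed

end
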